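(* Let $d\ge 2$ and let $K\subset\mathbb{R}^d$ be a convex body with smooth boundary $\partial K$ having everywhere positive Gaussian curvature, and let $\sigma$ be the surface measure supported on $\partial K$. Then $\sigma$ does not admit a Fourier frame; that is, there is no countable set $\Lambda\subset\mathbb{R}^d$ for which there exist constants $0<A\le B<\infty$ with $$A\int |f|^2\,d\sigma\le\sum_{\lambda\in\Lambda}\left|\int f(x)e^{-2\pi i\lambda\cdot x}\,d\sigma(x)\right|^2\le B\int|f|^2\,d\sigma\qquad\text{for all } f\in L^2(\sigma).$$
   Context: A convex body is a compact convex subset of $\mathbb{R}^d$ with nonempty interior. The surface measure $\sigma$ on $\partial K$ is the $(d-1)$-dimensional Hausdorff measure restricted to $\partial K$. A finite positive Borel measure $\mu$ on $\mathbb{R}^d$ is said to admit a Fourier frame (to be frame-spectral) if there is a set of exponentials $E(\Lambda)=\{e^{2\pi i\lambda\cdot x}:\lambda\in\Lambda\}$, $\Lambda\subset\mathbb{R}^d$ countable, and constants $0<A\le B<\infty$ such that $A\|f\|_{L^2(\mu)}^2\le\sum_{\lambda\in\Lambda}|\int f(x)e^{-2\pi i\lambda\cdot x}d\mu(x)|^2\le B\|f\|_{L^2(\mu)}^2$ for all $f\in L^2(\mu)$. *)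

theory Defs
  imports "HOL-Analysis.Analysis"
begin

section \<open>Hausdorff measure\<close>

text \<open>
  The normalisation is the one for which the \<open>k\<close>-dimensional Hausdorff measure on
  \<open>k\<close>-dimensional Euclidean space is Lebesgue measure.  The covering sets are required to be
  bounded because the library's \<^const>\<open>diameter\<close> is a junk value on unbounded sets; the empty set
  is treated separately so that it has weight \<open>0\<close> also for \<open>k = 0\<close>.
\<close>

definition hausdorff_weight :: "nat \<Rightarrow> 'a::metric_space set \<Rightarrow> ennreal" where
  "hausdorff_weight k C =
     (if C = {} then 0 else ennreal (unit_ball_vol (real k) * (diameter C / 2) ^ k))"

definition hausdorff_content :: "nat \<Rightarrow> real \<Rightarrow> 'a::metric_space set \<Rightarrow> ennreal" where
  "hausdorff_content k \<delta> A =
     (INF C \<in> {C :: nat \<Rightarrow> 'a set. A \<subseteq> (\<Union>i. C i) \<and> (\<forall>i. bounded (C i) \<and> diameter (C i) \<le> \<delta>)}.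
        \<Sum>i. hausdorff_weight k (C i))"

definition hausdorff_outer_measure :: "nat \<Rightarrow> 'a::metric_space set \<Rightarrow> ennreal" where
  "hausdorff_outer_measure k A = (SUP \<delta> \<in> {0<..}. hausdorff_content k \<delta> A)"

definition hausdorff_measure :: "nat \<Rightarrow> 'a::metric_space measure" where
  "hausdorff_measure k = measure_of UNIV (sets borel) (hausdorff_outer_measure k)"

lemma hausdorff_content_antimono:
  assumes "\<delta> \<le> \<epsilon>"
  shows "hausdorff_content k \<epsilon> A \<le> hausdorff_content k \<delta> A"
  unfolding hausdorff_content_def
  by (rule INF_superset_mono) (use assms in \<open>auto intro: order_trans\<close>)

lemma hausdorff_content_mono:
  assumes "A \<subseteq> B"
  shows "hausdorff_content k \<delta> A \<le> hausdorff_content k \<delta> B"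
  unfolding hausdorff_content_def
  by (rule INF_superset_mono) (use assms in auto)

lemma hausdorff_outer_measure_mono: "A \<subseteq> B \<Longrightarrow> hausdorff_outer_measure k A \<le> hausdorff_outer_measure k B"
  unfolding hausdorff_outer_measure_def by (intro SUP_mono) (auto intro: hausdorff_content_mono)

lemma hausdorff_content_empty: "\<delta> \<ge> 0 \<Longrightarrow> hausdorff_content k \<delta> {} = 0"
  unfolding hausdorff_content_def
  by (intro antisym INF_lower2[of "\<lambda>_. {}"]) (auto simp: hausdorff_weight_def)

lemma hausdorff_outer_measure_empty: "hausdorff_outer_measure k {} = 0"
  unfolding hausdorff_outer_measure_def by (simp add: hausdorff_content_empty)

lemma hausdorff_content_subadd:
  fixes A :: "nat \<Rightarrow> 'a::metric_space set"
  shows "hausdorff_content k \<delta> (\<Union>i. A i) \<le> (\<Sum>i. hausdorff_content k \<delta> (A i))"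
proof (cases "\<forall>i. hausdorff_content k \<delta> (A i) < top")
  case False
  then obtain i where "hausdorff_content k \<delta> (A i) = top"
    using less_top by blast
  moreover have "hausdorff_content k \<delta> (A i) \<le> (\<Sum>i. hausdorff_content k \<delta> (A i))"
    using sum_le_suminf[of "\<lambda>i. hausdorff_content k \<delta> (A i)" "{i}"] by simp
  ultimately show ?thesis by (simp add: top_unique)
next
  case True
  show ?thesis
  proof (rule ennreal_le_epsilon)
    fix e :: real assume "0 < e"
    have "\<exists>C. A i \<subseteq> (\<Union>j. C j) \<and> (\<forall>j. bounded (C j) \<and> diameter (C j) \<le> \<delta>) \<and>
       (\<Sum>j. hausdorff_weight k (C j)) \<le> hausdorff_content k \<delta> (A i) + ennreal (e * (1/2) ^ Suc i)" for i
    proof -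
      have "hausdorff_content k \<delta> (A i) < hausdorff_content k \<delta> (A i) + ennreal (e * (1/2) ^ Suc i)"
        using True \<open>0 < e\<close> by (auto simp: ennreal_add_left_cancel_less less_top[symmetric])
      then show ?thesis
        unfolding hausdorff_content_def[of k \<delta> "A i"] INF_less_iff
        by (auto intro: less_imp_le)
    qed
    then obtain C where C: "\<And>i. A i \<subseteq> (\<Union>j. C i j)"
      "\<And>i j. bounded (C i j) \<and> diameter (C i j) \<le> \<delta>"
      "\<And>i. (\<Sum>j. hausdorff_weight k (C i j)) \<le> hausdorff_content k \<delta> (A i) + ennreal (e * (1/2) ^ Suc i)"
      by metis
    define D where "D n = (case prod_decode n of (i, j) \<Rightarrow> C i j)" for n
    have "(\<Union>i. A i) \<subseteq> (\<Union>n. D n)"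
    proof
      fix x assume "x \<in> (\<Union>i. A i)"
      then obtain i j where "x \<in> C i j" using C(1) by blast
      then have "x \<in> D (prod_encode (i, j))" by (simp add: D_def)
      then show "x \<in> (\<Union>n. D n)" by blast
    qed
    then have "hausdorff_content k \<delta> (\<Union>i. A i) \<le> (\<Sum>n. hausdorff_weight k (D n))"
      unfolding hausdorff_content_def
      by (intro INF_lower) (auto simp: D_def C(2) split: prod.split)
    also have "\<dots> = (\<Sum>i. \<Sum>j. hausdorff_weight k (C i j))"
      using suminf_ennreal_2dimen[of "\<lambda>i. \<Sum>j. hausdorff_weight k (C i j)"
          "\<lambda>(i,j). hausdorff_weight k (C i j)"]
      by (simp add: D_def o_def split_beta)
    also have "\<dots> \<le> (\<Sum>i. hausdorff_content k \<delta> (A i) + ennreal (e * (1/2) ^ Suc i))"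
      by (intro suminf_le C) auto
    also have "\<dots> = (\<Sum>i. hausdorff_content k \<delta> (A i)) + (\<Sum>i. ennreal (e * (1/2) ^ Suc i))"
      by (intro suminf_add[symmetric]) auto
    also have "(\<Sum>i. ennreal (e * (1/2) ^ Suc i)) = ennreal e"
    proof -
      have "(\<lambda>i. e * (1/2) ^ Suc i) sums (e * 1)"
        by (intro sums_mult power_half_series)
      then show ?thesis using \<open>0 < e\<close>
        by (subst suminf_ennreal2) (auto simp: sums_iff)
    qed
    finally show "hausdorff_content k \<delta> (\<Union>i. A i) \<le> (\<Sum>i. hausdorff_content k \<delta> (A i)) + ennreal e" .
  qed
qed

lemma hausdorff_outer_measure_subadd:
  fixes A :: "nat \<Rightarrow> 'a::metric_space set"
  shows "hausdorff_outer_measure k (\<Union>i. A i) \<le> (\<Sum>i. hausdorff_outer_measure k (A i))"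
proof -
  have "hausdorff_content k \<delta> (\<Union>i. A i) \<le> (\<Sum>i. hausdorff_outer_measure k (A i))" if "\<delta> > 0" for \<delta>
    by (rule order_trans[OF hausdorff_content_subadd], intro suminf_le)
       (use that in \<open>auto simp: hausdorff_outer_measure_def intro: SUP_upper\<close>)
  then show ?thesis
    by (subst (1) hausdorff_outer_measure_def) (auto intro: SUP_least)
qed

lemma hausdorff_outer_measure_space:
  "outer_measure_space (Pow UNIV) (hausdorff_outer_measure k :: 'a::metric_space set \<Rightarrow> ennreal)"
  unfolding outer_measure_space_def positive_def increasing_def countably_subadditive_def
  by (auto simp: hausdorff_outer_measure_empty hausdorff_outer_measure_subadd intro: hausdorff_outer_measure_mono)

lemma hausdorff_outer_measure_Un: "hausdorff_outer_measure k (A \<union> B)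
    \<le> hausdorff_outer_measure k A + hausdorff_outer_measure k (B :: 'a::metric_space set)"
proof -
  interpret sigma_algebra UNIV "Pow (UNIV :: 'a set)" by (rule sigma_algebra_Pow)
  have "subadditive (Pow UNIV) (hausdorff_outer_measure k :: 'a set \<Rightarrow> ennreal)"
    using countably_subadditive_subadditive hausdorff_outer_measure_space[where 'a='a, of k]
    unfolding outer_measure_space_def by blast
  from subadditiveD[OF this, of A "B - A"]
  have "hausdorff_outer_measure k (A \<union> B) \<le> hausdorff_outer_measure k A + hausdorff_outer_measure k (B - A)"
    by (simp add: Un_Diff_cancel)
  also have "\<dots> \<le> hausdorff_outer_measure k A + hausdorff_outer_measure k B"
    by (intro add_left_mono hausdorff_outer_measure_mono) auto
  finally show ?thesis .
qed

lemma hausdorff_outer_measure_separated: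
  fixes A B :: "'a::metric_space set"
  assumes "\<eta> > 0" and sep: "\<And>x y. x \<in> A \<Longrightarrow> y \<in> B \<Longrightarrow> dist x y \<ge> \<eta>"
  shows "hausdorff_outer_measure k A + hausdorff_outer_measure k B \<le> hausdorff_outer_measure k (A \<union> B)"
proof -
  have small: "hausdorff_content k \<delta> A + hausdorff_content k \<delta> B \<le> hausdorff_content k \<delta> (A \<union> B)"
    if \<delta>: "0 < \<delta>" "\<delta> < \<eta>" for \<delta>
    unfolding hausdorff_content_def[of k \<delta> "A \<union> B"]
  proof (rule INF_greatest)
    fix C :: "nat \<Rightarrow> 'a set"
    assume C: "C \<in> {C. A \<union> B \<subseteq> (\<Union>i. C i) \<and> (\<forall>i. bounded (C i) \<and> diameter (C i) \<le> \<delta>)}"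
    define CA where "CA i = (if C i \<inter> A = {} then {} else C i)" for i
    define CB where "CB i = (if C i \<inter> B = {} then {} else C i)" for i
    have A: "hausdorff_content k \<delta> A \<le> (\<Sum>i. hausdorff_weight k (CA i))"
      unfolding hausdorff_content_def
      by (intro INF_lower) (use C \<delta> in \<open>fastforce simp: CA_def\<close>)
    have B: "hausdorff_content k \<delta> B \<le> (\<Sum>i. hausdorff_weight k (CB i))"
      unfolding hausdorff_content_def
      by (intro INF_lower) (use C \<delta> in \<open>fastforce simp: CB_def\<close>)
    have "C i \<inter> A = {} \<or> C i \<inter> B = {}" for i
    proof (rule ccontr)
      assume "\<not> ?thesis"
      then obtain x y where xy: "x \<in> C i" "x \<in> A" "y \<in> C i" "y \<in> B" by blast
      have "dist x y \<le> diameter (C i)" using C xy by (intro diameter_bounded_bound) auto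
      with C have "dist x y \<le> \<delta>" by (force intro: order_trans)
      with sep[OF xy(2,4)] \<delta> show False by simp
    qed
    then have le: "hausdorff_weight k (CA i) + hausdorff_weight k (CB i) \<le> hausdorff_weight k (C i)" for i
      unfolding CA_def CB_def by (auto simp: hausdorff_weight_def[of k "{}"])
    have "hausdorff_content k \<delta> A + hausdorff_content k \<delta> B
        \<le> (\<Sum>i. hausdorff_weight k (CA i)) + (\<Sum>i. hausdorff_weight k (CB i))"
      by (intro add_mono A B)
    also have "\<dots> = (\<Sum>i. hausdorff_weight k (CA i) + hausdorff_weight k (CB i))"
      by (intro suminf_add) auto
    also have "\<dots> \<le> (\<Sum>i. hausdorff_weight k (C i))"
      by (intro suminf_le le) auto
    finally show "hausdorff_content k \<delta> A + hausdorff_content k \<delta> B \<le> (\<Sum>i. hausdorff_weight k (C i))" .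
  qed
  have "hausdorff_outer_measure k A + hausdorff_outer_measure k B
      = (SUP \<delta> \<in> {0<..}. hausdorff_content k \<delta> A + hausdorff_content k \<delta> B)"
    unfolding hausdorff_outer_measure_def
  proof (rule SUP_add_directed_ennreal[symmetric])
    fix i j :: real assume "i \<in> {0<..}" "j \<in> {0<..}"
    then show "\<exists>m\<in>{0<..}. hausdorff_content k i A + hausdorff_content k j B
        \<le> hausdorff_content k m A + hausdorff_content k m B"
      by (intro bexI[of _ "min i j"] add_mono hausdorff_content_antimono) auto
  qed
  also have "\<dots> \<le> hausdorff_outer_measure k (A \<union> B)"
  proof (rule SUP_least)
    fix \<delta> :: real assume "\<delta> \<in> {0<..}"
    define m where "m = min \<delta> (\<eta> / 2)"
    have m: "0 < m" "m < \<eta>" "m \<le> \<delta>" using \<open>\<delta> \<in> _\<close> \<open>\<eta> > 0\<close> by (auto simp: m_def)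
    have "hausdorff_content k \<delta> A + hausdorff_content k \<delta> B \<le> hausdorff_content k m A + hausdorff_content k m B"
      by (intro add_mono hausdorff_content_antimono m)
    also have "\<dots> \<le> hausdorff_content k m (A \<union> B)" by (intro small m)
    also have "\<dots> \<le> hausdorff_outer_measure k (A \<union> B)"
      unfolding hausdorff_outer_measure_def using m by (intro SUP_upper) auto
    finally show "hausdorff_content k \<delta> A + hausdorff_content k \<delta> B \<le> hausdorff_outer_measure k (A \<union> B)" .
  qed
  finally show ?thesis .
qed

lemma hausdorff_outer_measure_closed:
  fixes F A :: "'a::metric_space set"
  assumes "closed F"
  shows "hausdorff_outer_measure k (A \<inter> F) + hausdorff_outer_measure k (A - F) \<le> hausdorff_outer_measure k A"
proof (cases "F = {} \<or> hausdorff_outer_measure k A = top")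
  case True
  then show ?thesis by (auto simp: hausdorff_outer_measure_empty)
next
  case False
  let ?H = "hausdorff_outer_measure k :: 'a set \<Rightarrow> ennreal"
  have ne: "F \<noteq> {}" and fin: "?H A < top" using False by (auto simp: less_top)
  define S where "S n = {x \<in> A. 1 / real (Suc n) \<le> infdist x F}" for n
  define R where "R n = {x \<in> A. 1 / real (Suc (Suc n)) \<le> infdist x F \<and> infdist x F < 1 / real (Suc n)}" for n
  have AF: "?H (A \<inter> F) + ?H (S n) \<le> ?H A" for n
  proof -
    have "?H (A \<inter> F) + ?H (S n) \<le> ?H ((A \<inter> F) \<union> S n)"
    proof (rule hausdorff_outer_measure_separated[of "1 / real (Suc n)"])
      fix x y assume "x \<in> A \<inter> F" "y \<in> S n"
      then show "1 / real (Suc n) \<le> dist x y"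
        using infdist_le[of x F y] by (simp add: S_def dist_commute)
    qed simp
    also have "\<dots> \<le> ?H A" by (intro hausdorff_outer_measure_mono) (auto simp: S_def)
    finally show ?thesis .
  qed
  have sepR: "dist x y \<ge> 1 / real (Suc (Suc m)) - 1 / real (Suc n)" if "x \<in> R m" "y \<in> R n" for x y m n
    using that infdist_triangle[of x F y] by (auto simp: R_def)
  have sumR: "(\<Sum>j<n. ?H (R (2 * j + b))) \<le> ?H (A \<inter> (\<Union>j<n. R (2 * j + b)))" for n b
  proof (induction n)
    case (Suc n)
    have "(\<Sum>j<Suc n. ?H (R (2 * j + b))) \<le> ?H (A \<inter> (\<Union>j<n. R (2 * j + b))) + ?H (R (2 * n + b))"
      using Suc by (simp add: add_mono)
    also have "\<dots> \<le> ?H ((A \<inter> (\<Union>j<n. R (2 * j + b))) \<union> R (2 * n + b))"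
    proof (rule hausdorff_outer_measure_separated[of "if n = 0 then 1 else 1 / real (2 * n + b) - 1 / real (Suc (2 * n + b))"])
      show "0 < (if n = 0 then 1 else 1 / real (2 * n + b) - 1 / real (Suc (2 * n + b)))"
        by (auto intro!: divide_strict_left_mono)
    next
      fix x y assume x: "x \<in> A \<inter> (\<Union>j<n. R (2 * j + b))" and y: "y \<in> R (2 * n + b)"
      then obtain j where j: "j < n" "x \<in> R (2 * j + b)" by blast
      have "1 / real (2 * n + b) \<le> 1 / real (Suc (Suc (2 * j + b)))"
        using j by (intro divide_left_mono) auto
      with sepR[OF j(2) y] j show "(if n = 0 then 1 else 1 / real (2 * n + b) - 1 / real (Suc (2 * n + b))) \<le> dist x y" by simp
    qed
    also have "\<dots> \<le> ?H (A \<inter> (\<Union>j<Suc n. R (2 * j + b)))"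
      by (intro hausdorff_outer_measure_mono) (auto simp: R_def lessThan_Suc)
    finally show ?case .
  qed simp
  have sumR2: "(\<Sum>j. ?H (R (2 * j + b))) \<le> ?H A" for b
    by (rule suminf_le_const) (auto intro: order_trans[OF sumR] hausdorff_outer_measure_mono)
  have "(\<Sum>n. ?H (R n)) \<le> ?H A + ?H A"
  proof (rule suminf_le_const)
    fix n
    have "(\<Sum>i<n. ?H (R i)) \<le> (\<Sum>i<2*n. ?H (R i))" by (intro sum_mono2) auto
    also have "\<dots> = (\<Sum>j<n. ?H (R (2 * j + 0))) + (\<Sum>j<n. ?H (R (2 * j + 1)))"
      by (induction n) (auto simp: algebra_simps)
    also have "\<dots> \<le> ?H A + ?H A"
      by (intro add_mono order_trans[OF sum_le_suminf sumR2]) auto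
    finally show "(\<Sum>i<n. ?H (R i)) \<le> ?H A + ?H A" .
  qed simp
  then have sfin: "(\<Sum>n. ?H (R n)) < top" using fin by (auto intro: le_less_trans)
  have cover: "A - F \<subseteq> S n \<union> (\<Union>i. R (i + n))" for n
  proof
    fix x assume x: "x \<in> A - F"
    then have pos: "infdist x F > 0"
      using ne \<open>closed F\<close> by (metis DiffD2 in_closed_iff_infdist_zero infdist_nonneg less_eq_real_def)
    show "x \<in> S n \<union> (\<Union>i. R (i + n))"
    proof (cases "x \<in> S n")
      case nS: False
      obtain m0 where m0: "inverse (real (Suc m0)) < infdist x F" using reals_Archimedean[OF pos] by blast
      define m where "m = (LEAST m. 1 / real (Suc m) \<le> infdist x F)"
      have m: "1 / real (Suc m) \<le> infdist x F"
        unfolding m_def by (rule LeastI[of _ m0]) (use m0 in \<open>auto simp: inverse_eq_divide\<close>)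
      have "m > n"
      proof (rule ccontr)
        assume "\<not> m > n"
        then have "1 / real (Suc n) \<le> 1 / real (Suc m)" by (intro divide_left_mono) auto
        with m nS x show False by (auto simp: S_def)
      qed
      then obtain i where i: "m = Suc (i + n)" by (metis add.commute less_imp_Suc_add)
      have "infdist x F < 1 / real (Suc (i + n))"
        using not_less_Least[of "i + n" "\<lambda>m. 1 / real (Suc m) \<le> infdist x F"] i
        unfolding m_def[symmetric] by simp
      then have "x \<in> R (i + n)" using m x i by (auto simp: R_def)
      then show ?thesis by blast
    qed auto
  qed
  have bound: "?H (A \<inter> F) + ?H (A - F) \<le> ?H A + (\<Sum>i. ?H (R (i + n)))" for n
  proof -
    have "?H (A - F) \<le> ?H (S n) + ?H (\<Union>i. R (i + n))"
      by (rule order_trans[OF hausdorff_outer_measure_mono[OF cover] hausdorff_outer_measure_Un])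
    also have "\<dots> \<le> ?H (S n) + (\<Sum>i. ?H (R (i + n)))"
      by (intro add_left_mono hausdorff_outer_measure_subadd)
    finally have "?H (A \<inter> F) + ?H (A - F) \<le> (?H (A \<inter> F) + ?H (S n)) + (\<Sum>i. ?H (R (i + n)))"
      by (metis add.assoc add_left_mono)
    also have "\<dots> \<le> ?H A + (\<Sum>i. ?H (R (i + n)))" by (intro add_right_mono AF)
    finally show ?thesis .
  qed
  show ?thesis
  proof (rule ennreal_le_epsilon)
    fix e :: real assume "0 < e"
    have "(\<lambda>n. \<Sum>i<n. ?H (R i)) \<longlonglongrightarrow> (\<Sum>n. ?H (R n))"
      by (rule summable_LIMSEQ) simp
    then have "(\<lambda>n. (\<Sum>i<n. ?H (R i)) + ennreal e) \<longlonglongrightarrow> (\<Sum>n. ?H (R n)) + ennreal e"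
      by (intro tendsto_intros)
    moreover have "(\<Sum>n. ?H (R n)) < (\<Sum>n. ?H (R n)) + ennreal e"
      using sfin \<open>0 < e\<close> by (simp add: ennreal_add_left_cancel_less less_top)
    ultimately have "\<forall>\<^sub>F n in sequentially. (\<Sum>n. ?H (R n)) < (\<Sum>i<n. ?H (R i)) + ennreal e"
      by (rule order_tendstoD(1))
    then obtain n where n: "(\<Sum>n. ?H (R n)) < (\<Sum>i<n. ?H (R i)) + ennreal e"
      by (auto simp: eventually_sequentially)
    have "(\<Sum>n. ?H (R n)) = (\<Sum>i<n. ?H (R i)) + (\<Sum>i. ?H (R (i + n)))"
      by (subst suminf_offset[of _ n]) (auto simp: add.commute)
    with n have "(\<Sum>i. ?H (R (i + n))) \<le> ennreal e"
      by (auto simp: ennreal_add_left_cancel_less intro: less_imp_le)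
    then show "?H (A \<inter> F) + ?H (A - F) \<le> ?H A + ennreal e"
      by (rule order_trans[OF bound add_left_mono])
  qed
qed

lemma measure_space_hausdorff_outer_measure:
  "measure_space UNIV (sets borel) (hausdorff_outer_measure k :: 'a::metric_space set \<Rightarrow> ennreal)"
proof -
  interpret P: sigma_algebra UNIV "Pow (UNIV :: 'a set)" by (rule sigma_algebra_Pow)
  let ?L = "lambda_system UNIV (Pow UNIV) (hausdorff_outer_measure k :: 'a set \<Rightarrow> ennreal)"
  have L: "measure_space UNIV ?L (hausdorff_outer_measure k)"
    by (rule P.caratheodory_lemma[OF hausdorff_outer_measure_space])
  then interpret L: sigma_algebra UNIV ?L by (simp add: measure_space_def)
  have "F \<in> ?L" if "closed F" for F
    unfolding P.lambda_system_eq
  proof (safe intro!: antisym)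
    fix A :: "'a set"
    show "hausdorff_outer_measure k (A \<inter> F) + hausdorff_outer_measure k (A - F) \<le> hausdorff_outer_measure k A"
      by (rule hausdorff_outer_measure_closed[OF that])
    show "hausdorff_outer_measure k A \<le> hausdorff_outer_measure k (A \<inter> F) + hausdorff_outer_measure k (A - F)"
      by (rule order_trans[OF hausdorff_outer_measure_mono hausdorff_outer_measure_Un]) auto
  qed auto
  then have "sigma_sets UNIV {F. closed F} \<subseteq> ?L"
    by (intro L.sigma_sets_subset) auto
  then have "sets borel \<subseteq> ?L"
    by (simp add: borel_eq_closed)
  moreover have "sigma_algebra UNIV (sets borel :: 'a set set)"
    using sets.sigma_algebra_axioms[of borel] by simp
  ultimately show ?thesis
    using L by (auto intro: measure_down)
qed

lemma space_hausdorff_measure [simp]: "space (hausdorff_measure k) = UNIV"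
  by (simp add: hausdorff_measure_def space_measure_of_conv)

lemma sets_hausdorff_measure [simp, measurable_cong]: "sets (hausdorff_measure k) = sets borel"
  unfolding hausdorff_measure_def
  using sets.sigma_sets_eq[of borel] by (simp add: sets_measure_of_conv)

lemma emeasure_hausdorff_measure:
  "A \<in> sets borel \<Longrightarrow> emeasure (hausdorff_measure k) A = hausdorff_outer_measure k A"
  using measure_space_hausdorff_outer_measure[of k]
  by (intro emeasure_measure_of[OF hausdorff_measure_def])
     (auto simp: measure_space_def)

section \<open>Convex bodies and their boundaries\<close>

definition convex_body :: "'a::euclidean_space set \<Rightarrow> bool" where
  "convex_body K \<longleftrightarrow> convex K \<and> compact K \<and> interior K \<noteq> {}"

definition surface_measure :: "(real^'n) set \<Rightarrow> (real^'n) measure" where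
  "surface_measure K = density (hausdorff_measure (CARD('n) - 1)) (indicator (frontier K))"

lemma emeasure_surface_measure:
  fixes K :: "(real^'n) set"
  assumes "A \<in> sets borel"
  shows "emeasure (surface_measure K) A = hausdorff_outer_measure (CARD('n) - 1) (A \<inter> frontier K)"
proof -
  have "frontier K \<in> sets borel" by (simp add: borel_closed)
  then show ?thesis using assms
    by (simp add: surface_measure_def emeasure_restricted emeasure_hausdorff_measure Int_commute)
qed

lemma sets_surface_measure [simp, measurable_cong]: "sets (surface_measure K) = sets borel"
  by (simp add: surface_measure_def)

text \<open>
  On an open set \<open>S\<close>, \<open>C_k_on k S f\<close> says that \<open>f\<close> is \<open>k\<close> times continuously differentiable:
  all iterated directional derivatives up to order \<open>k\<close> exist and are continuous.
\<close>

primrec C_k_on ::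
  "nat \<Rightarrow> 'a::real_normed_vector set \<Rightarrow> ('a \<Rightarrow> 'b::real_normed_vector) \<Rightarrow> bool" where
  "C_k_on 0 S f \<longleftrightarrow> continuous_on S f"
| "C_k_on (Suc k) S f \<longleftrightarrow> (\<forall>x\<in>S. f differentiable (at x)) \<and>
     (\<forall>v. C_k_on k S (\<lambda>x. frechet_derivative f (at x) v))"

definition smooth_on :: "'a::real_normed_vector set \<Rightarrow> ('a \<Rightarrow> 'b::real_normed_vector) \<Rightarrow> bool" where
  "smooth_on S f \<longleftrightarrow> (\<forall>k. C_k_on k S f)"

text \<open>
  The boundary is an embedded \<open>C\<^sup>\<infinity>\<close> hypersurface: near each of its points it is the zero set of a
  \<open>C\<^sup>\<infinity>\<close> function with nowhere vanishing differential.
\<close>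

definition smooth_boundary :: "'a::euclidean_space set \<Rightarrow> bool" where
  "smooth_boundary K \<longleftrightarrow> (\<forall>p\<in>frontier K. \<exists>U (\<phi> :: 'a \<Rightarrow> real).
     open U \<and> p \<in> U \<and> smooth_on U \<phi> \<and>
     (\<forall>x\<in>U. frechet_derivative \<phi> (at x) \<noteq> (\<lambda>_. 0)) \<and>
     frontier K \<inter> U = {x\<in>U. \<phi> x = 0})"

text \<open>
  The Gauss map.  A convex body has exactly one outer unit normal at \<open>p\<close> when its boundary is
  smooth at \<open>p\<close>.
\<close>

definition outer_unit_normal :: "'a::euclidean_space set \<Rightarrow> 'a \<Rightarrow> 'a" where
  "outer_unit_normal K p = (THE n. norm n = 1 \<and> (\<forall>y\<in>K. n \<bullet> (y - p) \<le> 0))"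

text \<open>
  The Gaussian curvature is the determinant of the differential of the Gauss map
  \<open>N\<close>, an endomorphism of the tangent hyperplane \<open>T\<^sub>p = {N p}\<^sup>\<bottom>\<close>.  The derivative of \<open>N\<close> within
  the boundary determines a linear map \<open>L\<close> on \<open>T\<^sub>p\<close> only, so we fix the value of \<open>L\<close> on the normal
  line by \<open>L (N p) = N p\<close>; this makes \<open>L\<close> unique, and its determinant is that of \<open>L\<close> restricted to
  \<open>T\<^sub>p\<close>.  With the outer normal, the principal curvatures of a convex body are nonnegative and
  those of the unit sphere are \<open>1\<close>.
\<close>

definition has_gaussian_curvature :: "(real^'n) set \<Rightarrow> real^'n \<Rightarrow> real \<Rightarrow> bool" where
  "has_gaussian_curvature K p \<kappa> \<longleftrightarrow>
     (\<exists>L. (outer_unit_normal K has_derivative L) (at p within frontier K) \<and>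
          L (outer_unit_normal K p) = outer_unit_normal K p \<and>
          \<kappa> = det (matrix L))"

section \<open>Fourier frames\<close>

definition square_integrable :: "'a measure \<Rightarrow> ('a \<Rightarrow> complex) \<Rightarrow> bool" where
  "square_integrable \<mu> f \<longleftrightarrow>
     f \<in> borel_measurable \<mu> \<and> integrable \<mu> (\<lambda>x. (cmod (f x))\<^sup>2)"

text \<open>
  Meant for finite Borel measures \<open>\<mu>\<close>, for which \<open>L\<^sup>2(\<mu>) \<subseteq> L\<^sup>1(\<mu>)\<close>, so that the integrals below
  converge.  The sum over \<open>\<Lambda>\<close> is taken in \<open>[0, \<infinity>]\<close>.
\<close>

definition fourier_coefficient :: "'a::euclidean_space measure \<Rightarrow> ('a \<Rightarrow> complex) \<Rightarrow> 'a \<Rightarrow> complex" where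
  "fourier_coefficient \<mu> f \<xi> =
     (LINT x|\<mu>. f x * exp (- 2 * of_real pi * \<i> * of_real (\<xi> \<bullet> x)))"

definition admits_fourier_frame :: "'a::euclidean_space measure \<Rightarrow> bool" where
  "admits_fourier_frame \<mu> \<longleftrightarrow>
     (\<exists>\<Lambda> A B. countable \<Lambda> \<and> 0 < A \<and> A \<le> B \<and>
       (\<forall>f. square_integrable \<mu> f \<longrightarrow>
          ennreal (A * (LINT x|\<mu>. (cmod (f x))\<^sup>2))
            \<le> (\<Sum>\<^sub>\<infinity>\<xi>\<in>\<Lambda>. ennreal ((cmod (fourier_coefficient \<mu> f \<xi>))\<^sup>2)) \<and>
          (\<Sum>\<^sub>\<infinity>\<xi>\<in>\<Lambda>. ennreal ((cmod (fourier_coefficient \<mu> f \<xi>))\<^sup>2))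
            \<le> ennreal (B * (LINT x|\<mu>. (cmod (f x))\<^sup>2))))"

end

theory Submission
  imports Defs
begin

text \<open>
  By strict convexity there is, for every direction \<open>\<theta>\<close>, a density \<open>f\<close> supported near the boundary
  point with normal \<open>\<theta>\<close> such that \<open>|(f \<sigma>)^(\<xi>)|\<^sup>2\<close> is at most of order \<open>|\<xi>|\<^bsup>-(d-1)\<^esup>\<close>
  everywhere and at least of that order for large \<open>\<xi>\<close> in a cone around \<open>\<theta>\<close>.  Finitely many cones cover
  all directions, so the upper frame bound forces \<open>\<Sum>\<^bsub>\<lambda>\<in>\<Lambda>\<^esub> (1 + |\<lambda>|)\<^bsup>-(d-1)\<^esup> < \<infinity>\<close>.  Now apply the lower
  frame bound to the modulations \<open>f e\<^bsup>i s x\<^esup>\<close>, all of the same norm, and average over \<open>s\<close> in a ball of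
  radius \<open>R\<close>: each term tends to \<open>0\<close> as \<open>R \<rightarrow> \<infinity>\<close>, since \<open>d \<ge> 2\<close>, and is dominated by a constant
  times \<open>(1 + |\<lambda>|)\<^bsup>-(d-1)\<^esup>\<close>.  So the sum tends to \<open>0\<close>, contradicting the positive lower bound.

  The decay rates come from the autocorrelation of the amplitude on a graph, whose phase difference
  \<open>h (m + u) - h m\<close> has no stationary point in the direction of \<open>u\<close>; no stationary phase expansion is
  needed.
\<close>

section \<open>Oscillatory integrals without stationary points\<close>

text \<open>The square modulus of the transform is itself the Fourier transform over the hyperplane
  of an autocorrelation, which for large normal frequency \<tau> lives at displacements of size
  1/\<tau>. Rescaling them produces the factor \<tau>^(-(d-1)), provided the rescaled
  autocorrelation has a majorant that is integrable over d - 1 dimensions. Decay of order d is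
  enough, hence exactly d integrations by parts, uniform in the displacement. The same majorant
  yields the lower bound by dominated convergence: near the normal direction the rescaled square
  modulus tends to a fixed number, and only positivity of that number remains to be shown.

  Two obstacles shape the rest. The density must be found without computing a surface element; crude
  covering and packing estimates on one patch supply a bounded Radon-Nikodym density. And curvature
  is given only as a determinant of the differential of the Gauss map, so the chart is built from
  the convex body itself, and a degenerate second derivative is converted into a kernel vector of
  that differential.\<close>

text \<open>
  Only derivatives in the direction \<open>w p\<close> are taken, and all bounds are uniform in the parameter \<open>p\<close>.
\<close>

primrec C_k_bounded ::
  "nat \<Rightarrow> 'p set \<Rightarrow> ('p \<Rightarrow> 'a::euclidean_space) \<Rightarrow> 'a set \<Rightarrow> ('p \<Rightarrow> 'a \<Rightarrow> real) \<Rightarrow> bool" where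
  "C_k_bounded 0 P w D f \<longleftrightarrow> (\<forall>p\<in>P. continuous_on D (f p)) \<and> (\<exists>C. \<forall>p\<in>P. \<forall>x\<in>D. \<bar>f p x\<bar> \<le> C)"
| "C_k_bounded (Suc n) P w D f \<longleftrightarrow>
     ((\<forall>p\<in>P. continuous_on D (f p)) \<and> (\<exists>C. \<forall>p\<in>P. \<forall>x\<in>D. \<bar>f p x\<bar> \<le> C)) \<and>
     (\<exists>f'. (\<forall>p\<in>P. \<forall>x\<in>D. ((\<lambda>s. f p (x + s *\<^sub>R w p)) has_real_derivative f' p x) (at 0)) \<and>
        C_k_bounded n P w D f')"

lemma C_k_bounded_0: "C_k_bounded n P w D f \<Longrightarrow> C_k_bounded 0 P w D f"
  by (cases n) auto

lemma C_k_bounded_cont: "C_k_bounded n P w D f \<Longrightarrow> p \<in> P \<Longrightarrow> continuous_on D (f p)"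
  by (cases n) auto

lemma C_k_bounded_bound:
  assumes "C_k_bounded n P w D f"
  obtains C where "C > 0" "\<And>p x. p \<in> P \<Longrightarrow> x \<in> D \<Longrightarrow> \<bar>f p x\<bar> \<le> C"
proof -
  obtain C where C: "\<forall>p\<in>P. \<forall>x\<in>D. \<bar>f p x\<bar> \<le> C"
    using C_k_bounded_0[OF assms] by auto
  then have "\<And>p x. p \<in> P \<Longrightarrow> x \<in> D \<Longrightarrow> \<bar>f p x\<bar> \<le> max C 1" by fastforce
  with that[of "max C 1"] show ?thesis by simp
qed

lemma C_k_bounded_SucI:
  assumes "C_k_bounded 0 P w D f"
    "\<And>p x. p \<in> P \<Longrightarrow> x \<in> D \<Longrightarrow> ((\<lambda>s. f p (x + s *\<^sub>R w p)) has_real_derivative f' p x) (at 0)"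
    "C_k_bounded n P w D f'"
  shows "C_k_bounded (Suc n) P w D f"
  using assms by auto

lemma C_k_bounded_SucE:
  assumes "C_k_bounded (Suc n) P w D f"
  obtains f' where "\<And>p x. p \<in> P \<Longrightarrow> x \<in> D \<Longrightarrow> ((\<lambda>s. f p (x + s *\<^sub>R w p)) has_real_derivative f' p x) (at 0)"
    "C_k_bounded n P w D f'"
  using assms that unfolding C_k_bounded.simps by blast

lemma C_k_bounded_Suc_imp: "C_k_bounded (Suc n) P w D f \<Longrightarrow> C_k_bounded n P w D f"
proof (induction n arbitrary: f)
  case 0
  then show ?case by auto
next
  case (Suc n)
  from C_k_bounded_SucE[OF Suc.prems] obtain f' where
    f': "\<And>p x. p \<in> P \<Longrightarrow> x \<in> D \<Longrightarrow> ((\<lambda>s. f p (x + s *\<^sub>R w p)) has_real_derivative f' p x) (at 0)"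
    "C_k_bounded (Suc n) P w D f'" by metis
  show ?case
    by (rule C_k_bounded_SucI[OF C_k_bounded_0[OF Suc.prems] f'(1) Suc.IH[OF f'(2)]])
qed

lemma C_k_bounded_const:
  assumes "\<And>p. p \<in> P \<Longrightarrow> \<bar>c p\<bar> \<le> C"
  shows "C_k_bounded n P w D (\<lambda>p x. c p)"
proof -
  have z: "C_k_bounded n P w D (\<lambda>p x. 0)" for n
    by (induction n) (auto intro!: exI[of _ "\<lambda>p x. 0"] exI[of _ 0])
  show ?thesis
    using assms z by (cases n) (auto intro!: exI[of _ "\<lambda>p x. 0"])
qed

lemma C_k_bounded_add:
  assumes "C_k_bounded n P w D f" "C_k_bounded n P w D g"
  shows "C_k_bounded n P w D (\<lambda>p x. f p x + g p x)"
  using assms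
proof (induction n arbitrary: f g)
  case 0
  obtain C1 where C1: "\<And>p x. p \<in> P \<Longrightarrow> x \<in> D \<Longrightarrow> \<bar>f p x\<bar> \<le> C1" using 0 by (elim C_k_bounded_bound) auto
  obtain C2 where C2: "\<And>p x. p \<in> P \<Longrightarrow> x \<in> D \<Longrightarrow> \<bar>g p x\<bar> \<le> C2" using 0 by (elim C_k_bounded_bound) auto
  have "\<forall>p\<in>P. \<forall>x\<in>D. \<bar>f p x + g p x\<bar> \<le> C1 + C2" using C1 C2 by (meson abs_triangle_ineq add_mono order_trans)
  with 0 show ?case by (auto intro!: continuous_intros)
next
  case (Suc n)
  obtain f' where f': "\<And>p x. p \<in> P \<Longrightarrow> x \<in> D \<Longrightarrow> ((\<lambda>s. f p (x + s *\<^sub>R w p)) has_real_derivative f' p x) (at 0)"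
    "C_k_bounded n P w D f'" using Suc.prems(1) by (rule C_k_bounded_SucE) blast
  obtain g' where g': "\<And>p x. p \<in> P \<Longrightarrow> x \<in> D \<Longrightarrow> ((\<lambda>s. g p (x + s *\<^sub>R w p)) has_real_derivative g' p x) (at 0)"
    "C_k_bounded n P w D g'" using Suc.prems(2) by (rule C_k_bounded_SucE) blast
  have "C_k_bounded n P w D (\<lambda>p x. f p x + g p x)"
    by (rule Suc.IH[OF Suc.prems[THEN C_k_bounded_Suc_imp]])
  from C_k_bounded_0[OF this] show ?case
  proof (rule C_k_bounded_SucI)
    show "C_k_bounded n P w D (\<lambda>p x. f' p x + g' p x)" by (rule Suc.IH[OF f'(2) g'(2)])
  qed (auto intro!: derivative_eq_intros f' g')
qed

lemma C_k_bounded_mult: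
  assumes "C_k_bounded n P w D f" "C_k_bounded n P w D g"
  shows "C_k_bounded n P w D (\<lambda>p x. f p x * g p x)"
  using assms
proof (induction n arbitrary: f g)
  case 0
  obtain C1 where C1: "C1 > 0" "\<And>p x. p \<in> P \<Longrightarrow> x \<in> D \<Longrightarrow> \<bar>f p x\<bar> \<le> C1" using 0 by (elim C_k_bounded_bound) auto
  obtain C2 where C2: "C2 > 0" "\<And>p x. p \<in> P \<Longrightarrow> x \<in> D \<Longrightarrow> \<bar>g p x\<bar> \<le> C2" using 0 by (elim C_k_bounded_bound) auto
  have "\<forall>p\<in>P. \<forall>x\<in>D. \<bar>f p x * g p x\<bar> \<le> C1 * C2" using C1 C2 by (fastforce simp: abs_mult intro!: mult_mono)
  with 0 show ?case by (auto intro!: continuous_intros)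
next
  case (Suc n)
  obtain f' where f': "\<And>p x. p \<in> P \<Longrightarrow> x \<in> D \<Longrightarrow> ((\<lambda>s. f p (x + s *\<^sub>R w p)) has_real_derivative f' p x) (at 0)"
    "C_k_bounded n P w D f'" using Suc.prems(1) by (rule C_k_bounded_SucE) blast
  obtain g' where g': "\<And>p x. p \<in> P \<Longrightarrow> x \<in> D \<Longrightarrow> ((\<lambda>s. g p (x + s *\<^sub>R w p)) has_real_derivative g' p x) (at 0)"
    "C_k_bounded n P w D g'" using Suc.prems(2) by (rule C_k_bounded_SucE) blast
  note fg = Suc.prems[THEN C_k_bounded_Suc_imp]
  from C_k_bounded_0[OF Suc.IH[OF fg]] show ?case
  proof (rule C_k_bounded_SucI)
    show "C_k_bounded n P w D (\<lambda>p x. f' p x * g p x + f p x * g' p x)"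
      by (intro C_k_bounded_add Suc.IH f' g' fg)
  qed (auto intro!: derivative_eq_intros f' g')
qed

lemma C_k_bounded_sum:
  assumes "finite I" "\<And>i. i \<in> I \<Longrightarrow> C_k_bounded n P w D (f i)"
  shows "C_k_bounded n P w D (\<lambda>p x. \<Sum>i\<in>I. f i p x)"
  using assms
proof (induction I rule: finite_induct)
  case empty
  show ?case using C_k_bounded_const[of P "\<lambda>_. 0" 0] by simp
next
  case (insert i I)
  then show ?case by (simp add: C_k_bounded_add)
qed

text \<open>Openness of \<open>D\<close> does the work: a short segment from \<open>x\<close> in
  direction \<open>w p\<close> stays inside \<open>D\<close>, where the two functions agree, so
  their directional derivatives at \<open>x\<close> coincide.\<close>

lemma C_k_bounded_cong:
  assumes D: "open D" and eq: "\<And>p x. p \<in> P \<Longrightarrow> x \<in> D \<Longrightarrow> f p x = g p x"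
    and f: "C_k_bounded n P w D f"
  shows "C_k_bounded n P w D g"
proof -
  have z: "C_k_bounded 0 P w D g"
    using C_k_bounded_0[OF f] eq by (auto cong: continuous_on_cong)
  show ?thesis
  proof (cases n)
    case 0
    then show ?thesis using z by simp
  next
    case (Suc m)
    obtain f' where f': "\<And>p x. p \<in> P \<Longrightarrow> x \<in> D \<Longrightarrow> ((\<lambda>s. f p (x + s *\<^sub>R w p)) has_real_derivative f' p x) (at 0)"
      "C_k_bounded m P w D f'" using f unfolding Suc by (rule C_k_bounded_SucE) blast
    show ?thesis unfolding Suc
    proof (rule C_k_bounded_SucI[OF z _ f'(2)])
      fix p x assume px: "p \<in> P" "x \<in> D"
      have "((\<lambda>s. x + s *\<^sub>R w p) \<longlongrightarrow> x + 0 *\<^sub>R w p) (nhds 0)"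
        by (intro tendsto_intros filterlim_ident)
      then have "((\<lambda>s. x + s *\<^sub>R w p) \<longlongrightarrow> x) (nhds 0)" by simp
      then have "\<forall>\<^sub>F s in nhds 0. x + s *\<^sub>R w p \<in> D"
        using topological_tendstoD[of _ x] D px by blast
      then have "\<forall>\<^sub>F s in nhds 0. f p (x + s *\<^sub>R w p) = g p (x + s *\<^sub>R w p)"
        by eventually_elim (use eq px in auto)
      then have "((\<lambda>s. f p (x + s *\<^sub>R w p)) has_real_derivative f' p x) (at 0) \<longleftrightarrow>
          ((\<lambda>s. g p (x + s *\<^sub>R w p)) has_real_derivative f' p x) (at 0)"
        by (intro DERIV_cong_ev refl)
      then show "((\<lambda>s. g p (x + s *\<^sub>R w p)) has_real_derivative f' p x) (at 0)"
        using f'(1)[OF px] by simp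
    qed
  qed
qed

text \<open>Differentiating 1/f produces -f'/f^2, in which 1/f reappears at one order less, so
  induction and the product rule close up. The lower bound \<open>c\<close> common to all
  \<open>p\<close> keeps the estimate uniform.\<close>

lemma C_k_bounded_inverse:
  assumes "C_k_bounded n P w D f" "c > 0" "\<And>p x. p \<in> P \<Longrightarrow> x \<in> D \<Longrightarrow> c \<le> \<bar>f p x\<bar>"
  shows "C_k_bounded n P w D (\<lambda>p x. inverse (f p x))"
  using assms(1)
proof (induction n)
  case 0
  have "\<forall>p\<in>P. \<forall>x\<in>D. \<bar>inverse (f p x)\<bar> \<le> inverse c" using assms(2,3) 
    by (auto simp: abs_inverse intro!: le_imp_inverse_le)
  moreover have "f p x \<noteq> 0" if "p \<in> P" "x \<in> D" for p x using assms(2) assms(3)[OF that] by auto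
  ultimately show ?case using 0 by (auto intro!: continuous_on_inverse)
next
  case (Suc n)
  obtain f' where f': "\<And>p x. p \<in> P \<Longrightarrow> x \<in> D \<Longrightarrow> ((\<lambda>s. f p (x + s *\<^sub>R w p)) has_real_derivative f' p x) (at 0)"
    "C_k_bounded n P w D f'" using Suc.prems(1) by (rule C_k_bounded_SucE) blast
  note IH = Suc.IH[OF C_k_bounded_Suc_imp[OF Suc.prems]]
  have nz: "f p x \<noteq> 0" if "p \<in> P" "x \<in> D" for p x using assms(2) assms(3)[OF that] by auto
  from C_k_bounded_0[OF IH] show ?case
  proof (rule C_k_bounded_SucI)
    have "C_k_bounded n P w D (\<lambda>p x. (- 1) * (f' p x * (inverse (f p x) * inverse (f p x))))"
      by (intro C_k_bounded_mult f' IH C_k_bounded_const[of P "\<lambda>_. -1" 1]) auto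
    then show "C_k_bounded n P w D (\<lambda>p x. - f' p x * inverse (f p x) * inverse (f p x))"
      by (simp add: mult.assoc)
  qed (use nz in \<open>auto intro!: derivative_eq_intros f' simp: field_simps\<close>)
qed

text \<open>Directional derivatives commute with translations, and the bounds are uniform over the
  parameter set. This serves to shift a function by a displacement that is itself the parameter, and
  to add components to the parameter.\<close>

lemma C_k_bounded_reindex:
  assumes "C_k_bounded n P w D f" "\<And>q. q \<in> Q \<Longrightarrow> \<pi> q \<in> P" "\<And>q. q \<in> Q \<Longrightarrow> w' q = w (\<pi> q)"
    and "\<And>q x. q \<in> Q \<Longrightarrow> x \<in> D' \<Longrightarrow> x + v q \<in> D"
  shows "C_k_bounded n Q w' D' (\<lambda>q x. f (\<pi> q) (x + v q))"
  using assms(1)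
proof (induction n arbitrary: f)
  case 0
  then obtain C where "\<forall>p\<in>P. \<forall>x\<in>D. \<bar>f p x\<bar> \<le> C" by auto
  then have "\<forall>q\<in>Q. \<forall>x\<in>D'. \<bar>f (\<pi> q) (x + v q)\<bar> \<le> C" using assms by auto
  moreover have "continuous_on D' (\<lambda>x. f (\<pi> q) (x + v q))" if "q \<in> Q" for q
    by (rule continuous_on_compose2[of D "f (\<pi> q)"]) (use 0 assms that in \<open>auto intro!: continuous_intros\<close>)
  ultimately show ?case by auto
next
  case (Suc n)
  obtain f' where f': "\<And>p x. p \<in> P \<Longrightarrow> x \<in> D \<Longrightarrow> ((\<lambda>s. f p (x + s *\<^sub>R w p)) has_real_derivative f' p x) (at 0)"
    "C_k_bounded n P w D f'" using Suc.prems(1) by (rule C_k_bounded_SucE) blast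
  from C_k_bounded_0[OF Suc.IH[OF C_k_bounded_Suc_imp[OF Suc.prems]]] show ?case
  proof (rule C_k_bounded_SucI)
    show "C_k_bounded n Q w' D' (\<lambda>q x. f' (\<pi> q) (x + v q))" by (rule Suc.IH[OF f'(2)])
  next
    fix q x assume "q \<in> Q" "x \<in> D'"
    with f'(1)[of "\<pi> q" "x + v q"] assms
    show "((\<lambda>s. f (\<pi> q) (x + s *\<^sub>R w' q + v q)) has_real_derivative f' (\<pi> q) (x + v q)) (at 0)"
      by (simp add: add_ac)
  qed
qed

section \<open>Derivatives along lines and difference quotients\<close>

lemma line_deriv_shift:
  fixes f :: "'a::real_normed_vector \<Rightarrow> 'b::real_normed_vector"
  assumes "((\<lambda>s. f ((x + a *\<^sub>R w) + s *\<^sub>R w)) has_vector_derivative d) (at 0)"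
  shows "((\<lambda>s. f (x + s *\<^sub>R w)) has_vector_derivative d) (at a)"
proof -
  have "((\<lambda>s. s - a) has_vector_derivative 1) (at a)" by (auto intro!: derivative_eq_intros)
  from vector_diff_chain_at[OF this, of "\<lambda>s. f ((x + a *\<^sub>R w) + s *\<^sub>R w)" d] assms
  moreover have "(\<lambda>s. f ((x + a *\<^sub>R w) + s *\<^sub>R w)) \<circ> (\<lambda>s. s - a) = (\<lambda>s. f (x + s *\<^sub>R w))"
    by (simp add: o_def scaleR_diff_left)
  ultimately show ?thesis by simp
qed

lemma line_real_deriv_shift:
  fixes f :: "'a::real_normed_vector \<Rightarrow> real"
  assumes "((\<lambda>s. f ((x + a *\<^sub>R w) + s *\<^sub>R w)) has_real_derivative d) (at 0)"
  shows "((\<lambda>s. f (x + s *\<^sub>R w)) has_real_derivative d) (at a)"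
  using line_deriv_shift[of f x a w d] assms by (simp add: has_real_derivative_iff_has_vector_derivative)

lemma line_mvt:
  fixes f :: "'a::real_normed_vector \<Rightarrow> real"
  assumes "0 < t" "\<And>a. 0 \<le> a \<Longrightarrow> a \<le> t \<Longrightarrow> ((\<lambda>s. f ((x + a *\<^sub>R w) + s *\<^sub>R w)) has_real_derivative f' (x + a *\<^sub>R w)) (at 0)"
  obtains a where "0 < a" "a < t" "f (x + t *\<^sub>R w) - f x = t * f' (x + a *\<^sub>R w)"
proof -
  have "\<exists>a. 0 < a \<and> a < t \<and> f (x + t *\<^sub>R w) - f (x + 0 *\<^sub>R w) = (t - 0) * f' (x + a *\<^sub>R w)"
    by (rule MVT2[OF assms(1)]) (rule line_real_deriv_shift, rule assms(2))
  with that show ?thesis by auto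
qed

text \<open>Dividing by the step does no harm, however small the step is: the mean value theorem
  bounds the quotient by the directional derivative, at the price of one order. Forming difference
  quotients commutes with differentiating, so higher orders follow from order zero. The step will be
  the norm of a displacement that may tend to 0.\<close>

lemma C_k_bounded_diffquot:
  assumes "C_k_bounded (Suc n) P w D f" "\<And>q. q \<in> Q \<Longrightarrow> \<pi> q \<in> P" "\<And>q. q \<in> Q \<Longrightarrow> w' q = w (\<pi> q)"
    and t: "\<And>q. q \<in> Q \<Longrightarrow> t q > 0"
    and seg: "\<And>q x a. q \<in> Q \<Longrightarrow> x \<in> D' \<Longrightarrow> 0 \<le> a \<Longrightarrow> a \<le> t q \<Longrightarrow> x + a *\<^sub>R w' q \<in> D"
  shows "C_k_bounded n Q w' D' (\<lambda>q x. (f (\<pi> q) (x + t q *\<^sub>R w' q) - f (\<pi> q) x) / t q)"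
proof -
  have sub: "x \<in> D" if "q \<in> Q" "x \<in> D'" for q x using seg[OF that, of 0] t[OF that(1)] by simp
  \<comment> \<open>Stated for every \<open>f\<close>, since the induction passes from
    \<open>f\<close> to its directional derivative.\<close>
  have base: "C_k_bounded 0 Q w' D' (\<lambda>q x. (f (\<pi> q) (x + t q *\<^sub>R w' q) - f (\<pi> q) x) / t q)"
    if "C_k_bounded (Suc 0) P w D f" for f
  proof -
    obtain f' where f': "\<And>p x. p \<in> P \<Longrightarrow> x \<in> D \<Longrightarrow> ((\<lambda>s. f p (x + s *\<^sub>R w p)) has_real_derivative f' p x) (at 0)"
      "C_k_bounded 0 P w D f'" using \<open>C_k_bounded (Suc 0) P w D f\<close> by (rule C_k_bounded_SucE) blast
    obtain C where C: "\<And>p x. p \<in> P \<Longrightarrow> x \<in> D \<Longrightarrow> \<bar>f' p x\<bar> \<le> C" using f'(2) by (elim C_k_bounded_bound) auto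
    have "\<bar>(f (\<pi> q) (x + t q *\<^sub>R w' q) - f (\<pi> q) x) / t q\<bar> \<le> C" if qx: "q \<in> Q" "x \<in> D'" for q x
    proof -
      obtain a where a: "0 < a" "a < t q" "f (\<pi> q) (x + t q *\<^sub>R w' q) - f (\<pi> q) x = t q * f' (\<pi> q) (x + a *\<^sub>R w' q)"
        by (rule line_mvt[of "t q" "f (\<pi> q)" x "w' q" "f' (\<pi> q)"])
          (use t[OF qx(1)] f'(1)[OF assms(2)[OF qx(1)] seg[OF qx]] assms(3)[OF qx(1)] in auto)
      have "x + a *\<^sub>R w' q \<in> D" by (rule seg) (use a that in auto)
      then show ?thesis unfolding a(3) using C[of "\<pi> q"] assms(2) that t[OF that(1)] by simp
    qed
    moreover have "continuous_on D' (\<lambda>x. (f (\<pi> q) (x + t q *\<^sub>R w' q) - f (\<pi> q) x) / t q)" if q: "q \<in> Q" for q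
    proof -
      have c: "continuous_on D (f (\<pi> q))" using that(1) assms(2) \<open>C_k_bounded (Suc 0) P w D f\<close> by auto
      have "continuous_on D' (\<lambda>x. f (\<pi> q) (x + t q *\<^sub>R w' q))"
        by (rule continuous_on_compose2[OF c]) (use seg[OF q, of _ "t q"] t[OF q] in \<open>auto intro!: continuous_intros\<close>)
      moreover have "continuous_on D' (f (\<pi> q))" using continuous_on_subset[OF c] sub q by blast
      ultimately show ?thesis using t[OF q] by (intro continuous_intros) auto
    qed
    ultimately show ?thesis by auto
  qed
  show ?thesis using assms(1)
  proof (induction n arbitrary: f)
    case 0
    then show ?case by (rule base)
  next
    case (Suc n)
    obtain f' where f': "\<And>p x. p \<in> P \<Longrightarrow> x \<in> D \<Longrightarrow> ((\<lambda>s. f p (x + s *\<^sub>R w p)) has_real_derivative f' p x) (at 0)"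
      "C_k_bounded (Suc n) P w D f'" using Suc.prems(1) by (rule C_k_bounded_SucE) blast
    have "C_k_bounded 0 Q w' D' (\<lambda>q x. (f (\<pi> q) (x + t q *\<^sub>R w' q) - f (\<pi> q) x) / t q)"
      by (rule C_k_bounded_0[OF Suc.IH[OF C_k_bounded_Suc_imp[OF Suc.prems]]])
    then show ?case
    proof (rule C_k_bounded_SucI)
      show "C_k_bounded n Q w' D' (\<lambda>q x. (f' (\<pi> q) (x + t q *\<^sub>R w' q) - f' (\<pi> q) x) / t q)"
        by (rule Suc.IH[OF f'(2)])
    next
      fix q x assume qx: "q \<in> Q" "x \<in> D'"
      have "((\<lambda>s. f (\<pi> q) (x + s *\<^sub>R w' q)) has_real_derivative f' (\<pi> q) x) (at 0)"
        using f'(1)[of "\<pi> q" x] assms(2,3) qx sub by auto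
      moreover have "((\<lambda>s. f (\<pi> q) (x + s *\<^sub>R w' q + t q *\<^sub>R w' q)) has_real_derivative f' (\<pi> q) (x + t q *\<^sub>R w' q)) (at 0)"
        using f'(1)[of "\<pi> q" "x + t q *\<^sub>R w' q"] assms(2,3) qx seg[OF qx, of "t q"] t[OF qx(1)] by (simp add: add_ac)
      ultimately show "((\<lambda>s. (f (\<pi> q) (x + s *\<^sub>R w' q + t q *\<^sub>R w' q) - f (\<pi> q) (x + s *\<^sub>R w' q)) / t q)
         has_real_derivative (f' (\<pi> q) (x + t q *\<^sub>R w' q) - f' (\<pi> q) x) / t q) (at 0)"
        using t[OF qx(1)] by (auto intro!: derivative_eq_intros)
    qed
  qed
qed

section \<open>Integration by parts along a direction\<close>

lemma integrable_compact_support: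
  fixes f :: "'a::euclidean_space \<Rightarrow> 'b::euclidean_space"
  assumes "compact S" "continuous_on UNIV f" "\<And>x. x \<notin> S \<Longrightarrow> f x = 0"
  shows "integrable lborel f"
proof -
  have "integrable lborel (\<lambda>x. indicator S x *\<^sub>R f x)"
    by (rule borel_integrable_compact[OF assms(1) continuous_on_subset[OF assms(2)]]) auto
  moreover have "(\<lambda>x. indicator S x *\<^sub>R f x) = f" using assms(3) by (force simp: indicator_def)
  ultimately show ?thesis by simp
qed

text \<open>\<open>D\<close> and the complement of \<open>S\<close> are open and cover the space,
  and the function is continuous on each of them.\<close>

lemma continuous_on_zero_extension:
  fixes f :: "'a::metric_space \<Rightarrow> 'b::real_normed_vector"
  assumes "open D" "closed S" "S \<subseteq> D" "continuous_on D f" "\<And>x. x \<notin> S \<Longrightarrow> f x = 0"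
  shows "continuous_on UNIV f"
proof -
  have "continuous_on (-S) f = continuous_on (-S) (\<lambda>_. 0::'b)" by (rule continuous_on_cong) (use assms(5) in auto)
  then have "continuous_on (-S) f" by simp
  then have "continuous_on (D \<union> (-S)) f" using assms by (intro continuous_on_open_Un) auto
  moreover have "D \<union> (-S) = UNIV" using assms(3) by auto
  ultimately show ?thesis by simp
qed

lemma lborel_integral_translate:
  fixes f :: "'a::euclidean_space \<Rightarrow> 'b::euclidean_space"
  assumes [measurable]: "f \<in> borel_measurable borel"
  shows "(\<integral>x. f (x + a) \<partial>lborel) = (\<integral>x. f x \<partial>lborel)"
proof -
  have "(\<integral>x. f x \<partial>lborel) = (\<integral>x. f x \<partial>distr lborel borel ((+) a))" by (simp add: lborel_distr_plus)
  also have "\<dots> = (\<integral>x. f (a + x) \<partial>lborel)" by (intro integral_distr) auto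
  finally show ?thesis by (simp add: add.commute)
qed

lemma has_vector_derivative_quotient_tendsto:
  assumes "(f has_vector_derivative d) (at 0)"
  shows "((\<lambda>s. (f s - f 0) /\<^sub>R s) \<longlongrightarrow> d) (at 0)"
proof -
  have "((\<lambda>s. norm (f s - f 0 - s *\<^sub>R d) / norm s) \<longlongrightarrow> 0) (at 0)"
    using assms by (simp add: has_vector_derivative_def has_derivative_at)
  moreover have "\<forall>\<^sub>F s in at 0. norm (f s - f 0 - s *\<^sub>R d) / norm s = norm ((f s - f 0) /\<^sub>R s - d)"
  proof (rule eventually_at_topological[THEN iffD2], intro exI[of _ UNIV] conjI ballI impI)
    fix s :: real assume "s \<noteq> 0"
    then have "(f s - f 0) /\<^sub>R s - d = (f s - f 0 - s *\<^sub>R d) /\<^sub>R s" by (simp add: scaleR_diff_right)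
    then show "norm (f s - f 0 - s *\<^sub>R d) / norm s = norm ((f s - f 0) /\<^sub>R s - d)"
      by (simp add: divide_inverse_commute)
  qed auto
  ultimately have "((\<lambda>s. norm ((f s - f 0) /\<^sub>R s - d)) \<longlongrightarrow> 0) (at 0)"
    by (rule Lim_transform_eventually)
  then show ?thesis by (simp add: tendsto_norm_zero_iff LIM_zero_iff)
qed

text \<open>Every difference quotient of \<open>F\<close> along \<open>w\<close> integrates to 0 by
  translation invariance of Lebesgue measure, and dominated convergence carries this over to the
  derivative.\<close>

lemma integral_line_derivative_eq_0:
  fixes F F' :: "'a::euclidean_space \<Rightarrow> complex"
  assumes S: "compact S" "\<And>x. x \<notin> S \<Longrightarrow> F x = 0"
    and F: "continuous_on UNIV F" and F': "continuous_on UNIV F'" "\<And>x. x \<notin> S \<Longrightarrow> F' x = 0"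
    and der: "\<And>x. ((\<lambda>s. F (x + s *\<^sub>R w)) has_vector_derivative F' x) (at 0)"
  shows "(\<integral>x. F' x \<partial>lborel) = 0"
proof -
  \<comment> \<open>All points \<open>x\<close> for which some \<open>x + s *\<^sub>R w\<close> with
    \<open>s\<close> between 0 and 1 lies in \<open>S\<close>. This compact set contains the support
    of every difference quotient below.\<close>
  define S1 where "S1 = (\<lambda>(x, s). x - s *\<^sub>R w) ` (S \<times> {0..1::real})"
  have S1: "compact S1" unfolding S1_def split_def
    by (intro compact_continuous_image compact_Times S compact_Icc continuous_intros)
  have [measurable]: "F \<in> borel_measurable borel" "F' \<in> borel_measurable borel"
    using F F' by (auto intro: borel_measurable_continuous_onI)
  have [measurable]: "S1 \<in> sets borel" using S1 by (simp add: compact_imp_closed)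
  have "bounded (F' ` S)" by (intro compact_imp_bounded compact_continuous_image continuous_on_subset[OF F'(1)] S) auto
  then obtain C where C0: "\<And>x. x \<in> S \<Longrightarrow> norm (F' x) \<le> C" by (auto simp: bounded_iff)
  \<comment> \<open>The maximum with 0 covers the points outside \<open>S\<close>, where
    \<open>F'\<close> vanishes, also when \<open>S\<close> is empty.\<close>
  define C' where "C' = max C 0"
  have C: "norm (F' x) \<le> C'" for x unfolding C'_def using C0[of x] F'(2)[of x] by (cases "x \<in> S") auto
  define sq where "sq n = inverse (real (Suc n))" for n
  have sq: "0 < sq n" "sq n \<le> 1" for n by (auto simp: sq_def inverse_le_1_iff)
  have lim: "(\<lambda>n. (F (x + sq n *\<^sub>R w) - F x) /\<^sub>R sq n) \<longlonglongrightarrow> F' x" for x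
  proof -
    have "((\<lambda>s. (F (x + s *\<^sub>R w) - F x) /\<^sub>R s) \<longlongrightarrow> F' x) (at 0)"
      using has_vector_derivative_quotient_tendsto[OF der[of x]] by simp
    moreover have "filterlim sq (at 0) sequentially"
      unfolding filterlim_at using LIMSEQ_inverse_real_of_nat by (auto simp: sq_def[abs_def])
    ultimately show ?thesis by (rule filterlim_compose)
  qed
  have bnd: "norm ((F (x + sq n *\<^sub>R w) - F x) /\<^sub>R sq n) \<le> C' * indicator S1 x" for x n
  proof (cases "x \<in> S1")
    case True
    have "norm (F (x + sq n *\<^sub>R w) - F (x + 0 *\<^sub>R w)) \<le> C' * norm (sq n - 0)"
    proof (rule differentiable_bound[of "{0..1}" "\<lambda>s. F (x + s *\<^sub>R w)" "\<lambda>a d. d *\<^sub>R F' (x + a *\<^sub>R w)"])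
      fix a :: real
      have "((\<lambda>s. F (x + s *\<^sub>R w)) has_vector_derivative F' (x + a *\<^sub>R w)) (at a)"
        by (rule line_deriv_shift[OF der])
      then show "((\<lambda>s. F (x + s *\<^sub>R w)) has_derivative (\<lambda>d. d *\<^sub>R F' (x + a *\<^sub>R w))) (at a within {0..1})"
        by (simp add: has_vector_derivative_def has_derivative_at_withinI)
      show "onorm (\<lambda>d. d *\<^sub>R F' (x + a *\<^sub>R w)) \<le> C'"
        by (rule onorm_bound) (simp add: C'_def, simp add: mult.commute[of C'] mult_left_mono C)
    qed (use sq[of n] in auto)
    then have "norm (F (x + sq n *\<^sub>R w) - F x) / sq n \<le> C'" using sq[of n] by (simp add: divide_le_eq)
    then show ?thesis using True sq[of n] by (simp add: divide_inverse_commute)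
  next
    case False
    have "x \<notin> S"
    proof
      assume "x \<in> S"
      then have "(\<lambda>(x, s). x - s *\<^sub>R w) (x, 0) \<in> S1"
        unfolding S1_def by (intro imageI) auto
      with False show False by simp
    qed
    moreover have "x + sq n *\<^sub>R w \<notin> S"
    proof
      assume "x + sq n *\<^sub>R w \<in> S"
      then have "(\<lambda>(x, s). x - s *\<^sub>R w) (x + sq n *\<^sub>R w, sq n) \<in> S1"
        unfolding S1_def using sq[of n] by (intro imageI) auto
      with False show False by simp
    qed
    ultimately show ?thesis using S(2) False by simp
  qed
  have "(\<lambda>n. \<integral>x. (F (x + sq n *\<^sub>R w) - F x) /\<^sub>R sq n \<partial>lborel) \<longlonglongrightarrow> (\<integral>x. F' x \<partial>lborel)"
  proof (rule integral_dominated_convergence[where w="\<lambda>x. C' * indicator S1 x"])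
    show "integrable lborel (\<lambda>x. C' * indicator S1 x)"
      using emeasure_compact_finite[OF S1]  
      by (intro integrable_mult_right integrable_real_indicator) (auto simp: less_top)
  qed (use lim bnd in auto)
  moreover have "(\<integral>x. (F (x + sq n *\<^sub>R w) - F x) /\<^sub>R sq n \<partial>lborel) = 0" for n
  proof -
    have i: "integrable lborel F" by (rule integrable_compact_support[OF S(1) F S(2)])
    have "integrable lborel (\<lambda>x. F (x + sq n *\<^sub>R w))"
    proof (rule integrable_compact_support)
      show "compact ((\<lambda>x. x - sq n *\<^sub>R w) ` S)" by (intro compact_continuous_image S continuous_intros)
      show "continuous_on UNIV (\<lambda>x. F (x + sq n *\<^sub>R w))"
        by (rule continuous_on_compose2[OF F]) (auto intro!: continuous_intros)
      show "F (x + sq n *\<^sub>R w) = 0" if "x \<notin> (\<lambda>x. x - sq n *\<^sub>R w) ` S" for x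
      proof (rule S(2))
        show "x + sq n *\<^sub>R w \<notin> S"
        proof
          assume "x + sq n *\<^sub>R w \<in> S"
          from imageI[OF this, of "\<lambda>x. x - sq n *\<^sub>R w"] that show False by simp
        qed
      qed
    qed
    with i have "(\<integral>x. F (x + sq n *\<^sub>R w) - F x \<partial>lborel) = (\<integral>x. F (x + sq n *\<^sub>R w) \<partial>lborel) - (\<integral>x. F x \<partial>lborel)"
      by (intro Bochner_Integration.integral_diff)
    also have "\<dots> = 0" by (subst lborel_integral_translate) auto
    finally show ?thesis by simp
  qed
  ultimately have "(\<lambda>n::nat. 0) \<longlonglongrightarrow> (\<integral>x. F' x \<partial>lborel)" by (simp only:)
  then show ?thesis by (simp only: LIMSEQ_const_iff)
qed

lemma has_vector_derivative_cis: "(cis has_vector_derivative \<i> * cis x) (at x)"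
proof -
  have "((\<lambda>x. exp (\<i> * of_real x)) has_vector_derivative \<i> * exp (\<i> * of_real x)) (at x)"
    by (rule has_vector_derivative_real_field) (auto intro!: derivative_eq_intros)
  then show ?thesis by (simp add: cis_conv_exp[abs_def])
qed

text \<open>Each step gains a factor 1/T: with b = a/\<kappa>, the derivative of b cis(T \<phi>)
  along \<open>w\<close> is i T a cis(T \<phi>) + b' cis(T \<phi>), and its integral is 0. So the
  amplitude \<open>a\<close> is replaced by -b', which has one order of smoothness less. Only the
  lower bound on \<kappa> and the uniform bounds on \<open>a\<close> and \<kappa> enter, hence the
  uniformity in \<open>p\<close>.\<close>

lemma nonstationary_phase:
  fixes a \<kappa> \<phi> :: "'p \<Rightarrow> 'a::euclidean_space \<Rightarrow> real"
  assumes D: "open D" and S: "compact S" "S \<subseteq> D"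
    and \<phi>: "\<And>p. p \<in> P \<Longrightarrow> continuous_on D (\<phi> p)"
      "\<And>p x. p \<in> P \<Longrightarrow> x \<in> D \<Longrightarrow> ((\<lambda>s. \<phi> p (x + s *\<^sub>R w p)) has_real_derivative \<kappa> p x) (at 0)"
    and c: "c > 0" "\<And>p x. p \<in> P \<Longrightarrow> x \<in> D \<Longrightarrow> c \<le> \<bar>\<kappa> p x\<bar>"
    and \<kappa>: "C_k_bounded n P w D \<kappa>"
    and a: "C_k_bounded n P w D a" "\<And>p x. p \<in> P \<Longrightarrow> x \<notin> S \<Longrightarrow> a p x = 0"
  shows "\<exists>C. \<forall>p\<in>P. \<forall>T>0. cmod (\<integral>x. complex_of_real (a p x) * cis (T * \<phi> p x) \<partial>lborel) * T ^ n \<le> C"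
  using \<kappa> a
proof (induction n arbitrary: a)
  case 0
  obtain C where C: "\<And>p x. p \<in> P \<Longrightarrow> x \<in> D \<Longrightarrow> \<bar>a p x\<bar> \<le> C" using 0(2) by (elim C_k_bounded_bound) auto
  have "cmod (\<integral>x. complex_of_real (a p x) * cis (T * \<phi> p x) \<partial>lborel) \<le> (\<integral>x. C * indicator S x \<partial>lborel)"
    if p: "p \<in> P" for p T
  proof -
    have le: "norm (complex_of_real (a p x) * cis (T * \<phi> p x)) \<le> C * indicator S x" for x
      using C[OF p, of x] 0(3)[OF p, of x] S by (cases "x \<in> S") (auto simp: norm_mult)
    have "integrable lborel (\<lambda>x. C * indicator S x)"
      using emeasure_compact_finite[OF S(1)] S(1)
      by (intro integrable_mult_right integrable_real_indicator) (auto simp: compact_imp_closed)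
    then have "(\<integral>x. norm (complex_of_real (a p x) * cis (T * \<phi> p x)) \<partial>lborel) \<le> (\<integral>x. C * indicator S x \<partial>lborel)"
      by (rule integral_mono') (use le order_trans[OF norm_ge_zero le] in auto)
    then show ?thesis by (rule order_trans[OF integral_norm_bound])
  qed
  then show ?case by auto
next
  case (Suc n)
  have \<kappa>nz: "\<kappa> p x \<noteq> 0" if "p \<in> P" "x \<in> D" for p x using c(1) c(2)[OF that] by auto
  define b where "b p x = a p x * inverse (\<kappa> p x)" for p x
  have "C_k_bounded (Suc n) P w D b" unfolding b_def
    by (intro C_k_bounded_mult Suc.prems C_k_bounded_inverse[OF _ c])
  then obtain b' where b': "\<And>p x. p \<in> P \<Longrightarrow> x \<in> D \<Longrightarrow> ((\<lambda>s. b p (x + s *\<^sub>R w p)) has_real_derivative b' p x) (at 0)"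
    "C_k_bounded n P w D b'" by (rule C_k_bounded_SucE) blast
  have bcont: "continuous_on D (b p)" if "p \<in> P" for p
    using \<open>C_k_bounded (Suc n) P w D b\<close> that by (rule C_k_bounded_cont)
  have off: "\<forall>\<^sub>F s in nhds 0. x + s *\<^sub>R v \<notin> S" if "x \<notin> S" for x v
  proof -
    have "((\<lambda>s. x + s *\<^sub>R v) \<longlongrightarrow> x + 0 *\<^sub>R v) (nhds 0)"
      by (intro tendsto_intros filterlim_ident)
    then have "((\<lambda>s. x + s *\<^sub>R v) \<longlongrightarrow> x) (nhds 0)" by simp
    moreover have "open (- S)" using S(1) by (simp add: compact_imp_closed open_Compl)
    ultimately show ?thesis using topological_tendstoD[of "\<lambda>s. x + s *\<^sub>R v" x _ "- S"] that by simp
  qed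
  have b'0: "b' p x = 0" if "p \<in> P" "x \<in> D" "x \<notin> S" for p x
  proof -
    have "\<forall>\<^sub>F s in nhds 0. b p (x + s *\<^sub>R w p) = 0"
      using off[OF that(3), of "w p"] by eventually_elim (simp add: b_def Suc.prems(3) that)
    then have "((\<lambda>s. b p (x + s *\<^sub>R w p)) has_real_derivative b' p x) (at 0) \<longleftrightarrow>
         ((\<lambda>s. 0) has_real_derivative b' p x) (at 0)" by (intro DERIV_cong_ev refl)
    with b'(1)[OF that(1,2)] have "((\<lambda>s. 0) has_real_derivative b' p x) (at (0::real))" by simp
    then show ?thesis using DERIV_const DERIV_unique by blast
  qed
  \<comment> \<open>\<open>b'\<close> is controlled on \<open>D\<close> only, so it is cut off by
    hand. Inside \<open>D\<close> this changes nothing, since \<open>b\<close> vanishes near every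
    point outside \<open>S\<close>.\<close>
  define a1 where "a1 p x = (if x \<in> S then - b' p x else 0)" for p x
  have "C_k_bounded n P w D (\<lambda>p x. (-1) * b' p x)"
    by (intro C_k_bounded_mult b' C_k_bounded_const[of P "\<lambda>_. -1" 1]) auto
  then have a1: "C_k_bounded n P w D a1"
    by (rule C_k_bounded_cong[OF D, rotated]) (auto simp: a1_def b'0)
  obtain C where C: "\<forall>p\<in>P. \<forall>T>0. cmod (\<integral>x. complex_of_real (a1 p x) * cis (T * \<phi> p x) \<partial>lborel) * T ^ n \<le> C"
    using Suc.IH[OF C_k_bounded_Suc_imp[OF Suc.prems(1)] a1] by (auto simp: a1_def)
  have "cmod (\<integral>x. complex_of_real (a p x) * cis (T * \<phi> p x) \<partial>lborel) * T ^ Suc n \<le> C" if p: "p \<in> P" and T: "T > 0" for p T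
  proof -
    define F where "F x = complex_of_real (b p x) * cis (T * \<phi> p x)" for x
    define F' where "F' x = \<i> * T * (complex_of_real (a p x) * cis (T * \<phi> p x)) - complex_of_real (a1 p x) * cis (T * \<phi> p x)" for x
    have ext: "continuous_on UNIV (\<lambda>x. complex_of_real (f x) * cis (T * \<phi> p x))"
      if "continuous_on D f" "\<And>x. x \<notin> S \<Longrightarrow> f x = 0" for f
      by (rule continuous_on_zero_extension[OF D _ S(2)])
        (use S that \<phi>(1)[OF p] in \<open>auto simp: compact_imp_closed intro!: continuous_intros\<close>)
    have ca: "continuous_on UNIV (\<lambda>x. complex_of_real (a p x) * cis (T * \<phi> p x))"
      by (rule ext) (use Suc.prems C_k_bounded_cont p in auto)
    have ca1: "continuous_on UNIV (\<lambda>x. complex_of_real (a1 p x) * cis (T * \<phi> p x))"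
      by (rule ext[OF C_k_bounded_cont[OF a1 p]]) (simp add: a1_def)
    have i: "integrable lborel (\<lambda>x. complex_of_real (a p x) * cis (T * \<phi> p x))"
      by (rule integrable_compact_support[OF S(1) ca]) (simp add: Suc.prems p)
    have i1: "integrable lborel (\<lambda>x. complex_of_real (a1 p x) * cis (T * \<phi> p x))"
      by (rule integrable_compact_support[OF S(1) ca1]) (simp add: a1_def)
    have "(\<integral>x. F' x \<partial>lborel) = 0"
    proof (rule integral_line_derivative_eq_0[OF S(1), of F _ "w p"])
      show "F x = 0" if "x \<notin> S" for x using that p by (simp add: F_def b_def Suc.prems)
      show "F' x = 0" if "x \<notin> S" for x using that p by (simp add: F'_def a1_def Suc.prems)
      show "continuous_on UNIV F" unfolding F_def
        by (rule ext) (use bcont p in \<open>auto simp: b_def Suc.prems\<close>)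
      show "continuous_on UNIV F'" unfolding F'_def
        by (intro continuous_on_diff continuous_on_mult continuous_on_const ca ca1)
      show "((\<lambda>s. F (x + s *\<^sub>R w p)) has_vector_derivative F' x) (at 0)" for x
      proof (cases "x \<in> S")
        case True
        then have x: "x \<in> D" using S by auto
        have 1: "((\<lambda>s. T * \<phi> p (x + s *\<^sub>R w p)) has_real_derivative T * \<kappa> p x) (at 0)"
          by (intro DERIV_cmult \<phi>(2) p x)
        have "((\<lambda>s. cis (T * \<phi> p (x + s *\<^sub>R w p))) has_vector_derivative
            (T * \<kappa> p x) *\<^sub>R (\<i> * cis (T * \<phi> p (x + 0 *\<^sub>R w p)))) (at 0)"
          using vector_diff_chain_at[OF 1[unfolded has_real_derivative_iff_has_vector_derivative], of cis]
          by (simp add: o_def has_vector_derivative_cis)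
        moreover have "((\<lambda>s. complex_of_real (b p (x + s *\<^sub>R w p))) has_vector_derivative complex_of_real (b' p x)) (at 0)"
          using b'(1)[OF p x] by (intro has_vector_derivative_of_real) 
        ultimately have "((\<lambda>s. F (x + s *\<^sub>R w p)) has_vector_derivative
          (complex_of_real (b p (x + 0 *\<^sub>R w p)) * ((T * \<kappa> p x) *\<^sub>R (\<i> * cis (T * \<phi> p (x + 0 *\<^sub>R w p)))) +
           complex_of_real (b' p x) * cis (T * \<phi> p (x + 0 *\<^sub>R w p)))) (at 0)"
          unfolding F_def by (intro has_vector_derivative_mult)
        moreover have "complex_of_real (b p (x + 0 *\<^sub>R w p)) * ((T * \<kappa> p x) *\<^sub>R (\<i> * cis (T * \<phi> p (x + 0 *\<^sub>R w p)))) +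
           complex_of_real (b' p x) * cis (T * \<phi> p (x + 0 *\<^sub>R w p)) = F' x"
          using True \<kappa>nz[OF p x] by (simp add: F'_def a1_def b_def scaleR_conv_of_real field_simps)
        ultimately show ?thesis by simp
      next
        case False
        have "\<forall>\<^sub>F s in nhds 0. F (x + s *\<^sub>R w p) = 0"
          using off[OF False, of "w p"] by eventually_elim (simp add: F_def b_def Suc.prems p)
        moreover have "F' x = 0" using False p by (simp add: F'_def a1_def Suc.prems)
        ultimately show ?thesis
          using has_vector_derivative_const[of 0 "at 0"] 
          by (subst has_vector_derivative_cong_ev[where g="\<lambda>_. 0"]) (auto elim: eventually_mono dest: eventually_nhds_x_imp_x)
      qed
    qed
    then have "\<i> * T * (\<integral>x. complex_of_real (a p x) * cis (T * \<phi> p x) \<partial>lborel)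
       = (\<integral>x. complex_of_real (a1 p x) * cis (T * \<phi> p x) \<partial>lborel)"
      using i i1 unfolding F'_def by (subst (asm) Bochner_Integration.integral_diff) (auto simp: mult.assoc)
    from arg_cong[OF this, of cmod]
    have "cmod (\<integral>x. complex_of_real (a p x) * cis (T * \<phi> p x) \<partial>lborel) * T
       = cmod (\<integral>x. complex_of_real (a1 p x) * cis (T * \<phi> p x) \<partial>lborel)"
      using T by (simp add: norm_mult mult.commute)
    moreover have "cmod (\<integral>x. complex_of_real (a p x) * cis (T * \<phi> p x) \<partial>lborel) * T ^ Suc n
       = cmod (\<integral>x. complex_of_real (a p x) * cis (T * \<phi> p x) \<partial>lborel) * T * T ^ n" by simp
    moreover have "cmod (\<integral>x. complex_of_real (a1 p x) * cis (T * \<phi> p x) \<partial>lborel) * T ^ n \<le> C"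
      using C p T by blast
    ultimately show ?thesis by (simp only:)
  qed
  then show ?case by auto
qed

section \<open>Graphs over a hyperplane\<close>

definition perp :: "'a::euclidean_space \<Rightarrow> 'a \<Rightarrow> 'a" where
  "perp e x = x - (x \<bullet> e) *\<^sub>R e"

lemma linear_perp: "linear (perp e)"
  by (rule linearI) (auto simp: perp_def algebra_simps inner_add_left)

lemmas perp_add = linear_add[OF linear_perp]
lemmas perp_diff = linear_diff[OF linear_perp]
lemmas perp_scaleR = linear_scale[OF linear_perp]
lemmas perp_0 = linear_0[OF linear_perp]

lemma continuous_on_perp [continuous_intros]:
  "continuous_on S f \<Longrightarrow> continuous_on S (\<lambda>x. perp e (f x))"
  unfolding perp_def by (intro continuous_intros)

lemma perp_measurable [measurable]: "perp e \<in> borel_measurable borel"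
  by (intro borel_measurable_continuous_onI continuous_intros)

lemma perp_inner: "e \<in> Basis \<Longrightarrow> perp e x \<bullet> e = 0"
  by (simp add: perp_def inner_diff_left)

lemma perp_axis: "e \<in> Basis \<Longrightarrow> perp e e = 0"
  by (simp add: perp_def)

lemma perp_eq: "x \<bullet> e = 0 \<Longrightarrow> perp e x = x"
  by (simp add: perp_def)

lemma perp_perp: "e \<in> Basis \<Longrightarrow> perp e (perp e x) = perp e x"
  by (simp add: perp_eq perp_inner)

lemma norm_perp_le: "e \<in> Basis \<Longrightarrow> norm (perp e x) \<le> norm x"
proof -
  assume e: "e \<in> Basis"
  have "(norm x)\<^sup>2 = (norm (perp e x + (x \<bullet> e) *\<^sub>R e))\<^sup>2" by (simp add: perp_def)
  also have "\<dots> = (norm (perp e x))\<^sup>2 + (norm ((x \<bullet> e) *\<^sub>R e))\<^sup>2"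
    by (intro norm_add_Pythagorean) (simp add: orthogonal_def perp_inner[OF e])
  finally have "(norm (perp e x))\<^sup>2 \<le> (norm x)\<^sup>2" by simp
  then show ?thesis by (simp add: power2_le_iff_abs_le)
qed

lemma norm_le_perp: "e \<in> Basis \<Longrightarrow> norm x \<le> norm (perp e x) + \<bar>x \<bullet> e\<bar>"
  using norm_triangle_ineq[of "perp e x" "(x \<bullet> e) *\<^sub>R e"] by (simp add: perp_def)

lemma perp_inner_perp: "w \<bullet> e = 0 \<Longrightarrow> w \<bullet> perp e x = w \<bullet> x"
  by (simp add: perp_def inner_diff_right)

section \<open>Dilations of the hyperplane, and cylinders over its balls\<close>

definition stretch :: "'a::euclidean_space \<Rightarrow> real \<Rightarrow> 'a \<Rightarrow> 'a" where
  "stretch e t x = t *\<^sub>R perp e x + (x \<bullet> e) *\<^sub>R e"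

lemma continuous_on_stretch [continuous_intros]:
  "continuous_on S f \<Longrightarrow> continuous_on S (\<lambda>x. stretch e t (f x))"
  unfolding stretch_def by (intro continuous_intros)

lemma stretch_measurable [measurable]: "stretch e t \<in> borel_measurable borel"
  by (intro borel_measurable_continuous_onI continuous_intros)

lemma perp_stretch: "e \<in> Basis \<Longrightarrow> perp e (stretch e t x) = t *\<^sub>R perp e x"
  by (simp add: stretch_def perp_add perp_scaleR perp_perp perp_axis)

lemma stretch_inner: "e \<in> Basis \<Longrightarrow> stretch e t x \<bullet> e = x \<bullet> e"
  by (simp add: stretch_def inner_add_left perp_inner)

text \<open>The map is diagonal in the standard basis, with factor 1 at \<open>e\<close> and
  \<open>t\<close> at the other d - 1 basis vectors; hence the exponent d - 1.\<close>

lemma lborel_stretch: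
  fixes e :: "'a::euclidean_space"
  assumes e: "e \<in> Basis" and t: "t > 0"
  shows "lborel = density (distr lborel borel (stretch e t)) (\<lambda>_. ennreal (t ^ (DIM('a) - 1)))"
proof -
  define c where "c j = (if j = e then 1 else t)" for j :: 'a
  have "(\<lambda>x. 0 + (\<Sum>j\<in>Basis. (c j * (x \<bullet> j)) *\<^sub>R j)) = stretch e t"
  proof
    fix x
    have "(\<Sum>j\<in>Basis. (c j * (x \<bullet> j)) *\<^sub>R j) = (\<Sum>j\<in>Basis. t *\<^sub>R (x \<bullet> j) *\<^sub>R j + (if j = e then ((1 - t) * (x \<bullet> e)) *\<^sub>R e else 0))"
      by (intro sum.cong refl) (auto simp: c_def algebra_simps)
    also have "\<dots> = t *\<^sub>R x + ((1 - t) * (x \<bullet> e)) *\<^sub>R e"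
      by (simp only: sum.distrib scaleR_sum_right[symmetric] euclidean_representation sum.delta finite_Basis e if_True)
    also have "\<dots> = stretch e t x" by (simp add: stretch_def perp_def algebra_simps)
    finally show "0 + (\<Sum>j\<in>Basis. (c j * (x \<bullet> j)) *\<^sub>R j) = stretch e t x" by simp
  qed
  moreover have "(\<Prod>j\<in>Basis. \<bar>c j\<bar>) = t ^ (DIM('a) - 1)"
    using e t by (subst prod.remove[of _ e]) (auto simp: c_def)
  moreover have "c j \<noteq> 0" for j using t by (simp add: c_def)
  ultimately show ?thesis using lborel_affine_euclidean[of c 0] by simp
qed

lemma nn_integral_stretch:
  fixes e :: "'a::euclidean_space"
  assumes "e \<in> Basis" "t > 0" and [measurable]: "f \<in> borel_measurable borel"
  shows "(\<integral>\<^sup>+x. f x \<partial>lborel) = ennreal (t ^ (DIM('a) - 1)) * (\<integral>\<^sup>+x. f (stretch e t x) \<partial>lborel)"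
  by (subst lborel_stretch[OF assms(1,2)])
    (simp add: nn_integral_density nn_integral_distr nn_integral_cmult)

lemma integral_stretch:
  fixes e :: "'a::euclidean_space" and f :: "'a \<Rightarrow> 'b::{banach,second_countable_topology}"
  assumes "e \<in> Basis" "t > 0" and [measurable]: "f \<in> borel_measurable borel"
  shows "(\<integral>x. f x \<partial>lborel) = t ^ (DIM('a) - 1) *\<^sub>R (\<integral>x. f (stretch e t x) \<partial>lborel)"
  using assms(2) by (subst lborel_stretch[OF assms(1,2)])
    (simp add: integral_density integral_distr)

text \<open>The ball of radius \<open>s\<close> in the hyperplane, thickened to a set of positive
  volume. The thickness is fixed, so the volume scales like s^(d-1) and stands in for the
  (d-1)-dimensional measure of the ball.\<close>

definition cyl :: "'a::euclidean_space \<Rightarrow> real \<Rightarrow> 'a set" where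
  "cyl e s = {x. norm (perp e x) \<le> s \<and> \<bar>x \<bullet> e\<bar> \<le> 1}"

lemma closed_cyl: "closed (cyl e s)"
  unfolding cyl_def by (intro closed_Collect_conj closed_Collect_le continuous_intros)

lemma cyl_borel [measurable]: "cyl e s \<in> sets borel"
  by (rule borel_closed[OF closed_cyl])

lemma compact_cyl: "e \<in> Basis \<Longrightarrow> compact (cyl e s)"
proof -
  assume e: "e \<in> Basis"
  have "cyl e s \<subseteq> cball 0 (s + 1)"
  proof
    fix x assume "x \<in> cyl e s"
    then show "x \<in> cball 0 (s + 1)" using norm_le_perp[OF e, of x] by (simp add: cyl_def)
  qed
  then show ?thesis
    using closed_cyl bounded_subset[OF bounded_cball] by (auto simp: compact_eq_bounded_closed)
qed

lemma emeasure_cyl_finite: "e \<in> Basis \<Longrightarrow> emeasure lborel (cyl e s) < \<infinity>"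
  by (intro emeasure_compact_finite compact_cyl)

lemma emeasure_cyl:
  fixes e :: "'a::euclidean_space"
  assumes e: "e \<in> Basis" and s: "s > 0"
  shows "emeasure lborel (cyl e s) = ennreal (s ^ (DIM('a) - 1)) * emeasure lborel (cyl e 1)"
proof -
  have "emeasure lborel (cyl e s) = (\<integral>\<^sup>+x. indicator (cyl e s) x \<partial>lborel)" by simp
  also have "\<dots> = ennreal (s ^ (DIM('a) - 1)) * (\<integral>\<^sup>+x. indicator (cyl e s) (stretch e s x) \<partial>lborel)"
    by (rule nn_integral_stretch[OF e s]) simp
  also have "(\<lambda>x. indicator (cyl e s) (stretch e s x)) = (indicator (cyl e 1) :: 'a \<Rightarrow> ennreal)"
    using s by (auto simp: cyl_def indicator_def perp_stretch[OF e] stretch_inner[OF e])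
  finally show ?thesis by simp
qed

lemma measure_cyl:
  fixes e :: "'a::euclidean_space"
  assumes e: "e \<in> Basis" and s: "s > 0"
  shows "measure lborel (cyl e s) = s ^ (DIM('a) - 1) * measure lborel (cyl e 1)"
  using emeasure_cyl[OF assms] s by (simp add: measure_def enn2real_mult)

lemma measure_cyl_pos: "e \<in> Basis \<Longrightarrow> measure lborel (cyl e 1) > 0"
proof -
  assume e: "e \<in> Basis"
  have "cball 0 1 \<subseteq> cyl e 1"
  proof
    fix x :: 'a assume "x \<in> cball 0 1"
    then show "x \<in> cyl e 1" using norm_perp_le[OF e, of x] Basis_le_norm[OF e, of x] by (simp add: cyl_def)
  qed
  then have "emeasure lborel (cball (0::'a) 1) \<le> emeasure lborel (cyl e 1)"
    by (intro emeasure_mono) auto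
  moreover have "0 < emeasure lborel (cball (0::'a) 1)"
    by (simp add: emeasure_cball)
  ultimately have "0 < emeasure lborel (cyl e 1)" by simp
  then show ?thesis using emeasure_cyl_finite[OF e, of 1]
    by (simp add: measure_def enn2real_positive_iff)
qed

lemma emeasure_cyl_eq: "e \<in> Basis \<Longrightarrow> emeasure lborel (cyl e s) = ennreal (measure lborel (cyl e s))"
  using emeasure_cyl_finite[of e s] by (simp add: emeasure_eq_ennreal_measure less_top)

lemma ennreal_le_suminf: "f n \<le> (\<Sum>n. f n :: ennreal)"
  using sum_le_suminf[of f "{n}"] by simp

text \<open>The exponent d exceeds the dimension d - 1 of the hyperplane by one, so the dyadic shell
  of radius 2^n contributes a multiple of 2^(-n).\<close>

lemma integrable_cyl_decay:
  fixes e :: "'a::euclidean_space"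
  assumes e: "e \<in> Basis"
  shows "integrable lborel (\<lambda>x. indicator {x. \<bar>x \<bullet> e\<bar> \<le> 1} x / (1 + norm (perp e x)) ^ DIM('a))"
proof (rule integrableI_nonneg)
  let ?d = "DIM('a)" and ?V = "measure lborel (cyl e 1)"
  let ?f = "\<lambda>x::'a. indicator {x. \<bar>x \<bullet> e\<bar> \<le> 1} x / (1 + norm (perp e x)) ^ ?d"
  have [measurable]: "{x. \<bar>x \<bullet> e\<bar> \<le> 1} \<in> sets borel"
    by (intro borel_closed closed_Collect_le continuous_intros)
  show "?f \<in> borel_measurable lborel" by measurable
  show "AE x in lborel. 0 \<le> ?f x" by simp
  have le: "ennreal (?f x) \<le> (\<Sum>n. ennreal (2 ^ ?d * (1 / 2 ^ ?d) ^ n) * indicator (cyl e (2 ^ n)) x)" (is "_ \<le> suminf ?g") for x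
  proof (cases "\<bar>x \<bullet> e\<bar> \<le> 1")
    case True
    \<comment> \<open>The dyadic shell of \<open>x\<close>. For n > 0 the norm exceeds 2^(n-1), and
      the lost factor 2 in the radius becomes the constant 2^d; for n = 0 the value is at most
      1.\<close>
    define n where "n = (LEAST n. norm (perp e x) \<le> 2 ^ n)"
    obtain m where "norm (perp e x) < 2 ^ m" using real_arch_pow[of 2] by auto
    then have n: "norm (perp e x) \<le> 2 ^ n" unfolding n_def by (rule LeastI[of _ m, OF less_imp_le])
    have "1 / (1 + norm (perp e x)) ^ ?d \<le> 2 ^ ?d * (1 / 2 ^ ?d) ^ n"
    proof (cases n)
      case 0
      have "1 / (1 + norm (perp e x)) ^ ?d \<le> 1 / 1 ^ ?d"
        by (intro divide_left_mono power_mono) (auto intro!: mult_pos_pos zero_less_power add_pos_nonneg)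
      also have "\<dots> \<le> 2 ^ ?d" by simp
      finally show ?thesis using 0 by simp
    next
      case (Suc m)
      have "\<not> norm (perp e x) \<le> 2 ^ m" using not_less_Least[of m "\<lambda>n. norm (perp e x) \<le> 2 ^ n"] Suc unfolding n_def by simp
      then have "1 / (1 + norm (perp e x)) ^ ?d \<le> 1 / (2 ^ m) ^ ?d"
        by (intro divide_left_mono power_mono) (auto intro!: mult_pos_pos zero_less_power add_pos_nonneg)
      also have "\<dots> = 2 ^ ?d * (1 / 2 ^ ?d) ^ n"
        by (simp add: Suc power_divide power_mult[symmetric] mult.commute)
      finally show ?thesis .
    qed
    then have "ennreal (?f x) \<le> ?g n" using True n by (simp add: cyl_def ennreal_leI)
    also have "\<dots> \<le> suminf ?g" by (rule ennreal_le_suminf)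
    finally show ?thesis .
  qed simp
  have "(\<integral>\<^sup>+x. ennreal (?f x) \<partial>lborel) \<le> (\<integral>\<^sup>+x. (\<Sum>n. ennreal (2 ^ ?d * (1 / 2 ^ ?d) ^ n) * indicator (cyl e (2 ^ n)) x) \<partial>lborel)"
    by (intro nn_integral_mono le)
  also have "\<dots> = (\<Sum>n. \<integral>\<^sup>+x. ennreal (2 ^ ?d * (1 / 2 ^ ?d) ^ n) * indicator (cyl e (2 ^ n)) x \<partial>lborel)"
    by (intro nn_integral_suminf) measurable
  also have "\<dots> = (\<Sum>n. ennreal (2 ^ ?d * ?V * (1 / 2) ^ n))"
  proof (intro suminf_cong)
    fix n
    have "(\<integral>\<^sup>+x. ennreal (2 ^ ?d * (1 / 2 ^ ?d) ^ n) * indicator (cyl e (2 ^ n)) x \<partial>lborel)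
        = ennreal (2 ^ ?d * (1 / 2 ^ ?d) ^ n) * emeasure lborel (cyl e (2 ^ n))"
      by (simp add: nn_integral_cmult)
    also have "\<dots> = ennreal (2 ^ ?d * (1 / 2 ^ ?d) ^ n * ((2 ^ n) ^ (?d - 1) * ?V))"
      using measure_cyl[OF e, of "2 ^ n"] by (simp add: emeasure_cyl_eq[OF e] ennreal_mult)
    also have "2 ^ ?d * (1 / 2 ^ ?d) ^ n * ((2 ^ n) ^ (?d - 1) * ?V) = 2 ^ ?d * ?V * ((1 / 2 ^ ?d) ^ n * (2 ^ n) ^ (?d - 1))"
      by (simp only: ac_simps)
    also have "(1 / 2 ^ ?d) ^ n * (2 ^ n) ^ (?d - 1) = (1 / 2 :: real) ^ n"
    proof -
      have "?d = Suc (?d - 1)" by simp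
      then have "(2::real) ^ ?d = 2 * 2 ^ (?d - 1)" by (metis power_Suc)
      then have "(1 / 2 ^ ?d :: real) ^ n * (2 ^ n) ^ (?d - 1) = (1 / 2) ^ n * ((1 / 2 ^ (?d - 1)) ^ n * (2 ^ (?d - 1)) ^ n)"
        by (simp add: power_mult_distrib[symmetric] power_mult[symmetric] mult.commute)
      also have "\<dots> = (1 / 2) ^ n" by (simp add: power_mult_distrib[symmetric])
      finally show ?thesis .
    qed
    finally show "(\<integral>\<^sup>+x. ennreal (2 ^ ?d * (1 / 2 ^ ?d) ^ n) * indicator (cyl e (2 ^ n)) x \<partial>lborel)
        = ennreal (2 ^ ?d * ?V * (1 / 2) ^ n)" .
  qed
  also have "\<dots> < \<infinity>"
  proof -
    have "summable (\<lambda>n. 2 ^ ?d * ?V * (1 / 2 :: real) ^ n)" by (intro summable_mult summable_geometric) simp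
    then show ?thesis by (subst suminf_ennreal2) auto
  qed
  finally show "(\<integral>\<^sup>+x. ennreal (?f x) \<partial>lborel) < \<infinity>" .
qed

section \<open>Amplitudes of finite smoothness\<close>

lemma DERIV_max_0_power:
  "((\<lambda>t. max 0 t ^ Suc (Suc j)) has_real_derivative real (Suc (Suc j)) * max 0 t ^ Suc j) (at t)"
proof -
  consider "t > 0" | "t < 0" | "t = 0" by linarith
  then show ?thesis
  proof cases
    case 1
    have "((\<lambda>t. t ^ Suc (Suc j)) has_real_derivative real (Suc (Suc j)) * t ^ Suc j) (at t)"
      using DERIV_pow[of "Suc (Suc j)" t] by simp
    then have "((\<lambda>t. max 0 t ^ Suc (Suc j)) has_real_derivative real (Suc (Suc j)) * t ^ Suc j) (at t)"
      by (rule has_field_derivative_transform_within_open[of _ _ _ "{0<..}"]) (use 1 in auto)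
    then show ?thesis using 1 by simp
  next
    case 2
    have "((\<lambda>t. 0) has_real_derivative 0) (at t)" by simp
    then have "((\<lambda>t. max 0 t ^ Suc (Suc j)) has_real_derivative 0) (at t)"
      by (rule has_field_derivative_transform_within_open[of _ _ _ "{..<0}"]) (use 2 in auto)
    then show ?thesis using 2 by simp
  next
    case 3
    have "((\<lambda>h::real. max 0 h ^ Suc j) \<longlongrightarrow> max 0 0 ^ Suc j) (at 0)"
      by (intro tendsto_intros)
    then have "((\<lambda>h::real. max 0 h ^ Suc j) \<longlongrightarrow> 0) (at 0)" by simp
    moreover have "\<forall>\<^sub>F h in at 0. max 0 h ^ Suc j = (max 0 (0 + h) ^ Suc (Suc j) - max 0 0 ^ Suc (Suc j)) / (h::real)"
      by (rule eventually_at_topological[THEN iffD2], intro exI[of _ UNIV]) (auto simp: max_def)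
    ultimately have "((\<lambda>h::real. (max 0 (0 + h) ^ Suc (Suc j) - max 0 0 ^ Suc (Suc j)) / h) \<longlongrightarrow> 0) (at 0)"
      by (rule Lim_transform_eventually)
    then show ?thesis using 3 by (simp add: DERIV_def)
  qed
qed

text \<open>Each derivative costs one power, and the last one is still taken of a power with
  exponent at least 2, where the kink at 0 disappears.\<close>

lemma C_k_bounded_pos_part_power:
  assumes "C_k_bounded n P w D y" "Suc n \<le> M"
  shows "C_k_bounded n P w D (\<lambda>p x. max 0 (y p x) ^ M)"
  using assms
proof (induction n arbitrary: y M)
  case 0
  obtain C where C: "C > 0" "\<And>p x. p \<in> P \<Longrightarrow> x \<in> D \<Longrightarrow> \<bar>y p x\<bar> \<le> C" using 0(1) by (elim C_k_bounded_bound) auto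
  have "\<bar>max 0 (y p x) ^ M\<bar> \<le> C ^ M" if "p \<in> P" "x \<in> D" for p x
    unfolding power_abs using C(1) C(2)[OF that] by (intro power_mono) auto
  then show ?case using 0 by (auto intro!: continuous_intros)
next
  case (Suc n)
  obtain j where M: "M = Suc (Suc j)" "n \<le> j" using Suc.prems(2) by (metis Suc_le_D Suc_le_mono)
  obtain y' where y': "\<And>p x. p \<in> P \<Longrightarrow> x \<in> D \<Longrightarrow> ((\<lambda>s. y p (x + s *\<^sub>R w p)) has_real_derivative y' p x) (at 0)"
    "C_k_bounded n P w D y'" using Suc.prems(1) by (rule C_k_bounded_SucE) blast
  note IH = Suc.IH[OF C_k_bounded_Suc_imp[OF Suc.prems(1)]]
  show ?case
  proof (rule C_k_bounded_SucI)
    show "C_k_bounded 0 P w D (\<lambda>p x. max 0 (y p x) ^ M)"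
      by (rule C_k_bounded_0[OF IH]) (use Suc.prems in auto)
    show "C_k_bounded n P w D (\<lambda>p x. real (Suc (Suc j)) * max 0 (y p x) ^ Suc j * y' p x)"
      by (intro C_k_bounded_mult IH y' C_k_bounded_const[of P "\<lambda>_. real (Suc (Suc j))" "real (Suc (Suc j))"])
        (use M in auto)
    fix p x assume px: "p \<in> P" "x \<in> D"
    have "((\<lambda>s. max 0 (y p (x + s *\<^sub>R w p)) ^ Suc (Suc j)) has_real_derivative
        real (Suc (Suc j)) * max 0 (y p (x + 0 *\<^sub>R w p)) ^ Suc j * y' p x) (at 0)"
      by (rule DERIV_chain2[OF DERIV_max_0_power y'(1)[OF px]])
    then show "((\<lambda>s. max 0 (y p (x + s *\<^sub>R w p)) ^ M) has_real_derivative
        real (Suc (Suc j)) * max 0 (y p x) ^ Suc j * y' p x) (at 0)" using M by simp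
  qed
qed

text \<open>Only derivatives along \<open>w\<close> are counted, so a function constant in these
  directions has all orders, however rough it is otherwise. This admits the merely Lipschitz factor
  \<open>tent\<close>.\<close>

lemma C_k_bounded_invariant:
  assumes "continuous_on D f" "\<And>x. x \<in> D \<Longrightarrow> \<bar>f x\<bar> \<le> C" "\<And>p x s. p \<in> P \<Longrightarrow> f (x + s *\<^sub>R w p) = f x"
  shows "C_k_bounded n P w D (\<lambda>p x. f x)"
proof (cases n)
  case 0
  then show ?thesis using assms by auto
next
  case (Suc m)
  show ?thesis unfolding Suc
  proof (rule C_k_bounded_SucI)
    show "C_k_bounded m P w D (\<lambda>p x. 0)" using C_k_bounded_const[of P "\<lambda>_. 0" 0] by simp
  qed (use assms in auto)
qed

definition tent :: "real \<Rightarrow> real" where "tent t = max 0 (1 - \<bar>t\<bar>)"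

lemma tent_bounds: "0 \<le> tent t" "tent t \<le> 1" "\<bar>t\<bar> \<ge> 1 \<Longrightarrow> tent t = 0"
  by (auto simp: tent_def)

lemma continuous_on_tent [continuous_intros]: "continuous_on S f \<Longrightarrow> continuous_on S (\<lambda>x. tent (f x))"
  unfolding tent_def by (intro continuous_intros)

lemma tent_measurable [measurable]: "tent \<in> borel_measurable borel"
  unfolding tent_def[abs_def] by measurable

text \<open>
  A function on the hyperplane orthogonal to \<open>e\<close> is encoded as a function on the whole space that depends only
  on \<open>perp e x\<close>.  Integrals over the hyperplane become integrals over the whole space, where the factor
  \<open>tent (x \<bullet> e)\<close> takes care of the redundant coordinate.
\<close>

locale graph_patch =
  fixes e :: "'a::euclidean_space" and h :: "'a \<Rightarrow> real" and g :: "'a \<Rightarrow> 'a" and r c M :: real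
  assumes e: "e \<in> Basis" and r: "r > 0" and c: "c > 0"
    and h_perp: "h x = h (perp e x)"
    and h_cont: "continuous_on {x. norm (perp e x) < 2 * r} h"
    and g_cont: "continuous_on {x. norm (perp e x) < 2 * r} g"
    and h_deriv: "\<And>w x. w \<bullet> e = 0 \<Longrightarrow> norm (perp e x) < 2 * r \<Longrightarrow>
       ((\<lambda>s. h (x + s *\<^sub>R w)) has_real_derivative w \<bullet> g x) (at 0)"
    and g_bd: "\<And>n. C_k_bounded n {w. norm w = 1 \<and> w \<bullet> e = 0} (\<lambda>w. w) {x. norm (perp e x) < 2 * r} (\<lambda>w x. w \<bullet> g x)"
    and g_mono: "\<And>w x s. norm w = 1 \<Longrightarrow> w \<bullet> e = 0 \<Longrightarrow> 0 < s \<Longrightarrow> norm (perp e x) < 2 * r \<Longrightarrow>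
       norm (perp e (x + s *\<^sub>R w)) < 2 * r \<Longrightarrow> c * s \<le> w \<bullet> (g (x + s *\<^sub>R w) - g x)"
    and g_lip: "\<And>x. norm (perp e x) < 2 * r \<Longrightarrow> norm (g x) \<le> M * norm (perp e x)"
begin

text \<open>The exponent leaves d + 1 directional derivatives, enough for d integrations by parts.
  The radius r / 3 keeps a pair m, m + u at which both amplitudes are nonzero well inside the tube
  of radius 2 r on which the graph is controlled.\<close>

definition bump :: "'a \<Rightarrow> real" where
  "bump x = max 0 ((r / 3)\<^sup>2 - (norm (perp e x))\<^sup>2) ^ (DIM('a) + 2)"

definition ampl :: "'a \<Rightarrow> real" where
  "ampl x = bump x * tent (x \<bullet> e)"

text \<open>For \<xi> orthogonal to \<open>e\<close>, the Fourier transform of the amplitude carried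
  by the graph of \<open>h\<close>, with frequency \<xi> in the hyperplane and \<tau> along the
  axis.\<close>

definition phi_hat :: "'a \<Rightarrow> real \<Rightarrow> complex" where
  "phi_hat \<xi> \<tau> = (\<integral>x. complex_of_real (ampl x) * cis (\<xi> \<bullet> x + \<tau> * h x) \<partial>lborel)"

text \<open>The autocorrelation of the oscillating amplitude. Displacements lie in the hyperplane,
  so the single factor \<open>tent\<close> inside \<open>ampl m\<close> already confines the
  integral along the axis.\<close>

definition corr :: "'a \<Rightarrow> real \<Rightarrow> complex" where
  "corr u \<tau> = (\<integral>m. complex_of_real (bump (m + u) * ampl m) * cis (\<tau> * (h (m + u) - h m)) \<partial>lborel)"

section \<open>The autocorrelation of the amplitude and its decay\<close>

lemma open_tube: "open {x. norm (perp e x) < s}"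
  by (intro open_Collect_less continuous_intros)

lemma bump_nonneg: "bump x \<ge> 0"
  by (simp add: bump_def)

lemma bump_eq_0: "norm (perp e x) \<ge> r / 3 \<Longrightarrow> bump x = 0"
  using power_mono[of "r / 3" "norm (perp e x)" 2] r by (simp add: bump_def)

lemma bump_cont: "continuous_on S bump"
  unfolding bump_def[abs_def] by (intro continuous_intros)

lemma bump_perp: "perp e x = perp e y \<Longrightarrow> bump x = bump y"
  by (simp add: bump_def)

lemma ampl_nonneg: "ampl x \<ge> 0"
  by (simp add: ampl_def bump_nonneg tent_bounds)

lemma ampl_eq_0: "x \<notin> cyl e (r / 3) \<Longrightarrow> ampl x = 0"
  using bump_eq_0[of x] tent_bounds(3)[of "x \<bullet> e"] by (auto simp: cyl_def ampl_def not_le)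

lemma ampl_cont: "continuous_on S ampl"
  unfolding ampl_def[abs_def] by (intro continuous_intros bump_cont)

lemma ampl_measurable [measurable]: "ampl \<in> borel_measurable borel"
  by (intro borel_measurable_continuous_onI ampl_cont)

lemma bump_measurable [measurable]: "bump \<in> borel_measurable borel"
  by (intro borel_measurable_continuous_onI bump_cont)

lemma bump_C_k_bounded:
  assumes "\<And>p. p \<in> P \<Longrightarrow> norm (w p) = 1 \<and> w p \<bullet> e = 0" "n \<le> DIM('a) + 1"
    and D: "\<And>x. x \<in> D \<Longrightarrow> norm (perp e x) \<le> R"
  shows "C_k_bounded n P w D (\<lambda>p. bump)"
proof -
  \<comment> \<open>Along a unit vector of the hyperplane this linear function has derivative 1, and
    the squared norm has twice the linear function as derivative, so both have all orders.\<close>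
  have lin: "C_k_bounded n P w D (\<lambda>p x. perp e x \<bullet> w p)" for n
  proof -
    have b: "\<bar>perp e x \<bullet> w p\<bar> \<le> R" if "p \<in> P" "x \<in> D" for p x
      using Cauchy_Schwarz_ineq2[of "perp e x" "w p"] assms(1)[OF that(1)] D[OF that(2)] by simp
    have 0: "C_k_bounded 0 P w D (\<lambda>p x. perp e x \<bullet> w p)"
      using b by (auto intro!: continuous_intros)
    show ?thesis
    proof (cases n)
      case 0
      with \<open>C_k_bounded 0 P w D (\<lambda>p x. perp e x \<bullet> w p)\<close> show ?thesis by simp
    next
      case (Suc m)
      show ?thesis unfolding Suc
      proof (rule C_k_bounded_SucI[OF 0])
        show "C_k_bounded m P w D (\<lambda>p x. 1)" by (rule C_k_bounded_const[of P "\<lambda>_. 1" 1]) simp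
        fix p x assume "p \<in> P" "x \<in> D"
        then have "perp e (x + s *\<^sub>R w p) \<bullet> w p = perp e x \<bullet> w p + s" for s
          using assms(1)[of p] by (simp add: perp_add perp_scaleR perp_eq inner_add_left dot_square_norm)
        then show "((\<lambda>s. perp e (x + s *\<^sub>R w p) \<bullet> w p) has_real_derivative 1) (at 0)"
          by (auto intro!: derivative_eq_intros)
      qed
    qed
  qed
  have y: "C_k_bounded n P w D (\<lambda>p x. (r / 3)\<^sup>2 - (norm (perp e x))\<^sup>2)" for n
  proof -
    have b: "\<bar>(r / 3)\<^sup>2 - (norm (perp e x))\<^sup>2\<bar> \<le> (r / 3)\<^sup>2 + R\<^sup>2" if "x \<in> D" for x
    proof -
      have "(norm (perp e x))\<^sup>2 \<le> R\<^sup>2" using D[OF that] by (intro power_mono) auto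
      then show ?thesis by (smt (verit) zero_le_power2)
    qed
    have 0: "C_k_bounded 0 P w D (\<lambda>p x. (r / 3)\<^sup>2 - (norm (perp e x))\<^sup>2)"
      using b by (auto intro!: continuous_intros)
    show ?thesis
    proof (cases n)
      case 0
      with \<open>C_k_bounded 0 P w D (\<lambda>p x. (r / 3)\<^sup>2 - (norm (perp e x))\<^sup>2)\<close> show ?thesis by simp
    next
      case (Suc m)
      show ?thesis unfolding Suc
      proof (rule C_k_bounded_SucI[OF 0])
        show "C_k_bounded m P w D (\<lambda>p x. (-2) * (perp e x \<bullet> w p))"
          by (intro C_k_bounded_mult lin C_k_bounded_const[of P "\<lambda>_. -2" 2]) simp
        fix p x assume p: "p \<in> P" "x \<in> D"
        have "w p \<bullet> w p = 1" using assms(1)[OF p(1)] by (simp add: dot_square_norm)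
        note ww = this
        have "(norm (perp e (x + s *\<^sub>R w p)))\<^sup>2 = (norm (perp e x))\<^sup>2 + 2 * s * (perp e x \<bullet> w p) + s\<^sup>2" for s
        proof -
          have "perp e (x + s *\<^sub>R w p) = perp e x + s *\<^sub>R w p"
            using assms(1)[OF p(1)] by (simp add: perp_add perp_scaleR perp_eq)
          moreover have "(a + s *\<^sub>R w p) \<bullet> (a + s *\<^sub>R w p) = a \<bullet> a + 2 * s * (a \<bullet> w p) + s\<^sup>2 * (w p \<bullet> w p)" for a
            by (simp add: inner_add_left inner_add_right inner_commute[of "w p" a] power2_eq_square distrib_left)
          ultimately show ?thesis by (simp add: power2_norm_eq_inner ww)
        qed
        then show "((\<lambda>s. (r / 3)\<^sup>2 - (norm (perp e (x + s *\<^sub>R w p)))\<^sup>2) has_real_derivative (-2) * (perp e x \<bullet> w p)) (at 0)"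
          by (auto intro!: derivative_eq_intros)
      qed
    qed
  qed
  show ?thesis unfolding bump_def
    by (rule C_k_bounded_pos_part_power[OF y]) (use assms(2) in auto)
qed

lemma ampl_C_k_bounded:
  assumes "\<And>p. p \<in> P \<Longrightarrow> norm (w p) = 1 \<and> w p \<bullet> e = 0" "n \<le> DIM('a) + 1"
    and D: "\<And>x. x \<in> D \<Longrightarrow> norm (perp e x) \<le> R"
  shows "C_k_bounded n P w D (\<lambda>p. ampl)"
proof -
  have "C_k_bounded n P w D (\<lambda>p x. tent (x \<bullet> e))"
    by (rule C_k_bounded_invariant[of _ _ 1])
      (use assms(1) in \<open>auto simp: inner_add_left tent_bounds intro!: continuous_intros\<close>)
  then show ?thesis unfolding ampl_def
    by (intro C_k_bounded_mult bump_C_k_bounded[OF assms])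
qed

text \<open>Strong monotonicity of the gradient makes the phase difference non-stationary: its
  derivative along u/|u| is at least c |u|. Dividing the phase by |u| normalises this to c,
  uniformly in \<open>u\<close>, and the large parameter becomes \<tau> |u|. With d integrations by
  parts the decay has order d.\<close>

lemma corr_bound_power:
  "\<exists>C. \<forall>u \<tau>. u \<bullet> e = 0 \<longrightarrow> 0 < norm u \<longrightarrow> norm u < r \<longrightarrow> 0 < \<tau> \<longrightarrow> cmod (corr u \<tau>) * (\<tau> * norm u) ^ DIM('a) \<le> C"
proof -
  define P where "P = {u. u \<bullet> e = 0 \<and> 0 < norm u \<and> norm u < r}"
  define w where "w u = u /\<^sub>R norm u" for u :: 'a
  let ?D = "{x. norm (perp e x) < r}" and ?W = "{w. norm w = 1 \<and> w \<bullet> e = 0}"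
  have w: "norm (w u) = 1 \<and> w u \<bullet> e = 0" "u = norm u *\<^sub>R w u" if "u \<in> P" for u
    using that by (auto simp: w_def P_def)
  have seg: "norm (perp e (x + a *\<^sub>R w u)) < 2 * r" if "u \<in> P" "x \<in> ?D" "0 \<le> a" "a \<le> norm u" for u x a
  proof -
    have "norm (perp e (x + a *\<^sub>R w u)) \<le> norm (perp e x) + a"
      using norm_triangle_ineq[of "perp e x" "a *\<^sub>R w u"] w[OF that(1)] that(3)
      by (simp add: perp_add perp_scaleR perp_eq)
    then show ?thesis using that r by (auto simp: P_def)
  qed
  define \<phi> where "\<phi> u m = (h (m + u) - h m) / norm u" for u m
  define \<kappa> where "\<kappa> u m = (w u \<bullet> g (m + norm u *\<^sub>R w u) - w u \<bullet> g m) / norm u" for u m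
  \<comment> \<open>A difference quotient of the gradient with step |u|, hence bounded to order d
    uniformly as \<open>u\<close> tends to 0.\<close>
  have \<kappa>: "C_k_bounded DIM('a) P w ?D \<kappa>" unfolding \<kappa>_def
    by (rule C_k_bounded_diffquot[OF g_bd, of P w w norm ?D]) (use w seg in \<open>auto simp: P_def\<close>)
  have in2: "x \<in> ?D \<Longrightarrow> norm (perp e x) < 2 * r" for x using r by auto
  have in2u: "norm (perp e (x + u)) < 2 * r" if "u \<in> P" "x \<in> ?D" for x u
    using seg[OF that, of "norm u"] w(2)[OF that(1)] by simp
  have "\<exists>C. \<forall>u\<in>P. \<forall>T>0. cmod (\<integral>x. complex_of_real (bump (x + u) * ampl x) * cis (T * \<phi> u x) \<partial>lborel) * T ^ DIM('a) \<le> C"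
  proof (rule nonstationary_phase[of ?D "cyl e (r/3)" P \<phi> w \<kappa> c])
    show "open ?D" by (rule open_tube)
    show "compact (cyl e (r / 3))" by (rule compact_cyl[OF e])
    show "cyl e (r / 3) \<subseteq> ?D" using r by (auto simp: cyl_def)
    show "c > 0" by (rule c)
    show "C_k_bounded DIM('a) P w ?D \<kappa>" by (rule \<kappa>)
    show "bump (x + u) * ampl x = 0" if "x \<notin> cyl e (r / 3)" for u x using ampl_eq_0[OF that] by simp
    have "C_k_bounded DIM('a) ?W (\<lambda>w. w) {x. norm (perp e x) < 2 * r} (\<lambda>p. bump)"
      by (rule bump_C_k_bounded[of _ _ _ _ "2 * r"]) auto
    from C_k_bounded_reindex[OF this, of P w w ?D "\<lambda>u. u"]
    have "C_k_bounded DIM('a) P w ?D (\<lambda>u x. bump (x + u))" using w in2u by auto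
    moreover have "C_k_bounded DIM('a) P w ?D (\<lambda>u. ampl)"
      by (rule ampl_C_k_bounded[of _ _ _ _ r]) (use w in auto)
    ultimately show "C_k_bounded DIM('a) P w ?D (\<lambda>u x. bump (x + u) * ampl x)"
      by (rule C_k_bounded_mult)
  next
    fix u assume u: "u \<in> P"
    have 1: "continuous_on ?D h" by (rule continuous_on_subset[OF h_cont]) (use r in auto)
    have 2: "continuous_on ?D (\<lambda>x. h (x + u))"
      by (rule continuous_on_compose2[OF h_cont]) (use in2u[OF u] in \<open>auto intro!: continuous_intros\<close>)
    show "continuous_on ?D (\<phi> u)" unfolding \<phi>_def using u
      by (intro continuous_intros 1 2) (auto simp: P_def)
    fix x assume x: "x \<in> ?D"
    have "((\<lambda>s. h (x + s *\<^sub>R w u)) has_real_derivative w u \<bullet> g x) (at 0)"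
      using w[OF u] in2[OF x] by (intro h_deriv) auto
    moreover have "((\<lambda>s. h (x + u + s *\<^sub>R w u)) has_real_derivative w u \<bullet> g (x + u)) (at 0)"
      using w[OF u] in2u[OF u x] by (intro h_deriv) auto
    ultimately show "((\<lambda>s. \<phi> u (x + s *\<^sub>R w u)) has_real_derivative \<kappa> u x) (at 0)"
      unfolding \<phi>_def \<kappa>_def w(2)[OF u, symmetric] using u
      by (auto intro!: derivative_eq_intros simp: add_ac P_def)
    have "c * norm u \<le> w u \<bullet> (g (x + norm u *\<^sub>R w u) - g x)"
      by (rule g_mono) (use w[OF u] in2[OF x] seg[OF u x, of "norm u"] u in \<open>auto simp: P_def\<close>)
    then have "c \<le> \<kappa> u x" using u by (simp add: \<kappa>_def P_def inner_diff_right le_divide_eq)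
    then show "c \<le> \<bar>\<kappa> u x\<bar>" by simp
  qed
  then obtain C where C: "\<And>u T. u \<in> P \<Longrightarrow> T > 0 \<Longrightarrow>
    cmod (\<integral>x. complex_of_real (bump (x + u) * ampl x) * cis (T * \<phi> u x) \<partial>lborel) * T ^ DIM('a) \<le> C" by blast
  have "cmod (corr u \<tau>) * (\<tau> * norm u) ^ DIM('a) \<le> C" if "u \<in> P" "\<tau> > 0" for u \<tau>
    using C[OF that(1), of "\<tau> * norm u"] that by (simp add: corr_def \<phi>_def P_def)
  then show ?thesis unfolding P_def by (intro exI[of _ C]) auto
qed

lemma corr_trivial_bound: "\<exists>C. \<forall>u \<tau>. cmod (corr u \<tau>) \<le> C"
proof -
  have b: "\<bar>bump x\<bar> \<le> ((r / 3)\<^sup>2) ^ (DIM('a) + 2)" for x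
  proof -
    have "max 0 ((r / 3)\<^sup>2 - (norm (perp e x))\<^sup>2) \<le> (r / 3)\<^sup>2" by (simp only: max.bounded_iff diff_le_eq) simp
    then have "bump x \<le> ((r / 3)\<^sup>2) ^ (DIM('a) + 2)" unfolding bump_def by (rule power_mono) (rule max.cobounded1)
    then show ?thesis using bump_nonneg[of x] by linarith
  qed
  let ?C = "\<integral>m. ((r / 3)\<^sup>2) ^ (DIM('a) + 2) * ampl m \<partial>lborel"
  have i: "integrable lborel (\<lambda>m. ((r / 3)\<^sup>2) ^ (DIM('a) + 2) * ampl m)"
    by (intro integrable_mult_right integrable_compact_support[OF compact_cyl[OF e] ampl_cont ampl_eq_0])
  have "cmod (corr u \<tau>) \<le> ?C" for u \<tau>
  proof -
    have "cmod (corr u \<tau>) \<le> (\<integral>m. cmod (complex_of_real (bump (m + u) * ampl m) * cis (\<tau> * (h (m + u) - h m))) \<partial>lborel)"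
      unfolding corr_def by (rule integral_norm_bound)
    also have "\<dots> \<le> ?C"
      by (rule integral_mono'[OF i]) (use b ampl_nonneg in \<open>auto simp: norm_mult abs_mult intro!: mult_right_mono\<close>)
    finally show ?thesis .
  qed
  then show ?thesis by blast
qed

lemma corr_eq_0: "norm (perp e u) \<ge> r \<Longrightarrow> corr u \<tau> = 0"
proof -
  assume u: "norm (perp e u) \<ge> r"
  have "bump (m + u) * ampl m = 0" for m
  proof (cases "norm (perp e m) < r / 3")
    case True
    have "norm (perp e u) \<le> norm (perp e (m + u)) + norm (perp e m)"
      using norm_triangle_ineq4[of "perp e (m + u)" "perp e m"] by (simp add: perp_add)
    then have "norm (perp e (m + u)) \<ge> r / 3" using u True r by linarith
    then show ?thesis by (simp add: bump_eq_0)
  next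
    case False
    then show ?thesis by (simp add: ampl_def bump_eq_0)
  qed
  then show ?thesis unfolding corr_def by (simp only: of_real_0 mult_zero_left Bochner_Integration.integral_zero)
qed

text \<open>Integration by parts gives nothing for \<tau> |u| \<le> 1, where the trivial bound takes
  over; for |u| \<ge> r the two factors have disjoint supports.\<close>

lemma corr_bound: "\<exists>C>0. \<forall>u \<tau>. u \<bullet> e = 0 \<longrightarrow> 0 < \<tau> \<longrightarrow> cmod (corr u \<tau>) \<le> C / (1 + \<tau> * norm u) ^ DIM('a)"
proof -
  obtain C1 where C1: "\<And>u \<tau>. u \<bullet> e = 0 \<Longrightarrow> 0 < norm u \<Longrightarrow> norm u < r \<Longrightarrow> 0 < \<tau> \<Longrightarrow>
    cmod (corr u \<tau>) * (\<tau> * norm u) ^ DIM('a) \<le> C1" using corr_bound_power by blast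
  obtain C0 where C0: "\<And>u \<tau>. cmod (corr u \<tau>) \<le> C0" using corr_trivial_bound by blast
  have C0': "C0 \<ge> 0" using order_trans[OF norm_ge_zero C0] by blast
  \<comment> \<open>2^d absorbs 1 + x \<le> 2 for x \<le> 1 and 1 + x \<le> 2 x otherwise; the final
    1 makes the constant positive.\<close>
  define C where "C = 2 ^ DIM('a) * max C0 C1 + 1"
  have Cpos: "C > 0" unfolding C_def using C0' by (intro add_nonneg_pos) auto
  have "cmod (corr u \<tau>) * (1 + \<tau> * norm u) ^ DIM('a) \<le> C" if u: "u \<bullet> e = 0" "0 < \<tau>" for u \<tau>
  proof -
    have "cmod (corr u \<tau>) * (1 + \<tau> * norm u) ^ DIM('a) \<le> 2 ^ DIM('a) * max C0 C1"
    proof (cases "\<tau> * norm u \<le> 1")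
      case True
      have "(1 + \<tau> * norm u) ^ DIM('a) \<le> 2 ^ DIM('a)" using True u by (intro power_mono) auto
      then have "cmod (corr u \<tau>) * (1 + \<tau> * norm u) ^ DIM('a) \<le> max C0 C1 * 2 ^ DIM('a)"
        using C0[of u \<tau>] C0' u by (intro mult_mono) auto
      then show ?thesis by (simp add: mult.commute)
    next
      case False
      then have nu: "norm u > 0" by (cases "u = 0") auto
      show ?thesis
      proof (cases "norm u < r")
        case True
        have "(1 + \<tau> * norm u) ^ DIM('a) \<le> (2 * (\<tau> * norm u)) ^ DIM('a)" using False u by (intro power_mono) auto
        then have "cmod (corr u \<tau>) * (1 + \<tau> * norm u) ^ DIM('a) \<le> cmod (corr u \<tau>) * (2 * (\<tau> * norm u)) ^ DIM('a)"
          by (intro mult_left_mono) auto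
        also have "\<dots> = 2 ^ DIM('a) * (cmod (corr u \<tau>) * (\<tau> * norm u) ^ DIM('a))" by (simp add: power_mult_distrib)
        also have "\<dots> \<le> 2 ^ DIM('a) * max C0 C1" using C1[OF u(1) nu True u(2)] by (intro mult_left_mono) auto
        finally show ?thesis .
      next
        case False
        then have "corr u \<tau> = 0" using corr_eq_0[of u \<tau>] u by (simp add: perp_eq)
        then show ?thesis using C0' by simp
      qed
    qed
    then show ?thesis by (simp add: C_def)
  qed
  then have "cmod (corr u \<tau>) \<le> C / (1 + \<tau> * norm u) ^ DIM('a)" if u: "u \<bullet> e = 0" "0 < \<tau>" for u \<tau>
    using that by (subst pos_le_divide_eq) (auto intro!: zero_less_power add_pos_nonneg)
  with Cpos show ?thesis by blast
qed

end

section \<open>Upper bounds for the transform of the amplitude\<close>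

lemma integrable_stretch:
  fixes e :: "'a::euclidean_space" and f :: "'a \<Rightarrow> 'b::{banach,second_countable_topology}"
  assumes "e \<in> Basis" "t > 0" and [measurable]: "f \<in> borel_measurable borel"
    and "integrable lborel (\<lambda>x. f (stretch e t x))"
  shows "integrable lborel f"
  using assms(2,4) by (subst lborel_stretch[OF assms(1,2)])
    (simp add: integrable_density integrable_distr_eq)

context graph_patch
begin

lemma cyl_subset_tube: "cyl e (r / 3) \<subseteq> {x. norm (perp e x) < 2 * r}"
  using r by (auto simp: cyl_def)

lemma ampl_cis_cont: "continuous_on UNIV (\<lambda>x. complex_of_real (ampl x) * cis (\<xi> \<bullet> x + \<tau> * h x))"
  by (rule continuous_on_zero_extension[of "{x. norm (perp e x) < 2 * r}" "cyl e (r / 3)"])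
    (use open_tube closed_cyl cyl_subset_tube in \<open>auto intro!: continuous_intros ampl_cont h_cont simp: ampl_eq_0\<close>)

text \<open>The square modulus is a double integral over points x and m. Shifting x by the
  hyperplane part of m makes the displacement v the new variable, and exchanging the integrals
  leaves the autocorrelation: the Wiener-Khinchin identity on a graph.\<close>

lemma phi_hat_square:
  assumes \<xi>: "\<xi> \<bullet> e = 0"
  shows "complex_of_real ((cmod (phi_hat \<xi> \<tau>))\<^sup>2)
    = (\<integral>v. complex_of_real (tent (v \<bullet> e)) * cis (\<xi> \<bullet> v) * corr (perp e v) \<tau> \<partial>lborel)"
proof -
  let ?S = "cyl e (r / 3)"
  define a where "a x = complex_of_real (ampl x) * cis (\<xi> \<bullet> x + \<tau> * h x)" for x
  have ac: "continuous_on UNIV a" unfolding a_def by (rule ampl_cis_cont)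
  have ai: "integrable lborel a" unfolding a_def
    by (rule integrable_compact_support[OF compact_cyl[OF e, of "r / 3"] ampl_cis_cont]) (simp add: ampl_eq_0)
  have [measurable]: "a \<in> borel_measurable borel" using ac by (rule borel_measurable_continuous_onI)
  have a0: "x \<notin> ?S \<Longrightarrow> a x = 0" for x by (simp add: a_def ampl_eq_0)
  have phi: "phi_hat \<xi> \<tau> = (\<integral>x. a x \<partial>lborel)" by (simp add: phi_hat_def a_def)
  have int: "integrable (lborel \<Otimes>\<^sub>M lborel) (\<lambda>(v, m). cnj (a m) * a (v + perp e m))"
    unfolding lborel_prod
  proof (rule integrable_compact_support)
    show "compact ((\<lambda>(x, m). (x - perp e m, m)) ` (?S \<times> ?S))"
      unfolding split_def by (intro compact_continuous_image compact_Times compact_cyl e continuous_intros)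
    have "continuous_on UNIV (\<lambda>z::'a \<times> 'a. a (fst z + perp e (snd z)))"
      by (rule continuous_on_compose2[OF ac]) (auto intro!: continuous_intros)
    moreover have "continuous_on UNIV (\<lambda>z::'a \<times> 'a. a (snd z))"
      by (rule continuous_on_compose2[OF ac]) (auto intro!: continuous_intros)
    ultimately show "continuous_on UNIV (\<lambda>(v, m). cnj (a m) * a (v + perp e m))"
      unfolding split_def by (intro continuous_intros)
    fix z :: "'a \<times> 'a" assume z: "z \<notin> (\<lambda>(x, m). (x - perp e m, m)) ` (?S \<times> ?S)"
    obtain v m where vm: "z = (v, m)" by (cases z)
    have "v + perp e m \<notin> ?S \<or> m \<notin> ?S"
    proof (rule ccontr)
      assume "\<not> ?thesis"
      then have "(\<lambda>(x, m). (x - perp e m, m)) (v + perp e m, m) \<in> (\<lambda>(x, m). (x - perp e m, m)) ` (?S \<times> ?S)"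
        by (intro imageI) auto
      with z vm show False by simp
    qed
    then show "(case z of (v, m) \<Rightarrow> cnj (a m) * a (v + perp e m)) = 0"
      using a0 vm by auto
  qed
  have "complex_of_real ((cmod (phi_hat \<xi> \<tau>))\<^sup>2) = (\<integral>m. cnj (a m) \<partial>lborel) * (\<integral>x. a x \<partial>lborel)"
    unfolding complex_norm_square phi by (simp add: mult.commute)
  also have "\<dots> = (\<integral>m. cnj (a m) * (\<integral>x. a x \<partial>lborel) \<partial>lborel)"
    by simp
  also have "\<dots> = (\<integral>m. (\<integral>v. cnj (a m) * a (v + perp e m) \<partial>lborel) \<partial>lborel)"
  proof (intro Bochner_Integration.integral_cong refl)
    fix m
    \<comment> \<open>The shift is by \<open>perp e m\<close> instead of \<open>m\<close>: then v
      \<bullet> e is the full axis coordinate of x, and the two \<open>tent\<close> factors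
      separate.\<close>
    have "(\<integral>x. a x \<partial>lborel) = (\<integral>v. a (v + perp e m) \<partial>lborel)" by (rule lborel_integral_translate[symmetric]) simp
    then show "cnj (a m) * (\<integral>x. a x \<partial>lborel) = (\<integral>v. cnj (a m) * a (v + perp e m) \<partial>lborel)" by simp
  qed
  also have "\<dots> = (\<integral>v. (\<integral>m. cnj (a m) * a (v + perp e m) \<partial>lborel) \<partial>lborel)"
    by (rule lborel_pair.Fubini_integral[OF int])
  also have "\<dots> = (\<integral>v. complex_of_real (tent (v \<bullet> e)) * cis (\<xi> \<bullet> v) * corr (perp e v) \<tau> \<partial>lborel)"
  proof (intro Bochner_Integration.integral_cong refl)
    fix v
    have "cnj (a m) * a (v + perp e m) = complex_of_real (tent (v \<bullet> e)) * cis (\<xi> \<bullet> v) *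
        (complex_of_real (bump (m + perp e v) * ampl m) * cis (\<tau> * (h (m + perp e v) - h m)))" for m
    proof -
      have p: "perp e (v + perp e m) = perp e (m + perp e v)" by (simp add: perp_add perp_perp[OF e])
      have "ampl (v + perp e m) = bump (m + perp e v) * tent (v \<bullet> e)"
        unfolding ampl_def bump_perp[OF p] by (simp add: inner_add_left perp_inner[OF e])
      moreover have "h (v + perp e m) = h (m + perp e v)" using h_perp p by metis
      moreover have "\<xi> \<bullet> (v + perp e m) = \<xi> \<bullet> v + \<xi> \<bullet> m" by (simp add: inner_add_right perp_inner_perp[OF \<xi>])
      moreover have "cis (- (\<xi> \<bullet> m + \<tau> * h m)) * cis (\<xi> \<bullet> v + \<xi> \<bullet> m + \<tau> * h (m + perp e v))
        = cis (\<xi> \<bullet> v) * cis (\<tau> * (h (m + perp e v) - h m))"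
        by (simp add: cis_mult algebra_simps)
      ultimately show ?thesis by (simp add: a_def cis_cnj)
    qed
    then show "(\<integral>m. cnj (a m) * a (v + perp e m) \<partial>lborel) = complex_of_real (tent (v \<bullet> e)) * cis (\<xi> \<bullet> v) * corr (perp e v) \<tau>"
      by (simp add: corr_def)
  qed
  finally show ?thesis .
qed

text \<open>Substituting v = w/\<tau> within the hyperplane costs \<tau>^(-(d-1)) and turns the
  bound on the autocorrelation into one integrable function independent of \<xi> and \<tau>; \<xi>
  only enters a factor of modulus 1.\<close>

lemma phi_hat_upper_conormal:
  "\<exists>C>0. \<forall>\<xi> \<tau>. \<xi> \<bullet> e = 0 \<longrightarrow> \<tau> > 0 \<longrightarrow> (cmod (phi_hat \<xi> \<tau>))\<^sup>2 * \<tau> ^ (DIM('a) - 1) \<le> C"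
proof -
  obtain C where C: "C > 0" "\<And>u \<tau>. u \<bullet> e = 0 \<Longrightarrow> 0 < \<tau> \<Longrightarrow> cmod (corr u \<tau>) \<le> C / (1 + \<tau> * norm u) ^ DIM('a)"
    using corr_bound by blast
  let ?\<Phi> = "\<lambda>x. C * (indicator {x. \<bar>x \<bullet> e\<bar> \<le> 1} x / (1 + norm (perp e x)) ^ DIM('a))"
  have i\<Phi>: "integrable lborel ?\<Phi>" by (intro integrable_mult_right integrable_cyl_decay e)
  have [measurable]: "{x. \<bar>x \<bullet> e\<bar> \<le> 1} \<in> sets borel"
    by (intro borel_closed closed_Collect_le continuous_intros)
  have le: "(cmod (phi_hat \<xi> \<tau>))\<^sup>2 * \<tau> ^ (DIM('a) - 1) \<le> (\<integral>x. ?\<Phi> x \<partial>lborel)" if \<xi>: "\<xi> \<bullet> e = 0" and \<tau>: "\<tau> > 0" for \<xi> \<tau>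
  proof -
    let ?f = "\<lambda>x. C * (indicator {x. \<bar>x \<bullet> e\<bar> \<le> 1} x / (1 + \<tau> * norm (perp e x)) ^ DIM('a))"
    have [measurable]: "?f \<in> borel_measurable borel" by measurable
    have eq: "?f (stretch e (1 / \<tau>) x) = ?\<Phi> x" for x
      using \<tau> by (simp add: perp_stretch[OF e] stretch_inner[OF e] indicator_def)
    have i: "integrable lborel ?f"
      by (rule integrable_stretch[OF e, of "1 / \<tau>"]) (use \<tau> i\<Phi> in \<open>simp_all only: eq zero_less_divide_1_iff, measurable\<close>)
    have "(cmod (phi_hat \<xi> \<tau>))\<^sup>2 = cmod (complex_of_real ((cmod (phi_hat \<xi> \<tau>))\<^sup>2))"
      by (simp only: norm_of_real abs_power2)
    also have "\<dots> \<le> (\<integral>v. cmod (complex_of_real (tent (v \<bullet> e)) * cis (\<xi> \<bullet> v) * corr (perp e v) \<tau>) \<partial>lborel)"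
      unfolding phi_hat_square[OF \<xi>] by (rule integral_norm_bound)
    also have "\<dots> \<le> (\<integral>v. ?f v \<partial>lborel)"
    proof (rule integral_mono'[OF i])
      fix v
      have "0 \<le> C / (1 + \<tau> * norm (perp e v)) ^ DIM('a)" using C \<tau> by simp
      moreover have "tent (v \<bullet> e) * cmod (corr (perp e v) \<tau>) \<le> 1 * (C / (1 + \<tau> * norm (perp e v)) ^ DIM('a))"
        using C(2)[OF perp_inner[OF e] \<tau>] tent_bounds by (intro mult_mono) auto
      ultimately show "cmod (complex_of_real (tent (v \<bullet> e)) * cis (\<xi> \<bullet> v) * corr (perp e v) \<tau>) \<le> ?f v"
        using tent_bounds[of "v \<bullet> e"] by (auto simp: norm_mult indicator_def)
      show "0 \<le> ?f v" using C \<tau> by simp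
    qed
    also have "\<dots> = (1 / \<tau>) ^ (DIM('a) - 1) *\<^sub>R (\<integral>v. ?f (stretch e (1 / \<tau>) v) \<partial>lborel)"
      by (rule integral_stretch[OF e]) (use \<tau> in auto)
    also have "\<dots> = (1 / \<tau>) ^ (DIM('a) - 1) * (\<integral>x. ?\<Phi> x \<partial>lborel)" by (simp only: eq real_scaleR_def)
    finally show ?thesis using \<tau> by (simp add: power_divide pos_le_divide_eq)
  qed
  show ?thesis
  proof (intro exI conjI allI impI)
    show "0 < max 1 (\<integral>x. ?\<Phi> x \<partial>lborel)" by simp
    fix \<xi> \<tau> assume "\<xi> \<bullet> e = 0" "(\<tau>::real) > 0"
    from le[OF this] show "(cmod (phi_hat \<xi> \<tau>))\<^sup>2 * \<tau> ^ (DIM('a) - 1) \<le> max 1 (\<integral>x. ?\<Phi> x \<partial>lborel)"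
      by (rule order_trans) simp
  qed
qed

lemma phi_hat_trivial: "cmod (phi_hat \<xi> \<tau>) \<le> (\<integral>x. ampl x \<partial>lborel)"
  using integral_norm_bound[of lborel "\<lambda>x. complex_of_real (ampl x) * cis (\<xi> \<bullet> x + \<tau> * h x)"] ampl_nonneg
  by (simp add: phi_hat_def norm_mult)

lemma phi_hat_cnj: "phi_hat (- \<xi>) (- \<tau>) = cnj (phi_hat \<xi> \<tau>)"
proof -
  have "phi_hat (- \<xi>) (- \<tau>) = (\<integral>x. cnj (complex_of_real (ampl x) * cis (\<xi> \<bullet> x + \<tau> * h x)) \<partial>lborel)"
    unfolding phi_hat_def by (intro Bochner_Integration.integral_cong) (auto simp: cis_cnj)
  then show ?thesis by (simp only: Bochner_Integration.integral_cnj phi_hat_def)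
qed

text \<open>If \<xi> dominates \<tau>, the phase \<xi> \<bullet> x + \<tau> h x itself is
  non-stationary: its derivative along \<xi>/|\<xi>| is |\<xi>| up to an error |\<tau>| B, which is
  at most half of it for G = 2 B.\<close>

lemma phi_hat_upper_tangential:
  "\<exists>C G. G > 0 \<and> (\<forall>\<xi> \<tau>. \<xi> \<bullet> e = 0 \<longrightarrow> \<xi> \<noteq> 0 \<longrightarrow> \<bar>\<tau>\<bar> * G \<le> norm \<xi> \<longrightarrow> cmod (phi_hat \<xi> \<tau>) * norm \<xi> ^ DIM('a) \<le> C)"
proof -
  let ?D = "{x. norm (perp e x) < 2 * r}" and ?W = "{w. norm w = 1 \<and> w \<bullet> e = 0}"
  obtain B where B: "B > 0" "\<And>w x. w \<in> ?W \<Longrightarrow> x \<in> ?D \<Longrightarrow> \<bar>w \<bullet> g x\<bar> \<le> B"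
    using g_bd[of 0] by (elim C_k_bounded_bound) auto
  \<comment> \<open>Frequencies are normalised to |\<xi>| = 1: a parameter is a unit vector together
    with the ratio \<tau>/|\<xi>|.\<close>
  define P where "P = {p :: 'a \<times> real. fst p \<in> ?W \<and> \<bar>snd p\<bar> * (2 * B) \<le> 1}"
  have "\<exists>C. \<forall>p\<in>P. \<forall>T>0. cmod (\<integral>x. complex_of_real (ampl x) * cis (T * (fst p \<bullet> x + snd p * h x)) \<partial>lborel) * T ^ DIM('a) \<le> C"
  proof (rule nonstationary_phase[of ?D "cyl e (r/3)" P _ fst "\<lambda>p x. 1 + snd p * (fst p \<bullet> g x)" "1/2"])
    show "open ?D" by (rule open_tube)
    show "compact (cyl e (r / 3))" by (rule compact_cyl[OF e])
    show "cyl e (r / 3) \<subseteq> ?D" by (rule cyl_subset_tube)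
    have "C_k_bounded DIM('a) P fst ?D (\<lambda>p x. fst p \<bullet> g (x + 0))"
      by (rule C_k_bounded_reindex[OF g_bd]) (auto simp: P_def)
    moreover have "\<bar>snd p\<bar> \<le> 1 / (2 * B)" if "p \<in> P" for p
      using that B(1) by (simp add: P_def le_divide_eq)
    ultimately show "C_k_bounded DIM('a) P fst ?D (\<lambda>p x. 1 + snd p * (fst p \<bullet> g x))"
      by (intro C_k_bounded_add C_k_bounded_mult C_k_bounded_const[of P "\<lambda>_. 1" 1] C_k_bounded_const[of P snd "1 / (2 * B)"]) auto
    show "C_k_bounded DIM('a) P fst ?D (\<lambda>p. ampl)"
      by (rule ampl_C_k_bounded[of _ _ _ _ "2 * r"]) (auto simp: P_def)
    show "ampl x = 0" if "x \<notin> cyl e (r / 3)" for x using ampl_eq_0[OF that] .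
    fix p assume p: "p \<in> P"
    show "continuous_on ?D (\<lambda>x. fst p \<bullet> x + snd p * h x)" by (intro continuous_intros h_cont)
    fix x assume x: "x \<in> ?D"
    have w: "norm (fst p) = 1" "fst p \<bullet> e = 0" using p by (auto simp: P_def)
    have d: "((\<lambda>s. h (x + s *\<^sub>R fst p)) has_real_derivative fst p \<bullet> g x) (at 0)"
      using w x by (intro h_deriv) auto
    have l: "fst p \<bullet> (x + s *\<^sub>R fst p) = fst p \<bullet> x + s" for s using w by (simp add: inner_add_right dot_square_norm)
    show "((\<lambda>s. fst p \<bullet> (x + s *\<^sub>R fst p) + snd p * h (x + s *\<^sub>R fst p)) has_real_derivative 1 + snd p * (fst p \<bullet> g x)) (at 0)"
      unfolding l using d by (auto intro!: derivative_eq_intros)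
    have "\<bar>snd p * (fst p \<bullet> g x)\<bar> \<le> \<bar>snd p\<bar> * B" unfolding abs_mult using B(2)[of "fst p" x] w x by (intro mult_left_mono) auto
    also have "\<dots> \<le> 1 / 2" using p by (simp add: P_def)
    finally show "1 / 2 \<le> \<bar>1 + snd p * (fst p \<bullet> g x)\<bar>" by linarith
  qed simp
  then obtain C where C: "\<And>p T. p \<in> P \<Longrightarrow> T > 0 \<Longrightarrow>
     cmod (\<integral>x. complex_of_real (ampl x) * cis (T * (fst p \<bullet> x + snd p * h x)) \<partial>lborel) * T ^ DIM('a) \<le> C" by blast
  have "cmod (phi_hat \<xi> \<tau>) * norm \<xi> ^ DIM('a) \<le> C" if "\<xi> \<bullet> e = 0" "\<xi> \<noteq> 0" "\<bar>\<tau>\<bar> * (2 * B) \<le> norm \<xi>" for \<xi> \<tau>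
  proof -
    have "(\<xi> /\<^sub>R norm \<xi>, \<tau> / norm \<xi>) \<in> P" using that by (auto simp: P_def divide_le_eq)
    moreover have "norm \<xi> * (inverse (norm \<xi>) * (\<xi> \<bullet> x) + \<tau> / norm \<xi> * h x) = \<xi> \<bullet> x + \<tau> * h x" for x
      using that(2) by (simp add: distrib_left)
    ultimately show ?thesis using C[of "(\<xi> /\<^sub>R norm \<xi>, \<tau> / norm \<xi>)" "norm \<xi>"] that by (simp add: phi_hat_def)
  qed
  with B(1) show ?thesis by (intro exI[of _ C] exI[of _ "2 * B"]) auto
qed

lemma phi_hat_upper:
  "\<exists>C>0. \<forall>\<xi> \<tau>. \<xi> \<bullet> e = 0 \<longrightarrow> (cmod (phi_hat \<xi> \<tau>))\<^sup>2 * (1 + norm \<xi> + \<bar>\<tau>\<bar>) ^ (DIM('a) - 1) \<le> C"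
proof -
  let ?k = "DIM('a) - 1"
  obtain C1 where C1: "C1 > 0" "\<And>\<xi> \<tau>. \<xi> \<bullet> e = 0 \<Longrightarrow> \<tau> > 0 \<Longrightarrow> (cmod (phi_hat \<xi> \<tau>))\<^sup>2 * \<tau> ^ ?k \<le> C1"
    using phi_hat_upper_conormal by blast
  have C1': "(cmod (phi_hat \<xi> \<tau>))\<^sup>2 * \<bar>\<tau>\<bar> ^ ?k \<le> C1" if "\<xi> \<bullet> e = 0" "\<tau> \<noteq> 0" for \<xi> \<tau>
    using C1(2)[of \<xi> \<tau>] C1(2)[of "- \<xi>" "- \<tau>"] that by (cases "\<tau> > 0") (auto simp: phi_hat_cnj)
  obtain C2 G where G: "G > 0" and C2: "\<And>\<xi> \<tau>. \<xi> \<bullet> e = 0 \<Longrightarrow> \<xi> \<noteq> 0 \<Longrightarrow> \<bar>\<tau>\<bar> * G \<le> norm \<xi> \<Longrightarrow> cmod (phi_hat \<xi> \<tau>) * norm \<xi> ^ DIM('a) \<le> C2"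
    using phi_hat_upper_tangential by blast
  define B where "B = (\<integral>x. ampl x \<partial>lborel)"
  have B: "cmod (phi_hat \<xi> \<tau>) \<le> B" for \<xi> \<tau> unfolding B_def by (rule phi_hat_trivial)
  have B0: "0 \<le> B" using order_trans[OF norm_ge_zero B] .
  \<comment> \<open>Both constants serve where |\<xi>| + |\<tau>| > 1, hence the factor 2; the rest
    expresses one frequency component through the dominating one.\<close>
  define L1 where "L1 = 2 * (1 + 1 / G)"
  define L2 where "L2 = 2 * (1 + G)"
  have L: "L1 > 0" "L2 > 0" using G by (auto simp: L1_def L2_def intro!: add_pos_pos)
  define C where "C = B\<^sup>2 * 2 ^ ?k + L1 ^ DIM('a) * \<bar>C2\<bar> * B + L2 ^ ?k * C1 + 1"
  have nn: "0 \<le> B\<^sup>2 * 2 ^ ?k" "0 \<le> L1 ^ DIM('a) * \<bar>C2\<bar> * B" "0 \<le> L2 ^ ?k * C1"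
    using B0 L C1(1) by auto
  have "(cmod (phi_hat \<xi> \<tau>))\<^sup>2 * (1 + norm \<xi> + \<bar>\<tau>\<bar>) ^ ?k \<le> C" if \<xi>: "\<xi> \<bullet> e = 0" for \<xi> \<tau>
  proof (cases "norm \<xi> + \<bar>\<tau>\<bar> \<le> 1")
    case True
    have "(cmod (phi_hat \<xi> \<tau>))\<^sup>2 * (1 + norm \<xi> + \<bar>\<tau>\<bar>) ^ ?k \<le> B\<^sup>2 * 2 ^ ?k"
      using True B by (intro mult_mono power_mono) auto
    then show ?thesis using nn unfolding C_def by linarith
  next
    case False
    show ?thesis
    proof (cases "\<bar>\<tau>\<bar> * G \<le> norm \<xi>")
      case True
      have \<xi>0: "\<xi> \<noteq> 0" using True False G by (auto simp: mult_le_0_iff)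
      have "\<bar>\<tau>\<bar> \<le> norm \<xi> / G" using True G by (simp add: le_divide_eq)
      then have "1 + norm \<xi> + \<bar>\<tau>\<bar> \<le> L1 * norm \<xi>" 
      proof -
        have "L1 * norm \<xi> = 2 * norm \<xi> + 2 * (norm \<xi> / G)" by (simp add: L1_def algebra_simps)
        with \<open>\<bar>\<tau>\<bar> \<le> norm \<xi> / G\<close> False show ?thesis by linarith
      qed
      then have "(1 + norm \<xi> + \<bar>\<tau>\<bar>) ^ DIM('a) \<le> (L1 * norm \<xi>) ^ DIM('a)" by (intro power_mono) auto
      moreover have "(1 + norm \<xi> + \<bar>\<tau>\<bar>) ^ ?k \<le> (1 + norm \<xi> + \<bar>\<tau>\<bar>) ^ DIM('a)" by (intro power_increasing) auto
      \<comment> \<open>One of the two factors is estimated trivially: a single one already decays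
        with order d, more than the required d - 1.\<close>
      ultimately have "(cmod (phi_hat \<xi> \<tau>))\<^sup>2 * (1 + norm \<xi> + \<bar>\<tau>\<bar>) ^ ?k \<le> (B * cmod (phi_hat \<xi> \<tau>)) * (L1 * norm \<xi>) ^ DIM('a)"
        unfolding power2_eq_square using B B0 by (intro mult_mono) auto
      also have "\<dots> = L1 ^ DIM('a) * (cmod (phi_hat \<xi> \<tau>) * norm \<xi> ^ DIM('a)) * B" by (simp add: power_mult_distrib)
      also have "\<dots> \<le> L1 ^ DIM('a) * \<bar>C2\<bar> * B"
        using C2[OF \<xi> \<xi>0 True] B0 L by (intro mult_right_mono mult_left_mono) auto
      finally show ?thesis using nn unfolding C_def by linarith
    next
      case F2: False
      then have \<tau>0: "\<tau> \<noteq> 0" by auto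
      have "1 + norm \<xi> + \<bar>\<tau>\<bar> \<le> L2 * \<bar>\<tau>\<bar>" using False F2 unfolding L2_def by (simp add: algebra_simps)
      then have "(1 + norm \<xi> + \<bar>\<tau>\<bar>) ^ ?k \<le> (L2 * \<bar>\<tau>\<bar>) ^ ?k" by (intro power_mono) auto
      then have "(cmod (phi_hat \<xi> \<tau>))\<^sup>2 * (1 + norm \<xi> + \<bar>\<tau>\<bar>) ^ ?k \<le> (cmod (phi_hat \<xi> \<tau>))\<^sup>2 * (L2 * \<bar>\<tau>\<bar>) ^ ?k"
        by (intro mult_left_mono) auto
      also have "\<dots> = L2 ^ ?k * ((cmod (phi_hat \<xi> \<tau>))\<^sup>2 * \<bar>\<tau>\<bar> ^ ?k)" by (simp add: power_mult_distrib)
      also have "\<dots> \<le> L2 ^ ?k * C1" using C1'[OF \<xi> \<tau>0] L by (intro mult_left_mono) auto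
      finally show ?thesis using nn unfolding C_def by linarith
    qed
  qed
  moreover have "C > 0" unfolding C_def using nn by linarith
  ultimately show ?thesis by blast
qed

end

section \<open>The limit of the rescaled square modulus\<close>

lemma cos_ge_half:
  fixes t :: real
  assumes "\<bar>t\<bar> \<le> 1"
  shows "cos t \<ge> 1 / 2"
proof -
  have "cos (pi / 3) \<le> cos \<bar>t\<bar>" by (rule cos_monotone_0_pi_le) (use assms pi_gt3 in auto)
  then show ?thesis by (simp add: cos_60)
qed

lemma tendsto_cis: "(f \<longlongrightarrow> y) F \<Longrightarrow> ((\<lambda>x. cis (f x)) \<longlongrightarrow> cis y) F"
  by (rule isCont_tendsto_compose[OF has_vector_derivative_continuous[OF has_vector_derivative_cis]])

lemma integrable_bounded_compact_support:
  fixes f :: "'a::euclidean_space \<Rightarrow> 'b::{banach,second_countable_topology}"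
  assumes "f \<in> borel_measurable borel" "compact S" "\<And>x. norm (f x) \<le> B" "\<And>x. x \<notin> S \<Longrightarrow> f x = 0"
  shows "integrable lborel f"
proof (rule Bochner_Integration.integrable_bound)
  show "integrable lborel (\<lambda>x. B * indicator S x)"
    using emeasure_compact_finite[OF assms(2)] assms(2)
    by (intro integrable_mult_right integrable_real_indicator) (auto simp: compact_imp_closed)
  have "0 \<le> B" using order_trans[OF norm_ge_zero assms(3)] .
  then show "AE x in lborel. norm (f x) \<le> norm (B * indicator S x)"
    using assms(3,4) by (intro AE_I2) (auto simp: indicator_def)
qed (use assms(1) in simp)

text \<open>A cutoff to radius \<open>s\<close> in the hyperplane. Its autocorrelation is positive
  definite and, once normalised, tends to 1 as \<open>s\<close> grows.\<close>

definition slab :: "'a::euclidean_space \<Rightarrow> real \<Rightarrow> 'a \<Rightarrow> real" where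
  "slab e s x = indicat_real {x. norm (perp e x) \<le> s} x * tent (x \<bullet> e)"

lemma slab_measurable [measurable]: "slab e s \<in> borel_measurable borel"
  unfolding slab_def[abs_def] by measurable

lemma slab_bounds: "0 \<le> slab e s x" "slab e s x \<le> 1"
  using tent_bounds[of "x \<bullet> e"] by (auto simp: slab_def indicator_def)

lemma abs_slab_le: "\<bar>slab e s x\<bar> \<le> 1"
  using slab_bounds[of e s x] by linarith

lemma slab_eq_0: "x \<notin> cyl e s \<Longrightarrow> slab e s x = 0"
  using tent_bounds(3)[of "x \<bullet> e"] by (auto simp: slab_def cyl_def)

lemma slab_integrable: "e \<in> Basis \<Longrightarrow> integrable lborel (slab e s)"
  by (rule integrable_bounded_compact_support[of _ "cyl e s" 1])
    (use slab_eq_0 in \<open>auto simp: compact_cyl abs_slab_le\<close>)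

lemma integral_slab:
  fixes e :: "'a::euclidean_space"
  assumes e: "e \<in> Basis" and s: "s > 0"
  shows "(\<integral>x. slab e s x \<partial>lborel) = s ^ (DIM('a) - 1) * (\<integral>x. slab e 1 x \<partial>lborel)"
proof -
  have "slab e s (stretch e s x) = slab e 1 x" for x
    using s by (simp add: slab_def perp_stretch[OF e] stretch_inner[OF e] indicator_def)
  then show ?thesis using integral_stretch[OF e s, of "slab e s"] by simp
qed

lemma integral_slab_pos:
  fixes e :: "'a::euclidean_space"
  assumes e: "e \<in> Basis" and s: "s > 0"
  shows "(\<integral>x. slab e s x \<partial>lborel) > 0"
proof -
  have "0 < measure lborel (cball (0::'a) (1/2))" by (simp add: content_cball)
  moreover have "(\<integral>x. 1/2 * indicator (cball (0::'a) (1/2)) x \<partial>lborel) \<le> (\<integral>x. slab e 1 x \<partial>lborel)"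
  proof (rule integral_mono[OF _ slab_integrable[OF e]])
    show "integrable lborel (\<lambda>x::'a. 1/2 * indicator (cball 0 (1/2)) x :: real)"
      by (intro integrable_mult_right integrable_real_indicator) (auto simp: emeasure_cball)
    fix x :: 'a
    show "1/2 * indicator (cball 0 (1/2)) x \<le> slab e 1 x"
      using norm_perp_le[OF e, of x] Basis_le_norm[OF e, of x] slab_bounds(1)[of e 1 x]
      by (auto simp: slab_def indicator_def tent_def)
  qed
  moreover have "(\<integral>x. 1/2 * indicator (cball (0::'a) (1/2)) x \<partial>lborel) = 1/2 * measure lborel (cball (0::'a) (1/2))" by simp
  ultimately have "(\<integral>x. slab e 1 x \<partial>lborel) > 0" by linarith
  then show ?thesis using s by (subst integral_slab[OF assms]) simp
qed

context graph_patch
begin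

text \<open>The phase \<tau> (h (m + u/\<tau>) - h m) tends to u \<bullet> g m, so this is the limit
  of the autocorrelation at displacement u/\<tau>.\<close>

definition lim_corr :: "'a \<Rightarrow> complex" where
  "lim_corr u = (\<integral>m. complex_of_real (bump m * ampl m) * cis (u \<bullet> g m) \<partial>lborel)"

lemma bump_bound: "bump x \<le> bump 0"
  unfolding bump_def by (intro power_mono) (auto simp: perp_0)

text \<open>Since \<open>h\<close> is controlled on the tube only, its phase is first attached to
  amplitudes that vanish near the boundary of the tube and beyond; each such product is continuous
  on the whole space.\<close>

lemma corr_integrand_measurable:
  "(\<lambda>(u, m). complex_of_real (bump (m + u) * ampl m) * cis (\<tau> * (h (m + u) - h m))) \<in> borel_measurable borel"
proof -
  let ?D = "{x. norm (perp e x) < 2 * r}"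
  have cl: "closed {x. norm (perp e x) \<le> r / 3}" by (intro closed_Collect_le continuous_intros)
  have 1: "continuous_on UNIV (\<lambda>x. complex_of_real (bump x) * cis (\<tau> * h x))"
    by (rule continuous_on_zero_extension[OF open_tube[of "2 * r"] cl])
      (use r bump_eq_0 in \<open>auto intro!: continuous_intros bump_cont h_cont\<close>)
  have 2: "continuous_on UNIV (\<lambda>x. complex_of_real (ampl x) * cis (- (\<tau> * h x)))"
    using ampl_cis_cont[of 0 "- \<tau>"] by simp
  have "(\<lambda>(u, m). complex_of_real (bump (m + u) * ampl m) * cis (\<tau> * (h (m + u) - h m))) =
    (\<lambda>z. (complex_of_real (bump (snd z + fst z)) * cis (\<tau> * h (snd z + fst z))) * (complex_of_real (ampl (snd z)) * cis (- (\<tau> * h (snd z)))))"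
  proof
    fix z :: "'a \<times> 'a"
    have "cis (\<tau> * (h (snd z + fst z) - h (snd z))) = cis (\<tau> * h (snd z + fst z)) * cis (- (\<tau> * h (snd z)))"
      by (simp add: cis_mult algebra_simps)
    then show "(case z of (u, m) \<Rightarrow> complex_of_real (bump (m + u) * ampl m) * cis (\<tau> * (h (m + u) - h m))) =
      (complex_of_real (bump (snd z + fst z)) * cis (\<tau> * h (snd z + fst z))) * (complex_of_real (ampl (snd z)) * cis (- (\<tau> * h (snd z))))"
      by (simp add: split_beta)
  qed
  moreover have "continuous_on UNIV (\<lambda>z::'a\<times>'a. (complex_of_real (bump (snd z + fst z)) * cis (\<tau> * h (snd z + fst z))) * (complex_of_real (ampl (snd z)) * cis (- (\<tau> * h (snd z)))))"
    by (intro continuous_on_mult continuous_on_compose2[OF 1] continuous_on_compose2[OF 2]) (auto intro!: continuous_intros)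
  ultimately show ?thesis by (simp add: borel_measurable_continuous_onI)
qed

lemma corr_integrand_measurable':
  "(\<lambda>m. complex_of_real (bump (m + u) * ampl m) * cis (\<tau> * (h (m + u) - h m))) \<in> borel_measurable borel"
  using measurable_compose[OF _ corr_integrand_measurable, of "\<lambda>m. (u, m)" borel]
  by (simp add: borel_prod[symmetric])

lemma corr_measurable: "(\<lambda>u. corr u \<tau>) \<in> borel_measurable borel"
  unfolding corr_def using corr_integrand_measurable[of \<tau>]
  by (intro lborel.borel_measurable_lebesgue_integral) (simp add: borel_prod[symmetric])

lemma lim_corr_integrand_measurable:
  "(\<lambda>(w, m). complex_of_real (bump m * ampl m) * cis (perp e w \<bullet> g m)) \<in> borel_measurable borel"
proof -
  let ?D = "{x. norm (perp e x) < 2 * r}"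
  have [measurable]: "(\<lambda>m. indicator ?D m *\<^sub>R g m) \<in> borel_measurable borel"
    by (intro borel_measurable_continuous_on_indicator g_cont borel_open open_tube)
  have "(\<lambda>(w, m). complex_of_real (bump m * ampl m) * cis (perp e w \<bullet> g m)) =
    (\<lambda>z. complex_of_real (bump (snd z) * ampl (snd z)) * cis (perp e (fst z) \<bullet> (indicator ?D (snd z) *\<^sub>R g (snd z))))"
    (is "?l = ?r")
  proof
    fix z :: "'a \<times> 'a"
    show "?l z = ?r z" using bump_eq_0[of "snd z"] r by (auto simp: split_beta indicator_def)
  qed
  moreover have "?r \<in> borel_measurable (borel \<Otimes>\<^sub>M borel)"
    unfolding cis_conv_exp by measurable
  ultimately show ?thesis by (simp add: borel_prod)
qed

lemma corr_tendsto_lim_corr: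
  assumes u: "u \<bullet> e = 0" and \<tau>: "filterlim \<tau> at_top sequentially" "\<And>n. \<tau> n > 0"
  shows "(\<lambda>n. corr (u /\<^sub>R \<tau> n) (\<tau> n)) \<longlonglongrightarrow> lim_corr u"
  unfolding corr_def lim_corr_def
proof (rule integral_dominated_convergence[where w="\<lambda>m. bump 0 * ampl m"])
  have inv: "(\<lambda>n. inverse (\<tau> n)) \<longlonglongrightarrow> 0" using \<tau>(1) by (rule tendsto_inverse_0_at_top)
  show "integrable lborel (\<lambda>m. bump 0 * ampl m)"
    by (intro integrable_mult_right integrable_compact_support[OF compact_cyl[OF e] ampl_cont ampl_eq_0])
  show "(\<lambda>m. complex_of_real (bump (m + u /\<^sub>R \<tau> n) * ampl m) * cis (\<tau> n * (h (m + u /\<^sub>R \<tau> n) - h m))) \<in> borel_measurable lborel" for n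
    using corr_integrand_measurable' by simp
  show "(\<lambda>m. complex_of_real (bump m * ampl m) * cis (u \<bullet> g m)) \<in> borel_measurable lborel"
    using measurable_compose[OF _ lim_corr_integrand_measurable, of "\<lambda>m. (u, m)" borel]
    by (simp add: borel_prod[symmetric] perp_eq[OF u])
  show "AE m in lborel. norm (complex_of_real (bump (m + u /\<^sub>R \<tau> n) * ampl m) * cis (\<tau> n * (h (m + u /\<^sub>R \<tau> n) - h m))) \<le> bump 0 * ampl m" for n
    using bump_bound bump_nonneg ampl_nonneg by (intro AE_I2) (auto simp: norm_mult intro!: mult_right_mono)
  show "AE m in lborel. (\<lambda>n. complex_of_real (bump (m + u /\<^sub>R \<tau> n) * ampl m) * cis (\<tau> n * (h (m + u /\<^sub>R \<tau> n) - h m)))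
     \<longlonglongrightarrow> complex_of_real (bump m * ampl m) * cis (u \<bullet> g m)"
  proof (rule AE_I2)
    fix m
    show "(\<lambda>n. complex_of_real (bump (m + u /\<^sub>R \<tau> n) * ampl m) * cis (\<tau> n * (h (m + u /\<^sub>R \<tau> n) - h m)))
       \<longlonglongrightarrow> complex_of_real (bump m * ampl m) * cis (u \<bullet> g m)"
    proof (cases "m \<in> cyl e (r / 3)")
      case False
      then show ?thesis by (simp add: ampl_eq_0)
    next
      case True
      then have m: "norm (perp e m) < 2 * r" using cyl_subset_tube by auto
      have "(\<lambda>n. m + inverse (\<tau> n) *\<^sub>R u) \<longlonglongrightarrow> m + 0 *\<^sub>R u" by (intro tendsto_intros inv)
      then have "(\<lambda>n. bump (m + inverse (\<tau> n) *\<^sub>R u)) \<longlonglongrightarrow> bump m"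
        using continuous_on_tendsto_compose[OF bump_cont[of UNIV], of _ m sequentially] by simp
      moreover have "(\<lambda>n. \<tau> n * (h (m + inverse (\<tau> n) *\<^sub>R u) - h m)) \<longlonglongrightarrow> u \<bullet> g m"
      proof -
        have "((\<lambda>s. (h (m + s *\<^sub>R u) - h m) / s) \<longlongrightarrow> u \<bullet> g m) (at 0)"
          using h_deriv[OF u m] by (simp add: DERIV_def)
        moreover have "filterlim (\<lambda>n. inverse (\<tau> n)) (at 0) sequentially"
          unfolding filterlim_at using inv \<tau>(2) by (auto simp: less_imp_neq[symmetric])
        ultimately have "(\<lambda>n. (h (m + inverse (\<tau> n) *\<^sub>R u) - h m) / inverse (\<tau> n)) \<longlonglongrightarrow> u \<bullet> g m"
          by (rule filterlim_compose)
        then show ?thesis by (simp add: divide_inverse mult.commute)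
      qed
      moreover have "(\<lambda>n. cis (x n)) \<longlonglongrightarrow> cis y" if "x \<longlonglongrightarrow> y" for x :: "nat \<Rightarrow> real" and y
        using that by (rule tendsto_cis)
      ultimately show ?thesis by (auto intro!: tendsto_intros)
    qed
  qed
qed

text \<open>The bound on the autocorrelation depends on \<tau> |u| only, and this product remains
  |u| when the displacement is divided by \<tau>; so it passes to the limit.\<close>

lemma lim_corr_bound: "\<exists>C>0. \<forall>u. u \<bullet> e = 0 \<longrightarrow> cmod (lim_corr u) \<le> C / (1 + norm u) ^ DIM('a)"
proof -
  obtain C where C: "C > 0" "\<And>u \<tau>. u \<bullet> e = 0 \<Longrightarrow> 0 < \<tau> \<Longrightarrow> cmod (corr u \<tau>) \<le> C / (1 + \<tau> * norm u) ^ DIM('a)"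
    using corr_bound by blast
  have "cmod (lim_corr u) \<le> C / (1 + norm u) ^ DIM('a)" if u: "u \<bullet> e = 0" for u
  proof (rule tendsto_upperbound)
    show "(\<lambda>n. cmod (corr (u /\<^sub>R real (Suc n)) (real (Suc n)))) \<longlonglongrightarrow> cmod (lim_corr u)"
      by (intro tendsto_norm corr_tendsto_lim_corr u filterlim_compose[OF filterlim_real_sequentially filterlim_Suc]) simp
    show "\<forall>\<^sub>F n in sequentially. cmod (corr (u /\<^sub>R real (Suc n)) (real (Suc n))) \<le> C / (1 + norm u) ^ DIM('a)"
    proof (rule always_eventually, rule allI)
      fix n
      have "real (Suc n) * norm (u /\<^sub>R real (Suc n)) = norm u" by simp
      then show "cmod (corr (u /\<^sub>R real (Suc n)) (real (Suc n))) \<le> C / (1 + norm u) ^ DIM('a)"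
        using C(2)[of "u /\<^sub>R real (Suc n)" "real (Suc n)"] u by (simp only: inner_scaleR_left)
    qed
  qed simp
  with C(1) show ?thesis by blast
qed

lemma lim_corr_measurable: "(\<lambda>w. lim_corr (perp e w)) \<in> borel_measurable borel"
  unfolding lim_corr_def using lim_corr_integrand_measurable
  by (intro lborel.borel_measurable_lebesgue_integral) (simp add: borel_prod[symmetric])

definition lim_total :: complex where
  "lim_total = (\<integral>w. complex_of_real (tent (w \<bullet> e)) * lim_corr (perp e w) \<partial>lborel)"

text \<open>After rescaling the hyperplane by 1/\<tau>, the frequency \<xi> appears only as
  \<xi>/\<tau>, which tends to 0, and the integrable majorant of the upper bound applies again. The
  limit does not depend on the sequence.\<close>

lemma phi_hat_tendsto:
  assumes \<xi>: "\<And>n. \<xi> n \<bullet> e = 0" and \<tau>: "filterlim \<tau> at_top sequentially" "\<And>n. \<tau> n > 0"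
    and lim: "(\<lambda>n. \<xi> n /\<^sub>R \<tau> n) \<longlonglongrightarrow> 0"
  shows "(\<lambda>n. complex_of_real ((cmod (phi_hat (\<xi> n) (\<tau> n)))\<^sup>2 * \<tau> n ^ (DIM('a) - 1))) \<longlonglongrightarrow> lim_total"
proof -
  obtain C where C: "C > 0" "\<And>u \<tau>. u \<bullet> e = 0 \<Longrightarrow> 0 < \<tau> \<Longrightarrow> cmod (corr u \<tau>) \<le> C / (1 + \<tau> * norm u) ^ DIM('a)"
    using corr_bound by blast
  note [measurable] = corr_measurable lim_corr_measurable
  have [measurable]: "cis \<in> borel_measurable borel"
    by (intro borel_measurable_continuous_onI continuous_intros)
  have eq: "complex_of_real ((cmod (phi_hat (\<xi> n) (\<tau> n)))\<^sup>2 * \<tau> n ^ (DIM('a) - 1)) =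
     (\<integral>w. complex_of_real (tent (w \<bullet> e)) * cis ((\<xi> n /\<^sub>R \<tau> n) \<bullet> w) * corr (perp e w /\<^sub>R \<tau> n) (\<tau> n) \<partial>lborel)" for n
  proof -
    let ?f = "\<lambda>v. complex_of_real (tent (v \<bullet> e)) * cis (\<xi> n \<bullet> v) * corr (perp e v) (\<tau> n)"
    have "complex_of_real ((cmod (phi_hat (\<xi> n) (\<tau> n)))\<^sup>2) = (\<integral>v. ?f v \<partial>lborel)" by (rule phi_hat_square[OF \<xi>])
    also have "\<dots> = (1 / \<tau> n) ^ (DIM('a) - 1) *\<^sub>R (\<integral>v. ?f (stretch e (1 / \<tau> n) v) \<partial>lborel)"
      by (rule integral_stretch[OF e]) (use \<tau> in auto)
    also have "(\<lambda>v. ?f (stretch e (1 / \<tau> n) v)) = (\<lambda>w. complex_of_real (tent (w \<bullet> e)) * cis ((\<xi> n /\<^sub>R \<tau> n) \<bullet> w) * corr (perp e w /\<^sub>R \<tau> n) (\<tau> n))"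
    proof
      fix v
      have "\<xi> n \<bullet> stretch e (1 / \<tau> n) v = (\<xi> n /\<^sub>R \<tau> n) \<bullet> v"
        by (simp add: stretch_def inner_add_right \<xi> perp_inner_perp[OF \<xi>] divide_inverse)
      then show "?f (stretch e (1 / \<tau> n) v) = complex_of_real (tent (v \<bullet> e)) * cis ((\<xi> n /\<^sub>R \<tau> n) \<bullet> v) * corr (perp e v /\<^sub>R \<tau> n) (\<tau> n)"
        by (simp add: perp_stretch[OF e] stretch_inner[OF e] divide_inverse)
    qed
    finally show ?thesis using \<tau>(2)[of n] by (simp add: scaleR_conv_of_real power_divide)
  qed
  show ?thesis unfolding eq lim_total_def
  proof (rule integral_dominated_convergence[where w="\<lambda>x. C * (indicator {x. \<bar>x \<bullet> e\<bar> \<le> 1} x / (1 + norm (perp e x)) ^ DIM('a))"])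
    show "integrable lborel (\<lambda>x. C * (indicator {x. \<bar>x \<bullet> e\<bar> \<le> 1} x / (1 + norm (perp e x)) ^ DIM('a)))"
      by (intro integrable_mult_right integrable_cyl_decay e)
    show "AE v in lborel. norm (complex_of_real (tent (v \<bullet> e)) * cis ((\<xi> n /\<^sub>R \<tau> n) \<bullet> v) * corr (perp e v /\<^sub>R \<tau> n) (\<tau> n))
      \<le> C * (indicator {x. \<bar>x \<bullet> e\<bar> \<le> 1} v / (1 + norm (perp e v)) ^ DIM('a))" for n
    proof (rule AE_I2)
      fix v
      have "\<tau> n * norm (perp e v /\<^sub>R \<tau> n) = norm (perp e v)" using \<tau>(2)[of n] by simp
      then have b: "cmod (corr (perp e v /\<^sub>R \<tau> n) (\<tau> n)) \<le> C / (1 + norm (perp e v)) ^ DIM('a)"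
        using C(2)[of "perp e v /\<^sub>R \<tau> n" "\<tau> n"] \<tau>(2)[of n] perp_inner[OF e, of v] by (simp only: inner_scaleR_left)
      have "0 \<le> C / (1 + norm (perp e v)) ^ DIM('a)" using C by simp
      moreover have "tent (v \<bullet> e) * cmod (corr (perp e v /\<^sub>R \<tau> n) (\<tau> n)) \<le> 1 * (C / (1 + norm (perp e v)) ^ DIM('a))"
        using b tent_bounds by (intro mult_mono) auto
      ultimately show "norm (complex_of_real (tent (v \<bullet> e)) * cis ((\<xi> n /\<^sub>R \<tau> n) \<bullet> v) * corr (perp e v /\<^sub>R \<tau> n) (\<tau> n))
      \<le> C * (indicator {x. \<bar>x \<bullet> e\<bar> \<le> 1} v / (1 + norm (perp e v)) ^ DIM('a))"
        using tent_bounds[of "v \<bullet> e"] by (auto simp: norm_mult indicator_def)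
    qed
    show "AE v in lborel. (\<lambda>n. complex_of_real (tent (v \<bullet> e)) * cis ((\<xi> n /\<^sub>R \<tau> n) \<bullet> v) * corr (perp e v /\<^sub>R \<tau> n) (\<tau> n))
       \<longlonglongrightarrow> complex_of_real (tent (v \<bullet> e)) * lim_corr (perp e v)"
    proof (rule AE_I2)
      fix v
      have "(\<lambda>n. (\<xi> n /\<^sub>R \<tau> n) \<bullet> v) \<longlonglongrightarrow> 0 \<bullet> v" by (intro tendsto_intros lim)
      then have "(\<lambda>n. cis ((\<xi> n /\<^sub>R \<tau> n) \<bullet> v)) \<longlonglongrightarrow> cis 0"
        using tendsto_cis by fastforce
      then have "(\<lambda>n. complex_of_real (tent (v \<bullet> e)) * cis ((\<xi> n /\<^sub>R \<tau> n) \<bullet> v) * corr (perp e v /\<^sub>R \<tau> n) (\<tau> n))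
       \<longlonglongrightarrow> complex_of_real (tent (v \<bullet> e)) * cis 0 * lim_corr (perp e v)"
        by (intro tendsto_mult tendsto_const corr_tendsto_lim_corr perp_inner[OF e] \<tau>)
      then show "(\<lambda>n. complex_of_real (tent (v \<bullet> e)) * cis ((\<xi> n /\<^sub>R \<tau> n) \<bullet> v) * corr (perp e v /\<^sub>R \<tau> n) (\<tau> n))
       \<longlonglongrightarrow> complex_of_real (tent (v \<bullet> e)) * lim_corr (perp e v)" by simp
    qed
  qed measurable
qed

end

section \<open>Positivity of the limit and the lower bound\<close>

lemma slab_shift:
  assumes e: "e \<in> Basis"
  shows "slab e s (w + perp e x) = indicat_real {y. norm (perp e y) \<le> s} (w + x) * tent (w \<bullet> e)"
  by (simp add: slab_def perp_add perp_perp[OF e] inner_add_left perp_inner[OF e] indicator_def)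

lemma cis_measurable [measurable]: "cis \<in> borel_measurable borel"
  by (intro borel_measurable_continuous_onI continuous_intros)

text \<open>As for the amplitude, a shift by \<open>perp e x\<close> and an exchange of integrals
  identify the transform of an autocorrelation with a square modulus.\<close>

lemma slab_autocorrelation:
  fixes e v :: "'a::euclidean_space"
  assumes e: "e \<in> Basis" and s: "s > 0"
  shows "(\<integral>w. complex_of_real ((\<integral>x. indicat_real {y. norm (perp e y) \<le> s} (w + x) * slab e s x \<partial>lborel) * tent (w \<bullet> e))
            * cis (perp e w \<bullet> v) \<partial>lborel)
    = complex_of_real ((cmod (\<integral>y. complex_of_real (slab e s y) * cis (perp e y \<bullet> v) \<partial>lborel))\<^sup>2)"
proof -
  let ?f = "\<lambda>w x. complex_of_real (slab e s (w + perp e x) * slab e s x) * cis (perp e w \<bullet> v)"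
  let ?g = "\<lambda>y. complex_of_real (slab e s y) * cis (perp e y \<bullet> v)"
  have gi: "integrable lborel ?g"
    by (rule integrable_bounded_compact_support[of _ "cyl e s" 1])
      (use slab_eq_0 in \<open>auto simp: norm_mult compact_cyl e abs_slab_le\<close>)
  have "(\<integral>w. complex_of_real ((\<integral>x. indicat_real {y. norm (perp e y) \<le> s} (w + x) * slab e s x \<partial>lborel) * tent (w \<bullet> e))
            * cis (perp e w \<bullet> v) \<partial>lborel) = (\<integral>w. (\<integral>x. ?f w x \<partial>lborel) \<partial>lborel)"
  proof (intro Bochner_Integration.integral_cong refl)
    fix w
    have "(\<integral>x. ?f w x \<partial>lborel) = (\<integral>x. complex_of_real (indicat_real {y. norm (perp e y) \<le> s} (w + x) * slab e s x) * (complex_of_real (tent (w \<bullet> e)) * cis (perp e w \<bullet> v)) \<partial>lborel)"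
      by (intro Bochner_Integration.integral_cong refl) (simp add: slab_shift[OF e])
    also have "\<dots> = complex_of_real (\<integral>x. indicat_real {y. norm (perp e y) \<le> s} (w + x) * slab e s x \<partial>lborel) * (complex_of_real (tent (w \<bullet> e)) * cis (perp e w \<bullet> v))"
      by (simp only: integral_mult_left_zero integral_complex_of_real)
    finally show "complex_of_real ((\<integral>x. indicat_real {y. norm (perp e y) \<le> s} (w + x) * slab e s x \<partial>lborel) * tent (w \<bullet> e))
            * cis (perp e w \<bullet> v) = (\<integral>x. ?f w x \<partial>lborel)" by simp
  qed
  also have "\<dots> = (\<integral>x. (\<integral>w. ?f w x \<partial>lborel) \<partial>lborel)"
  proof (rule lborel_pair.Fubini_integral)
    show "integrable (lborel \<Otimes>\<^sub>M lborel) (\<lambda>(x, w). ?f w x)"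
      unfolding lborel_prod
    proof (rule integrable_bounded_compact_support[where B=1 and S="(\<lambda>(x, y). (x, y - perp e x)) ` (cyl e s \<times> cyl e s)"])
      have "(\<lambda>z. ?f (snd z) (fst z)) \<in> borel_measurable (borel \<Otimes>\<^sub>M borel)" by measurable
      then show "(\<lambda>(x, w). ?f w x) \<in> borel_measurable borel" by (simp add: split_beta' borel_prod)
      show "compact ((\<lambda>(x, y). (x, y - perp e x)) ` (cyl e s \<times> cyl e s))"
        unfolding split_def by (intro compact_continuous_image compact_Times compact_cyl e continuous_intros)
      fix z :: "'a \<times> 'a"
      obtain x w where z: "z = (x, w)" by (cases z)
      show "norm (case z of (x, w) \<Rightarrow> ?f w x) \<le> 1"
        using abs_slab_le[of e s x] abs_slab_le[of e s "w + perp e x"]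
        by (simp add: z norm_mult abs_mult mult_le_one)
      assume nz: "z \<notin> (\<lambda>(x, y). (x, y - perp e x)) ` (cyl e s \<times> cyl e s)"
      have "\<not> (x \<in> cyl e s \<and> w + perp e x \<in> cyl e s)"
      proof
        assume "x \<in> cyl e s \<and> w + perp e x \<in> cyl e s"
        then have "(\<lambda>(x, y). (x, y - perp e x)) (x, w + perp e x) \<in> (\<lambda>(x, y). (x, y - perp e x)) ` (cyl e s \<times> cyl e s)"
          by (intro imageI) auto
        with nz z show False by simp
      qed
      then show "(case z of (x, w) \<Rightarrow> ?f w x) = 0" using slab_eq_0[of _ e s] z by auto
    qed
  qed
  also have "\<dots> = (\<integral>x. cnj (?g x) * (\<integral>y. ?g y \<partial>lborel) \<partial>lborel)"
  proof (intro Bochner_Integration.integral_cong refl)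
    fix x
    have "(\<integral>w. ?f w x \<partial>lborel) = (\<integral>w. (\<lambda>y. cnj (?g x) * ?g y) (w + perp e x) \<partial>lborel)"
    proof (intro Bochner_Integration.integral_cong refl)
      fix w
      have "cis (perp e w \<bullet> v) = cis (- (perp e x \<bullet> v)) * cis (perp e (w + perp e x) \<bullet> v)"
        by (simp add: cis_mult perp_add perp_perp[OF e] inner_add_left)
      then show "?f w x = (\<lambda>y. cnj (?g x) * ?g y) (w + perp e x)"
        by (simp add: cis_cnj)
    qed
    also have "\<dots> = (\<integral>y. cnj (?g x) * ?g y \<partial>lborel)" by (rule lborel_integral_translate) measurable
    also have "\<dots> = cnj (?g x) * (\<integral>y. ?g y \<partial>lborel)" by (rule integral_mult_right_zero)
    finally show "(\<integral>w. ?f w x \<partial>lborel) = cnj (?g x) * (\<integral>y. ?g y \<partial>lborel)" .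
  qed
  also have "\<dots> = cnj (\<integral>y. ?g y \<partial>lborel) * (\<integral>y. ?g y \<partial>lborel)"
    by (simp only: integral_mult_left_zero Bochner_Integration.integral_cnj)
  also have "\<dots> = complex_of_real ((cmod (\<integral>y. ?g y \<partial>lborel))\<^sup>2)"
    by (simp only: complex_norm_square mult.commute)
  finally show ?thesis .
qed

context graph_patch
begin

definition slab_ratio :: "real \<Rightarrow> 'a \<Rightarrow> real" where
  "slab_ratio s w = (\<integral>x. indicat_real {y. norm (perp e y) \<le> s} (w + x) * slab e s x \<partial>lborel) / (\<integral>x. slab e s x \<partial>lborel)"

lemma slab_ratio_integrable: "integrable lborel (\<lambda>x. indicat_real {y. norm (perp e y) \<le> s} (w + x) * slab e s x)"
  by (rule integrable_bounded_compact_support[of _ "cyl e s" 1])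
    (use slab_eq_0[of _ e s] in \<open>auto simp: compact_cyl e abs_slab_le indicator_def\<close>)

lemma slab_ratio_measurable [measurable]: "slab_ratio s \<in> borel_measurable borel"
  unfolding slab_ratio_def[abs_def] by measurable

lemma slab_ratio_bounds:
  assumes "s > 0"
  shows "0 \<le> slab_ratio s w" "slab_ratio s w \<le> 1"
proof -
  have "(\<integral>x. indicat_real {y. norm (perp e y) \<le> s} (w + x) * slab e s x \<partial>lborel) \<le> (\<integral>x. slab e s x \<partial>lborel)"
    by (rule integral_mono[OF slab_ratio_integrable slab_integrable[OF e]]) (auto simp: indicator_def slab_bounds)
  then show "slab_ratio s w \<le> 1"
    using integral_slab_pos[OF e assms] by (simp add: slab_ratio_def)
  show "0 \<le> slab_ratio s w" unfolding slab_ratio_def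
    by (intro divide_nonneg_nonneg Bochner_Integration.integral_nonneg) (auto simp: slab_bounds)
qed

lemma slab_ratio_eq_0:
  assumes "norm (perp e w) > 2 * s"
  shows "slab_ratio s w = 0"
proof -
  have "indicat_real {y. norm (perp e y) \<le> s} (w + x) * slab e s x = 0" for x
  proof (cases "norm (perp e x) \<le> s")
    case True
    have "norm (perp e w) \<le> norm (perp e (w + x)) + norm (perp e x)"
      using norm_triangle_ineq4[of "perp e (w + x)" "perp e x"] by (simp add: perp_add)
    with True assms have "\<not> norm (perp e (w + x)) \<le> s" by linarith
    then show ?thesis by simp
  qed (simp add: slab_def)
  then show ?thesis unfolding slab_ratio_def by (simp only:) simp
qed

text \<open>Moving the cutoff by w loses at most a boundary layer of width |perp e w|: the slab of
  radius s - |perp e w| survives, and slab integrals scale like s^(d-1).\<close>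

lemma slab_ratio_tendsto: "(\<lambda>n. slab_ratio (real (Suc n)) w) \<longlonglongrightarrow> 1"
proof -
  let ?k = "DIM('a) - 1" and ?a = "norm (perp e w)"
  have low: "((real (Suc n) - ?a) / real (Suc n)) ^ ?k \<le> slab_ratio (real (Suc n)) w" if n: "real (Suc n) > ?a" for n
  proof -
    let ?s = "real (Suc n)"
    have "(?s - ?a) ^ ?k * (\<integral>x. slab e 1 x \<partial>lborel) = (\<integral>x. slab e (?s - ?a) x \<partial>lborel)"
      using integral_slab[OF e, of "?s - ?a"] n by simp
    also have "\<dots> \<le> (\<integral>x. indicat_real {y. norm (perp e y) \<le> ?s} (w + x) * slab e ?s x \<partial>lborel)"
    proof (rule integral_mono[OF slab_integrable[OF e] slab_ratio_integrable])
      fix x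
      show "slab e (?s - ?a) x \<le> indicat_real {y. norm (perp e y) \<le> ?s} (w + x) * slab e ?s x"
      proof (cases "norm (perp e x) \<le> ?s - ?a")
        case True
        have "norm (perp e (w + x)) \<le> ?a + norm (perp e x)" using norm_triangle_ineq by (simp add: perp_add)
        then have "norm (perp e (w + x)) \<le> ?s" using True by linarith
        moreover have "norm (perp e x) \<le> ?s" using True norm_ge_zero[of "perp e w"] by linarith
        ultimately show ?thesis using True by (simp add: slab_def)
      next
        case False
        then show ?thesis by (simp add: slab_def tent_bounds)
      qed
    qed
    finally have "(?s - ?a) ^ ?k * (\<integral>x. slab e 1 x \<partial>lborel) / (\<integral>x. slab e ?s x \<partial>lborel) \<le> slab_ratio ?s w"
      unfolding slab_ratio_def using integral_slab_pos[OF e, of ?s] by (intro divide_right_mono) auto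
    moreover have "(\<integral>x. slab e ?s x \<partial>lborel) = ?s ^ ?k * (\<integral>x. slab e 1 x \<partial>lborel)"
      by (rule integral_slab[OF e]) simp
    ultimately have "(?s - ?a) ^ ?k * (\<integral>x. slab e 1 x \<partial>lborel) / (?s ^ ?k * (\<integral>x. slab e 1 x \<partial>lborel)) \<le> slab_ratio ?s w"
      by (simp only:)
    then show ?thesis using integral_slab_pos[OF e, of 1] by (simp add: power_divide)
  qed
  show ?thesis
  proof (rule tendsto_sandwich)
    show "\<forall>\<^sub>F n in sequentially. slab_ratio (real (Suc n)) w \<le> 1"
      by (intro always_eventually allI slab_ratio_bounds) simp
    obtain N :: nat where N: "?a < real N" using reals_Archimedean2 by blast
    show "\<forall>\<^sub>F n in sequentially. (1 - ?a * inverse (real (Suc n))) ^ ?k \<le> slab_ratio (real (Suc n)) w"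
      unfolding eventually_sequentially
    proof (intro exI[of _ N] allI impI)
      fix n assume "N \<le> n"
      then have "real (Suc n) > ?a" using N by linarith
      moreover have "(real (Suc n) - ?a) / real (Suc n) = 1 - ?a * inverse (real (Suc n))"
        by (simp only: diff_divide_distrib) (simp add: divide_inverse)
      ultimately show "(1 - ?a * inverse (real (Suc n))) ^ ?k \<le> slab_ratio (real (Suc n)) w" using low[of n] by simp
    qed
    have "(\<lambda>n. (1 - ?a * inverse (real (Suc n))) ^ ?k) \<longlonglongrightarrow> (1 - ?a * 0) ^ ?k"
      by (intro tendsto_intros LIMSEQ_inverse_real_of_nat)
    then show "(\<lambda>n. (1 - ?a * inverse (real (Suc n))) ^ ?k) \<longlonglongrightarrow> 1" by simp
  qed simp
qed

lemma lim_total_approx: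
  "(\<lambda>n. \<integral>w. complex_of_real (slab_ratio (real (Suc n)) w * tent (w \<bullet> e)) * lim_corr (perp e w) \<partial>lborel) \<longlonglongrightarrow> lim_total"
proof -
  obtain C where C: "C > 0" "\<And>u. u \<bullet> e = 0 \<Longrightarrow> cmod (lim_corr u) \<le> C / (1 + norm u) ^ DIM('a)"
    using lim_corr_bound by blast
  note [measurable] = lim_corr_measurable
  show ?thesis unfolding lim_total_def
  proof (rule integral_dominated_convergence[where w="\<lambda>x. C * (indicator {x. \<bar>x \<bullet> e\<bar> \<le> 1} x / (1 + norm (perp e x)) ^ DIM('a))"])
    show "integrable lborel (\<lambda>x. C * (indicator {x. \<bar>x \<bullet> e\<bar> \<le> 1} x / (1 + norm (perp e x)) ^ DIM('a)))"
      by (intro integrable_mult_right integrable_cyl_decay e)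
    show "AE w in lborel. norm (complex_of_real (slab_ratio (real (Suc n)) w * tent (w \<bullet> e)) * lim_corr (perp e w))
      \<le> C * (indicator {x. \<bar>x \<bullet> e\<bar> \<le> 1} w / (1 + norm (perp e w)) ^ DIM('a))" for n
    proof (rule AE_I2)
      fix w
      have \<rho>: "0 \<le> slab_ratio (real (Suc n)) w" "slab_ratio (real (Suc n)) w \<le> 1"
        by (rule slab_ratio_bounds, simp)+
      have "slab_ratio (real (Suc n)) w * tent (w \<bullet> e) \<le> 1 * 1" using \<rho> tent_bounds by (intro mult_mono) auto
      then have "(slab_ratio (real (Suc n)) w * tent (w \<bullet> e)) * cmod (lim_corr (perp e w)) \<le> 1 * (C / (1 + norm (perp e w)) ^ DIM('a))"
        using C(2)[OF perp_inner[OF e]] by (intro mult_mono) auto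
      moreover have "0 \<le> C / (1 + norm (perp e w)) ^ DIM('a)" using C by simp
      ultimately show "norm (complex_of_real (slab_ratio (real (Suc n)) w * tent (w \<bullet> e)) * lim_corr (perp e w))
      \<le> C * (indicator {x. \<bar>x \<bullet> e\<bar> \<le> 1} w / (1 + norm (perp e w)) ^ DIM('a))"
        using tent_bounds[of "w \<bullet> e"] \<rho> by (auto simp: norm_mult indicator_def)
    qed
    show "AE w in lborel. (\<lambda>n. complex_of_real (slab_ratio (real (Suc n)) w * tent (w \<bullet> e)) * lim_corr (perp e w))
       \<longlonglongrightarrow> complex_of_real (tent (w \<bullet> e)) * lim_corr (perp e w)"
    proof (rule AE_I2)
      fix w
      have "(\<lambda>n. complex_of_real (slab_ratio (real (Suc n)) w * tent (w \<bullet> e)) * lim_corr (perp e w))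
         \<longlonglongrightarrow> complex_of_real (1 * tent (w \<bullet> e)) * lim_corr (perp e w)"
        by (intro tendsto_intros slab_ratio_tendsto)
      then show "(\<lambda>n. complex_of_real (slab_ratio (real (Suc n)) w * tent (w \<bullet> e)) * lim_corr (perp e w))
       \<longlonglongrightarrow> complex_of_real (tent (w \<bullet> e)) * lim_corr (perp e w)" by simp
    qed
  qed measurable
qed

definition g0 :: "'a \<Rightarrow> 'a" where "g0 m = indicator {x. norm (perp e x) < 2 * r} m *\<^sub>R g m"

lemma g0_measurable [measurable]: "g0 \<in> borel_measurable borel"
  unfolding g0_def[abs_def]
  by (intro borel_measurable_continuous_on_indicator g_cont borel_open open_tube)

lemma lim_corr_g0: "lim_corr u = (\<integral>m. complex_of_real (bump m * ampl m) * cis (u \<bullet> g0 m) \<partial>lborel)"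
  unfolding lim_corr_def
proof (intro Bochner_Integration.integral_cong refl)
  fix m
  show "complex_of_real (bump m * ampl m) * cis (u \<bullet> g m) = complex_of_real (bump m * ampl m) * cis (u \<bullet> g0 m)"
    using bump_eq_0[of m] r by (auto simp: g0_def indicator_def)
qed

text \<open>
  Positivity of the limit without evaluating it: an average against the positive definite \<open>slab_ratio\<close> is an
  integral of squared moduli.
\<close>

lemma slab_average_eq:
  assumes s: "s > 0"
  shows "(\<integral>w. complex_of_real (slab_ratio s w * tent (w \<bullet> e)) * lim_corr (perp e w) \<partial>lborel) =
    complex_of_real ((\<integral>m. bump m * ampl m * (cmod (\<integral>y. complex_of_real (slab e s y) * cis (perp e y \<bullet> g0 m) \<partial>lborel))\<^sup>2 \<partial>lborel) / (\<integral>x. slab e s x \<partial>lborel))"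
proof -
  let ?f = "\<lambda>w m. complex_of_real (slab_ratio s w * tent (w \<bullet> e)) * (complex_of_real (bump m * ampl m) * cis (perp e w \<bullet> g0 m))"
  let ?b = "\<integral>x. slab e s x \<partial>lborel"
  have "(\<integral>w. complex_of_real (slab_ratio s w * tent (w \<bullet> e)) * lim_corr (perp e w) \<partial>lborel) = (\<integral>w. (\<integral>m. ?f w m \<partial>lborel) \<partial>lborel)"
    unfolding lim_corr_g0 by (intro Bochner_Integration.integral_cong refl) (simp only: integral_mult_right_zero)
  also have "\<dots> = (\<integral>m. (\<integral>w. ?f w m \<partial>lborel) \<partial>lborel)"
  proof (rule lborel_pair.Fubini_integral)
    show "integrable (lborel \<Otimes>\<^sub>M lborel) (\<lambda>(m, w). ?f w m)"
      unfolding lborel_prod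
    proof (rule integrable_bounded_compact_support[where B="bump 0 * bump 0" and S="cyl e (r / 3) \<times> cyl e (2 * s)"])
      have "(\<lambda>z. ?f (snd z) (fst z)) \<in> borel_measurable (borel \<Otimes>\<^sub>M borel)" by measurable
      then show "(\<lambda>(m, w). ?f w m) \<in> borel_measurable borel" by (simp add: split_beta' borel_prod)
      show "compact (cyl e (r / 3) \<times> cyl e (2 * s))" by (intro compact_Times compact_cyl e)
      fix z :: "'a \<times> 'a"
      obtain m w where z: "z = (m, w)" by (cases z)
      have "ampl m \<le> bump 0 * 1" unfolding ampl_def
        by (intro mult_mono bump_bound tent_bounds bump_nonneg)
      then have "bump m * ampl m \<le> bump 0 * bump 0"
        by (intro mult_mono bump_bound bump_nonneg ampl_nonneg) auto
      moreover have "slab_ratio s w * tent (w \<bullet> e) \<le> 1"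
        using slab_ratio_bounds[OF s, of w] tent_bounds[of "w \<bullet> e"] by (intro mult_le_one) auto
      ultimately have "(slab_ratio s w * tent (w \<bullet> e)) * (bump m * ampl m) \<le> 1 * (bump 0 * bump 0)"
        by (intro mult_mono[of "slab_ratio s w * tent (w \<bullet> e)"]) (auto simp: bump_nonneg ampl_nonneg)
      then show "norm (case z of (m, w) \<Rightarrow> ?f w m) \<le> bump 0 * bump 0"
        using slab_ratio_bounds[OF s, of w] tent_bounds[of "w \<bullet> e"] bump_nonneg ampl_nonneg
        by (simp add: z norm_mult abs_mult)
      assume "z \<notin> cyl e (r / 3) \<times> cyl e (2 * s)"
      then have "m \<notin> cyl e (r / 3) \<or> norm (perp e w) > 2 * s \<or> \<bar>w \<bullet> e\<bar> > 1" using z by (auto simp: cyl_def)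
      then show "(case z of (m, w) \<Rightarrow> ?f w m) = 0"
        using ampl_eq_0[of m] slab_ratio_eq_0[of s w] tent_bounds(3)[of "w \<bullet> e"] z by auto
    qed
  qed
  also have "\<dots> = (\<integral>m. complex_of_real (bump m * ampl m * (cmod (\<integral>y. complex_of_real (slab e s y) * cis (perp e y \<bullet> g0 m) \<partial>lborel))\<^sup>2 / ?b) \<partial>lborel)"
  proof (intro Bochner_Integration.integral_cong refl)
    fix m
    have "(\<integral>w. ?f w m \<partial>lborel) = (\<integral>w. complex_of_real (bump m * ampl m / ?b) * (complex_of_real ((\<integral>x. indicat_real {y. norm (perp e y) \<le> s} (w + x) * slab e s x \<partial>lborel) * tent (w \<bullet> e)) * cis (perp e w \<bullet> g0 m)) \<partial>lborel)"
      by (intro Bochner_Integration.integral_cong refl) (simp add: slab_ratio_def)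
    also have "\<dots> = complex_of_real (bump m * ampl m / ?b) * complex_of_real ((cmod (\<integral>y. complex_of_real (slab e s y) * cis (perp e y \<bullet> g0 m) \<partial>lborel))\<^sup>2)"
      by (simp only: integral_mult_right_zero slab_autocorrelation[OF e s])
    finally show "(\<integral>w. ?f w m \<partial>lborel) = complex_of_real (bump m * ampl m * (cmod (\<integral>y. complex_of_real (slab e s y) * cis (perp e y \<bullet> g0 m) \<partial>lborel))\<^sup>2 / ?b)"
      by simp
  qed
  also have "\<dots> = complex_of_real ((\<integral>m. bump m * ampl m * (cmod (\<integral>y. complex_of_real (slab e s y) * cis (perp e y \<bullet> g0 m) \<partial>lborel))\<^sup>2 \<partial>lborel) / ?b)"
    by (simp only: integral_complex_of_real integral_divide_zero)
  finally show ?thesis .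
qed

text \<open>At radius s the average is 1/b times an integral of |Z(m)|^2, with b of order s^(d-1).
  Where |perp e m| \<le> \<epsilon>/s, the Lipschitz bound on the gradient keeps the phase below 1,
  so |Z| \<ge> b/2. That region has measure of order s^(-(d-1)), so the powers of s cancel and
  \<open>c0\<close> survives the limit.\<close>

lemma lim_total_pos: "0 < Re lim_total"
proof -
  let ?k = "DIM('a) - 1" and ?N = "DIM('a) + 2"
  \<comment> \<open>r / 6 is half the radius of the bump, which is bounded below there; the other
    term makes |M| \<epsilon> at most 1.\<close>
  define \<epsilon> where "\<epsilon> = min (r / 6) (1 / (\<bar>M\<bar> + 1))"
  have \<epsilon>: "0 < \<epsilon>" "\<epsilon> \<le> r / 6" "\<bar>M\<bar> * \<epsilon> \<le> 1"
  proof -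
    show "0 < \<epsilon>" "\<epsilon> \<le> r / 6" using r by (auto simp: \<epsilon>_def intro!: divide_pos_pos add_nonneg_pos)
    have "\<bar>M\<bar> * \<epsilon> \<le> \<bar>M\<bar> * (1 / (\<bar>M\<bar> + 1))" unfolding \<epsilon>_def by (intro mult_left_mono) auto
    also have "\<dots> \<le> 1" by (simp add: divide_le_eq)
    finally show "\<bar>M\<bar> * \<epsilon> \<le> 1" .
  qed
  define \<kappa> where "\<kappa> = ((r / 3)\<^sup>2 - (r / 6)\<^sup>2) ^ ?N"
  have rr: "(r / 6)\<^sup>2 < (r / 3)\<^sup>2" using r by (intro power_strict_mono) auto
  then have \<kappa>: "\<kappa> > 0" by (simp add: \<kappa>_def)
  have bk: "\<kappa> \<le> bump m" if "norm (perp e m) \<le> r / 6" for m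
  proof -
    have "(norm (perp e m))\<^sup>2 \<le> (r / 6)\<^sup>2" using that by (intro power_mono) auto
    then show ?thesis unfolding \<kappa>_def bump_def using rr by (intro power_mono) auto
  qed
  let ?b1 = "\<integral>x. slab e 1 x \<partial>lborel"
  have b1: "?b1 > 0" using integral_slab_pos[OF e] by simp
  define c0 where "c0 = \<kappa>\<^sup>2 / 4 * \<epsilon> ^ ?k * ?b1\<^sup>2"
  have c0: "c0 > 0" using \<kappa> \<epsilon> b1 by (simp add: c0_def)
  have "c0 \<le> Re (\<integral>w. complex_of_real (slab_ratio s w * tent (w \<bullet> e)) * lim_corr (perp e w) \<partial>lborel)" if s: "s \<ge> 1" for s
  proof -
    have s0: "s > 0" using s by simp
    let ?b = "\<integral>x. slab e s x \<partial>lborel"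
    let ?Z = "\<lambda>m. \<integral>y. complex_of_real (slab e s y) * cis (perp e y \<bullet> g0 m) \<partial>lborel"
    have b: "?b > 0" by (rule integral_slab_pos[OF e s0])
    have gi: "integrable lborel (\<lambda>y. complex_of_real (slab e s y) * cis (perp e y \<bullet> v))" for v
      by (rule integrable_bounded_compact_support[of _ "cyl e s" 1])
        (use slab_eq_0[of _ e s] in \<open>auto simp: norm_mult compact_cyl e abs_slab_le\<close>)
    have Zle: "cmod (?Z m) \<le> ?b" for m
    proof -
      have "cmod (?Z m) \<le> (\<integral>y. cmod (complex_of_real (slab e s y) * cis (perp e y \<bullet> g0 m)) \<partial>lborel)" by (rule integral_norm_bound)
      also have "\<dots> = ?b" by (simp add: norm_mult slab_bounds)
      finally show ?thesis .
    qed
    have Z: "?b / 2 \<le> cmod (?Z m)" if m: "norm (perp e m) \<le> \<epsilon> / s" for m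
    proof -
      have "\<epsilon> / s \<le> \<epsilon>" using s \<epsilon> by (simp add: divide_le_eq)
      then have "norm (perp e m) < 2 * r" using m \<epsilon> r by linarith
      then have "norm (g m) \<le> M * norm (perp e m)" by (rule g_lip)
      also have "\<dots> \<le> \<bar>M\<bar> * (\<epsilon> / s)" using m by (intro mult_mono) auto
      also have "\<dots> \<le> 1 / s" using \<epsilon> s0 by (simp add: divide_right_mono)
      finally have g: "norm (g0 m) \<le> 1 / s" using s0 by (simp add: g0_def indicator_def)
      have "(\<integral>y. slab e s y / 2 \<partial>lborel) \<le> (\<integral>y. Re (complex_of_real (slab e s y) * cis (perp e y \<bullet> g0 m)) \<partial>lborel)"
      proof (rule integral_mono)
        show "integrable lborel (\<lambda>y. slab e s y / 2)" using slab_integrable[OF e] by simp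
        show "integrable lborel (\<lambda>y. Re (complex_of_real (slab e s y) * cis (perp e y \<bullet> g0 m)))" using gi by (rule integrable_Re)
        fix y
        show "slab e s y / 2 \<le> Re (complex_of_real (slab e s y) * cis (perp e y \<bullet> g0 m))"
        proof (cases "norm (perp e y) \<le> s")
          case True
          have "\<bar>perp e y \<bullet> g0 m\<bar> \<le> norm (perp e y) * norm (g0 m)" by (rule Cauchy_Schwarz_ineq2)
          also have "\<dots> \<le> s * (1 / s)" using True g s0 by (intro mult_mono) auto
          finally have "\<bar>perp e y \<bullet> g0 m\<bar> \<le> 1" using s0 by simp
          from mult_left_mono[OF cos_ge_half[OF this] slab_bounds(1)[of e s y]] show ?thesis by simp
        qed (simp add: slab_def)
      qed
      also have "\<dots> = Re (?Z m)" by (rule integral_Re[OF gi])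
      also have "\<dots> \<le> cmod (?Z m)" by (rule complex_Re_le_cmod)
      finally show ?thesis by simp
    qed
    have Zm: "(\<lambda>m. ?Z m) \<in> borel_measurable borel" by measurable
    have "(\<kappa>\<^sup>2 * ?b\<^sup>2 / 4) * (\<integral>m. slab e (\<epsilon> / s) m \<partial>lborel) = (\<integral>m. (\<kappa>\<^sup>2 * ?b\<^sup>2 / 4) * slab e (\<epsilon> / s) m \<partial>lborel)" by simp
    also have "\<dots> \<le> (\<integral>m. bump m * ampl m * (cmod (?Z m))\<^sup>2 \<partial>lborel)"
    proof (rule integral_mono)
      show "integrable lborel (\<lambda>m. (\<kappa>\<^sup>2 * ?b\<^sup>2 / 4) * slab e (\<epsilon> / s) m)"
        by (intro integrable_mult_right slab_integrable[OF e])
      show "integrable lborel (\<lambda>m. bump m * ampl m * (cmod (?Z m))\<^sup>2)"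
      proof (rule integrable_bounded_compact_support[where B="bump 0 * bump 0 * ?b\<^sup>2" and S="cyl e (r/3)"])
        show "(\<lambda>m. bump m * ampl m * (cmod (?Z m))\<^sup>2) \<in> borel_measurable borel" using Zm by measurable
        show "compact (cyl e (r / 3))" by (rule compact_cyl[OF e])
        fix m
        have "ampl m \<le> bump 0 * 1" unfolding ampl_def by (intro mult_mono bump_bound tent_bounds bump_nonneg)
        then have "bump m * ampl m * (cmod (?Z m))\<^sup>2 \<le> bump 0 * bump 0 * ?b\<^sup>2"
          by (intro mult_mono bump_bound bump_nonneg ampl_nonneg power_mono Zle mult_nonneg_nonneg) auto
        then show "norm (bump m * ampl m * (cmod (?Z m))\<^sup>2) \<le> bump 0 * bump 0 * ?b\<^sup>2"
          using bump_nonneg ampl_nonneg by (simp add: abs_mult)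
        show "bump m * ampl m * (cmod (?Z m))\<^sup>2 = 0" if "m \<notin> cyl e (r / 3)" using ampl_eq_0[OF that] by simp
      qed
      fix m
      show "(\<kappa>\<^sup>2 * ?b\<^sup>2 / 4) * slab e (\<epsilon> / s) m \<le> bump m * ampl m * (cmod (?Z m))\<^sup>2"
      proof (cases "norm (perp e m) \<le> \<epsilon> / s")
        case True
        have "\<epsilon> / s \<le> \<epsilon>" using s \<epsilon> by (simp add: divide_le_eq)
        then have bm: "\<kappa> \<le> bump m" using True \<epsilon> by (intro bk) linarith
        have "(?b / 2)\<^sup>2 \<le> (cmod (?Z m))\<^sup>2" using Z[OF True] b by (intro power_mono) auto
        moreover have "\<kappa>\<^sup>2 \<le> bump m * bump m" unfolding power2_eq_square using bm \<kappa> by (intro mult_mono) auto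
        ultimately have "\<kappa>\<^sup>2 * tent (m \<bullet> e) * (?b / 2)\<^sup>2 \<le> bump m * bump m * tent (m \<bullet> e) * (cmod (?Z m))\<^sup>2"
          using tent_bounds[of "m \<bullet> e"] bump_nonneg by (intro mult_mono) auto
        then show ?thesis using True by (simp add: slab_def ampl_def power_divide mult_ac)
      next
        case False
        then show ?thesis using bump_nonneg ampl_nonneg by (simp add: slab_def)
      qed
    qed
    finally have "(\<kappa>\<^sup>2 * ?b\<^sup>2 / 4) * (\<integral>m. slab e (\<epsilon> / s) m \<partial>lborel) / ?b \<le> (\<integral>m. bump m * ampl m * (cmod (?Z m))\<^sup>2 \<partial>lborel) / ?b"
      using b by (intro divide_right_mono) auto
    also have "\<dots> = Re (\<integral>w. complex_of_real (slab_ratio s w * tent (w \<bullet> e)) * lim_corr (perp e w) \<partial>lborel)"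
      unfolding slab_average_eq[OF s0] by (simp only: Re_complex_of_real)
    also have "(\<kappa>\<^sup>2 * ?b\<^sup>2 / 4) * (\<integral>m. slab e (\<epsilon> / s) m \<partial>lborel) / ?b = c0"
    proof -
      have "(\<integral>m. slab e (\<epsilon> / s) m \<partial>lborel) = (\<epsilon> / s) ^ ?k * ?b1" by (rule integral_slab[OF e]) (use \<epsilon> s0 in simp)
      moreover have "?b = s ^ ?k * ?b1" by (rule integral_slab[OF e s0])
      ultimately show ?thesis using b1 s0 by (simp add: c0_def power_divide power2_eq_square)
    qed
    finally show ?thesis .
  qed
  then have "\<forall>\<^sub>F n in sequentially. c0 \<le> Re (\<integral>w. complex_of_real (slab_ratio (real (Suc n)) w * tent (w \<bullet> e)) * lim_corr (perp e w) \<partial>lborel)"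
    by (intro always_eventually allI) simp
  then have "c0 \<le> Re lim_total"
    by (rule tendsto_lowerbound[OF tendsto_Re[OF lim_total_approx]]) simp
  with c0 show ?thesis by simp
qed

text \<open>By contradiction: failure for c0 = Re lim_total / 2, \<rho> = 1/(n+1) and T0 = n+1, for
  every n, gives a sequence with \<tau> \<rightarrow> \<infinity> and \<xi>/\<tau> \<rightarrow> 0,
  along which the limit is known and larger than c0.\<close>

lemma phi_hat_lower:
  "\<exists>c0>0. \<exists>\<rho>>0. \<exists>T0>0. \<forall>\<xi> \<tau>. \<xi> \<bullet> e = 0 \<longrightarrow> T0 \<le> \<tau> \<longrightarrow> norm \<xi> \<le> \<rho> * \<tau> \<longrightarrow>
     c0 \<le> (cmod (phi_hat \<xi> \<tau>))\<^sup>2 * \<tau> ^ (DIM('a) - 1)"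
proof (rule ccontr)
  assume neg: "\<not> ?thesis"
  let ?c = "Re lim_total / 2"
  have "\<exists>\<xi> \<tau>. \<xi> \<bullet> e = 0 \<and> real (Suc n) \<le> \<tau> \<and> norm \<xi> \<le> inverse (real (Suc n)) * \<tau> \<and>
     (cmod (phi_hat \<xi> \<tau>))\<^sup>2 * \<tau> ^ (DIM('a) - 1) < ?c" for n
  proof -
    have "0 < ?c" "0 < inverse (real (Suc n))" "0 < real (Suc n)" using lim_total_pos by auto
    with neg show ?thesis by (meson not_le)
  qed
  then obtain \<xi> \<tau> where *: "\<And>n. \<xi> n \<bullet> e = 0" "\<And>n. real (Suc n) \<le> \<tau> n" "\<And>n. norm (\<xi> n) \<le> inverse (real (Suc n)) * \<tau> n"
     "\<And>n. (cmod (phi_hat (\<xi> n) (\<tau> n)))\<^sup>2 * \<tau> n ^ (DIM('a) - 1) < ?c" by metis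
  have \<tau>0: "\<tau> n > 0" for n using *(2)[of n] by linarith
  have "filterlim (\<lambda>n. real (Suc n)) at_top sequentially"
    by (intro filterlim_compose[OF filterlim_real_sequentially filterlim_Suc])
  then have \<tau>: "filterlim \<tau> at_top sequentially"
    by (rule filterlim_at_top_mono) (use *(2) in auto)
  have "(\<lambda>n. \<xi> n /\<^sub>R \<tau> n) \<longlonglongrightarrow> 0"
  proof (rule Lim_null_comparison[OF _ LIMSEQ_inverse_real_of_nat])
    have "norm (\<xi> n /\<^sub>R \<tau> n) \<le> inverse (real (Suc n))" for n
      using *(3)[of n] \<tau>0[of n] by (simp add: divide_inverse_commute[symmetric] divide_le_eq)
    then show "\<forall>\<^sub>F n in sequentially. norm (\<xi> n /\<^sub>R \<tau> n) \<le> inverse (real (Suc n))" by simp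
  qed
  from tendsto_Re[OF phi_hat_tendsto[OF *(1) \<tau> \<tau>0 this]]
  have "(\<lambda>n. (cmod (phi_hat (\<xi> n) (\<tau> n)))\<^sup>2 * \<tau> n ^ (DIM('a) - 1)) \<longlonglongrightarrow> Re lim_total" by simp
  then have "Re lim_total \<le> ?c"
    by (rule tendsto_upperbound) (use *(4) in \<open>auto intro!: always_eventually less_imp_le\<close>)
  with lim_total_pos show False by simp
qed

end

text \<open>The value s = 0 is included because covering sets may have diameter 0. There d \<ge> 2
  makes the right-hand side vanish, and \<open>cyl e 0\<close> lies in cylinders of arbitrarily
  small volume.\<close>

lemma emeasure_cyl_le:
  fixes e :: "'a::euclidean_space"
  assumes e: "e \<in> Basis" and s: "s \<ge> 0" and d: "DIM('a) \<ge> 2"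
  shows "emeasure lborel (cyl e s) \<le> ennreal (s ^ (DIM('a) - 1) * measure lborel (cyl e 1))"
proof (cases "s = 0")
  case False
  then show ?thesis using s measure_cyl[OF e, of s] by (simp add: emeasure_cyl_eq[OF e])
next
  case True
  let ?V = "measure lborel (cyl e 1)"
  have V: "?V > 0" by (rule measure_cyl_pos[OF e])
  have "emeasure lborel (cyl e 0) \<le> 0"
  proof (rule ennreal_le_epsilon)
    fix \<epsilon> :: real assume \<epsilon>: "0 < \<epsilon>"
    define t where "t = min 1 (\<epsilon> / ?V)"
    have t: "0 < t" "t \<le> 1" "t * ?V \<le> \<epsilon>" using \<epsilon> V by (auto simp: t_def min_def field_simps)
    have "t ^ (DIM('a) - 1) \<le> t ^ 1" using t d by (intro power_decreasing) auto
    then have "t ^ (DIM('a) - 1) * ?V \<le> \<epsilon>" 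
    proof -
      have "t ^ (DIM('a) - 1) * ?V \<le> t ^ 1 * ?V"
        by (rule mult_right_mono) (use \<open>t ^ (DIM('a) - 1) \<le> t ^ 1\<close> V in auto)
      then show ?thesis using t(3) by (simp only: power_one_right)
    qed
    have "emeasure lborel (cyl e 0) \<le> emeasure lborel (cyl e t)"
      using t by (intro emeasure_mono) (auto simp: cyl_def)
    also have "\<dots> \<le> ennreal \<epsilon>"
      unfolding emeasure_cyl_eq[OF e] measure_cyl[OF e t(1)] by (rule ennreal_leI) fact
    finally show "emeasure lborel (cyl e 0) \<le> 0 + ennreal \<epsilon>" by simp
  qed
  then show ?thesis using True by simp
qed

lemma emeasure_lborel_translate_vimage:
  fixes A :: "'a::euclidean_space set"
  assumes "A \<in> sets borel"
  shows "emeasure lborel {x. x - a \<in> A} = emeasure lborel A"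
proof -
  have "emeasure lborel A = emeasure (distr lborel borel ((+) (- a))) A" by (simp add: lborel_distr_plus)
  also have "\<dots> = emeasure lborel ((+) (- a) -` A \<inter> space lborel)" using assms by (intro emeasure_distr) auto
  also have "(+) (- a) -` A \<inter> space lborel = {x. x - a \<in> A}" by auto
  finally show ?thesis by simp
qed

section \<open>The image of Lebesgue measure on a graph\<close>

text \<open>\<open>Q\<close> rotates the axis \<open>e\<close>, a standard basis vector, to the
  direction under study. The graph itself stays in standard position, where volumes are computed in
  coordinates.\<close>

locale surface_patch = graph_patch e h g r c M
  for e :: "real^'n" and h g r c M +
  fixes K :: "(real^'n) set" and p :: "real^'n" and Q :: "real^'n \<Rightarrow> real^'n"
  assumes dim2: "CARD('n) \<ge> 2" and Q: "orthogonal_transformation Q"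
    and in_frontier: "\<And>u. norm (perp e u) < 2 * r \<Longrightarrow> p + Q (perp e u + h u *\<^sub>R e) \<in> frontier K"
begin

definition \<Gamma> :: "real^'n \<Rightarrow> real^'n" where "\<Gamma> u = p + Q (perp e u + h u *\<^sub>R e)"

definition patch :: "(real^'n) set" where "patch = \<Gamma> ` cyl e (r / 3)"

lemma linear_Q: "linear Q"
  using Q by (simp add: orthogonal_transformation_def)

lemma norm_Q: "norm (Q x) = norm x"
  using Q by (simp add: orthogonal_transformation_norm)

section \<open>Lipschitz bounds for the parametrisation\<close>

lemma Gamma_diff: "norm (\<Gamma> u - \<Gamma> u') = norm (perp e (u - u') + (h u - h u') *\<^sub>R e)"
proof -
  have "\<Gamma> u - \<Gamma> u' = Q (perp e (u - u') + (h u - h u') *\<^sub>R e)"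
    unfolding \<Gamma>_def by (simp add: linear_diff[OF linear_Q, symmetric] perp_diff algebra_simps)
  then show ?thesis by (simp add: norm_Q)
qed

lemma Gamma_expanding: "norm (perp e (u - u')) \<le> norm (\<Gamma> u - \<Gamma> u')"
proof -
  have "perp e (perp e (u - u') + (h u - h u') *\<^sub>R e) = perp e (u - u')"
    by (simp add: perp_add perp_scaleR perp_perp[OF e] perp_axis[OF e])
  then show ?thesis unfolding Gamma_diff using norm_perp_le[OF e] by metis
qed

text \<open>The mean value theorem on the segment joining the two projections, which stays in the
  tube by convexity; there the gradient has norm at most |M| times 2 r.\<close>

lemma h_lipschitz:
  assumes u: "norm (perp e u) < 2 * r" and u': "norm (perp e u') < 2 * r"
  shows "\<bar>h u' - h u\<bar> \<le> \<bar>M\<bar> * (2 * r) * norm (perp e (u' - u))"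
proof (cases "perp e u = perp e u'")
  case True
  then have "h u = h u'" using h_perp by metis
  then show ?thesis using r by simp
next
  case False
  define t where "t = norm (perp e (u' - u))"
  define w where "w = perp e (u' - u) /\<^sub>R t"
  have t: "t > 0" using False by (simp add: t_def perp_diff)
  have w: "norm w = 1" "w \<bullet> e = 0" using t perp_inner[OF e] by (auto simp: w_def t_def)
  have pw: "perp e u + a *\<^sub>R w = (1 - a / t) *\<^sub>R perp e u + (a / t) *\<^sub>R perp e u'" for a
    using t by (simp add: w_def perp_diff algebra_simps divide_inverse)
  have seg: "norm (perp e (perp e u + a *\<^sub>R w)) < 2 * r" if a: "0 \<le> a" "a \<le> t" for a
  proof -
    have at: "0 \<le> a / t" "a / t \<le> 1" using a t by auto
    have "norm (perp e (perp e u + a *\<^sub>R w)) = norm ((1 - a / t) *\<^sub>R perp e u + (a / t) *\<^sub>R perp e u')"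
      unfolding pw by (simp add: perp_add perp_scaleR perp_perp[OF e])
    also have "\<dots> \<le> (1 - a / t) * norm (perp e u) + (a / t) * norm (perp e u')"
      using norm_triangle_ineq[of "(1 - a / t) *\<^sub>R perp e u" "(a / t) *\<^sub>R perp e u'"] at a t by (simp add: abs_of_nonneg)
    also have "\<dots> < 2 * r" using convex_bound_lt[OF u u', of "1 - a / t" "a / t"] at by simp
    finally show ?thesis .
  qed
  obtain a where a: "0 < a" "a < t" "h (perp e u + t *\<^sub>R w) - h (perp e u) = t * (w \<bullet> g (perp e u + a *\<^sub>R w))"
    by (rule line_mvt[OF t, of h "perp e u" w "\<lambda>x. w \<bullet> g x"]) (use h_deriv[OF w(2) seg] in auto)
  have "perp e u + t *\<^sub>R w = perp e u'" using pw[of t] t by simp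
  then have "h u' - h u = t * (w \<bullet> g (perp e u + a *\<^sub>R w))" using a(3) h_perp by metis
  moreover have "\<bar>w \<bullet> g (perp e u + a *\<^sub>R w)\<bar> \<le> \<bar>M\<bar> * (2 * r)"
  proof -
    have s: "norm (perp e (perp e u + a *\<^sub>R w)) < 2 * r" by (rule seg) (use a in auto)
    have "\<bar>w \<bullet> g (perp e u + a *\<^sub>R w)\<bar> \<le> norm w * norm (g (perp e u + a *\<^sub>R w))" by (rule Cauchy_Schwarz_ineq2)
    also have "\<dots> \<le> M * norm (perp e (perp e u + a *\<^sub>R w))" using g_lip[OF s] w by simp
    also have "\<dots> \<le> \<bar>M\<bar> * (2 * r)" using s by (intro mult_mono) auto
    finally show ?thesis .
  qed
  ultimately show ?thesis using t by (simp add: abs_mult t_def[symmetric] mult.commute)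
qed

lemma Gamma_lipschitz:
  assumes "norm (perp e u) < 2 * r" "norm (perp e u') < 2 * r"
  shows "norm (\<Gamma> u - \<Gamma> u') \<le> (1 + \<bar>M\<bar> * (2 * r)) * norm (perp e (u - u'))"
proof -
  have "norm (\<Gamma> u - \<Gamma> u') \<le> norm (perp e (u - u')) + \<bar>h u - h u'\<bar>"
    unfolding Gamma_diff using norm_triangle_ineq[of "perp e (u - u')" "(h u - h u') *\<^sub>R e"] e by simp
  then show ?thesis using h_lipschitz[OF assms(2,1)] by (simp add: algebra_simps)
qed

lemma Gamma_cont: "continuous_on {u. norm (perp e u) < 2 * r} \<Gamma>"
  unfolding \<Gamma>_def[abs_def]
  by (intro continuous_intros linear_continuous_on_compose[OF _ linear_Q] h_cont)

lemma Gamma_cont_cyl: "continuous_on (cyl e (r / 3)) \<Gamma>"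
  by (rule continuous_on_subset[OF Gamma_cont cyl_subset_tube])

lemma compact_patch: "compact patch"
  unfolding patch_def by (intro compact_continuous_image Gamma_cont_cyl compact_cyl e)

lemma patch_borel [measurable]: "patch \<in> sets borel"
  using compact_patch by (simp add: compact_imp_closed borel_closed)

lemma patch_subset: "patch \<subseteq> frontier K"
  using in_frontier cyl_subset_tube by (auto simp: patch_def \<Gamma>_def)

section \<open>Hausdorff measure of the patch against Lebesgue measure of its parameters\<close>

definition \<Gamma>0 :: "real^'n \<Rightarrow> real^'n" where "\<Gamma>0 u = indicator (cyl e (r / 3)) u *\<^sub>R \<Gamma> u"

lemma Gamma0_measurable [measurable]: "\<Gamma>0 \<in> borel_measurable borel"
  unfolding \<Gamma>0_def[abs_def] by (intro borel_measurable_continuous_on_indicator Gamma_cont_cyl) simp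

text \<open>Projecting to the hyperplane does not increase distances, so the part of the patch in a
  covering set pulls back into a cylinder whose radius is the diameter of that set. Summing volumes
  bounds the content at the single scale 1, and contents only grow as the scale shrinks.\<close>

lemma hausdorff_ge_projection:
  "\<exists>a>0. \<forall>A \<in> sets borel. ennreal a * emeasure lborel (cyl e (r / 3) \<inter> \<Gamma>0 -` A) \<le> hausdorff_outer_measure (CARD('n) - 1) (A \<inter> patch)"
proof -
  let ?k = "CARD('n) - 1" and ?V = "measure lborel (cyl e 1)" and ?S = "cyl e (r / 3)"
  let ?w = "unit_ball_vol (real ?k)"
  have V: "?V > 0" by (rule measure_cyl_pos[OF e])
  have w: "?w > 0" by simp
  \<comment> \<open>Chosen so that \<open>a\<close> times D^k V equals the weight w (D/2)^k of a set
    of diameter D.\<close>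
  define a where "a = ?w / (2 ^ ?k * ?V)"
  have a: "a > 0" using V w by (simp add: a_def)
  have "ennreal a * emeasure lborel (?S \<inter> \<Gamma>0 -` A) \<le> hausdorff_outer_measure ?k (A \<inter> patch)" if A: "A \<in> sets borel" for A
  proof -
    have meas: "?S \<inter> \<Gamma>0 -` A \<in> sets borel" using measurable_sets_borel[OF Gamma0_measurable A] by auto
    have "ennreal a * emeasure lborel (?S \<inter> \<Gamma>0 -` A) \<le> hausdorff_content ?k 1 (A \<inter> patch)"
      unfolding hausdorff_content_def
    proof (rule INF_greatest)
      fix C :: "nat \<Rightarrow> (real^'n) set"
      assume "C \<in> {C. A \<inter> patch \<subseteq> (\<Union>i. C i) \<and> (\<forall>i. bounded (C i) \<and> diameter (C i) \<le> 1)}"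
      then have C: "A \<inter> patch \<subseteq> (\<Union>i. C i)" "\<And>i. bounded (C i)" by auto
      define T where "T i = {u \<in> ?S. \<Gamma> u \<in> C i}" for i
      define b where "b i = (SOME u. u \<in> T i)" for i
      \<comment> \<open>Centred at the hyperplane part of \<open>b i\<close> only, so that the axis
        coordinate is not displaced.\<close>
      define N where "N i = (if T i = {} then {} else {x. x - perp e (b i) \<in> cyl e (diameter (C i))})" for i
      have b: "b i \<in> T i" if "T i \<noteq> {}" for i using that unfolding b_def by (simp add: some_in_eq)
      have TN: "T i \<subseteq> N i" for i
      proof
        fix u assume u: "u \<in> T i"
        then have bi: "b i \<in> T i" using b by blast
        have "norm (perp e (u - b i)) \<le> norm (\<Gamma> u - \<Gamma> (b i))" by (rule Gamma_expanding)
        also have "\<dots> \<le> diameter (C i)"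
          using diameter_bounded_bound[OF C(2)[of i], of "\<Gamma> u" "\<Gamma> (b i)"] u bi by (simp add: T_def dist_norm)
        finally have "norm (perp e (u - perp e (b i))) \<le> diameter (C i)"
          by (simp add: perp_diff perp_perp[OF e])
        moreover have "\<bar>(u - perp e (b i)) \<bullet> e\<bar> \<le> 1" using u by (simp add: T_def cyl_def inner_diff_left perp_inner[OF e])
        ultimately show "u \<in> N i" using u by (auto simp: N_def cyl_def)
      qed
      have Nm: "N i \<in> sets borel" for i
      proof -
        have "(\<lambda>x. x - perp e (b i)) -` cyl e (diameter (C i)) \<in> sets borel"
          by (intro borel_closed closed_vimage closed_cyl continuous_intros)
        then show ?thesis by (auto simp: N_def vimage_def)
      qed
      have le: "ennreal a * emeasure lborel (N i) \<le> hausdorff_weight ?k (C i)" for i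
      proof (cases "T i = {}")
        case True
        then show ?thesis by (simp add: N_def)
      next
        case False
        then have ne: "C i \<noteq> {}" by (auto simp: T_def)
        have d0: "diameter (C i) \<ge> 0" by (rule diameter_ge_0[OF C(2)])
        have "ennreal a * emeasure lborel (N i) = ennreal a * emeasure lborel (cyl e (diameter (C i)))"
          using False by (simp add: N_def emeasure_lborel_translate_vimage)
        also have "\<dots> \<le> ennreal a * ennreal (diameter (C i) ^ ?k * ?V)"
          using emeasure_cyl_le[OF e d0] dim2 by (intro mult_left_mono) auto
        also have "\<dots> = ennreal (a * (diameter (C i) ^ ?k * ?V))" using a by (intro ennreal_mult'[symmetric]) auto
        also have "a * (diameter (C i) ^ ?k * ?V) = ?w * (diameter (C i) / 2) ^ ?k"
          using V by (simp add: a_def power_divide)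
        finally show ?thesis using ne by (simp add: hausdorff_weight_def)
      qed
      have "?S \<inter> \<Gamma>0 -` A \<subseteq> (\<Union>i. N i)"
      proof
        fix u assume u: "u \<in> ?S \<inter> \<Gamma>0 -` A"
        then have "\<Gamma> u \<in> A \<inter> patch" by (auto simp: \<Gamma>0_def patch_def)
        then obtain i where "\<Gamma> u \<in> C i" using C(1) by blast
        then have "u \<in> T i" using u by (simp add: T_def)
        then show "u \<in> (\<Union>i. N i)" using TN by blast
      qed
      then have "emeasure lborel (?S \<inter> \<Gamma>0 -` A) \<le> emeasure lborel (\<Union>i. N i)"
        using Nm by (intro emeasure_mono) auto
      also have "\<dots> \<le> (\<Sum>i. emeasure lborel (N i))"
        using Nm by (intro emeasure_subadditive_countably) auto
      finally have "ennreal a * emeasure lborel (?S \<inter> \<Gamma>0 -` A) \<le> ennreal a * (\<Sum>i. emeasure lborel (N i))"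
        by (rule mult_left_mono) simp
      also have "\<dots> = (\<Sum>i. ennreal a * emeasure lborel (N i))" by simp
      also have "\<dots> \<le> (\<Sum>i. hausdorff_weight ?k (C i))" by (intro suminf_le le) auto
      finally show "ennreal a * emeasure lborel (?S \<inter> \<Gamma>0 -` A) \<le> (\<Sum>i. hausdorff_weight ?k (C i))" .
    qed
    also have "\<dots> \<le> hausdorff_outer_measure ?k (A \<inter> patch)"
      unfolding hausdorff_outer_measure_def by (intro SUP_upper) simp
    finally show ?thesis .
  qed
  with a show ?thesis by blast
qed

text \<open>Packing: the cylinders of radius \<rho>/3 around the points are disjoint and fit into
  the cylinder of radius r + 1, so volumes can be compared.\<close>

lemma separated_card_bound:
  assumes F: "finite F" "F \<subseteq> {x. x \<bullet> e = 0 \<and> norm x \<le> r}" and \<rho>: "0 < \<rho>" "\<rho> \<le> 1"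
    and sep: "\<And>x y. x \<in> F \<Longrightarrow> y \<in> F \<Longrightarrow> x \<noteq> y \<Longrightarrow> \<rho> < norm (x - y)"
  shows "real (card F) * \<rho> ^ (CARD('n) - 1) \<le> (3 * (r + 1)) ^ (CARD('n) - 1)"
proof -
  let ?k = "CARD('n) - 1" and ?V = "measure lborel (cyl e 1)"
  have V: "?V > 0" by (rule measure_cyl_pos[OF e])
  define N where "N a = {x. x - a \<in> cyl e (\<rho> / 3)}" for a
  have Nm: "N a \<in> sets borel" for a
  proof -
    have "(\<lambda>x. x - a) -` cyl e (\<rho> / 3) \<in> sets borel"
      by (intro borel_closed closed_vimage closed_cyl continuous_intros)
    then show ?thesis by (auto simp: N_def vimage_def)
  qed
  have Nv: "measure lborel (N a) = (\<rho> / 3) ^ ?k * ?V" for a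
    using measure_cyl[OF e, of "\<rho> / 3"] \<rho> by (simp add: N_def measure_def emeasure_lborel_translate_vimage)
  have Nf: "N a \<in> fmeasurable lborel" for a
    using Nm[of a] emeasure_cyl_finite[OF e, of "\<rho> / 3"]
    by (intro fmeasurableI) (auto simp: N_def emeasure_lborel_translate_vimage)
  have disj: "N a \<inter> N b = {}" if "a \<in> F" "b \<in> F" "a \<noteq> b" for a b
  proof (rule ccontr)
    assume "N a \<inter> N b \<noteq> {}"
    then obtain x where "norm (perp e (x - a)) \<le> \<rho> / 3" "norm (perp e (x - b)) \<le> \<rho> / 3"
      by (auto simp: N_def cyl_def)
    moreover have "perp e (x - b) - perp e (x - a) = a - b"
    proof -
      have "a \<bullet> e = 0" "b \<bullet> e = 0" using F(2) that by blast+
      then show ?thesis by (simp add: perp_diff perp_eq)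
    qed
    ultimately have "norm (a - b) \<le> \<rho> / 3 + \<rho> / 3"
      using norm_triangle_ineq4[of "perp e (x - b)" "perp e (x - a)"] by simp
    with sep[OF that] \<rho> show False by simp
  qed
  have sub: "(\<Union>a\<in>F. N a) \<subseteq> cyl e (r + 1)"
  proof
    fix x assume "x \<in> (\<Union>a\<in>F. N a)"
    then obtain a where a: "a \<in> F" "norm (perp e (x - a)) \<le> \<rho> / 3" "\<bar>(x - a) \<bullet> e\<bar> \<le> 1" by (auto simp: N_def cyl_def)
    have ae: "a \<bullet> e = 0" "norm a \<le> r" using F(2) a(1) by auto
    have "norm (perp e x) \<le> norm (perp e (x - a)) + norm (perp e a)"
      using norm_triangle_ineq[of "perp e (x - a)" "perp e a"] by (simp add: perp_diff)
    also have "\<dots> \<le> r + 1" using a ae \<rho> by (simp add: perp_eq)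
    finally show "x \<in> cyl e (r + 1)" using a ae by (simp add: cyl_def inner_diff_left)
  qed
  have "real (card F) * ((\<rho> / 3) ^ ?k * ?V) = (\<Sum>a\<in>F. measure lborel (N a))" by (simp add: Nv)
  also have "\<dots> = measure lborel (\<Union>a\<in>F. N a)"
    using F(1) Nf disj by (intro measure_UNION'[symmetric]) (auto simp: pairwise_def disjnt_def)
  also have "\<dots> \<le> measure lborel (cyl e (r + 1))"
    using sub Nm F(1) emeasure_cyl_finite[OF e, of "r + 1"] by (intro measure_mono_fmeasurable) (auto intro!: fmeasurableI sets.finite_UN)
  also have "\<dots> = (r + 1) ^ ?k * ?V" using measure_cyl[OF e, of "r + 1"] r by simp
  finally have "real (card F) * (\<rho> / 3) ^ ?k \<le> (r + 1) ^ ?k" using V by simp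
  then have "real (card F) * \<rho> ^ ?k / 3 ^ ?k \<le> (r + 1) ^ ?k" by (simp add: power_divide)
  then show ?thesis unfolding power_mult_distrib by (subst (asm) pos_divide_le_eq) (auto simp: mult.commute)
qed

text \<open>A maximal \<rho>-separated set in the hyperplane ball is a \<rho>-net, and the image of
  each piece of radius \<rho> has diameter at most 2 L \<rho>. Packing bounds the number of pieces
  by a multiple of \<rho>^(-k), so the total weight stays bounded as the scale tends to 0.\<close>

lemma hausdorff_patch_finite: "hausdorff_outer_measure (CARD('n) - 1) patch < \<infinity>"
proof -
  let ?k = "CARD('n) - 1" and ?B = "{x. x \<bullet> e = 0 \<and> norm x \<le> r}"
  define L where "L = 1 + \<bar>M\<bar> * (2 * r)"
  have L: "L > 0" using r by (auto simp: L_def intro!: add_pos_nonneg)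
  let ?C = "unit_ball_vol (real ?k) * (L * (3 * (r + 1))) ^ ?k"
  have "hausdorff_content ?k \<delta> patch \<le> ennreal ?C" if \<delta>: "\<delta> > 0" for \<delta>
  proof -
    define \<rho> where "\<rho> = min 1 (\<delta> / (2 * L))"
    have \<rho>: "0 < \<rho>" "\<rho> \<le> 1" "2 * L * \<rho> \<le> \<delta>"
      using \<delta> L by (auto simp: \<rho>_def min_def field_simps)
    define sepd where "sepd F \<longleftrightarrow> finite F \<and> F \<subseteq> ?B \<and> (\<forall>x\<in>F. \<forall>y\<in>F. x \<noteq> y \<longrightarrow> \<rho> < norm (x - y))" for F :: "(real^'n) set"
    obtain N :: nat where N: "(3 * (r + 1)) ^ ?k / \<rho> ^ ?k < real N" using reals_Archimedean2 by blast
    have cb: "real (card F) * \<rho> ^ ?k \<le> (3 * (r + 1)) ^ ?k" if "sepd F" for F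
      by (rule separated_card_bound) (use that \<rho> in \<open>auto simp: sepd_def\<close>)
    have bnd: "card F \<le> N" if "sepd F" for F
    proof -
      have "real (card F) \<le> (3 * (r + 1)) ^ ?k / \<rho> ^ ?k" using cb[OF that] \<rho> by (simp add: le_divide_eq)
      with N show ?thesis by linarith
    qed
    have "sepd {}" by (simp add: sepd_def)
    \<comment> \<open>A separated set of maximal size exists because \<open>N\<close> bounds all
      sizes.\<close>
    then have "\<exists>F. sepd F \<and> (\<forall>G. sepd G \<longrightarrow> card G \<le> card F)"
      by (rule ex_has_greatest_nat[where b="Suc N"]) (use bnd in \<open>auto intro: le_SucI less_Suc_eq_le[THEN iffD2]\<close>)
    then obtain F where F: "sepd F" "\<And>G. sepd G \<Longrightarrow> card G \<le> card F" by blast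
    have cov: "\<exists>a\<in>F. norm (x - a) \<le> \<rho>" if x: "x \<in> ?B" for x
    proof (rule ccontr)
      assume "\<not> ?thesis"
      then have far: "\<And>a. a \<in> F \<Longrightarrow> \<rho> < norm (x - a)" by auto
      then have "x \<notin> F" using \<rho> by force
      have "sepd (insert x F)" using F(1) x far by (auto simp: sepd_def norm_minus_commute)
      from F(2)[OF this] \<open>x \<notin> F\<close> F(1) show False by (simp add: sepd_def)
    qed
    have finF: "finite F" using F(1) by (simp add: sepd_def)
    define P where "P a = \<Gamma> ` {u \<in> cyl e (r / 3). norm (perp e u - a) \<le> \<rho>}" for a
    have distP: "norm (x - y) \<le> 2 * L * \<rho>" if xy: "x \<in> P a" "y \<in> P a" for x y a
    proof -
      obtain u u' where u: "x = \<Gamma> u" "u \<in> cyl e (r / 3)" "norm (perp e u - a) \<le> \<rho>"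
        and u': "y = \<Gamma> u'" "u' \<in> cyl e (r / 3)" "norm (perp e u' - a) \<le> \<rho>" using xy by (auto simp: P_def)
      have "norm (x - y) \<le> L * norm (perp e (u - u'))" unfolding u u' L_def
        by (rule Gamma_lipschitz) (use u u' cyl_subset_tube in auto)
      also have "norm (perp e (u - u')) \<le> \<rho> + \<rho>"
        using norm_triangle_ineq4[of "perp e u - a" "perp e u' - a"] u u' by (simp add: perp_diff)
      finally show ?thesis using L by simp
    qed
    have Pb: "bounded (P a)" for a
      by (rule bounded_subset[OF compact_imp_bounded[OF compact_patch]]) (auto simp: P_def patch_def)
    have Pd: "diameter (P a) \<le> 2 * L * \<rho>" for a
      by (rule diameter_le) (use distP L \<rho> in auto)
    obtain f where f: "bij_betw f {..<card F} F" using finF bij_betw_from_nat_into_finite by blast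
    define C where "C i = (if i < card F then P (f i) else {})" for i
    have Ccov: "patch \<subseteq> (\<Union>i. C i)"
    proof
      fix x assume "x \<in> patch"
      then obtain u where u: "x = \<Gamma> u" "u \<in> cyl e (r / 3)" by (auto simp: patch_def)
      then have "perp e u \<in> ?B" using r perp_inner[OF e] by (auto simp: cyl_def)
      from cov[OF this] obtain a where a: "a \<in> F" "norm (perp e u - a) \<le> \<rho>" by blast
      have "a \<in> f ` {..<card F}" using f a(1) by (simp add: bij_betw_def)
      then obtain i where i: "i < card F" "f i = a" by auto
      then have "x \<in> C i" using u a by (auto simp: C_def P_def)
      then show "x \<in> (\<Union>i. C i)" by blast
    qed
    have "hausdorff_content ?k \<delta> patch \<le> (\<Sum>i. hausdorff_weight ?k (C i))"
      unfolding hausdorff_content_def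
      by (intro INF_lower) (use Ccov Pb order_trans[OF Pd \<rho>(3)] \<delta> in \<open>auto simp: C_def\<close>)
    also have "\<dots> = (\<Sum>i<card F. hausdorff_weight ?k (C i))"
      by (intro suminf_finite) (auto simp: C_def hausdorff_weight_def)
    also have "\<dots> \<le> (\<Sum>i<card F. ennreal (unit_ball_vol (real ?k) * (L * \<rho>) ^ ?k))"
    proof (rule sum_mono)
      fix i
      have "diameter (P (f i)) / 2 \<le> L * \<rho>" using Pd[of "f i"] by simp
      moreover have "diameter (P (f i)) \<ge> 0" by (rule diameter_ge_0[OF Pb])
      ultimately show "hausdorff_weight ?k (C i) \<le> ennreal (unit_ball_vol (real ?k) * (L * \<rho>) ^ ?k)"
        by (auto simp: hausdorff_weight_def C_def intro!: ennreal_leI mult_left_mono power_mono)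
    qed
    also have "\<dots> = ennreal (real (card F) * (unit_ball_vol (real ?k) * (L * \<rho>) ^ ?k))"
      using L \<rho> by (simp add: ennreal_mult ennreal_of_nat_eq_real_of_nat)
    also have "real (card F) * (unit_ball_vol (real ?k) * (L * \<rho>) ^ ?k) = unit_ball_vol (real ?k) * L ^ ?k * (real (card F) * \<rho> ^ ?k)"
      by (simp add: power_mult_distrib)
    also have "ennreal \<dots> \<le> ennreal ?C"
      using cb[OF F(1)] L by (intro ennreal_leI) (auto simp: power_mult_distrib mult.assoc intro!: mult_left_mono)
    finally show ?thesis .
  qed
  then have "hausdorff_outer_measure ?k patch \<le> ennreal ?C"
    unfolding hausdorff_outer_measure_def by (intro SUP_least) auto
  then show ?thesis by (rule le_less_trans) simp
qed

text \<open>
  The projection of the patch to the hyperplane is 1-Lipschitz, so \<open>nu\<close> is at most a multiple of the surface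
  measure; its Radon-Nikodym density replaces the area formula.
\<close>

definition nu :: "(real^'n) measure" where
  "nu = distr (density lborel (\<lambda>u. ennreal (ampl u))) borel \<Gamma>0"

lemma sets_nu [simp, measurable_cong]: "sets nu = sets borel"
  by (simp add: nu_def)

section \<open>A bounded surface density for the amplitude\<close>

lemma emeasure_surface_patch:
  assumes "A \<in> sets borel"
  shows "emeasure (surface_measure K) (A \<inter> patch) = hausdorff_outer_measure (CARD('n) - 1) (A \<inter> patch)"
proof -
  have "A \<inter> patch \<inter> frontier K = A \<inter> patch" using patch_subset by auto
  then show ?thesis using emeasure_surface_measure[of "A \<inter> patch" K] assms by simp
qed

lemma nu_le: "\<exists>C>0. \<forall>A\<in>sets borel. emeasure nu A \<le> ennreal C * emeasure (surface_measure K) (A \<inter> patch)"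
proof -
  obtain a where a: "a > 0" "\<And>A. A \<in> sets borel \<Longrightarrow> ennreal a * emeasure lborel (cyl e (r / 3) \<inter> \<Gamma>0 -` A) \<le> hausdorff_outer_measure (CARD('n) - 1) (A \<inter> patch)"
    using hausdorff_ge_projection by blast
  have b0: "bump 0 > 0" using r by (simp add: bump_def perp_0)
  \<comment> \<open>\<open>bump 0\<close> bounds the amplitude, and 1 / a comes from the comparison
    with Hausdorff measure.\<close>
  define C where "C = bump 0 * (1 / a)"
  have "emeasure nu A \<le> ennreal C * emeasure (surface_measure K) (A \<inter> patch)" if A: "A \<in> sets borel" for A
  proof -
    let ?B = "\<Gamma>0 -` A"
    have B: "?B \<in> sets borel" by (rule measurable_sets_borel[OF Gamma0_measurable A])
    have "emeasure nu A = (\<integral>\<^sup>+u. ennreal (ampl u) * indicator ?B u \<partial>lborel)"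
      unfolding nu_def using A B by (simp add: emeasure_distr emeasure_density)
    also have "\<dots> \<le> (\<integral>\<^sup>+u. ennreal (bump 0) * indicator (cyl e (r / 3) \<inter> ?B) u \<partial>lborel)"
    proof (rule nn_integral_mono)
      fix u
      have "ampl u \<le> bump 0 * 1" unfolding ampl_def by (intro mult_mono bump_bound tent_bounds bump_nonneg)
      then show "ennreal (ampl u) * indicator ?B u \<le> ennreal (bump 0) * indicator (cyl e (r / 3) \<inter> ?B) u"
        using ampl_eq_0[of u] by (auto simp: indicator_def intro!: ennreal_leI)
    qed
    also have "\<dots> = ennreal (bump 0) * emeasure lborel (cyl e (r / 3) \<inter> ?B)"
      using B by (simp add: nn_integral_cmult_indicator)
    also have "\<dots> = ennreal C * (ennreal a * emeasure lborel (cyl e (r / 3) \<inter> ?B))"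
    proof -
      have "ennreal C * ennreal a = ennreal (bump 0)"
        using a b0 by (subst ennreal_mult'[symmetric]) (auto simp: C_def)
      then show ?thesis by (simp add: mult.assoc[symmetric])
    qed
    also have "\<dots> \<le> ennreal C * emeasure (surface_measure K) (A \<inter> patch)"
      unfolding emeasure_surface_patch[OF A] by (intro mult_left_mono a A) simp
    finally show ?thesis .
  qed
  moreover have "C > 0" using a b0 by (simp add: C_def)
  ultimately show ?thesis by blast
qed

text \<open>Radon-Nikodym is applied to the restriction \<open>t\<close> of the surface measure to
  the patch, whose mass is finite. Domination of \<open>nu\<close> by C times \<open>t\<close>
  forces the density below C almost everywhere: on the set where it exceeds C, the excess has
  integral 0.\<close>

lemma nu_density:
  obtains f :: "real^'n \<Rightarrow> real" and C where "f \<in> borel_measurable borel" "\<And>x. 0 \<le> f x" "\<And>x. f x \<le> C"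
    "density (surface_measure K) (\<lambda>x. ennreal (f x)) = nu"
proof -
  let ?s = "surface_measure K"
  define t where "t = density ?s (indicator patch)"
  have sets_t [measurable_cong, simp]: "sets t = sets borel" by (simp add: t_def)
  have space_s [simp]: "space ?s = UNIV" by (simp add: surface_measure_def)
  have space_t [simp]: "space t = UNIV" by (simp add: t_def)
  have et: "emeasure t A = emeasure ?s (A \<inter> patch)" if "A \<in> sets borel" for A
    using that by (simp add: t_def emeasure_restricted Int_commute)
  obtain C where C: "C > 0" "\<And>A. A \<in> sets borel \<Longrightarrow> emeasure nu A \<le> ennreal C * emeasure t A"
    using nu_le et by auto
  interpret t: finite_measure t
  proof
    have "emeasure t UNIV = hausdorff_outer_measure (CARD('n) - 1) patch"
      using et[of UNIV] emeasure_surface_patch[of UNIV] by simp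
    then show "emeasure t (space t) \<noteq> \<infinity>" using hausdorff_patch_finite by simp
  qed
  have "absolutely_continuous t nu"
    unfolding absolutely_continuous_def
  proof
    fix A assume A: "A \<in> null_sets t"
    then have "A \<in> sets borel" "emeasure t A = 0" by auto
    with C(2)[of A] show "A \<in> null_sets nu" by (auto intro!: null_setsI)
  qed
  from t.Radon_Nikodym[OF this] obtain F where F: "F \<in> borel_measurable t" "density t F = nu" by auto
  have [measurable]: "F \<in> borel_measurable borel" using F(1) by (simp add: measurable_def sets_eq_imp_space_eq[OF sets_t])
  define E where "E = {x. F x > ennreal C}"
  have E[measurable]: "E \<in> sets borel" unfolding E_def by measurable
  have finE: "emeasure t E \<noteq> \<infinity>" by (rule t.emeasure_finite[unfolded infinity_ennreal_def[symmetric]])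
  have "(\<integral>\<^sup>+x. F x * indicator E x - ennreal C * indicator E x \<partial>t)
     = (\<integral>\<^sup>+x. F x * indicator E x \<partial>t) - (\<integral>\<^sup>+x. ennreal C * indicator E x \<partial>t)"
  proof (rule nn_integral_diff)
    show "(\<lambda>x. F x * indicator E x) \<in> borel_measurable t" using F(1) by measurable
    show "(\<lambda>x. ennreal C * indicator E x) \<in> borel_measurable t" by measurable
    show "(\<integral>\<^sup>+x. ennreal C * indicator E x \<partial>t) \<noteq> \<infinity>"
      using finE by (simp add: nn_integral_cmult_indicator ennreal_mult_eq_top_iff)
    show "AE x in t. ennreal C * indicator E x \<le> F x * indicator E x"
      by (intro AE_I2) (auto simp: E_def indicator_def)
  qed
  also have "(\<integral>\<^sup>+x. F x * indicator E x \<partial>t) = emeasure nu E"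
    using F(1) by (simp add: F(2)[symmetric] emeasure_density)
  also have "(\<integral>\<^sup>+x. ennreal C * indicator E x \<partial>t) = ennreal C * emeasure t E"
    by (simp add: nn_integral_cmult_indicator)
  also have "emeasure nu E - ennreal C * emeasure t E = 0"
  proof -
    have "ennreal C * emeasure t E < top" unfolding ennreal_mult_less_top by (simp add: less_top[symmetric])
    then show ?thesis using C(2)[OF E] by (simp add: diff_eq_0_iff_ennreal le_less_trans)
  qed
  finally have "AE x in t. F x * indicator E x - ennreal C * indicator E x = 0"
    using F(1) by (subst (asm) nn_integral_0_iff_AE) auto
  then have "AE x in t. F x \<le> ennreal C"
  proof eventually_elim
    case (elim x)
    show ?case
    proof (rule ccontr)
      assume n: "\<not> F x \<le> ennreal C"
      then have "x \<in> E" by (simp add: E_def not_le)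
      then have "F x - ennreal C = 0" using elim by simp
      with n show False by (simp add: diff_eq_0_iff_ennreal)
    qed
  qed
  then have AE: "AE x in ?s. x \<in> patch \<longrightarrow> F x \<le> ennreal C"
    unfolding t_def by (subst (asm) AE_density) (auto simp: indicator_def elim!: eventually_mono split: if_splits)
  \<comment> \<open>Truncation makes the bound hold at every point, and the indicator turns a
    density with respect to \<open>t\<close> into one with respect to the surface measure.\<close>
  define f where "f x = enn2real (min (F x) (ennreal C)) * indicator patch x" for x
  have [measurable]: "f \<in> borel_measurable borel" unfolding f_def[abs_def] by measurable
  have "density ?s (\<lambda>x. ennreal (f x)) = density ?s (\<lambda>x. indicator patch x * F x)"
  proof (rule density_cong)
    show "(\<lambda>x. ennreal (f x)) \<in> borel_measurable ?s" by measurable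
    show "(\<lambda>x. indicator patch x * F x) \<in> borel_measurable ?s" by measurable
    show "AE x in ?s. ennreal (f x) = indicator patch x * F x"
      using AE
    proof eventually_elim
      case (elim x)
      have "min (F x) (ennreal C) < top" by (simp add: min_less_iff_disj)
      then show ?case using elim by (auto simp: f_def indicator_def min_absorb1)
    qed
  qed
  also have "\<dots> = density t F"
    unfolding t_def by (subst density_density_eq) auto
  also have "\<dots> = nu" by (rule F(2))
  finally have 1: "density ?s (\<lambda>x. ennreal (f x)) = nu" .
  have 2: "f x \<le> C" for x
  proof -
    have "enn2real (min (F x) (ennreal C)) \<le> C" using C(1) by (intro enn2real_leI) auto
    then show ?thesis using C(1) by (auto simp: f_def indicator_def)
  qed
  show thesis by (rule that[OF _ _ 2 1]) (auto simp: f_def)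
qed

text \<open>The transform does not vanish identically, by its lower bound, and the integral of the
  amplitude dominates it.\<close>

lemma integral_ampl_pos: "0 < (\<integral>u. ampl u \<partial>lborel)"
proof -
  obtain c0 \<rho> T0 where "c0 > 0" "\<rho> > 0" "T0 > 0" and L: "\<And>\<xi> \<tau>. \<xi> \<bullet> e = 0 \<Longrightarrow> T0 \<le> \<tau> \<Longrightarrow> norm \<xi> \<le> \<rho> * \<tau> \<Longrightarrow>
     c0 \<le> (cmod (phi_hat \<xi> \<tau>))\<^sup>2 * \<tau> ^ (DIM(real^'n) - 1)" using phi_hat_lower by blast
  have "c0 \<le> (cmod (phi_hat 0 T0))\<^sup>2 * T0 ^ (DIM(real^'n) - 1)" by (rule L) (use \<open>T0 > 0\<close> \<open>\<rho> > 0\<close> in auto)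
  then have "phi_hat 0 T0 \<noteq> 0" using \<open>c0 > 0\<close> by auto
  then show ?thesis using phi_hat_trivial[of 0 T0] by (meson norm_ge_zero order_less_le_trans zero_less_norm_iff)
qed

text \<open>Boundedness gives f^2 \<le> C f, hence square integrability. The Fourier integral of
  \<open>f\<close> is that of \<open>nu\<close>, an image measure, and so becomes an integral over
  the parameter domain without any surface element.\<close>

lemma patch_function:
  obtains f :: "real^'n \<Rightarrow> real" where "f \<in> borel_measurable borel"
    "integrable (surface_measure K) (\<lambda>x. (f x)\<^sup>2)" "0 < (\<integral>x. (f x)\<^sup>2 \<partial>surface_measure K)"
    "\<And>t. (\<integral>x. complex_of_real (f x) * cis (t \<bullet> x) \<partial>surface_measure K) = (\<integral>u. complex_of_real (ampl u) * cis (t \<bullet> \<Gamma> u) \<partial>lborel)"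
proof -
  let ?s = "surface_measure K"
  obtain f C where f[measurable]: "f \<in> borel_measurable borel" and f0: "\<And>x. 0 \<le> f x" and fC: "\<And>x. f x \<le> C"
    and fd: "density ?s (\<lambda>x. ennreal (f x)) = nu" by (rule nu_density) blast
  have ai: "integrable lborel ampl" by (rule integrable_compact_support[OF compact_cyl[OF e] ampl_cont ampl_eq_0])
  have "(\<integral>\<^sup>+x. ennreal (f x) \<partial>?s) = emeasure nu UNIV"
    by (simp add: fd[symmetric] emeasure_density surface_measure_def)
  also have "\<dots> = (\<integral>\<^sup>+u. ennreal (ampl u) \<partial>lborel)"
    by (simp add: nu_def emeasure_distr emeasure_density)
  also have "\<dots> = ennreal (\<integral>u. ampl u \<partial>lborel)"
    using ai ampl_nonneg by (intro nn_integral_eq_integral) auto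
  finally have nnf: "(\<integral>\<^sup>+x. ennreal (f x) \<partial>?s) = ennreal (\<integral>u. ampl u \<partial>lborel)" .
  have fi: "integrable ?s f" using nnf f0 by (intro integrableI_nonneg) auto
  have f2i: "integrable ?s (\<lambda>x. (f x)\<^sup>2)"
  proof (rule Bochner_Integration.integrable_bound)
    show "integrable ?s (\<lambda>x. C * f x)" using fi by simp
    show "AE x in ?s. norm ((f x)\<^sup>2) \<le> norm (C * f x)"
      using f0 fC by (intro AE_I2) (auto simp: power2_eq_square abs_mult intro!: mult_right_mono order_trans[OF fC abs_ge_self])
  qed simp
  \<comment> \<open>If f^2 had integral 0, then f would vanish almost everywhere, but its total mass
    is the positive integral of the amplitude.\<close>
  have pos: "0 < (\<integral>x. (f x)\<^sup>2 \<partial>?s)"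
  proof (rule ccontr)
    assume "\<not> ?thesis"
    moreover have "0 \<le> (\<integral>x. (f x)\<^sup>2 \<partial>?s)" by simp
    ultimately have "(\<integral>x. (f x)\<^sup>2 \<partial>?s) = 0" by linarith
    then have "AE x in ?s. (f x)\<^sup>2 = 0" by (subst (asm) integral_nonneg_eq_0_iff_AE[OF f2i]) auto
    then have "AE x in ?s. ennreal (f x) = 0" by eventually_elim simp
    then have "(\<integral>\<^sup>+x. ennreal (f x) \<partial>?s) = 0" by (subst nn_integral_0_iff_AE) auto
    with nnf integral_ampl_pos show False by simp
  qed
  have eq: "(\<integral>x. complex_of_real (f x) * cis (t \<bullet> x) \<partial>?s) = (\<integral>u. complex_of_real (ampl u) * cis (t \<bullet> \<Gamma> u) \<partial>lborel)" for t
  proof -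
    have "(\<integral>x. complex_of_real (f x) * cis (t \<bullet> x) \<partial>?s) = (\<integral>x. f x *\<^sub>R cis (t \<bullet> x) \<partial>?s)" by (simp add: scaleR_conv_of_real)
    also have "\<dots> = (\<integral>x. cis (t \<bullet> x) \<partial>density ?s (\<lambda>x. ennreal (f x)))"
      by (rule integral_density[symmetric]) (use f0 in auto)
    also have "\<dots> = (\<integral>u. cis (t \<bullet> \<Gamma>0 u) \<partial>density lborel (\<lambda>u. ennreal (ampl u)))"
      unfolding fd nu_def by (rule integral_distr) auto
    also have "\<dots> = (\<integral>u. ampl u *\<^sub>R cis (t \<bullet> \<Gamma>0 u) \<partial>lborel)"
      by (rule integral_density) (use ampl_nonneg in auto)
    also have "\<dots> = (\<integral>u. complex_of_real (ampl u) * cis (t \<bullet> \<Gamma> u) \<partial>lborel)"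
      by (intro Bochner_Integration.integral_cong refl)
        (use ampl_eq_0 in \<open>auto simp: \<Gamma>0_def indicator_def scaleR_conv_of_real\<close>)
    finally show ?thesis .
  qed
  show thesis by (rule that[OF f f2i pos eq])
qed

text \<open>\<open>Q\<close> preserves inner products, so t acts on the rotated graph as its
  preimage t' acts on the graph in standard position; the base point only contributes a
  phase.\<close>

lemma Gamma_phase:
  obtains t' where "norm t' = norm t" "Q t' = t"
    "(\<integral>u. complex_of_real (ampl u) * cis (t \<bullet> \<Gamma> u) \<partial>lborel) = cis (t \<bullet> p) * phi_hat (perp e t') (t' \<bullet> e)"
proof -
  obtain t' where t': "Q t' = t" using orthogonal_transformation_surj[OF Q] by (metis surjD)
  have in': "t \<bullet> Q y = t' \<bullet> y" for y using Q t' by (auto simp: orthogonal_transformation_def)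
  have "(\<integral>u. complex_of_real (ampl u) * cis (t \<bullet> \<Gamma> u) \<partial>lborel)
     = (\<integral>u. cis (t \<bullet> p) * (complex_of_real (ampl u) * cis (perp e t' \<bullet> u + (t' \<bullet> e) * h u)) \<partial>lborel)"
  proof (intro Bochner_Integration.integral_cong refl)
    fix u
    have "t' \<bullet> perp e u = perp e t' \<bullet> u" by (simp add: perp_def inner_diff_left inner_diff_right inner_commute)
    then have "t \<bullet> \<Gamma> u = t \<bullet> p + (perp e t' \<bullet> u + (t' \<bullet> e) * h u)"
      by (simp add: \<Gamma>_def inner_add_right in')
    then have "cis (t \<bullet> \<Gamma> u) = cis (t \<bullet> p) * cis (perp e t' \<bullet> u + (t' \<bullet> e) * h u)" by (simp only: cis_mult)
    then show "complex_of_real (ampl u) * cis (t \<bullet> \<Gamma> u) = cis (t \<bullet> p) * (complex_of_real (ampl u) * cis (perp e t' \<bullet> u + (t' \<bullet> e) * h u))"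
      by simp
  qed
  also have "\<dots> = cis (t \<bullet> p) * phi_hat (perp e t') (t' \<bullet> e)" by (simp only: integral_mult_right_zero phi_hat_def)
  finally show thesis using that[of t'] t' norm_Q[of t'] by simp
qed

lemma patch_transform:
  obtains f :: "real^'n \<Rightarrow> real" and C c0 \<rho> T0 where "f \<in> borel_measurable borel"
    "integrable (surface_measure K) (\<lambda>x. (f x)\<^sup>2)" "0 < (\<integral>x. (f x)\<^sup>2 \<partial>surface_measure K)"
    "C > 0" "\<And>t. (cmod (\<integral>x. complex_of_real (f x) * cis (t \<bullet> x) \<partial>surface_measure K))\<^sup>2 * (1 + norm t) ^ (CARD('n) - 1) \<le> C"
    "c0 > 0" "\<rho> > 0" "T0 > 0"
    "\<And>t. T0 \<le> norm t \<Longrightarrow> norm (t - norm t *\<^sub>R Q e) \<le> \<rho> * norm t \<Longrightarrow>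
       c0 \<le> (cmod (\<integral>x. complex_of_real (f x) * cis (t \<bullet> x) \<partial>surface_measure K))\<^sup>2 * norm t ^ (CARD('n) - 1)"
    "\<And>t. norm t \<le> \<rho> \<Longrightarrow> c0 \<le> (cmod (\<integral>x. complex_of_real (f x) * cis (t \<bullet> x) \<partial>surface_measure K))\<^sup>2"
proof -
  let ?k = "CARD('n) - 1"
  obtain f where f: "f \<in> borel_measurable borel"
    "integrable (surface_measure K) (\<lambda>x. (f x)\<^sup>2)" "0 < (\<integral>x. (f x)\<^sup>2 \<partial>surface_measure K)"
    "\<And>t. (\<integral>x. complex_of_real (f x) * cis (t \<bullet> x) \<partial>surface_measure K) = (\<integral>u. complex_of_real (ampl u) * cis (t \<bullet> \<Gamma> u) \<partial>lborel)"
    by (rule patch_function) blast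
  define H where "H t = (\<integral>x. complex_of_real (f x) * cis (t \<bullet> x) \<partial>surface_measure K)" for t
  have H: "H t = (\<integral>u. complex_of_real (ampl u) * cis (t \<bullet> \<Gamma> u) \<partial>lborel)" for t by (simp add: H_def f(4))
  obtain C where C: "C > 0" "\<And>\<xi> \<tau>. \<xi> \<bullet> e = 0 \<Longrightarrow> (cmod (phi_hat \<xi> \<tau>))\<^sup>2 * (1 + norm \<xi> + \<bar>\<tau>\<bar>) ^ ?k \<le> C"
    using phi_hat_upper by auto
  obtain c0 \<rho>0 T0 where L: "c0 > 0" "\<rho>0 > 0" "T0 > 0" "\<And>\<xi> \<tau>. \<xi> \<bullet> e = 0 \<Longrightarrow> T0 \<le> \<tau> \<Longrightarrow> norm \<xi> \<le> \<rho>0 * \<tau> \<Longrightarrow>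
     c0 \<le> (cmod (phi_hat \<xi> \<tau>))\<^sup>2 * \<tau> ^ ?k" using phi_hat_lower by auto
  have U: "(cmod (H t))\<^sup>2 * (1 + norm t) ^ ?k \<le> C" for t
  proof -
    obtain t' where t': "norm t' = norm t" "H t = cis (t \<bullet> p) * phi_hat (perp e t') (t' \<bullet> e)"
      unfolding H by (rule Gamma_phase) blast
    have "norm t \<le> norm (perp e t') + \<bar>t' \<bullet> e\<bar>" using norm_le_perp[OF e, of t'] t' by simp
    then have "(1 + norm t) ^ ?k \<le> (1 + norm (perp e t') + \<bar>t' \<bullet> e\<bar>) ^ ?k" by (intro power_mono) auto
    then have "(cmod (H t))\<^sup>2 * (1 + norm t) ^ ?k \<le> (cmod (phi_hat (perp e t') (t' \<bullet> e)))\<^sup>2 * (1 + norm (perp e t') + \<bar>t' \<bullet> e\<bar>) ^ ?k"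
      by (auto simp: t' norm_mult intro!: mult_left_mono)
    also have "\<dots> \<le> C" by (rule C(2)[OF perp_inner[OF e]])
    finally show ?thesis .
  qed
  \<comment> \<open>1/2 ensures t' \<bullet> e \<ge> |t|/2 in the cone, and \<rho>0/2 then turns the
    bound on \<open>perp e t'\<close> into \<rho>0 (t' \<bullet> e). For the same reason the
    threshold is 2 T0.\<close>
  define \<rho>1 where "\<rho>1 = min (1/2) (\<rho>0 / 2)"
  have \<rho>1: "\<rho>1 > 0" "\<rho>1 \<le> 1/2" "\<rho>1 \<le> \<rho>0 / 2" using L by (auto simp: \<rho>1_def)
  have Low: "c0 \<le> (cmod (H t))\<^sup>2 * norm t ^ ?k" if t: "2 * T0 \<le> norm t" "norm (t - norm t *\<^sub>R Q e) \<le> \<rho>1 * norm t" for t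
  proof -
    obtain t' where t': "norm t' = norm t" "Q t' = t" "H t = cis (t \<bullet> p) * phi_hat (perp e t') (t' \<bullet> e)"
      unfolding H by (rule Gamma_phase) blast
    have nn: "norm (t' - norm t *\<^sub>R e) = norm (t - norm t *\<^sub>R Q e)"
    proof -
      have "t - norm t *\<^sub>R Q e = Q (t' - norm t *\<^sub>R e)"
        using t'(2) by (simp add: linear_diff[OF linear_Q] linear_scale[OF linear_Q])
      then show ?thesis by (simp add: norm_Q)
    qed
    have "norm (perp e t') = norm (perp e (t' - norm t *\<^sub>R e))" by (simp add: perp_diff perp_scaleR perp_axis[OF e])
    also have "\<dots> \<le> norm (t' - norm t *\<^sub>R e)" by (rule norm_perp_le[OF e])
    also have "\<dots> \<le> \<rho>1 * norm t" using t(2) nn by simp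
    finally have p: "norm (perp e t') \<le> \<rho>1 * norm t" .
    have "\<bar>(t' - norm t *\<^sub>R e) \<bullet> e\<bar> \<le> norm (t' - norm t *\<^sub>R e)" by (rule Basis_le_norm[OF e])
    also have "\<dots> \<le> \<rho>1 * norm t" using t(2) nn by simp
    also have "\<dots> \<le> 1/2 * norm t" using \<rho>1 by (intro mult_right_mono) auto
    finally have "\<bar>(t' - norm t *\<^sub>R e) \<bullet> e\<bar> \<le> 1/2 * norm t" .
    moreover have "(t' - norm t *\<^sub>R e) \<bullet> e = t' \<bullet> e - norm t" using e by (simp add: inner_diff_left)
    ultimately have \<tau>: "t' \<bullet> e \<ge> norm t / 2" by linarith
    have "t' \<bullet> e \<le> norm t" using Basis_le_norm[OF e, of t'] t'(1) by simp
    have "\<rho>1 * norm t \<le> \<rho>0 / 2 * norm t" using \<rho>1 by (intro mult_right_mono) auto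
    also have "\<dots> = \<rho>0 * (norm t / 2)" by simp
    also have "\<dots> \<le> \<rho>0 * (t' \<bullet> e)" using \<tau> L by (intro mult_left_mono) auto
    finally have "norm (perp e t') \<le> \<rho>0 * (t' \<bullet> e)" using p by linarith
    then have "c0 \<le> (cmod (phi_hat (perp e t') (t' \<bullet> e)))\<^sup>2 * (t' \<bullet> e) ^ ?k"
      using \<tau> t(1) by (intro L perp_inner[OF e]) auto
    also have "\<dots> \<le> (cmod (phi_hat (perp e t') (t' \<bullet> e)))\<^sup>2 * norm t ^ ?k"
      using \<tau> \<open>t' \<bullet> e \<le> norm t\<close> by (intro mult_left_mono power_mono) (auto intro: order_trans[OF _ \<tau>])
    also have "\<dots> = (cmod (H t))\<^sup>2 * norm t ^ ?k" by (simp add: t' norm_mult)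
    finally show ?thesis .
  qed
  \<comment> \<open>Near frequency 0 the transform is close to its value at 0, the positive integral
    of the amplitude.\<close>
  have "H \<midarrow>0\<rightarrow> H 0"
  proof (rule tendsto_at_iff_sequentially[THEN iffD2], intro allI impI)
    fix X :: "nat \<Rightarrow> real^'n" assume "\<forall>i. X i \<in> UNIV - {0}" and X: "X \<longlonglongrightarrow> 0"
    have ai: "integrable lborel ampl" by (rule integrable_compact_support[OF compact_cyl[OF e] ampl_cont ampl_eq_0])
    have eq: "complex_of_real (ampl u) * cis (t \<bullet> \<Gamma> u) = complex_of_real (ampl u) * cis (t \<bullet> \<Gamma>0 u)" for t u
      using ampl_eq_0[of u] by (auto simp: \<Gamma>0_def indicator_def)
    show "(H \<circ> X) \<longlonglongrightarrow> H 0"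
      unfolding o_def H eq
    proof (rule integral_dominated_convergence[where w=ampl])
      show "AE u in lborel. (\<lambda>i. complex_of_real (ampl u) * cis (X i \<bullet> \<Gamma>0 u)) \<longlonglongrightarrow> complex_of_real (ampl u) * cis (0 \<bullet> \<Gamma>0 u)"
        by (intro AE_I2 tendsto_intros tendsto_cis X)
    qed (use ai ampl_nonneg in \<open>auto simp: norm_mult\<close>)
  qed
  then have "((\<lambda>t. (cmod (H t))\<^sup>2) \<longlongrightarrow> (cmod (H 0))\<^sup>2) (at 0)" by (intro tendsto_intros)
  moreover have H0: "(cmod (H 0))\<^sup>2 > 0" unfolding H using integral_ampl_pos by simp
  ultimately have "\<forall>\<^sub>F t in at 0. (cmod (H 0))\<^sup>2 / 2 < (cmod (H t))\<^sup>2"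
    by (intro order_tendstoD) auto
  then obtain d where d: "d > 0" "\<And>t. t \<noteq> 0 \<Longrightarrow> norm t < d \<Longrightarrow> (cmod (H 0))\<^sup>2 / 2 < (cmod (H t))\<^sup>2"
    unfolding eventually_at by (auto simp: dist_norm)
  define c1 where "c1 = min c0 ((cmod (H 0))\<^sup>2 / 2)"
  define \<rho> where "\<rho> = min \<rho>1 (d / 2)"
  have nz: "c1 \<le> (cmod (H t))\<^sup>2" if "norm t \<le> \<rho>" for t
  proof (cases "t = 0")
    case True
    have "c1 \<le> (cmod (H 0))\<^sup>2 / 2" by (simp add: c1_def)
    then show ?thesis using H0 unfolding True by linarith
  next
    case False
    then show ?thesis using d(2)[OF False] that d(1) by (auto simp: c1_def \<rho>_def min_def split: if_splits)
  qed
  show thesis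
  proof (rule that[of f C c1 \<rho> "2 * T0"])
    show "(cmod (\<integral>x. complex_of_real (f x) * cis (t \<bullet> x) \<partial>surface_measure K))\<^sup>2 * (1 + norm t) ^ ?k \<le> C" for t
      using U[of t] by (simp add: H_def)
    show "c1 \<le> (cmod (\<integral>x. complex_of_real (f x) * cis (t \<bullet> x) \<partial>surface_measure K))\<^sup>2 * norm t ^ ?k"
      if "2 * T0 \<le> norm t" "norm (t - norm t *\<^sub>R Q e) \<le> \<rho> * norm t" for t
    proof -
      have "\<rho> * norm t \<le> \<rho>1 * norm t" by (intro mult_right_mono) (auto simp: \<rho>_def)
      then have "c0 \<le> (cmod (H t))\<^sup>2 * norm t ^ ?k" using that by (intro Low) auto
      then show ?thesis by (simp add: c1_def H_def)
    qed
    show "c1 \<le> (cmod (\<integral>x. complex_of_real (f x) * cis (t \<bullet> x) \<partial>surface_measure K))\<^sup>2" if "norm t \<le> \<rho>" for t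
      using nz[OF that] by (simp add: H_def)
  qed (use f C L \<rho>1 d H0 in \<open>auto simp: c1_def \<rho>_def\<close>)
qed

end

section \<open>Averaging over modulations\<close>

text \<open>Written as an integral against counting measure, the unordered sum over \<Lambda> is
  open to Tonelli and dominated convergence.\<close>

lemma infsum_ennreal_eq_nn_integral:
  fixes f :: "'a \<Rightarrow> ennreal"
  assumes "countable A"
  shows "(\<Sum>\<^sub>\<infinity>x\<in>A. f x) = (\<integral>\<^sup>+x. f x \<partial>count_space A)"
proof (cases "finite A")
  case True
  then show ?thesis by (simp add: nn_integral_count_space_finite)
next
  case False
  have sup: "infsum f A = (SUP F\<in>{F. finite F \<and> F \<subseteq> A}. sum f F)"
    by (rule nonneg_infsum_complete) simp
  show ?thesis
  proof (rule antisym)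
    show "infsum f A \<le> (\<integral>\<^sup>+x. f x \<partial>count_space A)"
      unfolding sup
    proof (rule SUP_least)
      fix F assume F: "F \<in> {F. finite F \<and> F \<subseteq> A}"
      have "sum f F = (\<integral>\<^sup>+x. f x * indicator F x \<partial>count_space A)"
        using F by (subst nn_integral_count_space'[of F]) auto
      also have "\<dots> \<le> (\<integral>\<^sup>+x. f x \<partial>count_space A)"
        by (intro nn_integral_mono) (auto simp: indicator_def)
      finally show "sum f F \<le> (\<integral>\<^sup>+x. f x \<partial>count_space A)" .
    qed
    have bij: "bij_betw (from_nat_into A) UNIV A" by (rule bij_betw_from_nat_into[OF assms False])
    have "(\<integral>\<^sup>+x. f x \<partial>count_space A) = (\<Sum>n. f (from_nat_into A n))"
      by (simp add: nn_integral_bij_count_space[OF bij, symmetric] nn_integral_count_space_nat)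
    also have "\<dots> \<le> infsum f A"
    proof (rule suminf_le_const)
      fix n
      have "inj_on (from_nat_into A) {..<n}" using bij by (auto simp: bij_betw_def intro: inj_on_subset)
      then have "(\<Sum>i<n. f (from_nat_into A i)) = sum f (from_nat_into A ` {..<n})" by (simp add: sum.reindex)
      also have "\<dots> \<le> infsum f A" unfolding sup
        by (rule SUP_upper) (use bij in \<open>auto simp: bij_betw_def\<close>)
      finally show "(\<Sum>i<n. f (from_nat_into A i)) \<le> infsum f A" .
    qed simp
    finally show "(\<integral>\<^sup>+x. f x \<partial>count_space A) \<le> infsum f A" .
  qed
qed

section \<open>Averages of the radial weight over balls\<close>

lemma cball_borel [measurable]: "cball (x::'a::euclidean_space) R \<in> sets borel"
  by (simp add: borel_closed)

definition radial :: "'a::euclidean_space \<Rightarrow> real" where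
  "radial x = 1 / (1 + norm x) ^ (DIM('a) - 1)"

lemma radial_measurable [measurable]: "radial \<in> borel_measurable borel"
  unfolding radial_def[abs_def] by measurable

lemma radial_bounds: "0 < radial x" "radial x \<le> 1"
proof -
  have "1 ^ (DIM('a) - 1) \<le> (1 + norm x) ^ (DIM('a) - 1)" by (intro power_mono) auto
  then show "radial x \<le> 1" unfolding radial_def
    by (subst divide_le_eq_1_pos) (auto intro!: zero_less_power add_pos_nonneg)
  show "0 < radial x" by (auto simp: radial_def intro!: divide_pos_pos zero_less_power add_pos_nonneg)
qed

text \<open>Doubling the radius adds a shell on which the weight is at most 2^(-n(d-1)) and whose
  volume is of order 2^(nd). Its contribution is of order 2^n, as large as all previous ones
  together, so the mass grows linearly with the radius.\<close>

lemma nn_integral_radial_cball: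
  "(\<integral>\<^sup>+x. ennreal (radial x) * indicator (cball 0 (2 ^ n)) x \<partial>(lborel :: 'a::euclidean_space measure))
     \<le> ennreal (unit_ball_vol (real DIM('a)) * 2 ^ DIM('a) * 2 ^ n)"
proof (induction n)
  let ?V = "unit_ball_vol (real DIM('a))"
  case 0
  have "(\<integral>\<^sup>+x. ennreal (radial x) * indicator (cball 0 (2 ^ 0)) x \<partial>(lborel :: 'a measure)) \<le> (\<integral>\<^sup>+x. indicator (cball 0 1) x \<partial>(lborel :: 'a measure))"
    using radial_bounds by (intro nn_integral_mono) (auto simp: indicator_def ennreal_le_1)
  also have "\<dots> = ennreal ?V" by (simp add: emeasure_cball)
  also have "\<dots> \<le> ennreal (?V * 2 ^ DIM('a) * 2 ^ 0)" by (intro ennreal_leI) simp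
  finally show ?case .
next
  let ?V = "unit_ball_vol (real DIM('a))" and ?d = "DIM('a)" and ?k = "DIM('a) - 1"
  case (Suc n)
  have "(\<integral>\<^sup>+x. ennreal (radial x) * indicator (cball 0 (2 ^ Suc n)) x \<partial>(lborel :: 'a measure))
     \<le> (\<integral>\<^sup>+x. ennreal (radial x) * indicator (cball 0 (2 ^ n)) x + ennreal (1 / (2 ^ n) ^ ?k) * indicator (cball 0 (2 ^ Suc n)) x \<partial>(lborel :: 'a measure))"
  proof (rule nn_integral_mono)
    fix x :: 'a
    show "ennreal (radial x) * indicator (cball 0 (2 ^ Suc n)) x \<le> ennreal (radial x) * indicator (cball 0 (2 ^ n)) x + ennreal (1 / (2 ^ n) ^ ?k) * indicator (cball 0 (2 ^ Suc n)) x"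
    proof (cases "norm x \<le> 2 ^ n")
      case True
      then have "norm x \<le> 2 ^ Suc n" using order_trans[OF True, of "2 ^ Suc n"] by simp
      then show ?thesis using True by simp
    next
      case False
      have "(2 ^ n) ^ ?k \<le> (1 + norm x) ^ ?k" using False by (intro power_mono) auto
      then have "radial x \<le> 1 / (2 ^ n) ^ ?k" unfolding radial_def by (intro divide_left_mono) (auto intro!: mult_pos_pos zero_less_power add_pos_nonneg)
      then show ?thesis by (auto simp: indicator_def intro!: ennreal_leI)
    qed
  qed
  also have "\<dots> = (\<integral>\<^sup>+x. ennreal (radial x) * indicator (cball 0 (2 ^ n)) x \<partial>(lborel :: 'a measure)) + ennreal (1 / (2 ^ n) ^ ?k) * emeasure lborel (cball (0::'a) (2 ^ Suc n))"
  proof -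
    have "(\<lambda>x::'a. ennreal (radial x) * indicator (cball 0 (2 ^ n)) x) \<in> borel_measurable lborel"
      "(\<lambda>x::'a. ennreal (1 / (2 ^ n) ^ ?k) * indicator (cball 0 (2 ^ Suc n)) x) \<in> borel_measurable lborel"
      by measurable
    then show ?thesis by (simp only: nn_integral_add nn_integral_cmult_indicator) (simp add: nn_integral_cmult_indicator)
  qed
  also have "emeasure lborel (cball (0::'a) (2 ^ Suc n)) = ennreal (?V * (2 ^ Suc n) ^ ?d)"
    by (subst emeasure_cball) (auto simp: mult.commute)
  also have "ennreal (1 / (2 ^ n) ^ ?k) * ennreal (?V * (2 ^ Suc n) ^ ?d) = ennreal (?V * 2 ^ ?d * 2 ^ n)"
  proof -
    have "((2::real) ^ Suc n) ^ ?d = 2 ^ ?d * (2 ^ n * (2 ^ n) ^ ?k)"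
    proof -
      have "?d = Suc ?k" by simp
      then have "((2::real) ^ n) ^ ?d = 2 ^ n * (2 ^ n) ^ ?k" by (metis power_Suc)
      then show ?thesis by (simp add: power_mult_distrib)
    qed
    then have "1 / (2 ^ n) ^ ?k * (?V * (2 ^ Suc n) ^ ?d) = ?V * 2 ^ ?d * 2 ^ n" by simp
    then show ?thesis by (subst ennreal_mult'[symmetric]) auto
  qed
  also have "(\<integral>\<^sup>+x. ennreal (radial x) * indicator (cball 0 (2 ^ n)) x \<partial>(lborel :: 'a measure)) + ennreal (?V * 2 ^ ?d * 2 ^ n)
     \<le> ennreal (?V * 2 ^ ?d * 2 ^ n) + ennreal (?V * 2 ^ ?d * 2 ^ n)"
    by (intro add_right_mono Suc.IH)
  also have "\<dots> = ennreal (?V * 2 ^ ?d * 2 ^ Suc n)"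
    by (subst ennreal_plus[symmetric]) auto
  finally show ?case .
qed

definition ball_avg :: "nat \<Rightarrow> 'a::euclidean_space \<Rightarrow> ennreal" where
  "ball_avg n t = (\<integral>\<^sup>+s. ennreal (radial (s + t)) * indicator (cball 0 (2 ^ n)) s \<partial>lborel) / emeasure lborel (cball (0::'a) (2 ^ n))"

lemma ball_vol_pos_finite:
  "emeasure lborel (cball (0::'a::euclidean_space) (2 ^ n)) = ennreal (unit_ball_vol (real DIM('a)) * (2 ^ n) ^ DIM('a))"
  "0 < unit_ball_vol (real DIM('a)) * (2 ^ n) ^ DIM('a)"
  by (auto simp: emeasure_cball mult.commute)

lemma unit_ball_vol_neq_0: "unit_ball_vol (real n) \<noteq> 0"
  by (rule less_imp_neq[OF unit_ball_vol_pos, symmetric]) simp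

lemma ball_vol_neq:
  "emeasure lborel (cball (0::'a::euclidean_space) (2 ^ n)) \<noteq> 0"
  "emeasure lborel (cball (0::'a::euclidean_space) (2 ^ n)) \<noteq> top"
proof -
  have "0 < unit_ball_vol (real DIM('a)) * (2 ^ n) ^ DIM('a)" by (rule ball_vol_pos_finite(2))
  then show "emeasure lborel (cball (0::'a) (2 ^ n)) \<noteq> 0" "emeasure lborel (cball (0::'a) (2 ^ n)) \<noteq> top"
    unfolding ball_vol_pos_finite(1) by (simp_all only: ennreal_eq_0_iff not_le ennreal_neq_top not_False_eq_True)
qed

text \<open>The translated ball lies in the ball of radius 2^(n+2) around 0, where the weight has
  mass of order 2^n, while the volume divided by is of order 2^(nd).\<close>

lemma ball_avg_near:
  fixes t :: "'a::euclidean_space"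
  assumes "norm t \<le> 2 * 2 ^ n"
  shows "ball_avg n t \<le> ennreal (2 ^ DIM('a) * 4 / (2 ^ n) ^ (DIM('a) - 1))"
proof -
  let ?V = "unit_ball_vol (real DIM('a))" and ?d = "DIM('a)" and ?k = "DIM('a) - 1"
  have "(\<integral>\<^sup>+s. ennreal (radial (s + t)) * indicator (cball 0 (2 ^ n)) s \<partial>lborel)
     \<le> (\<integral>\<^sup>+s. (\<lambda>x. ennreal (radial x) * indicator (cball 0 (2 ^ (n + 2))) x) (t + s) \<partial>lborel)"
  proof (rule nn_integral_mono)
    fix s :: 'a
    have "norm (t + s) \<le> 2 ^ (n + 2)" if "norm s \<le> 2 ^ n"
    proof -
      have "norm (t + s) \<le> 2 * 2 ^ n + 2 ^ n" using norm_triangle_ineq[of t s] assms that by linarith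
      also have "\<dots> \<le> 2 ^ (n + 2)" by simp
      finally show ?thesis .
    qed
    then show "ennreal (radial (s + t)) * indicator (cball 0 (2 ^ n)) s \<le> (\<lambda>x. ennreal (radial x) * indicator (cball 0 (2 ^ (n + 2))) x) (t + s)"
      by (auto simp: indicator_def add.commute)
  qed
  also have "\<dots> = (\<integral>\<^sup>+x. ennreal (radial x) * indicator (cball 0 (2 ^ (n + 2))) x \<partial>distr lborel borel ((+) t))"
  proof -
    have "(\<lambda>x::'a. ennreal (radial x) * indicator (cball 0 (2 ^ (n + 2))) x) \<in> borel_measurable borel"
      by measurable
    then show ?thesis by (subst nn_integral_distr) (simp_all only:, simp_all)
  qed
  also have "\<dots> \<le> ennreal (?V * 2 ^ ?d * 2 ^ (n + 2))"
    unfolding lborel_distr_plus by (rule nn_integral_radial_cball)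
  finally have "ball_avg n t \<le> ennreal (?V * 2 ^ ?d * 2 ^ (n + 2)) / ennreal (?V * (2 ^ n) ^ ?d)"
    unfolding ball_avg_def ball_vol_pos_finite(1) by (rule divide_right_mono_ennreal)
  also have "\<dots> = ennreal (?V * 2 ^ ?d * 2 ^ (n + 2) / (?V * (2 ^ n) ^ ?d))"
    using ball_vol_pos_finite(2)[where 'a='a, of n] by (intro divide_ennreal) auto
  also have "?V * 2 ^ ?d * 2 ^ (n + 2) / (?V * (2 ^ n) ^ ?d) = 2 ^ ?d * 4 / (2 ^ n) ^ ?k"
  proof -
    have "?d = Suc ?k" by simp
    then have "((2::real) ^ n) ^ ?d = 2 ^ n * (2 ^ n) ^ ?k" by (metis power_Suc)
    moreover have "?V \<noteq> 0" by (rule unit_ball_vol_neq_0)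
    ultimately show ?thesis by (simp add: power_add)
  qed
  finally show ?thesis .
qed

text \<open>The majorant must not depend on n. For |t| \<le> 2 2^n the mean is of order 2^(-n(d-1)),
  which 1 + |t| \<le> 3 2^n converts into the weight at t; for larger t every point of the
  translated ball has norm at least |t|/2.\<close>

lemma ball_avg_le:
  fixes t :: "'a::euclidean_space"
  shows "ball_avg n t \<le> ennreal (2 ^ DIM('a) * 4 * 3 ^ (DIM('a) - 1) * radial t)"
proof (cases "norm t \<le> 2 * 2 ^ n")
  let ?d = "DIM('a)" and ?k = "DIM('a) - 1"
  case True
  have "(1 + norm t) ^ ?k \<le> (3 * 2 ^ n) ^ ?k"
  proof (intro power_mono)
    have "(1::real) \<le> 2 ^ n" by simp
    then show "1 + norm t \<le> 3 * 2 ^ n" using True by linarith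
  qed simp
  then have "(1 + norm t) ^ ?k \<le> 3 ^ ?k * (2 ^ n) ^ ?k" by (simp add: power_mult_distrib)
  then have "1 / (2 ^ n) ^ ?k \<le> 3 ^ ?k * radial t"
    unfolding radial_def by (simp add: field_simps add_pos_nonneg)
  then have "2 ^ ?d * 4 * (1 / (2 ^ n) ^ ?k) \<le> 2 ^ ?d * 4 * (3 ^ ?k * radial t)" by (rule mult_left_mono) simp
  then have "2 ^ ?d * 4 / (2 ^ n) ^ ?k \<le> 2 ^ ?d * 4 * 3 ^ ?k * radial t" by (simp add: mult.assoc)
  with ball_avg_near[OF True] show ?thesis by (meson ennreal_leI order_trans)
next
  let ?d = "DIM('a)" and ?k = "DIM('a) - 1"
  case False
  have "(\<integral>\<^sup>+s. ennreal (radial (s + t)) * indicator (cball 0 (2 ^ n)) s \<partial>lborel)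
     \<le> (\<integral>\<^sup>+s. ennreal (2 ^ ?k * radial t) * indicator (cball (0::'a) (2 ^ n)) s \<partial>lborel)"
  proof (rule nn_integral_mono)
    fix s :: 'a
    have "radial (s + t) \<le> 2 ^ ?k * radial t" if "norm s \<le> 2 ^ n"
    proof -
      have "norm t \<le> norm (s + t) + norm s" using norm_triangle_ineq4[of "s + t" s] by simp
      moreover define N where "N = (2::real) ^ n"
      ultimately have "1 + norm t \<le> 2 * (1 + norm (s + t))" using that False unfolding N_def[symmetric] by argo
      then have "(1 + norm t) ^ ?k \<le> (2 * (1 + norm (s + t))) ^ ?k" by (intro power_mono) auto
      then have "(1 + norm t) ^ ?k \<le> 2 ^ ?k * (1 + norm (s + t)) ^ ?k" unfolding power_mult_distrib .
      then show ?thesis unfolding radial_def by (simp add: field_simps add_pos_nonneg)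
    qed
    then show "ennreal (radial (s + t)) * indicator (cball 0 (2 ^ n)) s \<le> ennreal (2 ^ ?k * radial t) * indicator (cball (0::'a) (2 ^ n)) s"
      by (auto simp: indicator_def intro!: ennreal_leI)
  qed
  also have "\<dots> = ennreal (2 ^ ?k * radial t) * emeasure lborel (cball (0::'a) (2 ^ n))"
    by (simp add: nn_integral_cmult_indicator)
  finally have "ball_avg n t \<le> ennreal (2 ^ ?k * radial t) * emeasure lborel (cball (0::'a) (2 ^ n)) / emeasure lborel (cball (0::'a) (2 ^ n))"
    unfolding ball_avg_def by (rule divide_right_mono_ennreal)
  also have "\<dots> = ennreal (2 ^ ?k * radial t)"
    by (rule ennreal_mult_divide_eq[OF ball_vol_neq])
  also have "\<dots> \<le> ennreal (2 ^ ?d * 4 * 3 ^ ?k * radial t)"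
  proof (intro ennreal_leI mult_right_mono)
    have "(2::real) ^ ?k \<le> 2 ^ ?d" by (intro power_increasing) auto
    also have "\<dots> \<le> 2 ^ ?d * 4 * 3 ^ ?k"
    proof -
      have "1 \<le> 4 * (3::real) ^ ?k" using one_le_power[of "3::real" ?k] by linarith
      then show ?thesis using mult_left_mono[of 1 "4 * (3::real) ^ ?k" "2 ^ ?d"] by (simp add: mult.assoc)
    qed
    finally show "(2::real) ^ ?k \<le> 2 ^ ?d * 4 * 3 ^ ?k" .
    show "0 \<le> radial t" using radial_bounds(1)[of t] by simp
  qed
  finally show ?thesis .
qed

text \<open>For fixed t the near case eventually applies, and d \<ge> 2 makes the exponent d - 1
  positive.\<close>

lemma ball_avg_tendsto:
  fixes t :: "'a::euclidean_space"
  assumes d: "DIM('a) \<ge> 2"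
  shows "(\<lambda>n. ball_avg n t) \<longlonglongrightarrow> 0"
proof (rule tendsto_sandwich[where f="\<lambda>_. 0" and h="\<lambda>n. ennreal (2 ^ DIM('a) * 4 * (1/2) ^ n)"])
  let ?k = "DIM('a) - 1"
  obtain N where N: "norm t < 2 ^ N" using real_arch_pow[of 2] by auto
  have "ball_avg n t \<le> ennreal (2 ^ DIM('a) * 4 * (1/2) ^ n)" if "N \<le> n" for n
  proof -
    have "(2::real) ^ N \<le> 2 ^ n" using that by (intro power_increasing) auto
    then have "norm t \<le> 2 * 2 ^ n" using N norm_ge_zero[of t] by linarith
    from ball_avg_near[OF this] have "ball_avg n t \<le> ennreal (2 ^ DIM('a) * 4 / (2 ^ n) ^ ?k)" .
    also have "\<dots> \<le> ennreal (2 ^ DIM('a) * 4 * (1/2) ^ n)"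
    proof (rule ennreal_leI)
      have "((2::real) ^ n) ^ 1 \<le> (2 ^ n) ^ ?k" using d by (intro power_increasing) auto
      then have "2 ^ DIM('a) * 4 / (2 ^ n) ^ ?k \<le> 2 ^ DIM('a) * 4 / (2::real) ^ n"
        by (intro divide_left_mono) auto
      then show "2 ^ DIM('a) * 4 / (2 ^ n) ^ ?k \<le> 2 ^ DIM('a) * 4 * (1/2::real) ^ n" by (simp add: power_divide)
    qed
    finally show ?thesis .
  qed
  then show "\<forall>\<^sub>F n in sequentially. ball_avg n t \<le> ennreal (2 ^ DIM('a) * 4 * (1/2) ^ n)"
    by (auto simp: eventually_sequentially)
  have "(\<lambda>n. 2 ^ DIM('a) * 4 * (1/2::real) ^ n) \<longlonglongrightarrow> 2 ^ DIM('a) * 4 * 0"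
    by (intro tendsto_intros LIMSEQ_power_zero) simp
  then show "(\<lambda>n. ennreal (2 ^ DIM('a) * 4 * (1/2) ^ n)) \<longlonglongrightarrow> 0"
    using tendsto_ennrealI by fastforce
qed auto

section \<open>The frame inequalities for modulated densities\<close>

lemma fourier_coefficient_modulated:
  "fourier_coefficient \<mu> (\<lambda>x. complex_of_real (f x) * cis (s \<bullet> x)) \<xi>
     = (\<integral>x. complex_of_real (f x) * cis ((s + (- 2 * pi) *\<^sub>R \<xi>) \<bullet> x) \<partial>\<mu>)"
  unfolding fourier_coefficient_def
proof (intro Bochner_Integration.integral_cong refl)
  fix x
  have "exp (- 2 * complex_of_real pi * \<i> * complex_of_real (\<xi> \<bullet> x)) = cis (- 2 * pi * (\<xi> \<bullet> x))"
    by (simp add: cis_conv_exp mult_ac)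
  then show "complex_of_real (f x) * cis (s \<bullet> x) * exp (- 2 * complex_of_real pi * \<i> * complex_of_real (\<xi> \<bullet> x)) =
     complex_of_real (f x) * cis ((s + (- 2 * pi) *\<^sub>R \<xi>) \<bullet> x)"
    by (simp only: mult.assoc cis_mult inner_add_left inner_scaleR_left)
qed

text \<open>Everything about the surface is condensed into the assumption on directions, so that the
  contradiction involves only the frame inequalities and averages of a radial weight.\<close>

lemma no_fourier_frame:
  fixes \<mu> :: "'a::euclidean_space measure"
  assumes sets: "sets \<mu> = sets borel" and d: "DIM('a) \<ge> 2"
    and patch: "\<And>\<theta>. norm \<theta> = 1 \<Longrightarrow> \<exists>f C c0 \<rho> T0. f \<in> borel_measurable borel \<and>
      integrable \<mu> (\<lambda>x. (f x)\<^sup>2) \<and> 0 < (\<integral>x. (f x)\<^sup>2 \<partial>\<mu>) \<and> C > 0 \<and>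
      (\<forall>t. (cmod (\<integral>x. complex_of_real (f x) * cis (t \<bullet> x) \<partial>\<mu>))\<^sup>2 * (1 + norm t) ^ (DIM('a) - 1) \<le> C) \<and>
      c0 > 0 \<and> \<rho> > 0 \<and> T0 > 0 \<and>
      (\<forall>t. T0 \<le> norm t \<longrightarrow> norm (t - norm t *\<^sub>R \<theta>) \<le> \<rho> * norm t \<longrightarrow>
         c0 \<le> (cmod (\<integral>x. complex_of_real (f x) * cis (t \<bullet> x) \<partial>\<mu>))\<^sup>2 * norm t ^ (DIM('a) - 1)) \<and>
      (\<forall>t. norm t \<le> \<rho> \<longrightarrow> c0 \<le> (cmod (\<integral>x. complex_of_real (f x) * cis (t \<bullet> x) \<partial>\<mu>))\<^sup>2)"
  shows "\<not> admits_fourier_frame \<mu>"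
proof
  let ?k = "DIM('a) - 1" and ?S = "{\<theta>::'a. norm \<theta> = 1}"
  assume "admits_fourier_frame \<mu>"
  then obtain \<Lambda> A B where \<Lambda>: "countable \<Lambda>" and AB: "0 < A" "A \<le> B" and
    frame: "\<And>f. square_integrable \<mu> f \<Longrightarrow> ennreal (A * (LINT x|\<mu>. (cmod (f x))\<^sup>2)) \<le> (\<Sum>\<^sub>\<infinity>\<xi>\<in>\<Lambda>. ennreal ((cmod (fourier_coefficient \<mu> f \<xi>))\<^sup>2)) \<and>
      (\<Sum>\<^sub>\<infinity>\<xi>\<in>\<Lambda>. ennreal ((cmod (fourier_coefficient \<mu> f \<xi>))\<^sup>2)) \<le> ennreal (B * (LINT x|\<mu>. (cmod (f x))\<^sup>2))"
    unfolding admits_fourier_frame_def by blast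
  define H where "H f t = (cmod (\<integral>x. complex_of_real (f x) * cis (t \<bullet> x) \<partial>\<mu>))\<^sup>2" for f :: "'a \<Rightarrow> real" and t
  \<comment> \<open>The frame exponentials carry the factor -2 \<pi>, the transforms here do not.
    Modulation by s then moves the frequency T \<xi> to s + T \<xi>.\<close>
  define T where "T \<xi> = (- 2 * pi) *\<^sub>R \<xi>" for \<xi> :: 'a
  have fr: "ennreal (A * (\<integral>x. (f x)\<^sup>2 \<partial>\<mu>)) \<le> (\<integral>\<^sup>+\<xi>. ennreal (H f (s + T \<xi>)) \<partial>count_space \<Lambda>)"
    "(\<integral>\<^sup>+\<xi>. ennreal (H f (s + T \<xi>)) \<partial>count_space \<Lambda>) \<le> ennreal (B * (\<integral>x. (f x)\<^sup>2 \<partial>\<mu>))"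
    if f: "f \<in> borel_measurable borel" "integrable \<mu> (\<lambda>x. (f x)\<^sup>2)" for f s
  proof -
    have m: "(\<lambda>x. complex_of_real (f x) * cis (s \<bullet> x)) \<in> borel_measurable \<mu>"
    proof -
      have "(\<lambda>x. complex_of_real (f x) * cis (s \<bullet> x)) \<in> borel_measurable borel" using f(1) by measurable
      then show ?thesis using measurable_cong_sets[OF sets refl] by blast
    qed
    have n: "(cmod (complex_of_real (f x) * cis (s \<bullet> x)))\<^sup>2 = (f x)\<^sup>2" for x by (simp add: norm_mult)
    have "square_integrable \<mu> (\<lambda>x. complex_of_real (f x) * cis (s \<bullet> x))"
      unfolding square_integrable_def n using m f(2) by simp
    from frame[OF this] show "ennreal (A * (\<integral>x. (f x)\<^sup>2 \<partial>\<mu>)) \<le> (\<integral>\<^sup>+\<xi>. ennreal (H f (s + T \<xi>)) \<partial>count_space \<Lambda>)"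
      "(\<integral>\<^sup>+\<xi>. ennreal (H f (s + T \<xi>)) \<partial>count_space \<Lambda>) \<le> ennreal (B * (\<integral>x. (f x)\<^sup>2 \<partial>\<mu>))"
      unfolding n infsum_ennreal_eq_nn_integral[OF \<Lambda>] fourier_coefficient_modulated H_def T_def by simp_all
  qed
  have fin: "(\<integral>\<^sup>+\<xi>. ennreal (H f (s + T \<xi>)) \<partial>count_space \<Lambda>) < \<infinity>"
    if "f \<in> borel_measurable borel" "integrable \<mu> (\<lambda>x. (f x)\<^sup>2)" for f s
    by (rule le_less_trans[OF fr(2)[OF that]]) simp
  obtain F C c0 \<rho> T0 where P: "\<And>\<theta>. \<theta> \<in> ?S \<Longrightarrow> F \<theta> \<in> borel_measurable borel"
      "\<And>\<theta>. \<theta> \<in> ?S \<Longrightarrow> integrable \<mu> (\<lambda>x. (F \<theta> x)\<^sup>2)" "\<And>\<theta>. \<theta> \<in> ?S \<Longrightarrow> 0 < (\<integral>x. (F \<theta> x)\<^sup>2 \<partial>\<mu>)"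
      "\<And>\<theta>. \<theta> \<in> ?S \<Longrightarrow> C \<theta> > 0" "\<And>\<theta> t. \<theta> \<in> ?S \<Longrightarrow> H (F \<theta>) t * (1 + norm t) ^ ?k \<le> C \<theta>"
      "\<And>\<theta>. \<theta> \<in> ?S \<Longrightarrow> c0 \<theta> > 0" "\<And>\<theta>. \<theta> \<in> ?S \<Longrightarrow> \<rho> \<theta> > 0" "\<And>\<theta>. \<theta> \<in> ?S \<Longrightarrow> T0 \<theta> > 0"
      "\<And>\<theta> t. \<theta> \<in> ?S \<Longrightarrow> T0 \<theta> \<le> norm t \<Longrightarrow> norm (t - norm t *\<^sub>R \<theta>) \<le> \<rho> \<theta> * norm t \<Longrightarrow> c0 \<theta> \<le> H (F \<theta>) t * norm t ^ ?k"
      "\<And>\<theta> t. \<theta> \<in> ?S \<Longrightarrow> norm t \<le> \<rho> \<theta> \<Longrightarrow> c0 \<theta> \<le> H (F \<theta>) t"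
  proof -
    have "\<forall>\<theta>\<in>?S. \<exists>q. case q of (f, C, c0, \<rho>, T0) \<Rightarrow> f \<in> borel_measurable borel \<and>
      integrable \<mu> (\<lambda>x. (f x)\<^sup>2) \<and> 0 < (\<integral>x. (f x)\<^sup>2 \<partial>\<mu>) \<and> C > 0 \<and>
      (\<forall>t. H f t * (1 + norm t) ^ ?k \<le> C) \<and> c0 > 0 \<and> \<rho> > 0 \<and> T0 > 0 \<and>
      (\<forall>t. T0 \<le> norm t \<longrightarrow> norm (t - norm t *\<^sub>R \<theta>) \<le> \<rho> * norm t \<longrightarrow> c0 \<le> H f t * norm t ^ ?k) \<and>
      (\<forall>t. norm t \<le> \<rho> \<longrightarrow> c0 \<le> H f t)"
      using patch unfolding H_def by (simp add: split_paired_Ex)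
    from bchoice[OF this] obtain q where q: "\<forall>\<theta>\<in>?S. case q \<theta> of (f, C, c0, \<rho>, T0) \<Rightarrow> f \<in> borel_measurable borel \<and>
      integrable \<mu> (\<lambda>x. (f x)\<^sup>2) \<and> 0 < (\<integral>x. (f x)\<^sup>2 \<partial>\<mu>) \<and> C > 0 \<and>
      (\<forall>t. H f t * (1 + norm t) ^ ?k \<le> C) \<and> c0 > 0 \<and> \<rho> > 0 \<and> T0 > 0 \<and>
      (\<forall>t. T0 \<le> norm t \<longrightarrow> norm (t - norm t *\<^sub>R \<theta>) \<le> \<rho> * norm t \<longrightarrow> c0 \<le> H f t * norm t ^ ?k) \<and>
      (\<forall>t. norm t \<le> \<rho> \<longrightarrow> c0 \<le> H f t)" by blast
    show thesis
      by (rule that[of "\<lambda>\<theta>. fst (q \<theta>)" "\<lambda>\<theta>. fst (snd (q \<theta>))" "\<lambda>\<theta>. fst (snd (snd (q \<theta>)))"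
            "\<lambda>\<theta>. fst (snd (snd (snd (q \<theta>))))" "\<lambda>\<theta>. snd (snd (snd (snd (q \<theta>))))"])
        (use q in \<open>auto simp: split_beta\<close>)
  qed
  obtain \<theta>0 :: 'a where \<theta>0: "\<theta>0 \<in> ?S" using SOME_Basis norm_Basis by blast
  obtain \<Theta> where \<Theta>: "finite \<Theta>" "\<Theta> \<subseteq> ?S" "?S \<subseteq> (\<Union>\<theta>\<in>\<Theta>. ball \<theta> (\<rho> \<theta>))"
  proof -
    have "compact ?S" using compact_sphere[of "0::'a" 1] by (simp add: sphere_def)
    then show thesis
      by (rule compactE_image[of ?S ?S "\<lambda>\<theta>. ball \<theta> (\<rho> \<theta>)"]) (use P(7) that in auto)
  qed
  define R0 where "R0 = Max (insert 1 (T0 ` \<Theta>))"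
  have R0: "1 \<le> R0" "\<And>\<theta>. \<theta> \<in> \<Theta> \<Longrightarrow> T0 \<theta> \<le> R0" using \<Theta>(1) by (auto simp: R0_def)
  \<comment> \<open>For |t| < R0 the cones say nothing. Modulation by -s moves the lower bound near
    frequency 0 to frequencies near s, so finitely many modulations of one density cover this
    ball.\<close>
  obtain J :: "'a set" where J: "finite J" "cball 0 R0 \<subseteq> (\<Union>s\<in>J. ball s (\<rho> \<theta>0))"
    by (rule compactE_image[of "cball (0::'a) R0" "cball 0 R0" "\<lambda>s. ball s (\<rho> \<theta>0)"]) (use P(7)[OF \<theta>0] in auto)
  \<comment> \<open>\<open>0 + t\<close> is the shift by s = 0, so that both sums have the form in
    which the frame bounds are stated.\<close>
  define W where "W t = (\<Sum>\<theta>\<in>\<Theta>. ennreal (1 / c0 \<theta>) * ennreal (H (F \<theta>) (0 + t))) + (\<Sum>s\<in>J. ennreal (1 / c0 \<theta>0) * ennreal (H (F \<theta>0) (- s + t)))" for t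
  have W: "ennreal (radial t) \<le> W t" for t
  proof (cases "norm t \<ge> R0")
    case True
    then have t: "norm t > 0" using R0(1) by linarith
    then have "t /\<^sub>R norm t \<in> ?S" by simp
    then have "t /\<^sub>R norm t \<in> (\<Union>\<theta>\<in>\<Theta>. ball \<theta> (\<rho> \<theta>))" using \<Theta>(3) by blast
    then obtain \<theta> where \<theta>: "\<theta> \<in> \<Theta>" "norm (\<theta> - t /\<^sub>R norm t) < \<rho> \<theta>" unfolding UN_iff mem_ball dist_norm by blast
    have S: "\<theta> \<in> ?S" using \<theta> \<Theta>(2) by blast
    have "t - norm t *\<^sub>R \<theta> = (- norm t) *\<^sub>R (\<theta> - t /\<^sub>R norm t)" using t by (simp add: algebra_simps)
    then have "norm (t - norm t *\<^sub>R \<theta>) = norm t * norm (\<theta> - t /\<^sub>R norm t)" by simp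
    also have "\<dots> \<le> \<rho> \<theta> * norm t" using \<theta>(2) t by (simp add: mult.commute)
    finally have "c0 \<theta> \<le> H (F \<theta>) t * norm t ^ ?k" using R0(2)[OF \<theta>(1)] True by (intro P(9)[OF S]) auto
    then have "1 / norm t ^ ?k \<le> 1 / c0 \<theta> * H (F \<theta>) t" using P(6)[OF S] t by (simp add: field_simps)
    moreover have "radial t \<le> 1 / norm t ^ ?k" unfolding radial_def using t
      by (intro divide_left_mono power_mono) (auto intro!: mult_pos_pos zero_less_power add_pos_nonneg)
    ultimately have "ennreal (radial t) \<le> ennreal (1 / c0 \<theta> * H (F \<theta>) t)" by (intro ennreal_leI) linarith
    also have "\<dots> = ennreal (1 / c0 \<theta>) * ennreal (H (F \<theta>) (0 + t))"
      using P(6)[OF S] by (simp add: ennreal_mult'[symmetric])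
    also have "\<dots> \<le> (\<Sum>\<theta>\<in>\<Theta>. ennreal (1 / c0 \<theta>) * ennreal (H (F \<theta>) (0 + t)))"
      using \<theta>(1) \<Theta>(1) by (intro member_le_sum) auto
    also have "\<dots> \<le> W t" by (simp add: W_def)
    finally show ?thesis .
  next
    case False
    then obtain s where s: "s \<in> J" "norm (s - t) < \<rho> \<theta>0" using J(2) by (force simp: dist_norm)
    have "c0 \<theta>0 \<le> H (F \<theta>0) (- s + t)" using s(2) by (intro P(10)[OF \<theta>0]) (simp add: norm_minus_commute)
    then have "1 \<le> 1 / c0 \<theta>0 * H (F \<theta>0) (- s + t)" using P(6)[OF \<theta>0] by simp
    then have "ennreal (radial t) \<le> ennreal (1 / c0 \<theta>0 * H (F \<theta>0) (- s + t))"
      using radial_bounds(2)[of t] by (intro ennreal_leI) linarith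
    also have "\<dots> = ennreal (1 / c0 \<theta>0) * ennreal (H (F \<theta>0) (- s + t))"
      using P(6)[OF \<theta>0] by (subst ennreal_mult') auto
    also have "\<dots> \<le> (\<Sum>s\<in>J. ennreal (1 / c0 \<theta>0) * ennreal (H (F \<theta>0) (- s + t)))"
      using s(1) J(1) by (intro member_le_sum) auto
    also have "\<dots> \<le> W t" by (simp add: W_def)
    finally show ?thesis .
  qed
  have finW: "(\<integral>\<^sup>+\<xi>. ennreal (radial (T \<xi>)) \<partial>count_space \<Lambda>) < \<infinity>"
  proof -
    have "(\<integral>\<^sup>+\<xi>. ennreal (radial (T \<xi>)) \<partial>count_space \<Lambda>) \<le> (\<integral>\<^sup>+\<xi>. W (T \<xi>) \<partial>count_space \<Lambda>)"
      by (intro nn_integral_mono W)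
    also have "\<dots> = (\<Sum>\<theta>\<in>\<Theta>. ennreal (1 / c0 \<theta>) * (\<integral>\<^sup>+\<xi>. ennreal (H (F \<theta>) (0 + T \<xi>)) \<partial>count_space \<Lambda>))
       + (\<Sum>s\<in>J. ennreal (1 / c0 \<theta>0) * (\<integral>\<^sup>+\<xi>. ennreal (H (F \<theta>0) (- s + T \<xi>)) \<partial>count_space \<Lambda>))"
      unfolding W_def by (simp only: nn_integral_add nn_integral_sum nn_integral_cmult borel_measurable_count_space)
    also have "\<dots> < \<infinity>"
    proof -
      have lt: "ennreal (1 / c0 \<theta>) * (\<integral>\<^sup>+\<xi>. ennreal (H (F \<theta>) (s + T \<xi>)) \<partial>count_space \<Lambda>) < top" if "\<theta> \<in> ?S" for \<theta> s
        using fin[OF P(1,2)[OF that], of s] by (simp add: ennreal_mult_less_top)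
      have "(\<Sum>\<theta>\<in>\<Theta>. ennreal (1 / c0 \<theta>) * (\<integral>\<^sup>+\<xi>. ennreal (H (F \<theta>) (0 + T \<xi>)) \<partial>count_space \<Lambda>)) < top"
        using \<Theta>(2) by (subst ennreal_sum_less_top[OF \<Theta>(1)]) (intro ballI lt, blast)
      moreover have "(\<Sum>s\<in>J. ennreal (1 / c0 \<theta>0) * (\<integral>\<^sup>+\<xi>. ennreal (H (F \<theta>0) (- s + T \<xi>)) \<partial>count_space \<Lambda>)) < top"
        by (subst ennreal_sum_less_top[OF J(1)]) (intro ballI lt \<theta>0)
      ultimately show ?thesis unfolding infinity_ennreal_def ennreal_add_less_top by (rule conjI)
    qed
    finally show ?thesis .
  qed
  let ?f = "F \<theta>0"
  let ?q = "\<integral>x. (?f x)\<^sup>2 \<partial>\<mu>"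
  have low: "ennreal (A * ?q) \<le> ennreal (C \<theta>0) * (\<integral>\<^sup>+\<xi>. ball_avg n (T \<xi>) \<partial>count_space \<Lambda>)" for n
  proof -
    let ?B = "cball (0::'a) (2 ^ n)"
    have Hr: "H ?f t \<le> C \<theta>0 * radial t" for t
      using P(5)[OF \<theta>0, of t] by (simp add: radial_def le_divide_eq add_pos_nonneg)
    have pt: "ennreal (A * ?q) \<le> (\<integral>\<^sup>+\<xi>. ennreal (C \<theta>0) * ennreal (radial (s + T \<xi>)) \<partial>count_space \<Lambda>)" for s
    proof -
      have "ennreal (H ?f (s + T \<xi>)) \<le> ennreal (C \<theta>0) * ennreal (radial (s + T \<xi>))" for \<xi>
        using ennreal_leI[OF Hr] P(4)[OF \<theta>0] by (simp add: ennreal_mult')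
      then show ?thesis
        by (intro order_trans[OF fr(1)[OF P(1,2)[OF \<theta>0], of s] nn_integral_mono]) auto
    qed
    \<comment> \<open>The lower frame bound, with the transform replaced by its radial majorant, is
      integrated over the shifts s in a ball. Exchanging sum and integral leaves a ball average at
      each frequency.\<close>
    have "ennreal (A * ?q) * emeasure lborel ?B = (\<integral>\<^sup>+s. ennreal (A * ?q) * indicator ?B s \<partial>lborel)"
      by (simp add: nn_integral_cmult_indicator)
    also have "\<dots> \<le> (\<integral>\<^sup>+s. (\<integral>\<^sup>+\<xi>. ennreal (C \<theta>0) * (ennreal (radial (s + T \<xi>)) * indicator ?B s) \<partial>count_space \<Lambda>) \<partial>lborel)"
      by (intro nn_integral_mono) (use pt in \<open>auto simp: indicator_def\<close>)
    also have "\<dots> = (\<integral>\<^sup>+\<xi>. (\<integral>\<^sup>+s. ennreal (C \<theta>0) * (ennreal (radial (s + T \<xi>)) * indicator ?B s) \<partial>lborel) \<partial>count_space \<Lambda>)"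
      by (rule nn_integral_count_space_nn_integral[OF \<Lambda>]) measurable
    also have "\<dots> = (\<integral>\<^sup>+\<xi>. (ennreal (C \<theta>0) * emeasure lborel ?B) * ball_avg n (T \<xi>) \<partial>count_space \<Lambda>)"
    proof (intro nn_integral_cong)
      fix \<xi>
      have v: "emeasure lborel ?B \<noteq> 0" "emeasure lborel ?B \<noteq> top"
        by (rule ball_vol_neq)+
      have "(\<integral>\<^sup>+s. ennreal (radial (s + T \<xi>)) * indicator ?B s \<partial>lborel) = emeasure lborel ?B * ball_avg n (T \<xi>)"
        unfolding ball_avg_def using v by (simp add: ennreal_times_divide mult.commute[of "emeasure lborel ?B"] ennreal_mult_divide_eq)
      then show "(\<integral>\<^sup>+s. ennreal (C \<theta>0) * (ennreal (radial (s + T \<xi>)) * indicator ?B s) \<partial>lborel) = (ennreal (C \<theta>0) * emeasure lborel ?B) * ball_avg n (T \<xi>)"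
        by (subst nn_integral_cmult) (auto simp: mult.assoc)
    qed
    also have "\<dots> = emeasure lborel ?B * (ennreal (C \<theta>0) * (\<integral>\<^sup>+\<xi>. ball_avg n (T \<xi>) \<partial>count_space \<Lambda>))"
      by (subst nn_integral_cmult) (auto simp: mult_ac)
    finally have "emeasure lborel ?B * ennreal (A * ?q) \<le> emeasure lborel ?B * (ennreal (C \<theta>0) * (\<integral>\<^sup>+\<xi>. ball_avg n (T \<xi>) \<partial>count_space \<Lambda>))"
      by (simp add: mult.commute)
    then show ?thesis
      using ball_vol_neq[where 'a='a, of n] by (simp add: ennreal_mult_le_mult_iff)
  qed
  have "(\<lambda>n. \<integral>\<^sup>+\<xi>. ball_avg n (T \<xi>) \<partial>count_space \<Lambda>) \<longlonglongrightarrow> (\<integral>\<^sup>+\<xi>. 0 \<partial>count_space \<Lambda>)"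
  proof (rule nn_integral_dominated_convergence[where w="\<lambda>\<xi>. ennreal (2 ^ DIM('a) * 4 * 3 ^ ?k) * ennreal (radial (T \<xi>))"])
    show "AE \<xi> in count_space \<Lambda>. ball_avg n (T \<xi>) \<le> ennreal (2 ^ DIM('a) * 4 * 3 ^ ?k) * ennreal (radial (T \<xi>))" for n
      using ball_avg_le[of n] by (intro AE_I2) (simp add: ennreal_mult')
    show "(\<integral>\<^sup>+\<xi>. ennreal (2 ^ DIM('a) * 4 * 3 ^ ?k) * ennreal (radial (T \<xi>)) \<partial>count_space \<Lambda>) < \<infinity>"
      using finW by (subst nn_integral_cmult) (auto simp: ennreal_mult_less_top)
    show "AE \<xi> in count_space \<Lambda>. (\<lambda>n. ball_avg n (T \<xi>)) \<longlonglongrightarrow> 0"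
      by (intro AE_I2 ball_avg_tendsto d)
  qed auto
  then have "(\<lambda>n. ennreal (C \<theta>0) * (\<integral>\<^sup>+\<xi>. ball_avg n (T \<xi>) \<partial>count_space \<Lambda>)) \<longlonglongrightarrow> ennreal (C \<theta>0) * 0"
    by (intro ennreal_tendsto_cmult) auto
  then have "ennreal (A * ?q) \<le> 0"
    by (intro tendsto_lowerbound[of _ _ sequentially]) (use low in \<open>auto intro: always_eventually\<close>)
  moreover have "A * ?q > 0" using AB(1) P(3)[OF \<theta>0] by simp
  ultimately show False by (simp add: ennreal_eq_0_iff)
qed

section \<open>The boundary as a graph\<close>

text \<open>\<open>p\<close> minimises the linear function x \<bullet> Q e over \<open>K\<close>, so
  Q e is the inner normal there; \<open>U\<close> and \<phi> are the local data of the smooth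
  boundary at \<open>p\<close>.\<close>

locale boundary_point =
  fixes K :: "'a::euclidean_space set" and p :: 'a and Q :: "'a \<Rightarrow> 'a" and e :: 'a
    and U :: "'a set" and \<phi> :: "'a \<Rightarrow> real"
  assumes K: "convex_body K" and e: "e \<in> Basis" and Q: "orthogonal_transformation Q"
    and pK: "p \<in> K" and p_min: "\<And>x. x \<in> K \<Longrightarrow> p \<bullet> Q e \<le> x \<bullet> Q e"
    and U: "open U" "p \<in> U" and smooth: "smooth_on U \<phi>"
    and regular: "\<And>x. x \<in> U \<Longrightarrow> frechet_derivative \<phi> (at x) \<noteq> (\<lambda>_. 0)"
    and zero_set: "frontier K \<inter> U = {x \<in> U. \<phi> x = 0}"
begin

abbreviation \<theta> :: 'a where "\<theta> \<equiv> Q e"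
abbreviation D :: "'a \<Rightarrow> 'a \<Rightarrow> real" where "D x \<equiv> frechet_derivative \<phi> (at x)"

lemma linear_Q: "linear Q"
  using Q by (simp add: orthogonal_transformation_def)

lemma inner_Q: "Q x \<bullet> Q y = x \<bullet> y"
  using Q by (simp add: orthogonal_transformation_def)

lemma norm_Q: "norm (Q x) = norm x"
  using Q by (simp add: orthogonal_transformation_norm)

lemma inner_\<theta>: "\<theta> \<bullet> \<theta> = 1"
  using e by (simp add: inner_Q)

lemma convex_K: "convex K" and compact_K: "compact K" and interior_K: "interior K \<noteq> {}"
  using K by (auto simp: convex_body_def)

lemma closed_K: "closed K"
  using compact_K by (rule compact_imp_closed)

lemma frontier_K: "frontier K = K - interior K"
  using closed_K by (simp add: frontier_def)

lemma smooth_has_derivative: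
  fixes G :: "'a \<Rightarrow> real"
  assumes "smooth_on U G" "x \<in> U"
  shows "(G has_derivative frechet_derivative G (at x)) (at x)"
proof -
  have "C_k_on (Suc 0) U G" using assms(1) by (auto simp: smooth_on_def)
  then have "G differentiable (at x)" using assms(2) by simp
  then show ?thesis by (simp add: frechet_derivative_works)
qed

lemma smooth_frechet:
  fixes G :: "'a \<Rightarrow> real"
  assumes "smooth_on U G"
  shows "smooth_on U (\<lambda>x. frechet_derivative G (at x) v)"
  unfolding smooth_on_def
proof
  fix k
  have "C_k_on (Suc k) U G" using assms by (auto simp: smooth_on_def)
  then show "C_k_on k U (\<lambda>x. frechet_derivative G (at x) v)" by simp
qed

lemma smooth_continuous: "smooth_on U G \<Longrightarrow> continuous_on U G"
  using smooth_on_def[of U G] C_k_on.simps(1) by blast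

lemma \<phi>_deriv: "x \<in> U \<Longrightarrow> (\<phi> has_derivative D x) (at x)"
  by (rule smooth_has_derivative[OF smooth])

lemma linear_D: "x \<in> U \<Longrightarrow> linear (D x)"
  using has_derivative_linear[OF \<phi>_deriv] .

section \<open>The tangent hyperplane at the support point\<close>

lemma interior_below:
  assumes "x \<in> interior K"
  obtains \<delta> where "\<delta> > 0" "x - \<delta> *\<^sub>R \<theta> \<in> K"
proof -
  obtain d where d: "d > 0" "ball x d \<subseteq> K" using assms by (auto simp: mem_interior)
  have "x - (d / 2) *\<^sub>R \<theta> \<in> ball x d" using d(1) e by (simp add: dist_norm norm_Q)
  then have "x - (d / 2) *\<^sub>R \<theta> \<in> K" using d(2) by blast
  then show thesis using that[of "d / 2"] d(1) by simp
qed

lemma p_frontier: "p \<in> frontier K"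
proof (rule ccontr)
  assume "p \<notin> frontier K"
  then have "p \<in> interior K" using pK by (simp add: frontier_K)
  then obtain \<delta> where \<delta>: "\<delta> > 0" "p - \<delta> *\<^sub>R \<theta> \<in> K" by (rule interior_below)
  from p_min[OF \<delta>(2)] have "\<delta> \<le> 0" by (simp add: inner_diff_left inner_\<theta>)
  with \<delta> show False by simp
qed

lemma \<phi>_p: "\<phi> p = 0"
  using zero_set p_frontier U by auto

text \<open>Since \<phi> is o(|s|) at p + s v, moving this point by \<eta> |s| to either side along
  a transversal vector n makes \<phi> change sign. The intermediate value theorem yields a zero of
  \<phi>, which is a boundary point.\<close>

lemma tangent_approximation:
  assumes v: "D p v = 0" and \<epsilon>: "\<epsilon> > 0"
  obtains s0 where "s0 > 0" "\<And>s. \<bar>s\<bar> < s0 \<Longrightarrow> \<exists>x\<in>K. norm (x - (p + s *\<^sub>R v)) \<le> \<epsilon> * \<bar>s\<bar>"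
proof -
  interpret D: linear "D p" by (rule linear_D[OF U(2)])
  obtain n0 where n0: "D p n0 \<noteq> 0" using regular[OF U(2)] by auto
  define n where "n = n0 /\<^sub>R D p n0"
  have n: "D p n = 1" using n0 by (simp add: n_def D.scaleR)
  then have nn: "norm n > 0" using D.zero by force
  define \<eta> where "\<eta> = \<epsilon> / norm n"
  have \<eta>: "\<eta> > 0" using \<epsilon> nn by (simp add: \<eta>_def)
  \<comment> \<open>\<open>L\<close> bounds |Y t - p| / |s| for |t| \<le> 1; the accuracy \<eta> /
    (2 L) then leaves an error of at most half the shift \<eta> |s|.\<close>
  define L where "L = norm v + \<eta> * norm n + 1"
  have L: "L > 0" unfolding L_def using \<eta> nn by (intro add_nonneg_pos add_nonneg_nonneg) auto
  have "\<eta> / (2 * L) > 0" using \<eta> L by simp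
  then obtain d1 where d1: "d1 > 0" "\<And>y. norm (y - p) < d1 \<Longrightarrow> norm (\<phi> y - \<phi> p - D p (y - p)) \<le> \<eta> / (2 * L) * norm (y - p)"
    using \<phi>_deriv[OF U(2)] unfolding has_derivative_at_alt by blast
  obtain d2 where d2: "d2 > 0" "ball p d2 \<subseteq> U" using U by (meson openE)
  define s0 where "s0 = min d1 d2 / L"
  have s0: "s0 > 0" using d1 d2 L by (simp add: s0_def)
  have "\<exists>x\<in>K. norm (x - (p + s *\<^sub>R v)) \<le> \<epsilon> * \<bar>s\<bar>" if s: "\<bar>s\<bar> < s0" for s
  proof (cases "s = 0")
    case True
    then show ?thesis using pK by (intro bexI[of _ p]) auto
  next
    case False
    define Y where "Y t = p + s *\<^sub>R v + (t * (\<eta> * \<bar>s\<bar>)) *\<^sub>R n" for t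
    have Yp: "norm (Y t - p) \<le> \<bar>s\<bar> * L" if t: "\<bar>t\<bar> \<le> 1" for t
    proof -
      have "norm (Y t - p) \<le> \<bar>s\<bar> * norm v + \<bar>t\<bar> * (\<eta> * \<bar>s\<bar>) * norm n"
        using norm_triangle_ineq[of "s *\<^sub>R v" "(t * (\<eta> * \<bar>s\<bar>)) *\<^sub>R n"] \<eta> by (simp add: Y_def abs_mult)
      also have "\<dots> \<le> \<bar>s\<bar> * norm v + 1 * (\<eta> * \<bar>s\<bar>) * norm n"
        using t \<eta> by (intro add_left_mono mult_right_mono) auto
      also have "\<dots> \<le> \<bar>s\<bar> * L" by (simp add: L_def algebra_simps)
      finally show ?thesis .
    qed
    have small: "\<bar>s\<bar> * L < min d1 d2" using s L by (simp add: s0_def less_divide_eq)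
    have YU: "Y t \<in> U" if "\<bar>t\<bar> \<le> 1" for t
      using Yp[OF that] small d2(2) by (auto simp: dist_norm norm_minus_commute)
    have est: "\<bar>\<phi> (Y t) - t * (\<eta> * \<bar>s\<bar>)\<bar> \<le> \<eta> * \<bar>s\<bar> / 2" if t: "\<bar>t\<bar> \<le> 1" for t
    proof -
      have "D p (Y t - p) = t * (\<eta> * \<bar>s\<bar>)" using v n by (simp add: Y_def D.add D.scaleR)
      then have "\<bar>\<phi> (Y t) - t * (\<eta> * \<bar>s\<bar>)\<bar> \<le> \<eta> / (2 * L) * norm (Y t - p)"
        using d1(2)[of "Y t"] Yp[OF t] small \<phi>_p by simp
      also have "\<dots> \<le> \<eta> / (2 * L) * (\<bar>s\<bar> * L)" using Yp[OF t] \<eta> L by (intro mult_left_mono) auto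
      also have "\<dots> = \<eta> * \<bar>s\<bar> / 2" using L by simp
      finally show ?thesis .
    qed
    have es: "\<eta> * \<bar>s\<bar> > 0" using \<eta> False by simp
    have "\<exists>t. -1 \<le> t \<and> t \<le> 1 \<and> (\<phi> \<circ> Y) t = 0"
    proof (rule IVT')
      have "\<bar>\<phi> (Y (-1)) + \<eta> * \<bar>s\<bar>\<bar> \<le> \<eta> * \<bar>s\<bar> / 2" using est[of "-1"] by simp
      then show "(\<phi> \<circ> Y) (-1) \<le> 0" using es unfolding o_apply by linarith
      have "\<bar>\<phi> (Y 1) - \<eta> * \<bar>s\<bar>\<bar> \<le> \<eta> * \<bar>s\<bar> / 2" using est[of 1] by simp
      then show "0 \<le> (\<phi> \<circ> Y) 1" using es unfolding o_apply by linarith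
      show "continuous_on {-1..1} (\<phi> \<circ> Y)"
      proof (rule continuous_on_compose)
        show "continuous_on {-1..1} Y" unfolding Y_def by (intro continuous_intros)
        show "continuous_on (Y ` {-1..1}) \<phi>"
          by (rule continuous_on_subset[OF smooth_continuous[OF smooth]]) (use YU in auto)
      qed
    qed simp
    then obtain t where "-1 \<le> t" "t \<le> 1" and t0: "\<phi> (Y t) = 0" by auto
    then have t: "\<bar>t\<bar> \<le> 1" "\<phi> (Y t) = 0" by auto
    then have "Y t \<in> frontier K" using zero_set YU by auto
    then have "Y t \<in> K" by (simp add: frontier_K)
    moreover have "norm (Y t - (p + s *\<^sub>R v)) \<le> \<epsilon> * \<bar>s\<bar>"
    proof -
      have "norm (Y t - (p + s *\<^sub>R v)) = \<bar>t\<bar> * (\<epsilon> * \<bar>s\<bar>)"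
        using nn \<epsilon> by (simp add: Y_def \<eta>_def abs_mult)
      also have "\<dots> \<le> 1 * (\<epsilon> * \<bar>s\<bar>)" using t \<epsilon> by (intro mult_right_mono) auto
      finally show ?thesis by simp
    qed
    ultimately show ?thesis by blast
  qed
  with s0 that show thesis by blast
qed

text \<open>\<open>K\<close> lies on one side of the supporting hyperplane at \<open>p\<close>, yet
  it contains points close to p + s v for both signs of s, so v has no component along the
  normal.\<close>

lemma kernel_tangent:
  assumes v: "D p v = 0"
  shows "v \<bullet> \<theta> = 0"
proof -
  have "\<bar>v \<bullet> \<theta>\<bar> \<le> 0 + \<epsilon>" if \<epsilon>: "\<epsilon> > 0" for \<epsilon>
  proof -
    obtain s0 where s0: "s0 > 0" "\<And>s. \<bar>s\<bar> < s0 \<Longrightarrow> \<exists>x\<in>K. norm (x - (p + s *\<^sub>R v)) \<le> \<epsilon> * \<bar>s\<bar>"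
      using tangent_approximation[OF v \<epsilon>] by blast
    have *: "- (\<epsilon> * \<bar>s\<bar>) \<le> s * (v \<bullet> \<theta>)" if s: "\<bar>s\<bar> < s0" for s
    proof -
      obtain x where x: "x \<in> K" "norm (x - (p + s *\<^sub>R v)) \<le> \<epsilon> * \<bar>s\<bar>" using s0(2)[OF s] by blast
      have "(x - (p + s *\<^sub>R v)) \<bullet> \<theta> \<le> norm (x - (p + s *\<^sub>R v)) * norm \<theta>" by (rule norm_cauchy_schwarz)
      also have "\<dots> \<le> \<epsilon> * \<bar>s\<bar>" using x(2) e by (simp add: norm_Q)
      finally show ?thesis using p_min[OF x(1)] by (simp add: inner_diff_left inner_add_left)
    qed
    have "s0 / 2 * (- (v \<bullet> \<theta>)) \<le> s0 / 2 * \<epsilon>" "s0 / 2 * (v \<bullet> \<theta>) \<le> s0 / 2 * \<epsilon>"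
      using *[of "s0 / 2"] *[of "- (s0 / 2)"] s0(1) by (simp_all add: mult.commute)
    then have "- (v \<bullet> \<theta>) \<le> \<epsilon>" "v \<bullet> \<theta> \<le> \<epsilon>" using s0(1) by (simp_all only: mult_le_cancel_left_pos half_gt_zero)
    then show ?thesis by (simp add: abs_le_iff)
  qed
  then have "\<bar>v \<bullet> \<theta>\<bar> \<le> 0" by (rule field_le_epsilon)
  then show ?thesis by simp
qed

lemma D_\<theta>: "D p \<theta> \<noteq> 0"
  using kernel_tangent[of \<theta>] inner_\<theta> by auto

text \<open>A multiple of \<theta> moves v into the kernel, hence into the tangent hyperplane by
  \<open>kernel_tangent\<close>; as v was there already, the multiple is 0.\<close>

lemma D_tangent:
  assumes "v \<bullet> \<theta> = 0"
  shows "D p v = 0"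
proof -
  interpret D: linear "D p" by (rule linear_D[OF U(2)])
  have "D p (v - (D p v / D p \<theta>) *\<^sub>R \<theta>) = 0" using D_\<theta> by (simp add: D.diff D.scaleR)
  from kernel_tangent[OF this] have "D p v / D p \<theta> = 0" using assms by (simp add: inner_diff_left inner_\<theta>)
  then show ?thesis using D_\<theta> by simp
qed

text \<open>This would fail at a corner; smoothness enters through tangent points. For an interior
  point x0 put w = x0 - p and v = \<alpha> \<theta> - w, which is tangent. Near p + s v there is a
  point of \<open>K\<close>, around p + s w a whole ball of it, and the midpoints fill a ball around
  p + (s \<alpha>/2) \<theta>.\<close>

lemma interior_above: "\<exists>\<epsilon>0>0. p + \<epsilon>0 *\<^sub>R \<theta> \<in> interior K"
proof -
  obtain x0 where x0: "x0 \<in> interior K" using interior_K by auto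
  then obtain \<rho> where \<rho>: "\<rho> > 0" "ball x0 \<rho> \<subseteq> K" by (auto simp: mem_interior)
  define w where "w = x0 - p"
  define \<alpha> where "\<alpha> = w \<bullet> \<theta>"
  obtain \<delta> where \<delta>: "\<delta> > 0" "x0 - \<delta> *\<^sub>R \<theta> \<in> K" by (rule interior_below[OF x0])
  have \<alpha>: "\<alpha> > 0" using p_min[OF \<delta>(2)] \<delta>(1) by (simp add: \<alpha>_def w_def inner_diff_left inner_\<theta>)
  define v where "v = \<alpha> *\<^sub>R \<theta> - w"
  have "D p v = 0" by (rule D_tangent) (simp add: v_def \<alpha>_def inner_diff_left inner_\<theta>)
  then obtain s0 where s0: "s0 > 0" "\<And>s. \<bar>s\<bar> < s0 \<Longrightarrow> \<exists>x\<in>K. norm (x - (p + s *\<^sub>R v)) \<le> \<rho> / 2 * \<bar>s\<bar>"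
    using tangent_approximation[of v "\<rho> / 2"] \<rho>(1) by auto
  define s where "s = min 1 (s0 / 2)"
  have s: "0 < s" "s \<le> 1" "s < s0" using s0(1) by (auto simp: s_def min_def)
  obtain x where x: "x \<in> K" "norm (x - (p + s *\<^sub>R v)) \<le> \<rho> / 2 * s" using s0(2)[of s] s by auto
  have "ball (p + (s * \<alpha> / 2) *\<^sub>R \<theta>) (\<rho> * s / 4) \<subseteq> K"
  proof
    fix y assume y: "y \<in> ball (p + (s * \<alpha> / 2) *\<^sub>R \<theta>) (\<rho> * s / 4)"
    \<comment> \<open>Chosen so that y is the midpoint of x and y'; it remains to place y' in the
      ball around p + s w.\<close>
    define y' where "y' = 2 *\<^sub>R y - x"
    have eq: "y' - (p + s *\<^sub>R w) = 2 *\<^sub>R (y - (p + (s * \<alpha> / 2) *\<^sub>R \<theta>)) - (x - (p + s *\<^sub>R v))"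
      by (simp add: y'_def v_def algebra_simps scaleR_2)
    have "norm (y' - (p + s *\<^sub>R w)) \<le> 2 * norm (y - (p + (s * \<alpha> / 2) *\<^sub>R \<theta>)) + norm (x - (p + s *\<^sub>R v))"
      unfolding eq using norm_triangle_ineq4[of "2 *\<^sub>R (y - (p + (s * \<alpha> / 2) *\<^sub>R \<theta>))"] by (metis norm_scaleR abs_numeral)
    also have "\<dots> < 2 * (\<rho> * s / 4) + \<rho> / 2 * s" using y x(2) by (simp add: dist_norm norm_minus_commute)
    also have "\<dots> = \<rho> * s" by simp
    finally have n: "norm (y' - (p + s *\<^sub>R w)) < \<rho> * s" .
    define u where "u = (y' - (p + s *\<^sub>R w)) /\<^sub>R s"
    have "norm u < \<rho>" using n s(1) by (simp add: u_def divide_inverse_commute[symmetric] divide_less_eq)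
    then have "x0 + u \<in> K" using \<rho>(2) by (auto simp: dist_norm)
    then have "(1 - s) *\<^sub>R p + s *\<^sub>R (x0 + u) \<in> K" using s by (intro convexD[OF convex_K pK]) auto
    moreover have "(1 - s) *\<^sub>R p + s *\<^sub>R (x0 + u) = y'" using s(1) by (simp add: u_def w_def algebra_simps)
    ultimately have "y' \<in> K" by simp
    then have "(1/2) *\<^sub>R x + (1/2) *\<^sub>R y' \<in> K" by (intro convexD[OF convex_K x(1)]) auto
    moreover have "(1/2) *\<^sub>R x + (1/2) *\<^sub>R y' = y" by (simp add: y'_def algebra_simps)
    ultimately show "y \<in> K" by simp
  qed
  then have "p + (s * \<alpha> / 2) *\<^sub>R \<theta> \<in> interior K"
    using \<rho>(1) s(1) unfolding mem_interior by (intro exI[of _ "\<rho> * s / 4"]) auto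
  moreover have "s * \<alpha> / 2 > 0" using s \<alpha> by simp
  ultimately show ?thesis by blast
qed

section \<open>The lower boundary as a convex graph\<close>

definition height :: "'a \<Rightarrow> real" where
  "height u = Inf {z. p + Q (perp e u + z *\<^sub>R e) \<in> K}"

definition graph :: "'a \<Rightarrow> 'a" where
  "graph u = p + Q (perp e u + height u *\<^sub>R e)"

lemma height_perp: "height u = height (perp e u)"
  by (simp add: height_def perp_perp[OF e])

lemma graph_perp: "graph u = graph (perp e u)"
  using height_perp[of u] by (simp add: graph_def perp_perp[OF e])

lemma Q_coord: "(p + Q (perp e u + z *\<^sub>R e)) = p + Q (perp e u) + z *\<^sub>R \<theta>"
  by (simp add: linear_add[OF linear_Q] linear_scale[OF linear_Q])

lemma \<theta>_coord: "(p + Q (perp e u + z *\<^sub>R e)) \<bullet> \<theta> = p \<bullet> \<theta> + z"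
  using perp_inner[OF e, of u] by (simp add: Q_coord inner_add_left inner_Q inner_\<theta> e)

lemma height_lower:
  assumes "p + Q (perp e u + z *\<^sub>R e) \<in> K"
  shows "height u \<le> z"
  unfolding height_def
proof (rule cInf_lower)
  show "bdd_below {z. p + Q (perp e u + z *\<^sub>R e) \<in> K}"
  proof (rule bdd_belowI[of _ 0])
    fix z assume "z \<in> {z. p + Q (perp e u + z *\<^sub>R e) \<in> K}"
    then show "0 \<le> z" using p_min[of "p + Q (perp e u + z *\<^sub>R e)"] by (simp add: \<theta>_coord)
  qed
qed (use assms in simp)

lemma graph_in_K:
  assumes "p + Q (perp e u + z *\<^sub>R e) \<in> K"
  shows "graph u \<in> K" "0 \<le> height u"
proof -
  let ?Z = "{z. p + Q (perp e u + z *\<^sub>R e) \<in> K}"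
  have "closed ((\<lambda>z. p + Q (perp e u) + z *\<^sub>R \<theta>) -` K)"
    by (intro closed_vimage closed_K continuous_intros)
  then have cl: "closed ?Z" by (simp add: vimage_def Q_coord)
  have bd: "bdd_below ?Z"
  proof (rule bdd_belowI[of _ 0])
    fix z assume "z \<in> ?Z"
    then show "0 \<le> z" using p_min[of "p + Q (perp e u + z *\<^sub>R e)"] by (simp add: \<theta>_coord)
  qed
  have ne: "?Z \<noteq> {}" using assms by auto
  have "Inf ?Z \<in> ?Z" by (rule closed_contains_Inf[OF ne bd cl])
  then show 1: "graph u \<in> K" by (simp add: graph_def height_def)
  show "0 \<le> height u" using p_min[OF 1] by (simp add: graph_def \<theta>_coord)
qed

lemma graph_frontier:
  assumes "p + Q (perp e u + z *\<^sub>R e) \<in> K"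
  shows "graph u \<in> frontier K"
proof (rule ccontr)
  assume "graph u \<notin> frontier K"
  then have "graph u \<in> interior K" using graph_in_K(1)[OF assms] by (simp add: frontier_K)
  then obtain \<delta> where \<delta>: "\<delta> > 0" "graph u - \<delta> *\<^sub>R \<theta> \<in> K" by (rule interior_below)
  have "graph u - \<delta> *\<^sub>R \<theta> = p + Q (perp e u + (height u - \<delta>) *\<^sub>R e)"
    unfolding graph_def Q_coord by (simp add: scaleR_diff_left)
  then have "height u \<le> height u - \<delta>" using height_lower[of u "height u - \<delta>"] \<delta>(2) by simp
  with \<delta>(1) show False by simp
qed

lemma height_0: "height 0 = 0" "graph 0 = p"
proof -
  have 0: "p + Q (perp e 0 + 0 *\<^sub>R e) \<in> K" using pK by (simp add: perp_0 linear_0[OF linear_Q])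
  show "height 0 = 0" using height_lower[OF 0] graph_in_K(2)[OF 0] by simp
  then show "graph 0 = p" by (simp add: graph_def perp_0 linear_0[OF linear_Q])
qed

text \<open>A ball around p + \<epsilon>0 \<theta> contains, on every vertical line close to
  \<open>p\<close>, also points below the level \<epsilon>0; hence the strict inequality.\<close>

lemma good_radius:
  obtains R1 \<epsilon>0 where "R1 > 0" "\<epsilon>0 > 0" "\<And>u. norm (perp e u) < R1 \<Longrightarrow> p + Q (perp e u + \<epsilon>0 *\<^sub>R e) \<in> K"
    "\<And>u. norm (perp e u) < R1 \<Longrightarrow> height u < \<epsilon>0"
proof -
  obtain \<epsilon>0 where \<epsilon>0: "\<epsilon>0 > 0" "p + \<epsilon>0 *\<^sub>R \<theta> \<in> interior K" using interior_above by blast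
  then obtain d where d: "d > 0" "ball (p + \<epsilon>0 *\<^sub>R \<theta>) d \<subseteq> K" by (auto simp: mem_interior)
  have in_K: "p + Q (perp e u + (\<epsilon>0 - b) *\<^sub>R e) \<in> K" if "norm (perp e u) < d / 2" "0 \<le> b" "b < d / 2" for u b
  proof -
    have "(p + \<epsilon>0 *\<^sub>R \<theta>) - (p + Q (perp e u + (\<epsilon>0 - b) *\<^sub>R e)) = b *\<^sub>R \<theta> - Q (perp e u)"
      unfolding Q_coord by (simp add: scaleR_diff_left)
    moreover have "norm (b *\<^sub>R \<theta> - Q (perp e u)) \<le> b + norm (perp e u)"
      using norm_triangle_ineq4[of "b *\<^sub>R \<theta>" "Q (perp e u)"] that e by (simp add: norm_Q)
    ultimately have "p + Q (perp e u + (\<epsilon>0 - b) *\<^sub>R e) \<in> ball (p + \<epsilon>0 *\<^sub>R \<theta>) d"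
      using that by (simp add: dist_norm)
    then show ?thesis using d(2) by blast
  qed
  show thesis
  proof (rule that[of "d / 2" \<epsilon>0])
    fix u assume u: "norm (perp e u) < d / 2"
    show "p + Q (perp e u + \<epsilon>0 *\<^sub>R e) \<in> K" using in_K[OF u, of 0] d(1) by simp
    show "height u < \<epsilon>0" using height_lower[OF in_K[OF u, of "d / 4"]] d(1) by simp
  qed (use d \<epsilon>0 in auto)
qed

lemma convex_tube: "convex {u. norm (perp e u) < R}"
proof -
  have "{u. norm (perp e u) < R} = perp e -` ball 0 R" by auto
  then show ?thesis using convex_linear_vimage[OF linear_perp convex_ball] by metis
qed

lemma open_tube: "open {x. norm (perp e x) < s}"
  by (intro open_Collect_less continuous_intros)

lemma height_convex:
  assumes "\<And>u. norm (perp e u) < R \<Longrightarrow> graph u \<in> K"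
  shows "convex_on {u. norm (perp e u) < R} height"
proof (rule convex_onI[OF _ convex_tube])
  fix t x y assume t: "0 < (t::real)" "t < 1" and "x \<in> {u. norm (perp e u) < R}" "y \<in> {u. norm (perp e u) < R}"
  then have "(1 - t) *\<^sub>R graph x + t *\<^sub>R graph y \<in> K" using assms by (intro convexD[OF convex_K]) auto
  moreover have "(1 - t) *\<^sub>R graph x + t *\<^sub>R graph y = p + Q (perp e ((1 - t) *\<^sub>R x + t *\<^sub>R y) + ((1 - t) * height x + t * height y) *\<^sub>R e)"
    unfolding graph_def Q_coord perp_add perp_scaleR linear_add[OF linear_Q] linear_scale[OF linear_Q]
    by (simp add: algebra_simps)
  ultimately show "height ((1 - t) *\<^sub>R x + t *\<^sub>R y) \<le> (1 - t) * height x + t * height y"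
    using height_lower by metis
qed

text \<open>Continuity of the chart comes from convexity of the height, not from the equation \<phi>
  = 0. It then keeps the graph in \<open>U\<close> and the derivative of \<phi> along \<theta> at
  least half as large as at \<open>p\<close>.\<close>

lemma chart_radius:
  obtains R \<epsilon>0 where "R > 0" "\<epsilon>0 > 0" "\<And>u. norm (perp e u) < R \<Longrightarrow> p + Q (perp e u + \<epsilon>0 *\<^sub>R e) \<in> K"
    "\<And>u. norm (perp e u) < R \<Longrightarrow> height u < \<epsilon>0"
    "continuous_on {u. norm (perp e u) < R} height" "convex_on {u. norm (perp e u) < R} height"
    "\<And>u. norm (perp e u) < R \<Longrightarrow> graph u \<in> U"
    "\<And>u. norm (perp e u) < R \<Longrightarrow> \<bar>D p \<theta>\<bar> / 2 \<le> \<bar>D (graph u) \<theta>\<bar>"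
proof -
  obtain R1 \<epsilon>0 where R1: "R1 > 0" "\<epsilon>0 > 0" "\<And>u. norm (perp e u) < R1 \<Longrightarrow> p + Q (perp e u + \<epsilon>0 *\<^sub>R e) \<in> K"
    "\<And>u. norm (perp e u) < R1 \<Longrightarrow> height u < \<epsilon>0" by (rule good_radius) blast
  let ?T = "{u. norm (perp e u) < R1}"
  have cv: "convex_on ?T height" by (rule height_convex) (use graph_in_K R1(3) in blast)
  have ct: "continuous_on ?T height" by (rule convex_on_continuous[OF open_tube cv])
  have gc: "continuous_on ?T graph" unfolding graph_def[abs_def]
    by (intro continuous_intros linear_continuous_on_compose[OF _ linear_Q] ct)
  have 0: "0 \<in> ?T" using R1(1) by (simp add: perp_0)
  have g0: "(graph \<longlongrightarrow> p) (at 0)"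
    using gc 0 open_tube continuous_on_eq_continuous_at[of ?T graph] height_0(2)
    by (metis continuous_at)
  have Dc: "continuous_on U (\<lambda>x. D x \<theta>)" by (rule smooth_continuous[OF smooth_frechet[OF smooth]])
  then have "isCont (\<lambda>x. D x \<theta>) p" using U continuous_on_eq_continuous_at by blast
  then have "((\<lambda>u. \<bar>D (graph u) \<theta>\<bar>) \<longlongrightarrow> \<bar>D p \<theta>\<bar>) (at 0)"
    by (intro tendsto_rabs isCont_tendsto_compose[OF _ g0])
  then have "\<forall>\<^sub>F u in at 0. \<bar>D p \<theta>\<bar> / 2 < \<bar>D (graph u) \<theta>\<bar>"
    by (rule order_tendstoD) (use D_\<theta> in simp)
  moreover have "\<forall>\<^sub>F u in at 0. graph u \<in> U" using topological_tendstoD[OF g0 U] .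
  ultimately have "\<forall>\<^sub>F u in at 0. \<bar>D p \<theta>\<bar> / 2 < \<bar>D (graph u) \<theta>\<bar> \<and> graph u \<in> U" by eventually_elim simp
  then obtain d where d: "d > 0" "\<And>u. u \<noteq> 0 \<Longrightarrow> norm u < d \<Longrightarrow> \<bar>D p \<theta>\<bar> / 2 < \<bar>D (graph u) \<theta>\<bar> \<and> graph u \<in> U"
    unfolding eventually_at by (auto simp: dist_norm)
  \<comment> \<open>The limit at 0 says nothing about 0 itself or about the unbounded rest of the
    tube; both are reached because \<open>graph u\<close> depends on \<open>perp e u\<close>
    only.\<close>
  have d': "\<bar>D p \<theta>\<bar> / 2 \<le> \<bar>D (graph u) \<theta>\<bar> \<and> graph u \<in> U" if "norm (perp e u) < d" for u
  proof (cases "perp e u = 0")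
    case True
    then have "graph u = p" using graph_perp[of u] height_0 by simp
    then show ?thesis using U by simp
  next
    case False
    from d(2)[OF this that] show ?thesis using graph_perp[of u] by simp
  qed
  define R where "R = min R1 d"
  have sub: "{u. norm (perp e u) < R} \<subseteq> ?T" by (auto simp: R_def)
  show thesis
  proof (rule that[of R \<epsilon>0])
    show "continuous_on {u. norm (perp e u) < R} height" by (rule continuous_on_subset[OF ct sub])
    show "convex_on {u. norm (perp e u) < R} height" by (rule convex_on_subset[OF cv sub convex_tube])
  qed (use R1 d(1) d' in \<open>auto simp: R_def\<close>)
qed

end

section \<open>First derivatives of the height\<close>

locale boundary_chart = boundary_point +
  fixes R \<epsilon>0 :: real
  assumes R: "R > 0" and \<epsilon>0: "\<epsilon>0 > 0"
    and above: "\<And>u. norm (perp e u) < R \<Longrightarrow> p + Q (perp e u + \<epsilon>0 *\<^sub>R e) \<in> K"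
    and height_less: "\<And>u. norm (perp e u) < R \<Longrightarrow> height u < \<epsilon>0"
    and height_cont: "continuous_on {u. norm (perp e u) < R} height"
    and height_convex_on: "convex_on {u. norm (perp e u) < R} height"
    and graph_U: "\<And>u. norm (perp e u) < R \<Longrightarrow> graph u \<in> U"
    and D_lower: "\<And>u. norm (perp e u) < R \<Longrightarrow> \<bar>D p \<theta>\<bar> / 2 \<le> \<bar>D (graph u) \<theta>\<bar>"
begin

abbreviation tube :: "'a set" where "tube \<equiv> {u. norm (perp e u) < R}"

lemma graph_cont: "continuous_on tube graph"
  unfolding graph_def[abs_def]
  by (intro continuous_intros linear_continuous_on_compose[OF _ linear_Q] height_cont)

lemma graph_front: "u \<in> tube \<Longrightarrow> graph u \<in> frontier K"
  using graph_frontier above by blast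

lemma D_\<theta>_neq: "u \<in> tube \<Longrightarrow> D (graph u) \<theta> \<noteq> 0"
  using D_lower[of u] D_\<theta> by auto

lemma line_in_tube:
  assumes "u \<in> tube"
  shows "\<forall>\<^sub>F s in at 0. u + s *\<^sub>R w \<in> tube"
proof -
  have "((\<lambda>s. u + s *\<^sub>R w) \<longlongrightarrow> u + 0 *\<^sub>R w) (at 0)" by (intro tendsto_intros)
  then have "((\<lambda>s. u + s *\<^sub>R w) \<longlongrightarrow> u) (at 0)" by simp
  from topological_tendstoD[OF this open_tube assms] show ?thesis .
qed

text \<open>Implicit differentiation: s a + \<Delta> b vanishes up to an error \<eta> (|s| |w| +
  |\<Delta>|). As \<Delta> is not yet known to be O(s), half of |b| |\<Delta>| first absorbs the
  error and gives |\<Delta>| \<le> C |s|; a second use of the estimate identifies the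
  derivative.\<close>

lemma height_deriv_D:
  assumes w: "w \<bullet> e = 0" and u: "u \<in> tube"
  shows "((\<lambda>s. height (u + s *\<^sub>R w)) has_real_derivative - D (graph u) (Q w) / D (graph u) \<theta>) (at 0)"
proof -
  interpret D: linear "D (graph u)" by (rule linear_D[OF graph_U]) (use u in simp)
  define a where "a = D (graph u) (Q w)"
  define b where "b = D (graph u) \<theta>"
  define \<Delta> where "\<Delta> s = height (u + s *\<^sub>R w) - height u" for s
  have b: "b \<noteq> 0" using D_\<theta>_neq[OF u] by (simp add: b_def)
  have lim: "((\<lambda>s. u + s *\<^sub>R w) \<longlongrightarrow> u) (at 0)"
  proof -
    have "((\<lambda>s. u + s *\<^sub>R w) \<longlongrightarrow> u + 0 *\<^sub>R w) (at 0)" by (intro tendsto_intros)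
    then show ?thesis by simp
  qed
  have "isCont graph u" using graph_cont open_tube u continuous_on_eq_continuous_at by blast
  then have glim: "((\<lambda>s. graph (u + s *\<^sub>R w)) \<longlongrightarrow> graph u) (at 0)"
    by (rule isCont_tendsto_compose[OF _ lim])
  have pw: "perp e w = w" using w by (rule perp_eq)
  have diff: "graph (u + s *\<^sub>R w) - graph u = s *\<^sub>R Q w + \<Delta> s *\<^sub>R \<theta>" for s
    unfolding graph_def Q_coord perp_add perp_scaleR pw linear_add[OF linear_Q] linear_scale[OF linear_Q] \<Delta>_def
    by (simp add: algebra_simps)
  define C where "C = 2 / \<bar>b\<bar> * (\<bar>a\<bar> + \<bar>b\<bar> / 2 * norm w)"
  have C0: "C \<ge> 0" by (simp add: C_def)
  have "((\<lambda>s. \<Delta> s / s) \<longlongrightarrow> - a / b) (at 0)"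
  proof (rule tendstoI)
    fix \<epsilon> :: real assume \<epsilon>: "\<epsilon> > 0"
    \<comment> \<open>The first term permits the absorption, the second makes the final error at
      most \<epsilon>/2.\<close>
    define \<eta> where "\<eta> = min (\<bar>b\<bar> / 2) (\<epsilon> * \<bar>b\<bar> / (2 * (norm w + C + 1)))"
    have wC: "norm w + C + 1 > 0" using C0 by (simp add: add_nonneg_pos)
    have half_cancel: "y / (2 * X) * X = y / 2" if "X > 0" for X y :: real using that by simp
    have \<eta>: "\<eta> > 0" "\<eta> \<le> \<bar>b\<bar> / 2" "\<eta> * (norm w + C + 1) \<le> \<epsilon> * \<bar>b\<bar> / 2"
    proof -
      show "\<eta> > 0" using b \<epsilon> wC by (auto simp: \<eta>_def)
      show "\<eta> \<le> \<bar>b\<bar> / 2" unfolding \<eta>_def by (rule min.cobounded1)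
      have "\<eta> * (norm w + C + 1) \<le> \<epsilon> * \<bar>b\<bar> / (2 * (norm w + C + 1)) * (norm w + C + 1)"
        using wC by (intro mult_right_mono) (auto simp: \<eta>_def)
      also have "\<dots> = \<epsilon> * \<bar>b\<bar> / 2" by (rule half_cancel[OF wC])
      finally show "\<eta> * (norm w + C + 1) \<le> \<epsilon> * \<bar>b\<bar> / 2" .
    qed
    obtain d where d: "d > 0" "\<And>y. norm (y - graph u) < d \<Longrightarrow> norm (\<phi> y - \<phi> (graph u) - D (graph u) (y - graph u)) \<le> \<eta> * norm (y - graph u)"
      using \<phi>_deriv[OF graph_U] u \<eta>(1) unfolding has_derivative_at_alt by blast
    have "\<forall>\<^sub>F s in at 0. dist (graph (u + s *\<^sub>R w)) (graph u) < d" using tendstoD[OF glim d(1)] .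
    moreover have "\<forall>\<^sub>F s in at 0. s \<noteq> (0::real)" by (simp add: eventually_at_filter)
    ultimately show "\<forall>\<^sub>F s in at 0. dist (\<Delta> s / s) (- a / b) < \<epsilon>"
      using line_in_tube[OF u, of w]
    proof eventually_elim
      case (elim s)
      have "\<phi> (graph (u + s *\<^sub>R w)) = 0" "\<phi> (graph u) = 0"
        using zero_set graph_front graph_U elim(3) u by auto
      then have "\<bar>s * a + \<Delta> s * b\<bar> \<le> \<eta> * norm (s *\<^sub>R Q w + \<Delta> s *\<^sub>R \<theta>)"
        using d(2)[of "graph (u + s *\<^sub>R w)"] elim(1) unfolding diff
        by (simp add: dist_norm diff D.add D.scaleR a_def b_def)
      also have "\<dots> \<le> \<eta> * (\<bar>s\<bar> * norm w + \<bar>\<Delta> s\<bar>)"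
        using norm_triangle_ineq[of "s *\<^sub>R Q w" "\<Delta> s *\<^sub>R \<theta>"] \<eta>(1) e by (intro mult_left_mono) (auto simp: norm_Q)
      finally have est: "\<bar>s * a + \<Delta> s * b\<bar> \<le> \<eta> * (\<bar>s\<bar> * norm w + \<bar>\<Delta> s\<bar>)" .
      have "\<bar>\<Delta> s\<bar> * \<bar>b\<bar> \<le> \<bar>s\<bar> * \<bar>a\<bar> + \<eta> * (\<bar>s\<bar> * norm w + \<bar>\<Delta> s\<bar>)"
      proof -
        have "\<bar>\<Delta> s * b\<bar> \<le> \<bar>s * a\<bar> + \<bar>s * a + \<Delta> s * b\<bar>" by linarith
        with est show ?thesis unfolding abs_mult by linarith
      qed
      also have "\<dots> \<le> \<bar>s\<bar> * \<bar>a\<bar> + \<bar>b\<bar> / 2 * (\<bar>s\<bar> * norm w + \<bar>\<Delta> s\<bar>)"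
        using \<eta>(2) by (intro add_left_mono mult_right_mono) auto
      finally have "\<bar>\<Delta> s\<bar> * (\<bar>b\<bar> / 2) \<le> \<bar>s\<bar> * (\<bar>a\<bar> + \<bar>b\<bar> / 2 * norm w)" by (simp add: algebra_simps)
      have "\<bar>\<Delta> s\<bar> = 2 / \<bar>b\<bar> * (\<bar>\<Delta> s\<bar> * (\<bar>b\<bar> / 2))" using b by simp
      also have "\<dots> \<le> 2 / \<bar>b\<bar> * (\<bar>s\<bar> * (\<bar>a\<bar> + \<bar>b\<bar> / 2 * norm w))"
        by (rule mult_left_mono) (fact, simp)
      also have "\<dots> = C * \<bar>s\<bar>" by (simp add: C_def)
      finally have \<Delta>C: "\<bar>\<Delta> s\<bar> \<le> C * \<bar>s\<bar>" .
      have "\<bar>s * a + \<Delta> s * b\<bar> \<le> \<eta> * (\<bar>s\<bar> * norm w + C * \<bar>s\<bar>)"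
        by (rule order_trans[OF est], intro mult_left_mono add_left_mono \<Delta>C) (use \<eta>(1) in simp)
      also have "\<dots> \<le> \<bar>s\<bar> * (\<eta> * (norm w + C + 1))" using \<eta>(1) by (simp add: algebra_simps)
      also have "\<dots> \<le> \<bar>s\<bar> * (\<epsilon> * \<bar>b\<bar> / 2)" using \<eta>(3) by (intro mult_left_mono) auto
      finally have "\<bar>s * a + \<Delta> s * b\<bar> \<le> \<bar>s\<bar> * (\<epsilon> * \<bar>b\<bar> / 2)" .
      moreover have "\<Delta> s / s - (- a / b) = (s * a + \<Delta> s * b) / (s * b)" using b elim(2) by (simp add: field_simps)
      ultimately have "\<bar>\<Delta> s / s - (- a / b)\<bar> \<le> \<bar>s\<bar> * (\<epsilon> * \<bar>b\<bar> / 2) / (\<bar>s\<bar> * \<bar>b\<bar>)"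
        by (simp only: abs_divide abs_mult) (intro divide_right_mono; simp)
      also have "\<dots> = \<epsilon> / 2" using b elim(2) by simp
      also have "\<dots> < \<epsilon>" using \<epsilon> by simp
      finally show ?case by (simp add: dist_real_def)
    qed
  qed
  then show ?thesis by (simp add: DERIV_def \<Delta>_def a_def b_def)
qed

definition grad :: "'a \<Rightarrow> 'a" where
  "grad u = (\<Sum>b\<in>Basis. (if b = e then 0 else - D (graph u) (Q b) / D (graph u) \<theta>) *\<^sub>R b)"

lemma grad_inner_basis: "b \<in> Basis \<Longrightarrow> grad u \<bullet> b = (if b = e then 0 else - D (graph u) (Q b) / D (graph u) \<theta>)"
  by (simp add: grad_def inner_sum_left_Basis)

lemma grad_e: "grad u \<bullet> e = 0"
  using grad_inner_basis[OF e, of u] by simp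

lemma grad_perp: "grad u = grad (perp e u)"
  by (simp only: grad_def graph_perp[symmetric])

lemma sum_basis_linear:
  assumes "linear (f :: 'a \<Rightarrow> real)"
  shows "f (Q w) = (\<Sum>b\<in>Basis. (w \<bullet> b) * f (Q b))"
proof -
  have "f (Q w) = f (Q (\<Sum>b\<in>Basis. (w \<bullet> b) *\<^sub>R b))" by (simp add: euclidean_representation)
  also have "\<dots> = (\<Sum>b\<in>Basis. (w \<bullet> b) * f (Q b))"
    using assms by (simp add: linear_sum[OF linear_Q] linear_scale[OF linear_Q] linear_sum linear_scale)
  finally show ?thesis .
qed

lemma inner_grad:
  assumes w: "w \<bullet> e = 0" and u: "u \<in> tube"
  shows "w \<bullet> grad u = - D (graph u) (Q w) / D (graph u) \<theta>"
proof -
  have lin: "linear (D (graph u))" by (rule linear_D[OF graph_U]) (use u in simp)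
  have "w \<bullet> grad u = (\<Sum>b\<in>Basis. (w \<bullet> b) * (grad u \<bullet> b))" by (rule euclidean_inner)
  also have "\<dots> = (\<Sum>b\<in>Basis. - ((w \<bullet> b) * D (graph u) (Q b)) / D (graph u) \<theta>)"
    by (intro sum.cong refl) (use w in \<open>auto simp: grad_inner_basis\<close>)
  also have "\<dots> = - (\<Sum>b\<in>Basis. (w \<bullet> b) * D (graph u) (Q b)) / D (graph u) \<theta>"
    by (simp only: sum_negf[symmetric] sum_divide_distrib)
  finally show ?thesis by (simp only: sum_basis_linear[OF lin, of w])
qed

lemma height_deriv:
  "w \<bullet> e = 0 \<Longrightarrow> u \<in> tube \<Longrightarrow> ((\<lambda>s. height (u + s *\<^sub>R w)) has_real_derivative w \<bullet> grad u) (at 0)"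
  using height_deriv_D inner_grad by simp

text \<open>The derivative of \<open>G\<close> along the tangent vector Q b + (grad u \<bullet> b)
  \<theta>. For b = e it is just the derivative along \<theta>, which the derivative formulas
  multiply by w \<bullet> e = 0.\<close>

definition slope :: "('a \<Rightarrow> real) \<Rightarrow> 'a \<Rightarrow> 'a \<Rightarrow> real" where
  "slope G b u = frechet_derivative G (at (graph u)) (Q b) + (grad u \<bullet> b) * frechet_derivative G (at (graph u)) \<theta>"

lemma comp_deriv:
  assumes G: "smooth_on U G" and w: "w \<bullet> e = 0" and u: "u \<in> tube"
  shows "((\<lambda>s. G (graph (u + s *\<^sub>R w))) has_real_derivative (\<Sum>b\<in>Basis. (w \<bullet> b) * slope G b u)) (at 0)"
proof -
  let ?G = "frechet_derivative G (at (graph u))"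
  have gU: "graph u \<in> U" using graph_U u by simp
  have Gd: "(G has_derivative ?G) (at (graph u))" by (rule smooth_has_derivative[OF G gU])
  have lin: "linear ?G" using Gd by (rule has_derivative_linear)
  have pw: "perp e w = w" using w by (rule perp_eq)
  have "graph (u + s *\<^sub>R w) = p + Q (perp e u) + s *\<^sub>R Q w + height (u + s *\<^sub>R w) *\<^sub>R \<theta>" for s
    unfolding graph_def Q_coord perp_add perp_scaleR pw linear_add[OF linear_Q] linear_scale[OF linear_Q] by simp
  moreover have "((\<lambda>s. p + Q (perp e u) + s *\<^sub>R Q w + height (u + s *\<^sub>R w) *\<^sub>R \<theta>) has_vector_derivative
      0 + 1 *\<^sub>R Q w + (w \<bullet> grad u) *\<^sub>R \<theta>) (at 0)"
    using height_deriv[OF w u] by (auto intro!: derivative_eq_intros simp: has_vector_derivative_def has_field_derivative_def algebra_simps)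
  ultimately have "((\<lambda>s. graph (u + s *\<^sub>R w)) has_vector_derivative Q w + (w \<bullet> grad u) *\<^sub>R \<theta>) (at 0)" by simp
  then have "((\<lambda>s. graph (u + s *\<^sub>R w)) has_derivative (\<lambda>s. s *\<^sub>R (Q w + (w \<bullet> grad u) *\<^sub>R \<theta>))) (at 0)"
    by (simp add: has_vector_derivative_def)
  from has_derivative_compose[OF this, of G ?G] Gd
  have "((\<lambda>s. G (graph (u + s *\<^sub>R w))) has_derivative (\<lambda>s. ?G (s *\<^sub>R (Q w + (w \<bullet> grad u) *\<^sub>R \<theta>)))) (at 0)" by simp
  then have "((\<lambda>s. G (graph (u + s *\<^sub>R w))) has_real_derivative ?G (Q w + (w \<bullet> grad u) *\<^sub>R \<theta>)) (at 0)"
    by (simp add: has_field_derivative_def linear_scale[OF lin] mult_commute_abs)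
  moreover have "?G (Q w + (w \<bullet> grad u) *\<^sub>R \<theta>) = (\<Sum>b\<in>Basis. (w \<bullet> b) * slope G b u)"
  proof -
    have "?G (Q w + (w \<bullet> grad u) *\<^sub>R \<theta>) = ?G (Q w) + (w \<bullet> grad u) * ?G \<theta>"
      by (simp add: linear_add[OF lin] linear_scale[OF lin])
    also have "\<dots> = (\<Sum>b\<in>Basis. (w \<bullet> b) * ?G (Q b)) + (\<Sum>b\<in>Basis. (w \<bullet> b) * (grad u \<bullet> b)) * ?G \<theta>"
      by (simp only: sum_basis_linear[OF lin, of w] euclidean_inner[of w "grad u"])
    also have "\<dots> = (\<Sum>b\<in>Basis. (w \<bullet> b) * slope G b u)"
      by (simp add: slope_def sum_distrib_right distrib_left sum.distrib mult.assoc)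
    finally show ?thesis .
  qed
  ultimately show ?thesis by simp
qed

section \<open>Uniform bounds for all derivatives on the graph\<close>

lemma comp_cont: "smooth_on U G \<Longrightarrow> continuous_on tube (\<lambda>u. G (graph u))"
  by (rule continuous_on_compose2[OF smooth_continuous graph_cont]) (use graph_U in auto)

lemma grad_basis_cont: "b \<in> Basis \<Longrightarrow> continuous_on tube (\<lambda>u. grad u \<bullet> b)"
  using D_\<theta>_neq by (cases "b = e")
    (auto simp: grad_inner_basis intro!: continuous_intros comp_cont[OF smooth_frechet[OF smooth]])

lemma grad_cont: "continuous_on tube grad"
  by (subst continuous_on_componentwise) (use grad_basis_cont in blast)

lemma slope_cont: "smooth_on U G \<Longrightarrow> b \<in> Basis \<Longrightarrow> continuous_on tube (slope G b)"
  unfolding slope_def[abs_def]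
  by (intro continuous_intros comp_cont[OF smooth_frechet] grad_basis_cont)

text \<open>The tube is unbounded along \<open>e\<close>, but the graph depends on
  \<open>perp e u\<close> only, so a compact cylinder of radius r < R carries all values.\<close>

lemma comp_bounded:
  fixes G :: "'a \<Rightarrow> real"
  assumes G: "smooth_on U G" and r: "r < R"
  shows "\<exists>C. \<forall>u. norm (perp e u) \<le> r \<longrightarrow> \<bar>G (graph u)\<bar> \<le> C"
proof -
  have sub: "cyl e r \<subseteq> tube" using r by (auto simp: cyl_def)
  have "compact ((\<lambda>u. G (graph u)) ` cyl e r)"
    by (intro compact_continuous_image compact_cyl e continuous_on_subset[OF comp_cont[OF G] sub])
  then have "bounded ((\<lambda>u. G (graph u)) ` cyl e r)" by (rule compact_imp_bounded)
  then obtain C where "\<forall>x\<in>(\<lambda>u. G (graph u)) ` cyl e r. norm x \<le> C" unfolding bounded_iff by blast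
  then have C: "\<And>u. u \<in> cyl e r \<Longrightarrow> \<bar>G (graph u)\<bar> \<le> C" by auto
  have "\<bar>G (graph u)\<bar> \<le> C" if "norm (perp e u) \<le> r" for u
  proof -
    have "perp e u \<in> cyl e r" using that by (simp add: cyl_def perp_perp[OF e] perp_inner[OF e])
    from C[OF this] show ?thesis using graph_perp[of u] by simp
  qed
  then show ?thesis by blast
qed

abbreviation dirs :: "'a set" where "dirs \<equiv> {w. norm w = 1 \<and> w \<bullet> e = 0}"

lemma dirs_coord: "b \<in> Basis \<Longrightarrow> w \<in> dirs \<Longrightarrow> \<bar>w \<bullet> b\<bar> \<le> 1"
  using Basis_le_norm[of b w] by auto

text \<open>Kept apart from the induction because the gradient bound is needed inside it, at order
  n, and once more afterwards.\<close>

lemma grad_C_k_bounded_aux: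
  assumes r: "r < R" and b: "b \<in> Basis"
    and IH: "\<And>G. smooth_on U G \<Longrightarrow> C_k_bounded n dirs (\<lambda>w. w) {u. norm (perp e u) < r} (\<lambda>w u. G (graph u))"
  shows "C_k_bounded n dirs (\<lambda>w. w) {u. norm (perp e u) < r} (\<lambda>w u. grad u \<bullet> b)"
proof (cases "b = e")
  case True
  then show ?thesis using C_k_bounded_const[of dirs "\<lambda>_. 0" 0] by (simp add: grad_e)
next
  case False
  have "C_k_bounded n dirs (\<lambda>w. w) {u. norm (perp e u) < r} (\<lambda>w u. (-1) * (D (graph u) (Q b) * inverse (D (graph u) \<theta>)))"
    by (intro C_k_bounded_mult C_k_bounded_const[of dirs "\<lambda>_. -1" 1] C_k_bounded_inverse[of _ _ _ _ _ "\<bar>D p \<theta>\<bar> / 2"]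
        IH[OF smooth_frechet[OF smooth]]) (use D_\<theta> D_lower r in auto)
  then show ?thesis using False b by (simp add: grad_inner_basis divide_inverse)
qed

text \<open>Bootstrapping: the directional derivative of \<open>G\<close> on the graph is built from
  derivatives of \<open>G\<close> and the gradient, and the gradient from quotients of derivatives
  of \<phi>. All of these are smooth functions restricted to the graph, so one order less suffices
  for them; \<open>G\<close> must therefore stay arbitrary in the induction.\<close>

lemma comp_C_k_bounded:
  assumes r: "r < R" and G: "smooth_on U G"
  shows "C_k_bounded n dirs (\<lambda>w. w) {u. norm (perp e u) < r} (\<lambda>w u. G (graph u))"
  using G
proof (induction n arbitrary: G)
  case 0
  have "continuous_on {u. norm (perp e u) < r} (\<lambda>u. G (graph u))"
    by (rule continuous_on_subset[OF comp_cont[OF 0]]) (use r in auto)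
  moreover obtain C where "\<And>u. norm (perp e u) \<le> r \<Longrightarrow> \<bar>G (graph u)\<bar> \<le> C" using comp_bounded[OF 0 r] by blast
  ultimately show ?case by (auto intro!: exI[of _ C])
next
  case (Suc n)
  note IH = Suc.IH
  show ?case
  proof (rule C_k_bounded_SucI[OF C_k_bounded_0[OF IH[OF Suc.prems]]])
    show "C_k_bounded n dirs (\<lambda>w. w) {u. norm (perp e u) < r} (\<lambda>w u. \<Sum>b\<in>Basis. (w \<bullet> b) * slope G b u)"
      unfolding slope_def
      by (intro C_k_bounded_sum C_k_bounded_mult C_k_bounded_add IH smooth_frechet Suc.prems
          C_k_bounded_const[of dirs _ 1] grad_C_k_bounded_aux[OF r] dirs_coord) auto
    show "((\<lambda>s. G (graph (u + s *\<^sub>R w))) has_real_derivative (\<Sum>b\<in>Basis. (w \<bullet> b) * slope G b u)) (at 0)"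
      if "w \<in> dirs" "u \<in> {u. norm (perp e u) < r}" for w u
      by (rule comp_deriv[OF Suc.prems]) (use that r in auto)
  qed
qed

lemma grad_C_k_bounded:
  assumes "r < R" "b \<in> Basis"
  shows "C_k_bounded n dirs (\<lambda>w. w) {u. norm (perp e u) < r} (\<lambda>w u. grad u \<bullet> b)"
  by (rule grad_C_k_bounded_aux[OF assms comp_C_k_bounded[OF assms(1)]])

lemma inner_grad_C_k_bounded:
  assumes "r < R"
  shows "C_k_bounded n dirs (\<lambda>w. w) {u. norm (perp e u) < r} (\<lambda>w u. w \<bullet> grad u)"
  unfolding euclidean_inner[of _ "grad _"]
  by (intro C_k_bounded_sum C_k_bounded_mult C_k_bounded_const[of dirs _ 1] grad_C_k_bounded assms dirs_coord) auto

lemma grad_0: "grad 0 = 0"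
proof (rule euclidean_eqI)
  fix b :: 'a assume b: "b \<in> Basis"
  have "D p (Q b) = 0" if "b \<noteq> e" by (rule D_tangent) (use b e that in \<open>simp add: inner_Q inner_Basis\<close>)
  then show "grad 0 \<bullet> b = 0 \<bullet> b" using b by (simp add: grad_inner_basis height_0)
qed

text \<open>The gradient vanishes over the support point, and its components have bounded
  directional derivatives; the mean value theorem on the segment from 0 does the rest.\<close>

lemma grad_lipschitz:
  assumes r: "0 < r" "r < R"
  shows "\<exists>M\<ge>0. \<forall>u. norm (perp e u) < r \<longrightarrow> norm (grad u) \<le> M * norm (perp e u)"
proof -
  let ?T = "{u. norm (perp e u) < r}"
  have "\<exists>C. \<forall>u\<in>?T. \<bar>grad u \<bullet> b\<bar> \<le> C * norm (perp e u)" if b: "b \<in> Basis" for b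
  proof -
    obtain f' where f': "\<And>w x. w \<in> dirs \<Longrightarrow> x \<in> ?T \<Longrightarrow> ((\<lambda>s. grad (x + s *\<^sub>R w) \<bullet> b) has_real_derivative f' w x) (at 0)"
      "C_k_bounded 0 dirs (\<lambda>w. w) ?T f'"
      using grad_C_k_bounded[OF r(2) b, of "Suc 0"] by (rule C_k_bounded_SucE) blast
    obtain C where C: "C > 0" "\<And>w x. w \<in> dirs \<Longrightarrow> x \<in> ?T \<Longrightarrow> \<bar>f' w x\<bar> \<le> C" using f'(2) by (rule C_k_bounded_bound) blast
    have "\<bar>grad u \<bullet> b\<bar> \<le> C * norm (perp e u)" if u: "u \<in> ?T" for u
    proof (cases "perp e u = 0")
      case True
      then show ?thesis using grad_perp[of u] grad_0 by simp
    next
      case False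
      define t where "t = norm (perp e u)"
      define w where "w = perp e u /\<^sub>R t"
      have t: "t > 0" using False by (simp add: t_def)
      have w: "w \<in> dirs" using t perp_inner[OF e, of u] by (auto simp: w_def t_def)
      have seg: "0 + a *\<^sub>R w \<in> ?T" if "0 \<le> a" "a \<le> t" for a
        using w that u by (simp add: perp_scaleR perp_eq t_def)
      obtain a where a: "0 < a" "a < t" "grad (0 + t *\<^sub>R w) \<bullet> b - grad 0 \<bullet> b = t * f' w (0 + a *\<^sub>R w)"
        by (rule line_mvt[OF t, of "\<lambda>x. grad x \<bullet> b" 0 w "f' w"]) (use f'(1)[OF w seg] in auto)
      have "0 + t *\<^sub>R w = perp e u" using t by (simp add: w_def)
      then have "grad u \<bullet> b = t * f' w (0 + a *\<^sub>R w)" using a(3) grad_perp[of u] grad_0 by simp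
      moreover have "\<bar>f' w (0 + a *\<^sub>R w)\<bar> \<le> C" by (rule C(2)[OF w seg]) (use a in auto)
      ultimately show ?thesis using t by (simp add: abs_mult t_def[symmetric] mult.commute)
    qed
    then show ?thesis by blast
  qed
  then obtain C where C: "\<And>b u. b \<in> Basis \<Longrightarrow> u \<in> ?T \<Longrightarrow> \<bar>grad u \<bullet> b\<bar> \<le> C b * norm (perp e u)" by metis
  define M where "M = (\<Sum>b\<in>Basis. \<bar>C b\<bar>)"
  have "norm (grad u) \<le> M * norm (perp e u)" if "u \<in> ?T" for u
  proof -
    have "norm (grad u) \<le> (\<Sum>b\<in>Basis. \<bar>grad u \<bullet> b\<bar>)" by (rule norm_le_l1)
    also have "\<dots> \<le> (\<Sum>b\<in>Basis. \<bar>C b\<bar> * norm (perp e u))"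
      by (intro sum_mono order_trans[OF C[OF _ that]] mult_right_mono) auto
    finally show ?thesis by (simp add: M_def sum_distrib_right)
  qed
  moreover have "M \<ge> 0" by (simp add: M_def sum_nonneg)
  ultimately show ?thesis by blast
qed

section \<open>Second derivatives of the height\<close>

definition hess :: "'a \<Rightarrow> 'a \<Rightarrow> 'a \<Rightarrow> real" where
  "hess b b' u = (if b = e then 0 else
     - (slope (\<lambda>x. D x (Q b)) b' u * D (graph u) \<theta> - D (graph u) (Q b) * slope (\<lambda>x. D x \<theta>) b' u) / (D (graph u) \<theta> * D (graph u) \<theta>))"

definition hess_form :: "'a \<Rightarrow> 'a \<Rightarrow> real" where
  "hess_form w u = (\<Sum>b\<in>Basis. (w \<bullet> b) * (\<Sum>b'\<in>Basis. (w \<bullet> b') * hess b b' u))"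

lemma hess_cont: "b \<in> Basis \<Longrightarrow> b' \<in> Basis \<Longrightarrow> continuous_on tube (hess b b')"
  unfolding hess_def[abs_def] using D_\<theta>_neq
  by (cases "b = e") (auto intro!: continuous_intros slope_cont smooth_frechet smooth comp_cont[OF smooth_frechet])

lemma grad_basis_deriv:
  assumes w: "w \<bullet> e = 0" and u: "u \<in> tube" and b: "b \<in> Basis"
  shows "((\<lambda>s. grad (u + s *\<^sub>R w) \<bullet> b) has_real_derivative (\<Sum>b'\<in>Basis. (w \<bullet> b') * hess b b' u)) (at 0)"
proof (cases "b = e")
  case True
  then show ?thesis by (simp add: grad_e hess_def)
next
  case False
  let ?N = "\<Sum>b'\<in>Basis. (w \<bullet> b') * slope (\<lambda>x. D x (Q b)) b' u" and ?D = "\<Sum>b'\<in>Basis. (w \<bullet> b') * slope (\<lambda>x. D x \<theta>) b' u"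
  have 1: "((\<lambda>s. D (graph (u + s *\<^sub>R w)) (Q b)) has_real_derivative ?N) (at 0)"
    by (rule comp_deriv[OF smooth_frechet[OF smooth] w u])
  have 2: "((\<lambda>s. D (graph (u + s *\<^sub>R w)) \<theta>) has_real_derivative ?D) (at 0)"
    by (rule comp_deriv[OF smooth_frechet[OF smooth] w u])
  have nz: "D (graph (u + 0 *\<^sub>R w)) \<theta> \<noteq> 0" using D_\<theta>_neq[OF u] by simp
  have "((\<lambda>s. - (D (graph (u + s *\<^sub>R w)) (Q b) / D (graph (u + s *\<^sub>R w)) \<theta>)) has_real_derivative
     - ((?N * D (graph (u + 0 *\<^sub>R w)) \<theta> - D (graph (u + 0 *\<^sub>R w)) (Q b) * ?D) / (D (graph (u + 0 *\<^sub>R w)) \<theta> * D (graph (u + 0 *\<^sub>R w)) \<theta>))) (at 0)"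
    by (rule DERIV_minus[OF DERIV_divide[OF 1 2 nz]])
  moreover have "(\<Sum>b'\<in>Basis. (w \<bullet> b') * hess b b' u) = - ((?N * D (graph u) \<theta> - D (graph u) (Q b) * ?D) / (D (graph u) \<theta> * D (graph u) \<theta>))"
  proof -
    let ?d = "D (graph u) \<theta>" and ?q = "D (graph u) (Q b)"
    have "(w \<bullet> b') * hess b b' u = (w \<bullet> b') * slope (\<lambda>x. D x (Q b)) b' u * (- ?d / (?d * ?d)) + (w \<bullet> b') * slope (\<lambda>x. D x \<theta>) b' u * (?q / (?d * ?d))" for b'
      using False by (simp add: hess_def diff_divide_distrib algebra_simps)
    then have "(\<Sum>b'\<in>Basis. (w \<bullet> b') * hess b b' u) = ?N * (- ?d / (?d * ?d)) + ?D * (?q / (?d * ?d))"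
      by (simp only: sum.distrib sum_distrib_right[symmetric])
    also have "\<dots> = - ((?N * ?d - ?q * ?D) / (?d * ?d))"
      by (simp only: diff_divide_distrib minus_diff_eq times_divide_eq_right mult_minus_right minus_divide_left mult.commute[of ?q])
    finally show ?thesis .
  qed
  ultimately show ?thesis using False b by (simp add: grad_inner_basis)
qed

lemma inner_grad_deriv:
  assumes w: "w \<bullet> e = 0" and u: "u \<in> tube"
  shows "((\<lambda>s. w \<bullet> grad (u + s *\<^sub>R w)) has_real_derivative hess_form w u) (at 0)"
  unfolding euclidean_inner[of w "grad _"] hess_form_def
  by (intro DERIV_sum DERIV_cmult grad_basis_deriv w u)

subsection \<open>Normal vectors and curvature\<close>

lemma zero_in_tube: "0 \<in> tube"
  using R by (simp add: perp_0)

text \<open>Convexity puts the lower boundary below the chord from \<open>graph x\<close> to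
  \<open>y\<close>; letting the parameter tend to 0 compares the slope of the chord with the
  gradient. The projection of \<open>y\<close> may lie outside the tube, since only the derivative
  at \<open>x\<close> is used.\<close>

lemma support_inequality:
  assumes x: "x \<in> tube" and y: "y \<in> K"
  shows "Q (grad x - e) \<bullet> (y - graph x) \<le> 0"
proof -
  obtain y0 where y0: "y - p = Q y0"
    using orthogonal_transformation_surj[OF Q] by (metis surj_def)
  define z where "z = y0 \<bullet> e"
  define w where "w = perp e (y0 - x)"
  have we: "w \<bullet> e = 0" by (simp add: w_def perp_inner[OF e])
  have pw: "perp e w = w" by (rule perp_eq[OF we])
  have y0_eq: "y0 = perp e y0 + z *\<^sub>R e" by (simp add: perp_def z_def)
  have y_eq: "y = p + Q (perp e y0) + z *\<^sub>R \<theta>"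
  proof -
    have "y = p + Q y0" using y0 by (simp add: algebra_simps)
    also have "\<dots> = p + Q (perp e y0 + z *\<^sub>R e)" using y0_eq by simp
    finally show ?thesis by (simp add: Q_coord)
  qed
  have seg: "height (x + t *\<^sub>R w) \<le> height x + t * (z - height x)" if t: "0 \<le> t" "t \<le> 1" for t
  proof -
    have "(1 - t) *\<^sub>R graph x + t *\<^sub>R y \<in> K"
      using graph_in_K(1)[OF above] x y t by (intro convexD[OF convex_K]) auto
    moreover have "(1 - t) *\<^sub>R graph x + t *\<^sub>R y = p + Q (perp e (x + t *\<^sub>R w) + (height x + t * (z - height x)) *\<^sub>R e)"
    proof -
      have seg_eq: "perp e (x + t *\<^sub>R w) = (1 - t) *\<^sub>R perp e x + t *\<^sub>R perp e y0"
        unfolding perp_add perp_scaleR pw unfolding w_def perp_diff by (simp add: algebra_simps)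
      then show ?thesis
        unfolding y_eq graph_def Q_coord seg_eq by (simp add: linear_add[OF linear_Q] linear_diff[OF linear_Q] linear_scale[OF linear_Q] algebra_simps)
    qed
    ultimately show ?thesis using height_lower by metis
  qed
  have "((\<lambda>t. (height (x + t *\<^sub>R w) - height x) / t) \<longlongrightarrow> w \<bullet> grad x) (at_right 0)"
    using height_deriv[OF we x] unfolding DERIV_def by (simp add: filterlim_at_split)
  moreover have "\<forall>\<^sub>F t in at_right 0. (height (x + t *\<^sub>R w) - height x) / t \<le> z - height x"
    unfolding eventually_at_right_field
  proof (intro exI[of _ 1] conjI allI impI)
    fix t :: real assume t: "0 < t" "t < 1"
    have "height (x + t *\<^sub>R w) - height x \<le> (z - height x) * t" using seg[of t] t by (simp add: mult.commute)
    then show "(height (x + t *\<^sub>R w) - height x) / t \<le> z - height x" using t by (simp only: pos_divide_le_eq)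
  qed simp
  ultimately have "w \<bullet> grad x \<le> z - height x"
    by (intro tendsto_upperbound) auto
  moreover have "y - graph x = Q (w + (z - height x) *\<^sub>R e)"
    unfolding y_eq graph_def Q_coord w_def perp_diff
    by (simp add: linear_add[OF linear_Q] linear_diff[OF linear_Q] linear_scale[OF linear_Q] algebra_simps)
  ultimately show ?thesis
    using e we grad_e[of x] inner_commute[of w "grad x"] inner_commute[of w e]
    by (simp add: inner_Q inner_diff_left inner_add_right)
qed

lemma norm_grad_e: "norm (grad u - e) = sqrt (1 + grad u \<bullet> grad u)"
  using e grad_e[of u] inner_commute[of "grad u" e]
  by (simp add: norm_eq_sqrt_inner inner_diff_left inner_diff_right add.commute)

text \<open>The supporting inequality gives existence. For any normal n = Q m, the function n
  \<bullet> (graph (u + s w) - graph u) is maximal at s = 0, so n is orthogonal to all tangent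
  vectors and m is a multiple of grad u - e. The point of \<open>K\<close> above the graph fixes the
  sign, the norm fixes the length.\<close>

lemma outer_unit_normal_graph:
  assumes u: "u \<in> tube"
  shows "outer_unit_normal K (graph u) = inverse (sqrt (1 + grad u \<bullet> grad u)) *\<^sub>R Q (grad u - e)"
  unfolding outer_unit_normal_def
proof (rule the_equality)
  let ?s = "sqrt (1 + grad u \<bullet> grad u)"
  have s: "?s > 0" by (simp add: add_pos_nonneg)
  show "norm (inverse ?s *\<^sub>R Q (grad u - e)) = 1 \<and> (\<forall>y\<in>K. inverse ?s *\<^sub>R Q (grad u - e) \<bullet> (y - graph u) \<le> 0)"
    using support_inequality[OF u] s by (simp add: norm_Q norm_grad_e mult_nonneg_nonpos)
  fix n assume n: "norm n = 1 \<and> (\<forall>y\<in>K. n \<bullet> (y - graph u) \<le> 0)"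
  obtain m where m: "n = Q m" using orthogonal_transformation_surj[OF Q] by (metis surj_def)
  have "m \<bullet> w + (m \<bullet> e) * (w \<bullet> grad u) = 0" if w: "w \<bullet> e = 0" for w
  proof -
    have pw: "perp e w = w" by (rule perp_eq[OF w])
    have diff: "graph (u + s *\<^sub>R w) - graph u = Q (s *\<^sub>R w + (height (u + s *\<^sub>R w) - height u) *\<^sub>R e)" for s
      unfolding graph_def perp_add perp_scaleR pw
      by (simp add: linear_add[OF linear_Q] linear_diff[OF linear_Q] linear_scale[OF linear_Q] algebra_simps)
    define f where "f s = s * (m \<bullet> w) + (height (u + s *\<^sub>R w) - height u) * (m \<bullet> e)" for s
    obtain d where d: "d > 0" "\<And>s. s \<noteq> 0 \<Longrightarrow> \<bar>s\<bar> < d \<Longrightarrow> u + s *\<^sub>R w \<in> tube"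
      using line_in_tube[OF u, of w] unfolding eventually_at by (auto simp: dist_norm)
    have "(f has_real_derivative 1 * (m \<bullet> w) + (w \<bullet> grad u - 0) * (m \<bullet> e)) (at 0)"
      unfolding f_def[abs_def] by (intro DERIV_add DERIV_cmult_right DERIV_diff DERIV_ident DERIV_const height_deriv w u)
    moreover have "\<forall>s. \<bar>0 - s\<bar> < d \<longrightarrow> f s \<le> f 0"
    proof safe
      fix s assume s: "\<bar>0 - s\<bar> < d"
      have "u + s *\<^sub>R w \<in> tube" using d(2)[of s] s u by (cases "s = 0") auto
      then have "graph (u + s *\<^sub>R w) \<in> K" using graph_in_K(1)[OF above] by simp
      with n have "n \<bullet> (graph (u + s *\<^sub>R w) - graph u) \<le> 0" by blast
      then show "f s \<le> f 0" unfolding diff m inner_Q by (simp add: f_def inner_add_right)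
    qed
    ultimately have "1 * (m \<bullet> w) + (w \<bullet> grad u - 0) * (m \<bullet> e) = 0" by (rule DERIV_local_max[OF _ d(1)])
    then show ?thesis by (simp add: mult.commute)
  qed
  note tang = this
  \<comment> \<open>Chosen so that the orthogonality relation reads w \<bullet> w = 0.\<close>
  define w where "w = perp e m + (m \<bullet> e) *\<^sub>R grad u"
  have we: "w \<bullet> e = 0" by (simp add: w_def inner_add_left perp_inner[OF e] grad_e)
  have "w \<bullet> w = w \<bullet> perp e m + (m \<bullet> e) * (w \<bullet> grad u)" by (subst (2) w_def) (simp add: inner_add_right)
  also have "\<dots> = 0" using tang[OF we] by (simp add: perp_inner_perp[OF we] inner_commute)
  finally have "perp e m = - (m \<bullet> e) *\<^sub>R grad u" by (simp add: w_def eq_neg_iff_add_eq_0)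
  then have m_eq: "m = (- (m \<bullet> e)) *\<^sub>R (grad u - e)" by (simp add: perp_def algebra_simps)
  have "p + Q (perp e u + \<epsilon>0 *\<^sub>R e) - graph u = Q ((\<epsilon>0 - height u) *\<^sub>R e)"
    unfolding graph_def by (simp add: linear_add[OF linear_Q] linear_diff[OF linear_Q] linear_scale[OF linear_Q] algebra_simps)
  moreover have "n \<bullet> (p + Q (perp e u + \<epsilon>0 *\<^sub>R e) - graph u) \<le> 0" using n above u by blast
  ultimately have "(\<epsilon>0 - height u) * (m \<bullet> e) \<le> 0" by (simp add: m inner_Q)
  then have me: "m \<bullet> e \<le> 0" using height_less[of u] u by (simp add: mult_le_0_iff)
  have "1 = norm m" using n by (simp add: m norm_Q)
  also have "\<dots> = \<bar>m \<bullet> e\<bar> * ?s" by (subst m_eq) (simp only: norm_scaleR norm_grad_e abs_minus_cancel)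
  finally have "- (m \<bullet> e) = inverse ?s" using me s by (simp add: field_simps)
  with m_eq show "n = inverse ?s *\<^sub>R Q (grad u - e)" unfolding m using linear_scale[OF linear_Q] by metis
qed

text \<open>Near 0 the slope at a v is below C a, and the mean value theorem turns this into a bound
  on the height. The factor 1/2 of Taylor's formula is given away by replacing C a with C t, which
  uses C \<ge> 0.\<close>

lemma height_le_quadratic:
  assumes v: "v \<bullet> e = 0" and C: "C \<ge> 0" "hess_form v 0 < C"
  obtains d where "d > 0" "\<And>t. 0 < t \<Longrightarrow> t < d \<Longrightarrow> height (t *\<^sub>R v) \<le> C * t\<^sup>2"
proof -
  have "((\<lambda>s. (v \<bullet> grad (0 + s *\<^sub>R v) - v \<bullet> grad (0 + 0 *\<^sub>R v)) / s) \<longlongrightarrow> hess_form v 0) (at 0)"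
    using inner_grad_deriv[OF v zero_in_tube] unfolding DERIV_def by simp
  then have "\<forall>\<^sub>F s in at 0. (v \<bullet> grad (s *\<^sub>R v)) / s < C"
    using order_tendstoD(2)[OF _ C(2)] by (simp add: grad_0)
  moreover have "\<forall>\<^sub>F s in at 0. s *\<^sub>R v \<in> tube" using line_in_tube[OF zero_in_tube, of v] by simp
  ultimately have "\<forall>\<^sub>F s in at 0. (v \<bullet> grad (s *\<^sub>R v)) / s < C \<and> s *\<^sub>R v \<in> tube" by eventually_elim simp
  then obtain d where d: "d > 0" "\<And>s. s \<noteq> 0 \<Longrightarrow> \<bar>s\<bar> < d \<Longrightarrow> (v \<bullet> grad (s *\<^sub>R v)) / s < C \<and> s *\<^sub>R v \<in> tube"
    unfolding eventually_at by (auto simp: dist_norm)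
  show thesis
  proof (rule that[OF d(1)])
    fix t assume t: "0 < t" "t < d"
    have "((\<lambda>s. height ((0 + a *\<^sub>R v) + s *\<^sub>R v)) has_real_derivative v \<bullet> grad (0 + a *\<^sub>R v)) (at 0)" if "0 \<le> a" "a \<le> t" for a
      by (rule height_deriv[OF v]) (use that t d(2)[of a] zero_in_tube in \<open>cases "a = 0"; auto\<close>)
    then obtain a where a: "0 < a" "a < t" "height (0 + t *\<^sub>R v) - height 0 = t * (v \<bullet> grad (0 + a *\<^sub>R v))"
      using line_mvt[OF t(1), of height 0 v "\<lambda>x. v \<bullet> grad x"] by blast
    have "v \<bullet> grad (a *\<^sub>R v) < C * a" using d(2)[of a] a t by (simp add: divide_less_eq)
    also have "\<dots> \<le> C * t" using C a by (intro mult_left_mono) auto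
    finally have "t * (v \<bullet> grad (a *\<^sub>R v)) \<le> t * (C * t)" using t by (intro mult_left_mono) auto
    then show "height (t *\<^sub>R v) \<le> C * t\<^sup>2" using a(3) by (simp add: height_0 power2_eq_square algebra_simps)
  qed
qed

lemma height_tangent:
  assumes x: "x \<in> tube" and y: "y \<in> tube" and xe: "x \<bullet> e = 0" and ye: "y \<bullet> e = 0"
  shows "height x + grad x \<bullet> (y - x) \<le> height y"
proof -
  have "graph y - graph x = Q ((y - x) + (height y - height x) *\<^sub>R e)"
    unfolding graph_def perp_eq[OF xe] perp_eq[OF ye]
    by (simp add: linear_add[OF linear_Q] linear_diff[OF linear_Q] linear_scale[OF linear_Q] algebra_simps)
  moreover have "graph y \<in> K" using graph_in_K(1)[OF above] y by simp
  ultimately show ?thesis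
    using support_inequality[OF x, of "graph y"] e xe ye grad_e[of x] inner_commute[of x e] inner_commute[of y e]
    by (simp add: inner_Q inner_diff_left inner_diff_right inner_add_right)
qed

text \<open>
  If the graph is flat to second order in the direction \<open>w\<close>, then its tangent planes at \<open>t w\<close>, which lie
  below it, have slope \<open>o(t)\<close>; this avoids the symmetry of the second derivative.
\<close>

lemma flat_direction:
  assumes w: "w \<in> dirs" and flat: "hess_form w 0 \<le> 0" and b: "b \<in> Basis"
  shows "((\<lambda>s. grad (s *\<^sub>R w) \<bullet> b) has_real_derivative 0) (at 0)"
proof -
  have we: "w \<bullet> e = 0" using w by simp
  define V where "V b = (\<Sum>b'\<in>Basis. (w \<bullet> b') * hess b b' 0)" for b
  have V: "((\<lambda>s. grad (s *\<^sub>R w) \<bullet> b) has_real_derivative V b) (at 0)" if "b \<in> Basis" for b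
    using grad_basis_deriv[OF we zero_in_tube that] by (simp add: V_def)
  \<comment> \<open>The one-sided estimate for both signs of the basis vector gives V b = 0.\<close>
  have upper: "\<sigma> * V b \<le> 0" if b: "b \<in> Basis" "b \<noteq> e" and \<sigma>: "\<sigma> = 1 \<or> \<sigma> = -1" for b \<sigma>
  proof -
    define v where "v = \<sigma> *\<^sub>R b"
    have ve: "v \<bullet> e = 0" using b e by (simp add: v_def inner_Basis)
    define C where "C = max 0 (hess_form v 0) + 1"
    have C: "C \<ge> 0" "hess_form v 0 < C" by (auto simp: C_def)
    \<comment> \<open>The test point s w + \<delta> s v is the midpoint of 2 s w and 2 \<delta> s v,
      so its height is at most 2 \<delta>^2 (1 + C) s^2 by convexity, while the tangent plane at s w
      lies below it. Dividing by \<delta> s bounds the slope along v by 2 \<delta> (1 + C)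
      s.\<close>
    have "\<sigma> * V b \<le> 2 * \<delta> * (1 + C)" if \<delta>: "\<delta> > 0" for \<delta>
    proof -
      obtain d1 where d1: "d1 > 0" "\<And>t. 0 < t \<Longrightarrow> t < d1 \<Longrightarrow> height (t *\<^sub>R w) \<le> \<delta>\<^sup>2 * t\<^sup>2"
        by (rule height_le_quadratic[OF we, of "\<delta>\<^sup>2"]) (use flat \<delta> in \<open>auto intro: le_less_trans\<close>)
      obtain d2 where d2: "d2 > 0" "\<And>t. 0 < t \<Longrightarrow> t < d2 \<Longrightarrow> height (t *\<^sub>R v) \<le> C * t\<^sup>2"
        using height_le_quadratic[OF ve C] by blast
      have tb: "\<forall>\<^sub>F s in at 0. (k * s) *\<^sub>R z \<in> tube" for z k
        using line_in_tube[OF zero_in_tube, of "k *\<^sub>R z"] by (simp add: mult.commute)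
      have "\<forall>\<^sub>F s in at 0. \<bar>s\<bar> < min (d1 / 2) (d2 / (2 * \<delta>))"
        unfolding eventually_at by (rule exI[of _ "min (d1 / 2) (d2 / (2 * \<delta>))"]) (use d1 d2 \<delta> in \<open>auto simp: dist_norm\<close>)
      then have ev: "\<forall>\<^sub>F s in at 0. \<bar>s\<bar> < min (d1 / 2) (d2 / (2 * \<delta>)) \<and> (1 * s) *\<^sub>R w \<in> tube \<and> (2 * s) *\<^sub>R w \<in> tube \<and> (2 * \<delta> * s) *\<^sub>R v \<in> tube"
        by (intro eventually_conj tb)
      have "((\<lambda>s. (grad (s *\<^sub>R w) \<bullet> b) / s) \<longlongrightarrow> V b) (at 0)"
        using V[OF b(1)] unfolding DERIV_def by (simp add: grad_0)
      then have "((\<lambda>s. \<sigma> * ((grad (s *\<^sub>R w) \<bullet> b) / s)) \<longlongrightarrow> \<sigma> * V b) (at_right 0)"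
        by (intro tendsto_intros) (simp add: filterlim_at_split)
      moreover have "\<forall>\<^sub>F s in at_right 0. \<sigma> * ((grad (s *\<^sub>R w) \<bullet> b) / s) \<le> 2 * \<delta> * (1 + C)"
      proof -
        have "\<forall>\<^sub>F s in at_right 0. \<bar>s\<bar> < min (d1 / 2) (d2 / (2 * \<delta>)) \<and> (1 * s) *\<^sub>R w \<in> tube \<and> (2 * s) *\<^sub>R w \<in> tube \<and> (2 * \<delta> * s) *\<^sub>R v \<in> tube"
          using ev unfolding eventually_at_split by blast
        moreover have "\<forall>\<^sub>F s in at_right 0. s > (0::real)" by (simp add: eventually_at_filter)
        ultimately show ?thesis
        proof eventually_elim
          case (elim s)
          then have s: "0 < s" "2 * s < d1" "2 * \<delta> * s < d2" using \<delta> by (auto simp: field_simps)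
          let ?x = "s *\<^sub>R w" and ?y = "s *\<^sub>R w + (\<delta> * s) *\<^sub>R v"
          have mid: "?y = (1 - 1/2) *\<^sub>R ((2 * s) *\<^sub>R w) + (1/2) *\<^sub>R ((2 * \<delta> * s) *\<^sub>R v)" by simp
          have yt: "?y \<in> tube" unfolding mid by (rule convexD_alt[OF convex_tube]) (use elim in auto)
          have "height ?x + grad ?x \<bullet> (?y - ?x) \<le> height ?y"
            by (rule height_tangent) (use elim yt we ve in \<open>auto simp: inner_add_left\<close>)
          moreover have "0 \<le> height ?x" using graph_in_K(2)[OF above] elim by simp
          ultimately have "(\<delta> * s) * (grad ?x \<bullet> v) \<le> height ?y" by simp
          also have "\<dots> \<le> (1 - 1/2) * height ((2 * s) *\<^sub>R w) + (1/2) * height ((2 * \<delta> * s) *\<^sub>R v)"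
            unfolding mid by (rule convex_onD[OF height_convex_on]) (use elim in auto)
          also have "\<dots> \<le> (1 - 1/2) * (\<delta>\<^sup>2 * (2 * s)\<^sup>2) + (1/2) * (C * (2 * \<delta> * s)\<^sup>2)"
            using s \<delta> by (intro add_mono mult_left_mono d1 d2) auto
          also have "\<dots> = (\<delta> * s) * (2 * \<delta> * (1 + C) * s)" by (simp add: power2_eq_square algebra_simps)
          finally have "grad ?x \<bullet> v \<le> 2 * \<delta> * (1 + C) * s" using s \<delta> by (simp only: mult_le_cancel_left_pos mult_pos_pos)
          then show ?case using s by (simp add: v_def pos_divide_le_eq)
        qed
      qed
      ultimately show ?thesis by (intro tendsto_upperbound) auto
    qed
    note * = this
    have cancel: "2 * (y / (2 * X)) * X = y" if "X > 0" for X y :: real using that by simp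
    have C1: "1 + C > 0" using C(1) by simp
    have "\<sigma> * V b \<le> 0 + \<epsilon>" if \<epsilon>: "\<epsilon> > 0" for \<epsilon>
      using *[of "\<epsilon> / (2 * (1 + C))"] \<epsilon> C1 unfolding cancel[OF C1] by simp
    then show ?thesis by (rule field_le_epsilon)
  qed
  show ?thesis
  proof (cases "b = e")
    case True
    then show ?thesis by (simp add: grad_e)
  next
    case False
    have "V b = 0" using upper[OF b False, of 1] upper[OF b False, of "-1"] by simp
    with V[OF b] show ?thesis by simp
  qed
qed

text \<open>Along t w the gradient is o(t), and the outer normal is a differentiable function of the
  gradient. So the normal is constant to first order along the boundary curve
  \<open>graph (t w)\<close>, which passes \<open>p\<close> with velocity Q w.\<close>

lemma flat_direction_normal:
  assumes w: "w \<in> dirs" and flat: "hess_form w 0 \<le> 0"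
    and L: "(outer_unit_normal K has_derivative L) (at p within frontier K)"
  shows "L (Q w) = 0"
proof -
  have we: "w \<bullet> e = 0" using w by simp
  have pw: "perp e w = w" by (rule perp_eq[OF we])
  define S where "S = {t. t *\<^sub>R w \<in> tube}"
  have S: "open S" "0 \<in> S"
    unfolding S_def using R by (auto simp: perp_0 intro!: open_Collect_less continuous_intros)
  have gd: "((\<lambda>t. grad (t *\<^sub>R w)) has_derivative (\<lambda>t. 0)) (at 0)"
    using flat_direction[OF w flat]
    by (subst has_derivative_componentwise_within) (simp add: has_field_derivative_def lambda_zero[symmetric])
  have hd: "((\<lambda>t. height (t *\<^sub>R w)) has_derivative (\<lambda>t. 0)) (at 0)"
    using height_deriv[OF we zero_in_tube] by (simp add: grad_0 has_field_derivative_def lambda_zero[symmetric])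
  have "graph (t *\<^sub>R w) = p + t *\<^sub>R Q w + height (t *\<^sub>R w) *\<^sub>R \<theta>" for t
    unfolding graph_def Q_coord perp_scaleR pw by (simp add: linear_add[OF linear_Q] linear_scale[OF linear_Q])
  moreover have "((\<lambda>t. p + t *\<^sub>R Q w + height (t *\<^sub>R w) *\<^sub>R \<theta>) has_derivative (\<lambda>t. 0 + t *\<^sub>R Q w + 0 *\<^sub>R \<theta>)) (at 0 within S)"
    by (intro has_derivative_add has_derivative_const has_derivative_scaleR_left has_derivative_at_withinI[OF hd] has_derivative_ident)
  ultimately have "((\<lambda>t. graph (t *\<^sub>R w)) has_derivative (\<lambda>t. t *\<^sub>R Q w)) (at 0 within S)" by simp
  moreover have "(outer_unit_normal K has_derivative L) (at (graph (0 *\<^sub>R w)) within (\<lambda>t. graph (t *\<^sub>R w)) ` S)"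
    using has_derivative_subset[OF L, of "(\<lambda>t. graph (t *\<^sub>R w)) ` S"] graph_front by (auto simp: height_0 S_def)
  ultimately have "((\<lambda>t. outer_unit_normal K (graph (t *\<^sub>R w))) has_derivative (\<lambda>t. L (t *\<^sub>R Q w))) (at 0 within S)"
    by (rule has_derivative_in_compose)
  then have 1: "((\<lambda>t. outer_unit_normal K (graph (t *\<^sub>R w))) has_derivative (\<lambda>t. L (t *\<^sub>R Q w))) (at 0)"
    using at_within_open[OF S(2,1)] by simp
  \<comment> \<open>Only differentiability of \<open>F\<close> matters: its derivative will be
    applied to 0.\<close>
  define F where "F v = inverse (sqrt (1 + v \<bullet> v)) *\<^sub>R Q (v - e)" for v
  have Qb: "bounded_linear Q" using linear_Q linear_conv_bounded_linear by blast
  have "\<exists>F'. (F has_derivative F') (at (grad (0 *\<^sub>R w)))"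
    unfolding F_def
    by (rule exI) (rule has_derivative_scaleR derivative_eq_intros bounded_linear.has_derivative[OF Qb] refl | simp add: grad_0)+
  then obtain F' where F': "(F has_derivative F') (at (grad (0 *\<^sub>R w)))" by blast
  have "((\<lambda>t. F (grad (t *\<^sub>R w))) has_derivative (\<lambda>t. F' 0)) (at 0)"
    by (rule has_derivative_compose[OF gd F'])
  moreover have "F' 0 = 0" by (rule linear_0[OF has_derivative_linear[OF F']])
  ultimately have "((\<lambda>t. F (grad (t *\<^sub>R w))) has_derivative (\<lambda>t. 0)) (at 0)" by simp
  then have "((\<lambda>t. outer_unit_normal K (graph (t *\<^sub>R w))) has_derivative (\<lambda>t. 0)) (at 0)"
    by (rule has_derivative_transform_within_open[OF _ S]) (simp add: S_def F_def outer_unit_normal_graph)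
  from has_derivative_unique[OF 1 this] have "(\<lambda>t. L (t *\<^sub>R Q w)) = (\<lambda>t. 0)" .
  from fun_cong[OF this, of 1] show ?thesis by simp
qed

text \<open>Compactness of the unit directions gives a positive lower bound over the support point,
  and continuity of the coefficients preserves half of it nearby. They depend on
  \<open>perp e u\<close> only, so nearby means close in the hyperplane.\<close>

lemma hess_form_uniform:
  assumes pos: "\<And>w. w \<in> dirs \<Longrightarrow> hess_form w 0 > 0"
  obtains r c where "r > 0" "2 * r < R" "c > 0" "\<And>w u. w \<in> dirs \<Longrightarrow> norm (perp e u) < 2 * r \<Longrightarrow> c \<le> hess_form w u"
proof -
  have "compact (sphere 0 1 \<inter> {w. w \<bullet> e = 0})"
    by (intro compact_Int_closed compact_sphere closed_Collect_eq continuous_intros)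
  moreover have "sphere 0 1 \<inter> {w. w \<bullet> e = 0} = dirs" by auto
  ultimately have cp: "compact dirs" by simp
  have "continuous_on dirs (\<lambda>w. hess_form w 0)" unfolding hess_form_def by (intro continuous_intros)
  \<comment> \<open>There are no directions in dimension 1, where any positive constant will
    do.\<close>
  then obtain c where c: "c > 0" "\<And>w. w \<in> dirs \<Longrightarrow> c \<le> hess_form w 0"
    using continuous_attains_inf[OF cp, of "\<lambda>w. hess_form w 0"] pos by (cases "dirs = {}") (auto, metis zero_less_one)
  define S where "S u = (\<Sum>b\<in>Basis. \<Sum>b'\<in>Basis. \<bar>hess b b' u - hess b b' 0\<bar>)" for u
  have "continuous_on tube S" unfolding S_def by (intro continuous_intros hess_cont)
  then have "isCont S 0" using open_tube zero_in_tube continuous_on_eq_continuous_at by blast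
  then have "(S \<longlongrightarrow> S 0) (at 0)" by (simp add: isCont_def)
  moreover have "S 0 = 0" by (simp add: S_def)
  ultimately have "\<forall>\<^sub>F u in at 0. S u < c / 2" using c(1) by (intro order_tendstoD(2)) auto
  then obtain d where d: "d > 0" "\<And>u. u \<noteq> 0 \<Longrightarrow> norm u < d \<Longrightarrow> S u < c / 2"
    unfolding eventually_at by (auto simp: dist_norm)
  have hess_perp: "hess b b' u = hess b b' (perp e u)" for b b' u
    using graph_perp[of u] grad_perp[of u] by (simp add: hess_def slope_def)
  have Sd: "S u < c / 2" if "norm (perp e u) < d" for u
  proof -
    have "S u = S (perp e u)" unfolding S_def using hess_perp[of _ _ u] by simp
    then show ?thesis using d(2)[of "perp e u"] that c(1) \<open>S 0 = 0\<close> by (cases "perp e u = 0") auto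
  qed
  define r where "r = min (d / 2) (R / 3)"
  have r: "r > 0" "2 * r < R" "2 * r \<le> d" using d(1) R by (auto simp: r_def)
  have "c / 2 \<le> hess_form w u" if w: "w \<in> dirs" and u: "norm (perp e u) < 2 * r" for w u
  proof -
    have "hess_form w 0 - hess_form w u = (\<Sum>b\<in>Basis. \<Sum>b'\<in>Basis. (w \<bullet> b) * (w \<bullet> b') * (hess b b' 0 - hess b b' u))"
      by (simp add: hess_form_def sum_distrib_left sum_subtractf right_diff_distrib mult.assoc)
    also have "\<dots> \<le> S u" unfolding S_def
    proof (intro sum_mono)
      fix b b' :: 'a assume bb: "b \<in> Basis" "b' \<in> Basis"
      have "(w \<bullet> b) * (w \<bullet> b') * (hess b b' 0 - hess b b' u) \<le> \<bar>w \<bullet> b\<bar> * \<bar>w \<bullet> b'\<bar> * \<bar>hess b b' u - hess b b' 0\<bar>"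
        using abs_ge_self[of "(w \<bullet> b) * (w \<bullet> b') * (hess b b' 0 - hess b b' u)"] by (simp only: abs_mult abs_minus_commute[of "hess b b' 0"])
      also have "\<dots> \<le> 1 * \<bar>hess b b' u - hess b b' 0\<bar>"
        using dirs_coord[OF bb(1) w] dirs_coord[OF bb(2) w] by (intro mult_right_mono mult_le_one) auto
      finally show "(w \<bullet> b) * (w \<bullet> b') * (hess b b' 0 - hess b b' u) \<le> \<bar>hess b b' u - hess b b' 0\<bar>" by simp
    qed
    also have "\<dots> < c / 2" using Sd u r(3) by simp
    finally show ?thesis using c(2)[OF w] by simp
  qed
  then show thesis using that[of r "c / 2"] r c(1) by simp
qed

text \<open>Strong monotonicity is the mean value theorem for w \<bullet> grad along
  \<open>w\<close>, whose derivative is the quadratic form, bounded below by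
  \<open>c\<close>.\<close>

lemma graph_patch_exists:
  assumes pos: "\<And>w. w \<in> dirs \<Longrightarrow> hess_form w 0 > 0"
  obtains r c M where "graph_patch e height grad r c M" "2 * r < R"
proof -
  obtain r c where r: "r > 0" "2 * r < R" and c: "c > 0"
    and hc: "\<And>w u. w \<in> dirs \<Longrightarrow> norm (perp e u) < 2 * r \<Longrightarrow> c \<le> hess_form w u"
    by (rule hess_form_uniform) (rule pos, assumption, blast)
  obtain M where M: "\<And>u. norm (perp e u) < 2 * r \<Longrightarrow> norm (grad u) \<le> M * norm (perp e u)"
    using grad_lipschitz[of "2 * r"] r by auto
  have sub: "{x. norm (perp e x) < 2 * r} \<subseteq> tube" using r by auto
  have "graph_patch e height grad r c M"
  proof
    show "continuous_on {x. norm (perp e x) < 2 * r} height" by (rule continuous_on_subset[OF height_cont sub])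
    show "continuous_on {x. norm (perp e x) < 2 * r} grad" by (rule continuous_on_subset[OF grad_cont sub])
    show "height x = height (perp e x)" for x by (rule height_perp)
    show "((\<lambda>s. height (x + s *\<^sub>R w)) has_real_derivative w \<bullet> grad x) (at 0)" if "w \<bullet> e = 0" "norm (perp e x) < 2 * r" for w x
      by (rule height_deriv) (use that r in auto)
    show "C_k_bounded n dirs (\<lambda>w. w) {x. norm (perp e x) < 2 * r} (\<lambda>w x. w \<bullet> grad x)" for n
      by (rule inner_grad_C_k_bounded[OF r(2)])
    show "norm (grad x) \<le> M * norm (perp e x)" if "norm (perp e x) < 2 * r" for x by (rule M[OF that])
    fix w x :: 'a and s :: real
    assume w: "norm w = 1" "w \<bullet> e = 0" and s: "0 < s" and x: "norm (perp e x) < 2 * r" "norm (perp e (x + s *\<^sub>R w)) < 2 * r"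
    have seg: "norm (perp e (x + a *\<^sub>R w)) < 2 * r" if "0 \<le> a" "a \<le> s" for a
    proof -
      have "(1 - a / s) *\<^sub>R x + (a / s) *\<^sub>R (x + s *\<^sub>R w) \<in> {x. norm (perp e x) < 2 * r}"
        by (rule convexD_alt[OF convex_tube]) (use x s that in auto)
      moreover have "(1 - a / s) *\<^sub>R x + (a / s) *\<^sub>R (x + s *\<^sub>R w) = x + a *\<^sub>R w" using s by (simp add: algebra_simps)
      ultimately show ?thesis by simp
    qed
    obtain a where a: "0 < a" "a < s" "w \<bullet> grad (x + s *\<^sub>R w) - w \<bullet> grad x = s * hess_form w (x + a *\<^sub>R w)"
    proof (rule line_mvt[OF s, of "\<lambda>u. w \<bullet> grad u" x w "hess_form w"])
      show "((\<lambda>t. w \<bullet> grad (x + a *\<^sub>R w + t *\<^sub>R w)) has_real_derivative hess_form w (x + a *\<^sub>R w)) (at 0)"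
        if "0 \<le> a" "a \<le> s" for a
        by (rule inner_grad_deriv[OF w(2)]) (use seg[OF that] r in simp)
    qed
    have "s * c \<le> s * hess_form w (x + a *\<^sub>R w)"
      using s w a by (intro mult_left_mono hc seg) auto
    then show "c * s \<le> w \<bullet> (grad (x + s *\<^sub>R w) - grad x)" using a(3) by (simp add: inner_diff_right mult.commute)
  qed (use e r c in auto)
  then show thesis using that r by blast
qed

end

text \<open>Curvature enters through injectivity of the differential of the Gauss map: a direction
  in which the second derivative is not positive would be mapped to 0. Every unit vector is an inner
  normal, at a minimiser of the corresponding linear function, so every direction has a
  patch.\<close>

theorem theorem1p1:
  fixes K :: "(real^'n) set"
  assumes "CARD('n) \<ge> 2"
    and "convex_body K"
    and "smooth_boundary K"
    and "\<forall>p\<in>frontier K. \<exists>\<kappa>>0. has_gaussian_curvature K p \<kappa>"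
  shows "\<not> admits_fourier_frame (surface_measure K)"
proof (rule no_fourier_frame)
  show "sets (surface_measure K) = sets borel" by simp
  show "DIM(real^'n) \<ge> 2" using assms(1) by simp
  fix \<theta> :: "real^'n" assume \<theta>: "norm \<theta> = 1"
  obtain e :: "real^'n" where e: "e \<in> Basis" using nonempty_Basis by blast
  obtain Q where rot: "orthogonal_transformation Q" "Q e = \<theta>"
    using orthogonal_transformation_exists[of e \<theta>] e \<theta> by auto
  have ne: "compact K" "K \<noteq> {}" using assms(2) unfolding convex_body_def by (auto simp: interior_empty)
  obtain p where p: "p \<in> K" "\<And>x. x \<in> K \<Longrightarrow> p \<bullet> \<theta> \<le> x \<bullet> \<theta>"
    using continuous_attains_inf[OF ne continuous_on_inner[OF continuous_on_id continuous_on_const[of _ \<theta>]]] by blast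
  have pf: "p \<in> frontier K"
  proof (rule ccontr)
    assume "p \<notin> frontier K"
    then have "p \<in> interior K" using p(1) closure_subset by (auto simp: frontier_def)
    then obtain \<delta> where \<delta>: "\<delta> > 0" "ball p \<delta> \<subseteq> K" unfolding mem_interior by blast
    have "p - (\<delta> / 2) *\<^sub>R \<theta> \<in> K" using \<delta> \<theta> by (intro subsetD[OF \<delta>(2)]) (simp add: dist_norm)
    from p(2)[OF this] \<delta>(1) \<theta> show False by (simp add: inner_diff_left norm_eq_1)
  qed
  obtain U and \<phi> :: "real^'n \<Rightarrow> real" where U: "open U" "p \<in> U" and \<phi>: "smooth_on U \<phi>"
      "\<forall>x\<in>U. frechet_derivative \<phi> (at x) \<noteq> (\<lambda>_. 0)" "frontier K \<inter> U = {x\<in>U. \<phi> x = 0}"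
    using assms(3) pf unfolding smooth_boundary_def by blast
  interpret boundary_point K p Q e U \<phi>
    by standard (use assms(2) e rot p U \<phi> in auto)
  obtain R \<epsilon>0 where chart: "boundary_chart K p Q e U \<phi> R \<epsilon>0"
  proof (rule chart_radius)
    fix R \<epsilon>0 assume c: "R > 0" "\<epsilon>0 > 0" "\<And>u. norm (perp e u) < R \<Longrightarrow> p + Q (perp e u + \<epsilon>0 *\<^sub>R e) \<in> K"
      "\<And>u. norm (perp e u) < R \<Longrightarrow> height u < \<epsilon>0"
      "continuous_on {u. norm (perp e u) < R} height" "convex_on {u. norm (perp e u) < R} height"
      "\<And>u. norm (perp e u) < R \<Longrightarrow> graph u \<in> U" 
      "\<And>u. norm (perp e u) < R \<Longrightarrow> \<bar>frechet_derivative \<phi> (at p) (Q e)\<bar> / 2 \<le> \<bar>frechet_derivative \<phi> (at (graph u)) (Q e)\<bar>"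
    have "boundary_chart K p Q e U \<phi> R \<epsilon>0" by unfold_locales (fact c)+
    then show thesis by (rule that)
  qed
  interpret boundary_chart K p Q e U \<phi> R \<epsilon>0 by (rule chart)
  obtain \<kappa> L where L: "(outer_unit_normal K has_derivative L) (at p within frontier K)" "\<kappa> > 0" "\<kappa> = det (matrix L)"
    using assms(4) pf unfolding has_gaussian_curvature_def by blast
  have linL: "linear L" using L(1) by (rule has_derivative_linear)
  have inj: "inj L" using L(2,3) det_nz_iff_inj[OF linL] by simp
  have pos: "hess_form w 0 > 0" if w: "norm w = 1 \<and> w \<bullet> e = 0" for w
  proof (rule ccontr)
    assume "\<not> hess_form w 0 > 0"
    then have "L (Q w) = 0" using w by (intro flat_direction_normal[OF _ _ L(1)]) auto
    then have "Q w = 0" using inj linear_0[OF linL] by (metis injD)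
    then show False using w norm_Q[of w] by simp
  qed
  obtain r c M where gp: "graph_patch e height grad r c M" "2 * r < R"
    by (rule graph_patch_exists) (simp add: pos, blast)
  interpret graph_patch e height grad r c M by (rule gp(1))
  interpret surface_patch e height grad r c M K p Q
    by standard (use assms(1) rot(1) graph_front gp(2) in \<open>auto simp: graph_def[symmetric]\<close>)
  show "\<exists>f C c0 \<rho> T0. f \<in> borel_measurable borel \<and>
      integrable (surface_measure K) (\<lambda>x. (f x)\<^sup>2) \<and> 0 < (\<integral>x. (f x)\<^sup>2 \<partial>surface_measure K) \<and> C > 0 \<and>
      (\<forall>t. (cmod (\<integral>x. complex_of_real (f x) * cis (t \<bullet> x) \<partial>surface_measure K))\<^sup>2 * (1 + norm t) ^ (DIM(real^'n) - 1) \<le> C) \<and>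
      c0 > 0 \<and> \<rho> > 0 \<and> T0 > 0 \<and>
      (\<forall>t. T0 \<le> norm t \<longrightarrow> norm (t - norm t *\<^sub>R \<theta>) \<le> \<rho> * norm t \<longrightarrow>
         c0 \<le> (cmod (\<integral>x. complex_of_real (f x) * cis (t \<bullet> x) \<partial>surface_measure K))\<^sup>2 * norm t ^ (DIM(real^'n) - 1)) \<and>
      (\<forall>t. norm t \<le> \<rho> \<longrightarrow> c0 \<le> (cmod (\<integral>x. complex_of_real (f x) * cis (t \<bullet> x) \<partial>surface_measure K))\<^sup>2)"
    by (rule patch_transform) (unfold rot(2) DIM_cart DIM_real mult_1_right, blast)
qed

end
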